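(* Let $\mathcal{A}$ be a finite-dimensional weak Hopf algebra over $\mathbb{C}$ with $\mathcal{A}^*$ semisimple, and let $d_a$, $g$, $l_a$ be as in the context. Define $\Lambda\in\mathcal{A}$ by $$f(\Lambda)=\sum_{a\in\mathrm{Irr}(\mathcal{A}^* )}\frac{d_a}{\sum_{x:\,l_x=l_a}d_x^2}\,\mathrm{Tr}\big(\psi_a(g)\psi_a(f)\big)\qquad\text{for all }f\in\mathcal{A}^*$$ (the denominators being nonzero). Then $\Lambda$ is a non-degenerate normalized left integral of $\mathcal{A}$ which is also a q-trace; that is: $\Lambda^2=\Lambda$; $\{(f\otimes\mathrm{Id})\Delta(\Lambda):f\in\mathcal{A}^*\}=\{(\mathrm{Id}\otimes f)\Delta(\Lambda):f\in\mathcal{A}^*\}=\mathcal{A}$; $(1\otimes x)\Delta(\Lambda)=(S(x)\otimes1)\Delta(\Lambda)$ for all $x\in\mathcal{A}$; and $\Delta_{\mathrm{op}}(\Lambda)=(S^{-2}\otimes\mathrm{Id})\Delta(\Lambda)$.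
   Context: Weak Hopf algebra: a finite-dimensional unital algebra $\mathcal{A}$ with coassociative counital coproduct $\Delta$ (Sweedler notation), counit $\epsilon$, $\Delta(xy)=\Delta(x)\Delta(y)$, $\Delta^2(1)=(1\otimes\Delta(1))(\Delta(1)\otimes1)=(\Delta(1)\otimes1)(1\otimes\Delta(1))$, $\epsilon(xyz)=\sum\epsilon(xy_{(1)})\epsilon(y_{(2)}z)=\sum\epsilon(xy_{(2)})\epsilon(y_{(1)}z)$, and antipode $S$ with $\sum S(x_{(1)})x_{(2)}=\sum 1_{(1)}\epsilon(x1_{(2)})$, $\sum x_{(1)}S(x_{(2)})=\sum\epsilon(1_{(1)}x)1_{(2)}$, $\sum S(x_{(1)})x_{(2)}S(x_{(3)})=S(x)$ ($S$ is bijective). $\Delta_{\mathrm{op}}(x)=\sum x_{(2)}\otimes x_{(1)}$. The dual $\mathcal{A}^*$ is a weak Hopf algebra with product $(fg)(x)=\sum f(x_{(1)})g(x_{(2)})$, unit $\epsilon$, coproduct $\Delta(f)(x\otimes y)=f(xy)$, antipode $S(f)=f\circ S$. Irreps: for $a\in\mathrm{Irr}(\mathcal{A}^* )$ fix $\psi_a:\mathcal{A}^*\to\mathrm{End}(W_a)$. $N_{ab}^c$ = multiplicity of $\psi_c$ in $f\mapsto(\psi_a\otimes\psi_b)(\Delta f)$ restricted to the range of the idempotent $(\psi_a\otimes\psi_b)(\Delta\epsilon)$. Fusion tensors $V^{c\mu}_{ab}:W_c\to W_a\otimes W_b$, $W^{c\mu}_{ab}:W_a\otimes W_b\to W_c$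 ($\mu=1..N_{ab}^c$) satisfy $(\psi_a\otimes\psi_b)(\Delta f)=\sum_{c,\mu}V^{c\mu}_{ab}\psi_c(f)W^{c\mu}_{ab}$ and $W^{c\mu}_{ab}V^{d\nu}_{ab}=\delta_{cd}\delta_{\mu\nu}\mathrm{id}$. Vacuum: let $b_a\in\mathrm{End}(W_a)$ be such that $f(1)=\sum_a\mathrm{Tr}(b_a\psi_a(f))$, $E=\{a:b_a\ne0\}$. It is known that each $b_e$, $e\in E$, is rank one, $b_e=v_eu_e$ with $v_e\in W_e$, $u_e\in W_e^*$, and for each $a$ there are unique $l_a,r_a\in E$ with $N_{ea}^b=\delta_{e,l_a}\delta_{ab}$, $N_{ae}^b=\delta_{e,r_a}\delta_{ab}$ for $e\in E$. Conjugation: $\bar a$ is the class of $f\mapsto\psi_a(S f)^T$ on $W_a^*$; fix invertible $Z_a:W_{\bar a}\to W_a^*$ with $\psi_a(S(f))^T=Z_a\psi_{\bar a}(f)Z_a^{-1}$ for all $f$. For each $c$ let $\zeta_c\in(W_{\bar c}\otimes W_c)^*$, $\zeta_c(\xi\otimes\eta)=(Z_c\xi)(\eta)$, and let $\theta_c\in W_{\bar c}\otimes W_c$ correspond to $Z_{\bar c}^{-1}:W_{\bar c}^*\to W_c$, i.e. $(\varphi\otimes\mathrm{id})\theta_c=Z_{\bar c}^{-1}(\varphi)$. Then $N^{r_c}_{\bar cc}=1$ and there is a nonzero $w_c\in\mathbb{C}$ with $\zeta_c\otimes\theta_c=w_c\,(u_{r_c}\circ W^{r_c}_{\bar cc})\otimes(V^{r_c}_{\bar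 cc}v_{r_c})$. Let $d_a\in\mathbb{C}$ with $d_a^2=w_aw_{\bar a}$ and $d_a=d_{\bar a}$. Define $g\in\mathcal{A}^*$ by $\psi_a(g)=\frac{d_a}{w_{\bar a}}(Z_a^{-1})^TZ_{\bar a}$ for all $a$, where $Z_{\bar a}:W_a\to W_{\bar a}^*$ and $(Z_a^{-1})^T:W_{\bar a}^*\to W_a$. *)

theory Defs
  imports Complex_Main "Jordan_Normal_Form.Matrix"
begin

text \<open>A finite-dimensional complex vector space is represented in coordinates w.r.t. a basis
indexed by a finite type 'n: an element is a function 'n => complex.  Elements of the dual
space are represented in the dual basis, also as functions 'n => complex, and the pairing is
pair_ev.  The tensor square is represented by functions on 'n x 'n, the tensor cube by functions
on 'n x 'n x 'n.  Linear maps are ordinary functions (assumed linear) and are extended to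
tensors via the basis.\<close>

definition bvec :: "'n \<Rightarrow> 'n \<Rightarrow> complex" where
  "bvec i = (\<lambda>j. if j = i then 1 else 0)"

definition pair_ev :: "('n::finite \<Rightarrow> complex) \<Rightarrow> ('n \<Rightarrow> complex) \<Rightarrow> complex" where
  "pair_ev f x = (\<Sum>i\<in>UNIV. f i * x i)"

definition linear_fun :: "(('a \<Rightarrow> complex) \<Rightarrow> ('b \<Rightarrow> complex)) \<Rightarrow> bool" where
  "linear_fun F \<longleftrightarrow>
     (\<forall>x y. F (\<lambda>i. x i + y i) = (\<lambda>k. F x k + F y k)) \<and>
     (\<forall>c x. F (\<lambda>i. c * x i) = (\<lambda>k. c * F x k))"

definition linear_functional :: "(('a \<Rightarrow> complex) \<Rightarrow> complex) \<Rightarrow> bool" where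
  "linear_functional F \<longleftrightarrow>
     (\<forall>x y. F (\<lambda>i. x i + y i) = F x + F y) \<and> (\<forall>c x. F (\<lambda>i. c * x i) = c * F x)"

definition tens :: "('a \<Rightarrow> complex) \<Rightarrow> ('b \<Rightarrow> complex) \<Rightarrow> ('a \<times> 'b \<Rightarrow> complex)" where
  "tens x y = (\<lambda>(p, q). x p * y q)"

definition tens3 :: "('a \<Rightarrow> complex) \<Rightarrow> ('b \<Rightarrow> complex) \<Rightarrow> ('c \<Rightarrow> complex)
    \<Rightarrow> ('a \<times> 'b \<times> 'c \<Rightarrow> complex)" where
  "tens3 x y z = (\<lambda>(p, q, r). x p * y q * z r)"

definition tmap :: "(('a::finite \<Rightarrow> complex) \<Rightarrow> ('c \<Rightarrow> complex)) \<Rightarrow>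
    (('b::finite \<Rightarrow> complex) \<Rightarrow> ('d \<Rightarrow> complex)) \<Rightarrow> ('a \<times> 'b \<Rightarrow> complex) \<Rightarrow> ('c \<times> 'd \<Rightarrow> complex)" where
  "tmap F G T = (\<lambda>(p, q). \<Sum>i\<in>UNIV. \<Sum>j\<in>UNIV. T (i, j) * F (bvec i) p * G (bvec j) q)"

definition tswap :: "('a \<times> 'b \<Rightarrow> complex) \<Rightarrow> ('b \<times> 'a \<Rightarrow> complex)" where
  "tswap T = (\<lambda>(p, q). T (q, p))"

definition mult2 :: "(('n::finite \<Rightarrow> complex) \<Rightarrow> ('n \<Rightarrow> complex) \<Rightarrow> ('n \<Rightarrow> complex)) \<Rightarrow>
    ('n \<times> 'n \<Rightarrow> complex) \<Rightarrow> ('n \<times> 'n \<Rightarrow> complex) \<Rightarrow> ('n \<times> 'n \<Rightarrow> complex)" where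
  "mult2 m T U = (\<lambda>(p, q). \<Sum>i\<in>UNIV. \<Sum>j\<in>UNIV. \<Sum>k\<in>UNIV. \<Sum>l\<in>UNIV.
      T (i, j) * U (k, l) * m (bvec i) (bvec k) p * m (bvec j) (bvec l) q)"

definition mult3 :: "(('n::finite \<Rightarrow> complex) \<Rightarrow> ('n \<Rightarrow> complex) \<Rightarrow> ('n \<Rightarrow> complex)) \<Rightarrow>
    ('n \<times> 'n \<times> 'n \<Rightarrow> complex) \<Rightarrow> ('n \<times> 'n \<times> 'n \<Rightarrow> complex) \<Rightarrow> ('n \<times> 'n \<times> 'n \<Rightarrow> complex)" where
  "mult3 m T U = (\<lambda>(p, q, r). \<Sum>i\<in>UNIV. \<Sum>j\<in>UNIV. \<Sum>k\<in>UNIV. \<Sum>i'\<in>UNIV. \<Sum>j'\<in>UNIV. \<Sum>k'\<in>UNIV.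
      T (i, j, k) * U (i', j', k') * m (bvec i) (bvec i') p * m (bvec j) (bvec j') q
        * m (bvec k) (bvec k') r)"

definition comult2_left :: "(('n::finite \<Rightarrow> complex) \<Rightarrow> ('n \<times> 'n \<Rightarrow> complex)) \<Rightarrow>
    ('n \<Rightarrow> complex) \<Rightarrow> ('n \<times> 'n \<times> 'n \<Rightarrow> complex)" where
  "comult2_left \<Delta> x = (\<lambda>(p, q, r). \<Sum>i\<in>UNIV. \<Sum>j\<in>UNIV. \<Delta> x (i, j) * \<Delta> (bvec i) (p, q) * bvec j r)"

definition comult2_right :: "(('n::finite \<Rightarrow> complex) \<Rightarrow> ('n \<times> 'n \<Rightarrow> complex)) \<Rightarrow>
    ('n \<Rightarrow> complex) \<Rightarrow> ('n \<times> 'n \<times> 'n \<Rightarrow> complex)" where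
  "comult2_right \<Delta> x = (\<lambda>(p, q, r). \<Sum>i\<in>UNIV. \<Sum>j\<in>UNIV. \<Delta> x (i, j) * bvec i p * \<Delta> (bvec j) (q, r))"

definition tens_l :: "('a \<Rightarrow> complex) \<Rightarrow> ('b \<times> 'c \<Rightarrow> complex) \<Rightarrow> ('a \<times> 'b \<times> 'c \<Rightarrow> complex)" where
  "tens_l x T = (\<lambda>(p, q, r). x p * T (q, r))"

definition tens_r :: "('a \<times> 'b \<Rightarrow> complex) \<Rightarrow> ('c \<Rightarrow> complex) \<Rightarrow> ('a \<times> 'b \<times> 'c \<Rightarrow> complex)" where
  "tens_r T x = (\<lambda>(p, q, r). T (p, q) * x r)"

text \<open>Sweedler sums are written out in the basis: \<Sum> x_(1) \<otimes> x_(2) = \<Sum>_{i,j} \<Delta> x (i,j) e_i \<otimes> e_j,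
and similarly \<Sum> x_(1) \<otimes> x_(2) \<otimes> x_(3) = (\<Delta> \<otimes> id) \<Delta> x.\<close>

definition weak_hopf_algebra ::
  "(('n::finite \<Rightarrow> complex) \<Rightarrow> ('n \<Rightarrow> complex) \<Rightarrow> ('n \<Rightarrow> complex)) \<Rightarrow> ('n \<Rightarrow> complex) \<Rightarrow>
   (('n \<Rightarrow> complex) \<Rightarrow> ('n \<times> 'n \<Rightarrow> complex)) \<Rightarrow> (('n \<Rightarrow> complex) \<Rightarrow> complex) \<Rightarrow>
   (('n \<Rightarrow> complex) \<Rightarrow> ('n \<Rightarrow> complex)) \<Rightarrow> bool" where
  "weak_hopf_algebra m unitA \<Delta> \<epsilon> S \<longleftrightarrow>
     \<comment> \<open>unital associative algebra\<close>
     (\<forall>x. linear_fun (m x)) \<and> (\<forall>y. linear_fun (\<lambda>x. m x y)) \<and>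
     (\<forall>x y z. m (m x y) z = m x (m y z)) \<and>
     (\<forall>x. m unitA x = x \<and> m x unitA = x) \<and>
     \<comment> \<open>coassociative counital coalgebra\<close>
     linear_fun \<Delta> \<and> linear_functional \<epsilon> \<and>
     (\<forall>x. comult2_left \<Delta> x = comult2_right \<Delta> x) \<and>
     (\<forall>x. (\<lambda>q. \<Sum>p\<in>UNIV. \<epsilon> (bvec p) * \<Delta> x (p, q)) = x) \<and>
     (\<forall>x. (\<lambda>p. \<Sum>q\<in>UNIV. \<Delta> x (p, q) * \<epsilon> (bvec q)) = x) \<and>
     \<comment> \<open>\<Delta>(xy) = \<Delta>(x)\<Delta>(y)\<close>
     (\<forall>x y. \<Delta> (m x y) = mult2 m (\<Delta> x) (\<Delta> y)) \<and>
     \<comment> \<open>\<Delta>^2(1) = (1 \<otimes> \<Delta>(1))(\<Delta>(1) \<otimes> 1) = (\<Delta>(1) \<otimes> 1)(1 \<otimes> \<Delta>(1))\<close>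
     comult2_left \<Delta> unitA = mult3 m (tens_l unitA (\<Delta> unitA)) (tens_r (\<Delta> unitA) unitA) \<and>
     comult2_left \<Delta> unitA = mult3 m (tens_r (\<Delta> unitA) unitA) (tens_l unitA (\<Delta> unitA)) \<and>
     \<comment> \<open>\<epsilon>(xyz) = \<Sum> \<epsilon>(x y_(1)) \<epsilon>(y_(2) z) = \<Sum> \<epsilon>(x y_(2)) \<epsilon>(y_(1) z)\<close>
     (\<forall>x y z. \<epsilon> (m (m x y) z) =
        (\<Sum>i\<in>UNIV. \<Sum>j\<in>UNIV. \<Delta> y (i, j) * \<epsilon> (m x (bvec i)) * \<epsilon> (m (bvec j) z))) \<and>
     (\<forall>x y z. \<epsilon> (m (m x y) z) =
        (\<Sum>i\<in>UNIV. \<Sum>j\<in>UNIV. \<Delta> y (i, j) * \<epsilon> (m x (bvec j)) * \<epsilon> (m (bvec i) z))) \<and>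
     \<comment> \<open>antipode\<close>
     linear_fun S \<and> bij S \<and>
     (\<forall>x. (\<lambda>k. \<Sum>i\<in>UNIV. \<Sum>j\<in>UNIV. \<Delta> x (i, j) * m (S (bvec i)) (bvec j) k) =
          (\<lambda>k. \<Sum>i\<in>UNIV. \<Sum>j\<in>UNIV. \<Delta> unitA (i, j) * \<epsilon> (m x (bvec j)) * bvec i k)) \<and>
     (\<forall>x. (\<lambda>k. \<Sum>i\<in>UNIV. \<Sum>j\<in>UNIV. \<Delta> x (i, j) * m (bvec i) (S (bvec j)) k) =
          (\<lambda>k. \<Sum>i\<in>UNIV. \<Sum>j\<in>UNIV. \<Delta> unitA (i, j) * \<epsilon> (m (bvec i) x) * bvec j k)) \<and>
     (\<forall>x. (\<lambda>k. \<Sum>i\<in>UNIV. \<Sum>j\<in>UNIV. \<Sum>l\<in>UNIV. comult2_left \<Delta> x (i, j, l) * m (m (S (bvec i)) (bvec j)) (S (bvec l)) k)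
          = S x)"

definition dmult :: "(('n::finite \<Rightarrow> complex) \<Rightarrow> ('n \<times> 'n \<Rightarrow> complex)) \<Rightarrow>
    ('n \<Rightarrow> complex) \<Rightarrow> ('n \<Rightarrow> complex) \<Rightarrow> ('n \<Rightarrow> complex)" where
  "dmult \<Delta> f g = (\<lambda>k. \<Sum>i\<in>UNIV. \<Sum>j\<in>UNIV. \<Delta> (bvec k) (i, j) * f i * g j)"

definition dunit :: "(('n \<Rightarrow> complex) \<Rightarrow> complex) \<Rightarrow> ('n \<Rightarrow> complex)" where
  "dunit \<epsilon> = (\<lambda>k. \<epsilon> (bvec k))"

definition dantipode :: "(('n::finite \<Rightarrow> complex) \<Rightarrow> ('n \<Rightarrow> complex)) \<Rightarrow>
    ('n \<Rightarrow> complex) \<Rightarrow> ('n \<Rightarrow> complex)" where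
  "dantipode S f = (\<lambda>k. pair_ev f (S (bvec k)))"

definition fun_subspace :: "('n \<Rightarrow> complex) set \<Rightarrow> bool" where
  "fun_subspace I \<longleftrightarrow> (\<lambda>_. 0) \<in> I \<and> (\<forall>x\<in>I. \<forall>y\<in>I. (\<lambda>k. x k + y k) \<in> I) \<and>
     (\<forall>c. \<forall>x\<in>I. (\<lambda>k. c * x k) \<in> I)"

definition two_sided_ideal :: "(('n \<Rightarrow> complex) \<Rightarrow> ('n \<Rightarrow> complex) \<Rightarrow> ('n \<Rightarrow> complex)) \<Rightarrow>
    ('n \<Rightarrow> complex) set \<Rightarrow> bool" where
  "two_sided_ideal mul I \<longleftrightarrow> fun_subspace I \<and> (\<forall>a x. x \<in> I \<longrightarrow> mul a x \<in> I \<and> mul x a \<in> I)"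

definition nilpotent_ideal :: "(('n \<Rightarrow> complex) \<Rightarrow> ('n \<Rightarrow> complex) \<Rightarrow> ('n \<Rightarrow> complex)) \<Rightarrow>
    ('n \<Rightarrow> complex) \<Rightarrow> ('n \<Rightarrow> complex) set \<Rightarrow> bool" where
  "nilpotent_ideal mul u I \<longleftrightarrow> (\<exists>k>0. \<forall>xs. length xs = k \<and> set xs \<subseteq> I \<longrightarrow> foldr mul xs u = (\<lambda>_. 0))"

text \<open>A finite-dimensional algebra is semisimple iff it has no nonzero nilpotent two-sided ideal
(i.e. its Jacobson radical vanishes).\<close>
definition semisimple_alg :: "(('n \<Rightarrow> complex) \<Rightarrow> ('n \<Rightarrow> complex) \<Rightarrow> ('n \<Rightarrow> complex)) \<Rightarrow>
    ('n \<Rightarrow> complex) \<Rightarrow> bool" where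
  "semisimple_alg mul u \<longleftrightarrow>
     (\<forall>I. two_sided_ideal mul I \<and> nilpotent_ideal mul u I \<longrightarrow> I = {\<lambda>_. 0})"

definition mtrace :: "complex mat \<Rightarrow> complex" where
  "mtrace M = (\<Sum>i<dim_row M. M $$ (i, i))"

definition minv :: "complex mat \<Rightarrow> complex mat" where
  "minv M = (SOME B. inverts_mat M B \<and> inverts_mat B M)"

definition kron :: "complex mat \<Rightarrow> complex mat \<Rightarrow> complex mat" where
  "kron A B = mat (dim_row A * dim_row B) (dim_col A * dim_col B)
     (\<lambda>(i, j). A $$ (i div dim_row B, j div dim_col B) * B $$ (i mod dim_row B, j mod dim_col B))"

definition msum :: "nat \<Rightarrow> nat \<Rightarrow> ('s \<Rightarrow> complex mat) \<Rightarrow> 's set \<Rightarrow> complex mat" where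
  "msum n k F X = mat n k (\<lambda>ij. \<Sum>s\<in>X. F s $$ ij)"

text \<open>Outer product v u of a vector v \<in> W and a covector u \<in> W^* (in the dual basis).\<close>
definition outer :: "complex vec \<Rightarrow> complex vec \<Rightarrow> complex mat" where
  "outer v u = mat (dim_vec v) (dim_vec u) (\<lambda>(i, j). v $ i * u $ j)"

definition is_rep :: "(('n \<Rightarrow> complex) \<Rightarrow> ('n \<Rightarrow> complex) \<Rightarrow> ('n \<Rightarrow> complex)) \<Rightarrow> ('n \<Rightarrow> complex) \<Rightarrow>
    (('n \<Rightarrow> complex) \<Rightarrow> complex mat) \<Rightarrow> nat \<Rightarrow> bool" where
  "is_rep mul u \<rho> n \<longleftrightarrow>
     (\<forall>f. \<rho> f \<in> carrier_mat n n) \<and>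
     (\<forall>f g. \<rho> (\<lambda>k. f k + g k) = \<rho> f + \<rho> g) \<and>
     (\<forall>c f. \<rho> (\<lambda>k. c * f k) = c \<cdot>\<^sub>m \<rho> f) \<and>
     (\<forall>f g. \<rho> (mul f g) = \<rho> f * \<rho> g) \<and>
     \<rho> u = 1\<^sub>m n"

definition vec_subspace :: "nat \<Rightarrow> complex vec set \<Rightarrow> bool" where
  "vec_subspace n U \<longleftrightarrow> U \<subseteq> carrier_vec n \<and> 0\<^sub>v n \<in> U \<and>
     (\<forall>x\<in>U. \<forall>y\<in>U. x + y \<in> U) \<and> (\<forall>c. \<forall>x\<in>U. c \<cdot>\<^sub>v x \<in> U)"

definition irreducible_rep :: "(('n \<Rightarrow> complex) \<Rightarrow> complex mat) \<Rightarrow> nat \<Rightarrow> bool" where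
  "irreducible_rep \<rho> n \<longleftrightarrow> n > 0 \<and>
     (\<forall>U. vec_subspace n U \<and> (\<forall>f. \<forall>x\<in>U. \<rho> f *\<^sub>v x \<in> U) \<longrightarrow> U = {0\<^sub>v n} \<or> U = carrier_vec n)"

definition rep_iso :: "(('n \<Rightarrow> complex) \<Rightarrow> complex mat) \<Rightarrow> nat \<Rightarrow>
    (('n \<Rightarrow> complex) \<Rightarrow> complex mat) \<Rightarrow> nat \<Rightarrow> bool" where
  "rep_iso \<rho> n \<sigma> k \<longleftrightarrow> (\<exists>T. T \<in> carrier_mat k n \<and> invertible_mat T \<and> (\<forall>f. T * \<rho> f = \<sigma> f * T))"

text \<open>(\<psi>_a \<otimes> \<psi>_b)(\<Delta> f) on W_a \<otimes> W_b = \<complex>^(D a * D b), index (i,j) \<mapsto> i * D b + j.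
Here \<Delta> f = \<Sum>_{i,j} f(e_i e_j) e^i \<otimes> e^j in A^* \<otimes> A^*.\<close>
definition tensor_rep :: "(('n::finite \<Rightarrow> complex) \<Rightarrow> ('n \<Rightarrow> complex) \<Rightarrow> ('n \<Rightarrow> complex)) \<Rightarrow>
    (('n \<Rightarrow> complex) \<Rightarrow> complex mat) \<Rightarrow> nat \<Rightarrow> (('n \<Rightarrow> complex) \<Rightarrow> complex mat) \<Rightarrow> nat \<Rightarrow>
    ('n \<Rightarrow> complex) \<Rightarrow> complex mat" where
  "tensor_rep m \<rho> n \<sigma> k f = msum (n * k) (n * k)
     (\<lambda>(i, j). pair_ev f (m (bvec i) (bvec j)) \<cdot>\<^sub>m kron (\<rho> (bvec i)) (\<sigma> (bvec j))) UNIV"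

end

theory Submission
  imports Defs "HOL-Library.Function_Algebras" "Jordan_Normal_Form.Schur_Decomposition"
    "Jordan_Normal_Form.Spectral_Radius"
begin

text \<open>
Let \<open>t\<^sup>a\<^sub>i\<^sub>j \<in> A\<close> be the matrix coefficients of \<open>\<psi>\<^sub>a\<close>. They form a basis of \<open>A\<close>, multiply through the
fusion tensors, and \<open>\<Lambda> = \<Sum>\<^sub>a c\<^sub>a Tr(G\<^sub>a t\<^sup>a)\<close> with \<open>G = \<psi>(g)\<close> up to a scalar and \<open>S\<^sup>2 t = G t G\<^sup>-\<^sup>1\<close>.
Bending a leg of a fusion tensor with \<open>Z\<close> turns the channel \<open>b a \<rightarrow> c\<close> into the channel \<open>bar b c \<rightarrow> a\<close>;
this gives the integral property directly, provided that the coefficients \<open>c\<^sub>a\<close> match. Conjugation by \<open>G\<close> acts on the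
multiplicity space of \<open>b a \<rightarrow> c\<close> by a kernel \<open>\<kappa>\<close>, and computing the two partial traces of one
intertwiner in two ways shows that a rescaling of \<open>\<kappa>\<close> is an involution. Its traces \<open>\<tau>\<close> are therefore
real, they are invariant under rotation, and they satisfy \<open>d\<^sub>b d\<^sub>a = \<Sum>\<^sub>c \<tau> d\<^sub>c\<close>. Testing this identity
against the complex conjugates of the \<open>d\<^sub>a\<close> gives \<open>d\<^sub>a\<^sup>2 > 0\<close>, hence nonzero denominators; testing it against
the \<open>d\<^sub>a\<close> themselves shows that the denominators of \<open>l\<^sub>a\<close> and \<open>r\<^sub>a\<close> coincide, and yields \<open>\<Lambda>\<^sup>2 = \<Lambda>\<close>.
\<close>

section \<open>Sweedler calculus in weak Hopf algebras\<close>

text \<open>There is no star structure and no positivity of traces to start from: \<open>V\<close>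
  and \<open>W\<close> are not adjoint to each other, and each d_a is a square root of a complex
  number whose phase is unknown. Nor is \<open>g\<close> known to be group-like; \<kappa> measures
  how far (G \<otimes> G) V is from V G. This is the obstacle: the numbers \<tau> could be negative,
  so a Perron-Frobenius argument does not apply to d_b d_a = \<Sum> \<tau> d_c. Reality of \<tau>
  replaces it. The conjugates of the d_a solve the same system, and pairing the two solutions
  through the rotation symmetry of \<tau> expresses d_b^2 as |d_b|^2 times a quotient of two sums of
  squared moduli. The rescaling of \<kappa> is a square root of the ratio between left and right
  traces, and the chosen d_a are what supplies this root. The coefficient c_a is w_a divided by the
  denominator, since d_a (d_a / w_{bar a}) = w_a. Left and right are exchanged by the opposite
  product with transposed coefficients, which interchanges G and its inverse; therefore rotation is
  developed abstractly and instantiated twice.\<close>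

definition vscale :: "complex \<Rightarrow> ('k \<Rightarrow> complex) \<Rightarrow> 'k \<Rightarrow> complex" (infixr \<open>*v\<close> 75) where
  "c *v x = (\<lambda>i. c * x i)"

lemma sum_fun_apply: "(\<Sum>i\<in>A. f i) k = (\<Sum>i\<in>A. f i (k :: 'k) :: complex)"
  by (induction A rule: infinite_finite_induct) auto

lemma vscale_apply [simp]: "(c *v x) i = c * x i"
  by (simp add: vscale_def)

lemma linear_fun_iff:
  "linear_fun F \<longleftrightarrow> (\<forall>x y. F (x + y) = F x + F y) \<and> (\<forall>c x. F (c *v x) = c *v F x)"
  by (simp add: linear_fun_def plus_fun_def vscale_def)

lemma linear_functional_iff:
  "linear_functional F \<longleftrightarrow> (\<forall>x y. F (x + y) = F x + F y) \<and> (\<forall>c x. F (c *v x) = c * F x)"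
  by (simp add: linear_functional_def plus_fun_def vscale_def)

lemma linear_functional_zero: "linear_functional \<phi> \<Longrightarrow> \<phi> 0 = 0"
proof -
  assume "linear_functional \<phi>"
  hence "\<phi> (0 *v 0) = 0 * \<phi> 0" unfolding linear_functional_iff by blast
  thus ?thesis by (simp add: vscale_def zero_fun_def)
qed

lemma linear_functional_sum:
  assumes "linear_functional \<phi>"
  shows "\<phi> (\<Sum>i\<in>A. f i) = (\<Sum>i\<in>A. \<phi> (f i))"
  using assms linear_functional_zero[OF assms]
  by (induction A rule: infinite_finite_induct) (auto simp: linear_functional_iff)

lemma linear_fun_zero: "linear_fun F \<Longrightarrow> F 0 = 0"
proof -
  assume "linear_fun F"
  hence "F (0 *v 0) = 0 *v F 0" unfolding linear_fun_iff by blast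
  thus ?thesis by (simp add: vscale_def zero_fun_def)
qed

lemma linear_fun_sum:
  assumes "linear_fun F"
  shows "F (\<Sum>i\<in>A. f i) = (\<Sum>i\<in>A. F (f i))"
  using assms linear_fun_zero[OF assms]
  by (induction A rule: infinite_finite_induct) (auto simp: linear_fun_iff)

lemma bvec_expand: "x = (\<Sum>i\<in>UNIV. x i *v bvec i)" for x :: "'n::finite \<Rightarrow> complex"
  by (simp add: fun_eq_iff sum_fun_apply vscale_def bvec_def if_distrib cong: if_cong)

lemma linear_functional_expand:
  assumes "linear_functional \<phi>"
  shows "\<phi> x = (\<Sum>i\<in>UNIV. x i * \<phi> (bvec (i :: 'n::finite)))"
  by (subst bvec_expand[of x], subst linear_functional_sum[OF assms])
     (use assms in \<open>simp add: linear_functional_iff\<close>)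

lemma linear_functional_coord: "linear_functional (\<lambda>x. x k)"
  by (simp add: linear_functional_def)

definition bilin :: "(('a \<Rightarrow> complex) \<Rightarrow> ('b \<Rightarrow> complex) \<Rightarrow> complex) \<Rightarrow> bool" where
  "bilin B \<longleftrightarrow> (\<forall>x. linear_functional (B x)) \<and> (\<forall>y. linear_functional (\<lambda>x. B x y))"

text \<open>Sweedler notation: \<open>sw \<Delta> B x\<close> stands for \<open>\<Sum> B x\<^sub>(\<^sub>1\<^sub>) x\<^sub>(\<^sub>2\<^sub>)\<close>.\<close>

definition sw :: "(('n::finite \<Rightarrow> complex) \<Rightarrow> ('n \<times> 'n \<Rightarrow> complex)) \<Rightarrow>
    (('n \<Rightarrow> complex) \<Rightarrow> ('n \<Rightarrow> complex) \<Rightarrow> complex) \<Rightarrow> ('n \<Rightarrow> complex) \<Rightarrow> complex" where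
  "sw \<Delta> B x = (\<Sum>i\<in>UNIV. \<Sum>j\<in>UNIV. \<Delta> x (i, j) * B (bvec i) (bvec j))"

lemma sw_add_form: "sw \<Delta> (\<lambda>p q. B p q + B' p q) x = sw \<Delta> B x + sw \<Delta> B' x"
  by (simp add: sw_def algebra_simps sum.distrib)

lemma sw_scale_form: "sw \<Delta> (\<lambda>p q. c * B p q) x = c * sw \<Delta> B x"
  by (simp add: sw_def algebra_simps sum_distrib_left)

lemma sw_scale_form2: "sw \<Delta> (\<lambda>p q. B p q * c) x = sw \<Delta> B x * c"
  by (simp add: sw_def algebra_simps sum_distrib_left)

lemma sum_swap22:
  "(\<Sum>i\<in>A. \<Sum>j\<in>B. \<Sum>k\<in>C. \<Sum>l\<in>D. f i j k l) = (\<Sum>k\<in>C. \<Sum>l\<in>D. \<Sum>i\<in>A. \<Sum>j\<in>B. f i j k l)"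
proof -
  have "(\<Sum>i\<in>A. \<Sum>j\<in>B. \<Sum>k\<in>C. \<Sum>l\<in>D. f i j k l) = (\<Sum>i\<in>A. \<Sum>k\<in>C. \<Sum>j\<in>B. \<Sum>l\<in>D. f i j k l)"
    by (rule sum.cong[OF refl], rule sum.swap)
  also have "\<dots> = (\<Sum>k\<in>C. \<Sum>i\<in>A. \<Sum>j\<in>B. \<Sum>l\<in>D. f i j k l)"
    by (rule sum.swap)
  also have "\<dots> = (\<Sum>k\<in>C. \<Sum>i\<in>A. \<Sum>l\<in>D. \<Sum>j\<in>B. f i j k l)"
    by (rule sum.cong[OF refl], rule sum.cong[OF refl], rule sum.swap)
  also have "\<dots> = (\<Sum>k\<in>C. \<Sum>l\<in>D. \<Sum>i\<in>A. \<Sum>j\<in>B. f i j k l)"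
    by (rule sum.cong[OF refl], rule sum.swap)
  finally show ?thesis .
qed

lemma sw_swap:
  "sw \<Delta> (\<lambda>p q. sw \<Delta>' (\<lambda>p' q'. T p q p' q') y) x = sw \<Delta>' (\<lambda>p' q'. sw \<Delta> (\<lambda>p q. T p q p' q') x) y"
proof -
  show ?thesis
    unfolding sw_def sum_distrib_left by (subst sum_swap22) (simp add: mult.left_commute)
qed

lemma sw_tswap: "sw (\<lambda>x. tswap (\<Delta> x)) B x = sw \<Delta> (\<lambda>p q. B q p) x"
  unfolding sw_def tswap_def by (subst sum.swap) simp

lemma linear_functional_sw_fun:
  assumes "linear_functional \<phi>"
  shows "\<phi> (\<lambda>k. sw \<Delta> (\<lambda>p q. F p q k) x) = sw \<Delta> (\<lambda>p q. \<phi> (F p q)) x"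
proof -
  have "(\<lambda>k. sw \<Delta> (\<lambda>p q. F p q k) x) = (\<Sum>i\<in>UNIV. \<Sum>j\<in>UNIV. \<Delta> x (i,j) *v F (bvec i) (bvec j))"
    by (simp add: fun_eq_iff sum_fun_apply sw_def vscale_def)
  thus ?thesis using assms
    by (simp add: linear_functional_sum sw_def linear_functional_iff)
qed

text \<open>Identities between vectors are tested against linear functionals, so each axiom is an
  equality of complex numbers and factors can be moved through \<open>sw\<close>. As
  \<open>sw\<close> evaluates its form on basis vectors, \<open>coassoc\<close> makes sense for
  arbitrary \<open>T\<close>; linearity is demanded where an argument receives a vector that need
  not belong to the basis, such as a product.\<close>

locale weak_hopf =
  fixes m :: "('n::finite \<Rightarrow> complex) \<Rightarrow> ('n \<Rightarrow> complex) \<Rightarrow> ('n \<Rightarrow> complex)"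
    and un :: "'n \<Rightarrow> complex"
    and \<Delta> :: "('n \<Rightarrow> complex) \<Rightarrow> ('n \<times> 'n \<Rightarrow> complex)"
    and \<epsilon> :: "('n \<Rightarrow> complex) \<Rightarrow> complex"
    and S :: "('n \<Rightarrow> complex) \<Rightarrow> ('n \<Rightarrow> complex)"
  assumes lin_m1: "linear_fun (\<lambda>x. m x y)" and lin_m2: "linear_fun (m x)"
    and assoc: "m (m x y) z = m x (m y z)"
    and unit1: "m un x = x" and unit2: "m x un = x"
    and lin_D: "linear_fun \<Delta>" and lin_e: "linear_functional \<epsilon>" and lin_S: "linear_fun S"
    and coassoc: "sw \<Delta> (\<lambda>p q. sw \<Delta> (\<lambda>p1 p2. T p1 p2 q) p) x = sw \<Delta> (\<lambda>p q. sw \<Delta> (\<lambda>q1 q2. T p q1 q2) q) x"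
    and counit1: "linear_functional \<phi> \<Longrightarrow> sw \<Delta> (\<lambda>p q. \<epsilon> p * \<phi> q) x = \<phi> x"
    and counit2: "linear_functional \<phi> \<Longrightarrow> sw \<Delta> (\<lambda>p q. \<phi> p * \<epsilon> q) x = \<phi> x"
    and sw_mult: "bilin B \<Longrightarrow> sw \<Delta> B (m x y) = sw \<Delta> (\<lambda>p q. sw \<Delta> (\<lambda>p' q'. B (m p p') (m q q')) y) x"
    and weak_unit1: "(\<And>p q. linear_functional (\<lambda>z. T p z q)) \<Longrightarrow>
        sw \<Delta> (\<lambda>p q. sw \<Delta> (\<lambda>p1 p2. T p1 p2 q) p) un = sw \<Delta> (\<lambda>p q. sw \<Delta> (\<lambda>p' q'. T p (m p' q) q') un) un"
    and weak_unit2: "(\<And>p q. linear_functional (\<lambda>z. T p z q)) \<Longrightarrow>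
        sw \<Delta> (\<lambda>p q. sw \<Delta> (\<lambda>p1 p2. T p1 p2 q) p) un = sw \<Delta> (\<lambda>p q. sw \<Delta> (\<lambda>p' q'. T p (m q p') q') un) un"
    and weak_counit1: "\<epsilon> (m (m x y) z) = sw \<Delta> (\<lambda>p q. \<epsilon> (m x p) * \<epsilon> (m q z)) y"
    and weak_counit2: "\<epsilon> (m (m x y) z) = sw \<Delta> (\<lambda>p q. \<epsilon> (m x q) * \<epsilon> (m p z)) y"
    and antipode1: "linear_functional \<phi> \<Longrightarrow>
        sw \<Delta> (\<lambda>p q. \<phi> (m (S p) q)) x = sw \<Delta> (\<lambda>p q. \<epsilon> (m x q) * \<phi> p) un"
    and antipode2: "linear_functional \<phi> \<Longrightarrow>
        sw \<Delta> (\<lambda>p q. \<phi> (m p (S q))) x = sw \<Delta> (\<lambda>p q. \<epsilon> (m p x) * \<phi> q) un"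
    and antipode3: "linear_functional \<phi> \<Longrightarrow>
        sw \<Delta> (\<lambda>p q. sw \<Delta> (\<lambda>p1 p2. \<phi> (m (m (S p1) p2) (S q))) p) x = \<phi> (S x)"
begin

text \<open>Reversing product and coproduct simultaneously respects all axioms and keeps the
  antipode. It exchanges the two counital maps, so every fact about one of them has a counterpart
  for the other.\<close>

lemma mirror: "weak_hopf (\<lambda>x y. m y x) un (\<lambda>x. tswap (\<Delta> x)) \<epsilon> S"
proof (unfold_locales, goal_cases)
  case (6) show ?case using lin_D unfolding linear_fun_def tswap_def by (auto simp: fun_eq_iff)
next
  case (9 T x) show ?case unfolding sw_tswap using coassoc[of "\<lambda>a b c. T c b a" x] by simp
next
  case (12 B x y) 
  have b: "bilin (\<lambda>p q. B q p)" using 12 unfolding bilin_def by auto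
  show ?case unfolding sw_tswap sw_mult[OF b] by (rule sw_swap)
next
  case (13 T)
  have t: "linear_functional (\<lambda>z. (\<lambda>a b c. T c b a) p z q)" for p q using 13 by simp
  have "sw \<Delta> (\<lambda>p q. sw \<Delta> (\<lambda>p1 p2. T p2 p1 p) q) un = sw \<Delta> (\<lambda>p q. sw \<Delta> (\<lambda>p1 p2. T q p2 p1) p) un"
    using coassoc[of "\<lambda>a b c. T c b a" un] by simp
  also have "\<dots> = sw \<Delta> (\<lambda>p q. sw \<Delta> (\<lambda>p' q'. T q' (m p' q) p) un) un"
    using weak_unit1[of "\<lambda>a b c. T c b a"] 13 by simp
  also have "\<dots> = sw \<Delta> (\<lambda>p q. sw \<Delta> (\<lambda>p' q'. T q (m p q') p') un) un"
    by (subst sw_swap) simp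
  finally show ?case unfolding sw_tswap .
next
  case (14 T)
  have "sw \<Delta> (\<lambda>p q. sw \<Delta> (\<lambda>p1 p2. T p2 p1 p) q) un = sw \<Delta> (\<lambda>p q. sw \<Delta> (\<lambda>p1 p2. T q p2 p1) p) un"
    using coassoc[of "\<lambda>a b c. T c b a" un] by simp
  also have "\<dots> = sw \<Delta> (\<lambda>p q. sw \<Delta> (\<lambda>p' q'. T q' (m q p') p) un) un"
    using weak_unit2[of "\<lambda>a b c. T c b a"] 14 by simp
  also have "\<dots> = sw \<Delta> (\<lambda>p q. sw \<Delta> (\<lambda>p' q'. T q (m q' p) p') un) un"
    by (subst sw_swap) simp
  finally show ?case unfolding sw_tswap .
next
  case (19 \<phi> x)
  have "sw \<Delta> (\<lambda>p q. sw \<Delta> (\<lambda>p1 p2. \<phi> (m (S p) (m p1 (S p2)))) q) x = \<phi> (S x)"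
    using antipode3[OF 19, of x] coassoc[of "\<lambda>a b c. \<phi> (m (S a) (m b (S c)))" x] by (simp add: assoc)
  thus ?case unfolding sw_tswap .
next
  case (15 x y z) show ?case unfolding sw_tswap assoc[symmetric] weak_counit1 by (simp add: mult.commute)
next
  case (16 x y z) show ?case unfolding sw_tswap assoc[symmetric] weak_counit2 by (simp add: mult.commute)
next
  case (17 \<phi> x) show ?case unfolding sw_tswap by (rule antipode2[OF 17])
next
  case (18 \<phi> x) show ?case unfolding sw_tswap by (rule antipode1[OF 18])
next
  case (10 \<phi> x) show ?case unfolding sw_tswap using counit2[OF 10] by (simp add: mult.commute)
next
  case (11 \<phi> x) show ?case unfolding sw_tswap using counit1[OF 11] by (simp add: mult.commute)
qed (simp_all add: lin_m1 lin_m2 assoc unit1 unit2 lin_e lin_S)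

lemma m_add1: "m (x + x') y = m x y + m x' y" and m_sc1: "m (c *v x) y = c *v m x y"
  and m_add2: "m y (x + x') = m y x + m y x'" and m_sc2: "m y (c *v x) = c *v m y x"
  using lin_m1[of y] lin_m2[of y] unfolding linear_fun_iff by auto

lemma S_add: "S (x + x') = S x + S x'" and S_sc: "S (c *v x) = c *v S x"
  using lin_S unfolding linear_fun_iff by auto

lemma sw_add: "sw \<Delta> B (x + x') = sw \<Delta> B x + sw \<Delta> B x'"
  and sw_sc: "sw \<Delta> B (c *v x) = c * sw \<Delta> B x"
  using lin_D unfolding linear_fun_iff
  by (simp_all add: sw_def algebra_simps sum.distrib vscale_def sum_distrib_left)

lemmas lin_simps = m_add1 m_sc1 m_add2 m_sc2 S_add S_sc sw_add sw_sc
  sw_add_form sw_scale_form sw_scale_form2 linear_functional_iff linear_fun_iff bilin_def algebra_simps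

text \<open>The source counital map; \<open>et\<close> is the target counital map. For an ordinary
  Hopf algebra both are x \<mapsto> \<epsilon>(x) 1.\<close>

definition es where "es x = (\<lambda>k. sw \<Delta> (\<lambda>p q. m (S p) q k) x)"
definition et where "et x = (\<lambda>k. sw \<Delta> (\<lambda>p q. m p (S q) k) x)"

lemma es_sw: "linear_functional \<phi> \<Longrightarrow> \<phi> (es x) = sw \<Delta> (\<lambda>p q. \<phi> (m (S p) q)) x"
  unfolding es_def by (rule linear_functional_sw_fun)

lemma et_sw: "linear_functional \<phi> \<Longrightarrow> \<phi> (et x) = sw \<Delta> (\<lambda>p q. \<phi> (m p (S q))) x"
  unfolding et_def by (rule linear_functional_sw_fun)

lemma lin_es: "linear_fun es" and lin_et: "linear_fun et"
  by (simp_all add: es_def et_def linear_fun_iff sw_add sw_sc fun_eq_iff)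

lemma es_add: "es (x + x') = es x + es x'" and es_sc: "es (c *v x) = c *v es x"
  and et_add: "et (x + x') = et x + et x'" and et_sc: "et (c *v x) = c *v et x"
  using lin_es lin_et unfolding linear_fun_iff by auto

lemmas lin_simps' = lin_simps es_add es_sc et_add et_sc

lemma es_unit: "linear_functional \<phi> \<Longrightarrow> \<phi> (es x) = sw \<Delta> (\<lambda>p q. \<epsilon> (m x q) * \<phi> p) un"
  by (simp add: es_sw antipode1)

lemma et_unit: "linear_functional \<phi> \<Longrightarrow> \<phi> (et x) = sw \<Delta> (\<lambda>p q. \<epsilon> (m p x) * \<phi> q) un"
  by (simp add: et_sw antipode2)

text \<open>Writing y = 1 y splits the coproduct over \<Delta>(1) and \<Delta>(y). The second weak
  counit axiom separates the factor containing \<open>x\<close>, and after coassociativity the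
  counit recombines what is left into 1_(1) y.\<close>

lemma es_mult_left:
  assumes \<phi>: "linear_functional \<phi>"
  shows "\<phi> (m (es x) y) = sw \<Delta> (\<lambda>p q. \<phi> p * \<epsilon> (m x q)) y"
proof -
  have bil: "sw \<Delta> (\<lambda>p1 p2. \<phi> p1 * \<epsilon> p2) (m p y) =
      sw \<Delta> (\<lambda>p1 p2. sw \<Delta> (\<lambda>p' q'. \<phi> (m p1 p') * \<epsilon> (m p2 q')) y) p" for p
    by (rule sw_mult) (use \<phi> lin_e in \<open>simp add: lin_simps\<close>)
  have "sw \<Delta> (\<lambda>p q. \<phi> p * \<epsilon> (m x q)) y = sw \<Delta> (\<lambda>p q. \<phi> p * \<epsilon> (m x q)) (m un y)"
    by (simp add: unit1)
  also have "\<dots> = sw \<Delta> (\<lambda>p q. sw \<Delta> (\<lambda>p' q'. \<phi> (m p p') * \<epsilon> (m x (m q q'))) y) un"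
    by (rule sw_mult) (use \<phi> lin_e in \<open>simp add: lin_simps\<close>)
  also have "\<dots> = sw \<Delta> (\<lambda>p q. sw \<Delta> (\<lambda>q1 q2. sw \<Delta> (\<lambda>p' q'. \<phi> (m p p') * (\<epsilon> (m x q2) * \<epsilon> (m q1 q'))) y) q) un"
    unfolding assoc[symmetric] weak_counit2 by (subst sw_swap) (simp add: sw_scale_form)
  also have "\<dots> = sw \<Delta> (\<lambda>p q. sw \<Delta> (\<lambda>p1 p2. sw \<Delta> (\<lambda>p' q'. \<phi> (m p1 p') * (\<epsilon> (m x q) * \<epsilon> (m p2 q'))) y) p) un"
    by (rule coassoc[symmetric])
  also have "\<dots> = sw \<Delta> (\<lambda>p q. sw \<Delta> (\<lambda>p1 p2. sw \<Delta> (\<lambda>p' q'. \<epsilon> (m x q) * (\<phi> (m p1 p') * \<epsilon> (m p2 q'))) y) p) un"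
    by (simp add: mult.left_commute)
  also have "\<dots> = sw \<Delta> (\<lambda>p q. \<epsilon> (m x q) * sw \<Delta> (\<lambda>p1 p2. \<phi> p1 * \<epsilon> p2) (m p y)) un"
    by (simp add: bil sw_scale_form)
  also have "\<dots> = sw \<Delta> (\<lambda>p q. \<epsilon> (m x q) * \<phi> (m p y)) un"
    by (simp add: counit2[OF \<phi>])
  also have "\<dots> = \<phi> (m (es x) y)"
    by (rule es_unit[symmetric]) (use \<phi> in \<open>simp add: lin_simps\<close>)
  finally show ?thesis ..
qed

lemma eps_es: "\<epsilon> (m (es x) y) = \<epsilon> (m x y)"
  unfolding es_mult_left[OF lin_e] by (rule counit1) (use lin_e in \<open>simp add: lin_simps\<close>)

lemma es_S: "linear_functional \<phi> \<Longrightarrow> sw \<Delta> (\<lambda>p q. \<phi> (m (es p) (S q))) x = \<phi> (S x)"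
  by (subst antipode3[symmetric], assumption, subst es_sw)
     (simp_all add: lin_simps)

lemma eps_S: "\<epsilon> (m (S x) y) = \<epsilon> (m (et x) y)"
proof -
  have l: "linear_functional (\<lambda>z. \<epsilon> (m z y))" using lin_e by (simp add: lin_simps)
  have "\<epsilon> (m (S x) y) = sw \<Delta> (\<lambda>p q. \<epsilon> (m (m (es p) (S q)) y)) x"
    using es_S[OF l] by simp
  also have "\<dots> = sw \<Delta> (\<lambda>p q. \<epsilon> (m (m p (S q)) y)) x"
    unfolding assoc eps_es ..
  also have "\<dots> = \<epsilon> (m (et x) y)"
    using et_sw[OF l] by simp
  finally show ?thesis .
qed

text \<open>\<open>eps_S\<close> trades the antipode for \<open>et\<close>, which is expanded over
  \<Delta>(1). Inserting 1 y produces a second \<Delta>(1); \<open>weak_unit2\<close> merges the two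
  copies into one iterated coproduct, where the counit applies.\<close>

lemma et_mult_left:
  assumes \<phi>: "linear_functional \<phi>"
  shows "\<phi> (m (et x) y) = sw \<Delta> (\<lambda>p q. \<epsilon> (m (S x) p) * \<phi> q) y"
proof -
  have bil: "sw \<Delta> (\<lambda>p q. \<epsilon> (m z p) * \<phi> q) (m w y) =
      sw \<Delta> (\<lambda>p q. sw \<Delta> (\<lambda>y1 y2. \<epsilon> (m z (m p y1)) * \<phi> (m q y2)) y) w" for z w
    by (rule sw_mult) (use \<phi> lin_e in \<open>simp add: lin_simps\<close>)
  have bil': "sw \<Delta> (\<lambda>p q. \<epsilon> p * \<phi> q) (m w y) =
      sw \<Delta> (\<lambda>p q. sw \<Delta> (\<lambda>y1 y2. \<epsilon> (m p y1) * \<phi> (m q y2)) y) w" for w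
    by (rule sw_mult) (use \<phi> lin_e in \<open>simp add: lin_simps\<close>)
  have "sw \<Delta> (\<lambda>p q. \<epsilon> (m (S x) p) * \<phi> q) y = sw \<Delta> (\<lambda>p q. \<epsilon> (m (et x) p) * \<phi> q) y"
    by (simp add: eps_S)
  also have "\<dots> = sw \<Delta> (\<lambda>p q. sw \<Delta> (\<lambda>p' q'. (\<epsilon> (m p' x) * \<epsilon> (m q' p)) * \<phi> q) un) y"
    by (subst et_unit) (use lin_e in \<open>simp_all add: lin_simps\<close>)
  also have "\<dots> = sw \<Delta> (\<lambda>p' q'. \<epsilon> (m p' x) * sw \<Delta> (\<lambda>p q. \<epsilon> (m q' p) * \<phi> q) y) un"
    by (subst sw_swap) (simp add: sw_scale_form mult.assoc)
  also have "\<dots> = sw \<Delta> (\<lambda>p' q'. \<epsilon> (m p' x) * sw \<Delta> (\<lambda>p q. \<epsilon> (m q' p) * \<phi> q) (m un y)) un"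
    by (simp add: unit1)
  also have "\<dots> = sw \<Delta> (\<lambda>p' q'. sw \<Delta> (\<lambda>p q. sw \<Delta> (\<lambda>y1 y2. \<epsilon> (m p' x) * (\<epsilon> (m (m q' p) y1) * \<phi> (m q y2))) y) un) un"
    by (simp add: bil sw_scale_form assoc)
  also have "\<dots> = sw \<Delta> (\<lambda>p' q'. sw \<Delta> (\<lambda>p1 p2. sw \<Delta> (\<lambda>y1 y2. \<epsilon> (m p1 x) * (\<epsilon> (m p2 y1) * \<phi> (m q' y2))) y) p') un"
    by (rule weak_unit2[where T = "\<lambda>p1 p2 q. sw \<Delta> (\<lambda>y1 y2. \<epsilon> (m p1 x) * (\<epsilon> (m p2 y1) * \<phi> (m q y2))) y", symmetric])
       (use \<phi> lin_e in \<open>simp add: lin_simps\<close>)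
  also have "\<dots> = sw \<Delta> (\<lambda>p q. sw \<Delta> (\<lambda>q1 q2. sw \<Delta> (\<lambda>y1 y2. \<epsilon> (m p x) * (\<epsilon> (m q1 y1) * \<phi> (m q2 y2))) y) q) un"
    by (rule coassoc)
  also have "\<dots> = sw \<Delta> (\<lambda>p q. \<epsilon> (m p x) * sw \<Delta> (\<lambda>y1 y2. \<epsilon> y1 * \<phi> y2) (m q y)) un"
    by (simp add: bil' sw_scale_form)
  also have "\<dots> = sw \<Delta> (\<lambda>p q. \<epsilon> (m p x) * \<phi> (m q y)) un"
    by (simp add: counit1[OF \<phi>])
  also have "\<dots> = \<phi> (m (et x) y)"
    by (rule et_unit[symmetric]) (use \<phi> in \<open>simp add: lin_simps\<close>)
  finally show ?thesis ..
qed

lemma es_mult: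
  assumes \<phi>: "linear_functional \<phi>"
  shows "\<phi> (es (m x y)) = sw \<Delta> (\<lambda>p q. \<phi> (es p) * \<epsilon> (m x q)) y"
proof -
  have "\<phi> (es (m x y)) = sw \<Delta> (\<lambda>p q. \<epsilon> (m (m x y) q) * \<phi> p) un"
    by (rule es_unit[OF \<phi>])
  also have "\<dots> = sw \<Delta> (\<lambda>p q. sw \<Delta> (\<lambda>y1 y2. \<epsilon> (m x y2) * (\<epsilon> (m y1 q) * \<phi> p)) y) un"
    unfolding weak_counit2 by (simp add: sw_scale_form2[symmetric] mult.assoc)
  also have "\<dots> = sw \<Delta> (\<lambda>y1 y2. \<epsilon> (m x y2) * \<phi> (es y1)) y"
    by (subst sw_swap) (simp add: sw_scale_form es_unit[OF \<phi>])
  finally show ?thesis by (simp add: mult.commute)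
qed

text \<open>\<open>es_mult\<close> leaves \<open>es\<close> of y_(1) times \<epsilon>(x y_(2)).
  Splitting this \<open>es\<close> and reassociating, \<open>es_mult_left\<close> collects the last
  two factors into \<open>es x\<close> times y_(2).\<close>

lemma es_mult_conj:
  assumes \<phi>: "linear_functional \<phi>"
  shows "\<phi> (es (m x y)) = sw \<Delta> (\<lambda>p q. \<phi> (m (m (S p) (es x)) q)) y"
proof -
  have e: "\<phi> (m (S p) (m (es x) q)) = sw \<Delta> (\<lambda>q1 q2. \<phi> (m (S p) q1) * \<epsilon> (m x q2)) q" for p q
    by (rule es_mult_left) (use \<phi> in \<open>simp add: lin_simps\<close>)
  have "sw \<Delta> (\<lambda>p q. \<phi> (m (m (S p) (es x)) q)) y = sw \<Delta> (\<lambda>p q. sw \<Delta> (\<lambda>q1 q2. \<phi> (m (S p) q1) * \<epsilon> (m x q2)) q) y"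
    by (simp add: e assoc)
  also have "\<dots> = sw \<Delta> (\<lambda>p q. \<phi> (es p) * \<epsilon> (m x q)) y"
    by (subst coassoc[symmetric]) (simp add: sw_scale_form2 es_sw[OF \<phi>])
  finally show ?thesis using es_mult[OF \<phi>] by simp
qed

end

context weak_hopf
begin

interpretation mir: weak_hopf "\<lambda>x y. m y x" un "\<lambda>x. tswap (\<Delta> x)" \<epsilon> S
  by (rule mirror)

lemma mir_es: "mir.es = et" and mir_et: "mir.et = es"
  by (simp_all add: fun_eq_iff mir.es_def mir.et_def es_def et_def sw_tswap)

lemma et_mult_right: "linear_functional \<phi> \<Longrightarrow> \<phi> (m y (et x)) = sw \<Delta> (\<lambda>p q. \<phi> q * \<epsilon> (m p x)) y"
  using mir.es_mult_left unfolding mir_es sw_tswap .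

lemma es_mult_right: "linear_functional \<phi> \<Longrightarrow> \<phi> (m y (es x)) = sw \<Delta> (\<lambda>p q. \<epsilon> (m q (S x)) * \<phi> p) y"
  using mir.et_mult_left unfolding mir_et sw_tswap .

lemma et_mult: "linear_functional \<phi> \<Longrightarrow> \<phi> (et (m x y)) = sw \<Delta> (\<lambda>p q. \<phi> (et q) * \<epsilon> (m p y)) x"
  using mir.es_mult unfolding mir_es sw_tswap .

lemma et_mult_conj: "linear_functional \<phi> \<Longrightarrow> \<phi> (et (m x y)) = sw \<Delta> (\<lambda>p q. \<phi> (m p (m (et y) (S q)))) x"
  using mir.es_mult_conj unfolding mir_es sw_tswap .

lemma S_et: "linear_functional \<phi> \<Longrightarrow> sw \<Delta> (\<lambda>p q. \<phi> (m (S p) (et q))) x = \<phi> (S x)"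
  using mir.es_S unfolding mir_es sw_tswap .

lemma functional_ext:
  assumes "\<And>\<phi>. linear_functional \<phi> \<Longrightarrow> \<phi> x = \<phi> y"
  shows "x = (y :: 'n \<Rightarrow> complex)"
  using assms[OF linear_functional_coord] by (rule ext)

text \<open>Expanding \<open>et y\<close> and then \<open>es x\<close> over the unit leads to the
  three legs of the iterated coproduct of 1. The axiom \<open>weak_unit2\<close> reads them as two
  copies of \<Delta>(1) whose middle product already has the order of \<open>et y\<close> times
  \<open>es x\<close>.\<close>

lemma es_et_commute: "m (es x) (et y) = m (et y) (es x)"
proof (rule functional_ext)
  fix \<phi> :: "('n \<Rightarrow> complex) \<Rightarrow> complex" assume \<phi>: "linear_functional \<phi>"
  have e: "\<phi> (m q (es x)) = sw \<Delta> (\<lambda>p' q'. \<epsilon> (m x q') * \<phi> (m q p')) un" for q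
    by (rule es_unit) (use \<phi> in \<open>simp add: lin_simps\<close>)
  have "\<phi> (m (es x) (et y)) = sw \<Delta> (\<lambda>p q. \<epsilon> (m p y) * \<phi> (m (es x) q)) un"
    by (rule et_unit) (use \<phi> in \<open>simp add: lin_simps\<close>)
  also have "\<dots> = sw \<Delta> (\<lambda>p q. sw \<Delta> (\<lambda>q1 q2. \<epsilon> (m p y) * (\<phi> q1 * \<epsilon> (m x q2))) q) un"
    unfolding es_mult_left[OF \<phi>] sw_scale_form ..
  also have "\<dots> = sw \<Delta> (\<lambda>p q. sw \<Delta> (\<lambda>p1 p2. \<epsilon> (m p1 y) * (\<phi> p2 * \<epsilon> (m x q))) p) un"
    by (rule coassoc[symmetric])
  also have "\<dots> = sw \<Delta> (\<lambda>p q. sw \<Delta> (\<lambda>p' q'. \<epsilon> (m p y) * (\<phi> (m q p') * \<epsilon> (m x q'))) un) un"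
    by (rule weak_unit2) (use \<phi> in \<open>simp add: lin_simps\<close>)
  also have "\<dots> = sw \<Delta> (\<lambda>p q. \<epsilon> (m p y) * \<phi> (m q (es x))) un"
    by (simp add: e sw_scale_form mult.commute)
  also have "\<dots> = \<phi> (m (et y) (es x))"
    by (rule et_unit[symmetric]) (use \<phi> in \<open>simp add: lin_simps\<close>)
  finally show "\<phi> (m (es x) (et y)) = \<phi> (m (et y) (es x))" .
qed

text \<open>Start from S(xy) as S(x_(1) y_(1)) times \<open>et\<close> of x_(2) y_(2) and unfold
  \<open>et\<close>. The leading factors form \<open>es\<close> of x_(1) y_(1), which unfolds by
  conjugation with y. Commutation of the two counital images then separates S(y_(1))
  \<open>et\<close> y_(2) from \<open>es\<close> x_(1) S(x_(2)), that is, S(y) from S(x).\<close>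

lemma S_mult: "S (m x y) = m (S y) (S x)"
proof (rule functional_ext)
  have comm: "m (es x) (m (et y) z) = m (et y) (m (es x) z)" for x y z
    by (simp only: assoc[symmetric] es_et_commute)
  fix \<phi> :: "('n \<Rightarrow> complex) \<Rightarrow> complex" assume \<phi>: "linear_functional \<phi>"
  have e1: "\<phi> (m (S (m x1 y1)) (et (m x2 y2))) = sw \<Delta> (\<lambda>p q. sw \<Delta> (\<lambda>r s. 
      \<phi> (m (S (m x1 y1)) (m p (m (m r (S s)) (S q))))) y2) x2" for x1 x2 y1 y2
  proof -
    have "\<phi> (m (S (m x1 y1)) (et (m x2 y2))) = sw \<Delta> (\<lambda>p q. \<phi> (m (S (m x1 y1)) (m p (m (et y2) (S q))))) x2"
      by (rule et_mult_conj) (use \<phi> in \<open>simp add: lin_simps\<close>)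
    moreover have "\<phi> (m (S (m x1 y1)) (m p (m (et y2) (S q)))) = 
      sw \<Delta> (\<lambda>r s. \<phi> (m (S (m x1 y1)) (m p (m (m r (S s)) (S q))))) y2" for p q
      by (rule et_sw) (use \<phi> in \<open>simp add: lin_simps\<close>)
    ultimately show ?thesis by simp
  qed
  have e2: "\<phi> (m (es (m x' y')) z) = sw \<Delta> (\<lambda>p1 p2. sw \<Delta> (\<lambda>r1 r2. \<phi> (m (m (S (m p1 r1)) (m p2 r2)) z)) y') x'" for x' y' z
  proof -
    have "\<phi> (m (es (m x' y')) z) = sw \<Delta> (\<lambda>p q. \<phi> (m (m (S p) q) z)) (m x' y')"
      by (rule es_sw) (use \<phi> in \<open>simp add: lin_simps\<close>)
    also have "\<dots> = sw \<Delta> (\<lambda>p1 p2. sw \<Delta> (\<lambda>r1 r2. \<phi> (m (m (S (m p1 r1)) (m p2 r2)) z)) y') x'"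
      by (rule sw_mult) (use \<phi> in \<open>simp add: lin_simps\<close>)
    finally show ?thesis .
  qed
  have e3: "\<phi> (m (es (m x' y')) z) = sw \<Delta> (\<lambda>r1 r2. \<phi> (m (m (m (S r1) (es x')) r2) z)) y'" for x' y' z
    by (rule es_mult_conj) (use \<phi> in \<open>simp add: lin_simps\<close>)
  have e4: "\<phi> (m (S r) (m (es x') (m (et y'') z))) = sw \<Delta> (\<lambda>p q. \<phi> (m (S r) (m (es x') (m (m p (S q)) z)))) y''" for r x' y'' z
    by (rule et_sw) (use \<phi> in \<open>simp add: lin_simps\<close>)
  have e5: "sw \<Delta> (\<lambda>p q. \<phi> (m z (m (es p) (S q)))) x = \<phi> (m z (S x))" for z
    by (rule es_S) (use \<phi> in \<open>simp add: lin_simps\<close>)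
  have e6: "sw \<Delta> (\<lambda>p q. \<phi> (m (m (S p) (et q)) z)) y = \<phi> (m (S y) z)" for z
    by (rule S_et) (use \<phi> in \<open>simp add: lin_simps\<close>)
  have "\<phi> (S (m x y)) = sw \<Delta> (\<lambda>p q. \<phi> (m (S p) (et q))) (m x y)"
    by (rule S_et[OF \<phi>, symmetric])
  also have "\<dots> = sw \<Delta> (\<lambda>x1 x2. sw \<Delta> (\<lambda>y1 y2. \<phi> (m (S (m x1 y1)) (et (m x2 y2)))) y) x"
    by (rule sw_mult) (use \<phi> in \<open>simp add: lin_simps'\<close>)
  also have "\<dots> = sw \<Delta> (\<lambda>x1 x2. sw \<Delta> (\<lambda>p q. sw \<Delta> (\<lambda>y1 y2. sw \<Delta> (\<lambda>r s. 
      \<phi> (m (S (m x1 y1)) (m p (m (m r (S s)) (S q))))) y2) y) x2) x"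
    unfolding e1 by (subst (2) sw_swap) (rule refl)
  also have "\<dots> = sw \<Delta> (\<lambda>x1 x2. sw \<Delta> (\<lambda>p q. sw \<Delta> (\<lambda>y1 y2. sw \<Delta> (\<lambda>r s. 
      \<phi> (m (S (m x1 r)) (m p (m (m s (S y2)) (S q))))) y1) y) x2) x"
    by (subst coassoc[where x = y, symmetric]) (rule refl)
  also have "\<dots> = sw \<Delta> (\<lambda>x1 x2. sw \<Delta> (\<lambda>p q. sw \<Delta> (\<lambda>y1 y2. sw \<Delta> (\<lambda>r s. 
      \<phi> (m (S (m p r)) (m q (m (m s (S y2)) (S x2))))) y1) y) x1) x"
    by (rule coassoc[symmetric])
  also have "\<dots> = sw \<Delta> (\<lambda>x1 x2. sw \<Delta> (\<lambda>y1 y2. \<phi> (m (es (m x1 y1)) (m (S y2) (S x2)))) y) x"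
    unfolding e2 by (subst (2) sw_swap) (simp add: assoc)
  also have "\<dots> = sw \<Delta> (\<lambda>x1 x2. sw \<Delta> (\<lambda>y1 y2. sw \<Delta> (\<lambda>r1 r2. \<phi> (m (S r1) (m (es x1) (m (m r2 (S y2)) (S x2))))) y1) y) x"
    unfolding e3 by (simp add: assoc)
  also have "\<dots> = sw \<Delta> (\<lambda>x1 x2. sw \<Delta> (\<lambda>y1 y2. \<phi> (m (S y1) (m (es x1) (m (et y2) (S x2))))) y) x"
    unfolding e4 by (subst coassoc) (rule refl)
  also have "\<dots> = sw \<Delta> (\<lambda>x1 x2. sw \<Delta> (\<lambda>y1 y2. \<phi> (m (m (S y1) (et y2)) (m (es x1) (S x2)))) y) x"
    by (simp add: assoc comm)
  also have "\<dots> = sw \<Delta> (\<lambda>x1 x2. \<phi> (m (S y) (m (es x1) (S x2)))) x"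
    unfolding e6 ..
  also have "\<dots> = \<phi> (m (S y) (S x))"
    unfolding e5 ..
  finally show "\<phi> (S (m x y)) = \<phi> (m (S y) (S x))" .
qed

end

section \<open>From the coordinate axioms to the functional form\<close>

lemma linear_fun_expand:
  assumes "linear_fun F"
  shows "F x k = (\<Sum>i\<in>UNIV. x i * F (bvec (i :: 'n::finite)) k)"
  using linear_functional_expand[of "\<lambda>x. F x k" x] assms
  unfolding linear_functional_iff linear_fun_iff by simp

lemma bilin_expand:
  assumes "bilin B"
  shows "B x y = (\<Sum>i\<in>UNIV. \<Sum>j\<in>UNIV. x i * y j * B (bvec (i :: 'n::finite)) (bvec (j :: 'm::finite)))"
proof -
  have "B x y = (\<Sum>i\<in>UNIV. x i * B (bvec i) y)"
    by (rule linear_functional_expand) (use assms in \<open>simp add: bilin_def\<close>)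
  moreover have "B (bvec i) y = (\<Sum>j\<in>UNIV. y j * B (bvec i) (bvec j))" for i
    by (rule linear_functional_expand) (use assms in \<open>simp add: bilin_def\<close>)
  ultimately show ?thesis by (simp add: sum_distrib_left mult.assoc)
qed

lemma sum_move5:
  "(\<Sum>i\<in>I. \<Sum>a\<in>A. \<Sum>b\<in>B. \<Sum>c\<in>C. \<Sum>d\<in>D. f i a b c d) = (\<Sum>a\<in>A. \<Sum>b\<in>B. \<Sum>c\<in>C. \<Sum>d\<in>D. \<Sum>i\<in>I. f i a b c d)"
  by (subst sum.swap, rule sum.cong[OF refl], subst sum.swap, rule sum.cong[OF refl],
      subst sum.swap, rule sum.cong[OF refl], rule sum.swap)

lemma sum_move4:
  "(\<Sum>i\<in>I. \<Sum>a\<in>A. \<Sum>b\<in>B. \<Sum>c\<in>C. f i a b c) = (\<Sum>a\<in>A. \<Sum>b\<in>B. \<Sum>c\<in>C. \<Sum>i\<in>I. f i a b c)"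
  by (subst sum.swap, rule sum.cong[OF refl], subst sum.swap, rule sum.cong[OF refl], rule sum.swap)

lemma sum_swap33:
  "(\<Sum>i\<in>I. \<Sum>j\<in>J. \<Sum>k\<in>K. \<Sum>a\<in>A. \<Sum>b\<in>B. \<Sum>c\<in>C. f i j k a b c) =
   (\<Sum>a\<in>A. \<Sum>b\<in>B. \<Sum>c\<in>C. \<Sum>i\<in>I. \<Sum>j\<in>J. \<Sum>k\<in>K. f i j k a b c)"
proof -
  have "(\<Sum>i\<in>I. \<Sum>j\<in>J. \<Sum>k\<in>K. \<Sum>a\<in>A. \<Sum>b\<in>B. \<Sum>c\<in>C. f i j k a b c) =
     (\<Sum>i\<in>I. \<Sum>j\<in>J. \<Sum>a\<in>A. \<Sum>b\<in>B. \<Sum>c\<in>C. \<Sum>k\<in>K. f i j k a b c)"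
    by (rule sum.cong[OF refl], rule sum.cong[OF refl], rule sum_move4)
  also have "\<dots> = (\<Sum>i\<in>I. \<Sum>a\<in>A. \<Sum>b\<in>B. \<Sum>c\<in>C. \<Sum>j\<in>J. \<Sum>k\<in>K. f i j k a b c)"
    by (rule sum.cong[OF refl], rule sum_move4)
  also have "\<dots> = (\<Sum>a\<in>A. \<Sum>b\<in>B. \<Sum>c\<in>C. \<Sum>i\<in>I. \<Sum>j\<in>J. \<Sum>k\<in>K. f i j k a b c)"
    by (rule sum_move4)
  finally show ?thesis .
qed

lemma sum_bvec [simp]:
  "(\<Sum>j\<in>UNIV. f j * bvec j k) = f (k :: 'n::finite)" "(\<Sum>j\<in>UNIV. bvec j k * f j) = f k"
  by (simp_all add: bvec_def if_distrib[of "\<lambda>z. _ * z"] if_distrib[of "\<lambda>z. z * _"] cong: if_cong)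

lemma sum_bvec_out: "(\<Sum>k\<in>UNIV. g k * bvec i k) = g (i :: 'n::finite)"
  by (simp add: bvec_def if_distrib[of "\<lambda>z. _ * z"] cong: if_cong)

lemma sw_left_iter:
  "sw \<Delta> (\<lambda>p q. sw \<Delta> (\<lambda>p1 p2. T p1 p2 q) p) x =
   (\<Sum>a\<in>UNIV. \<Sum>b\<in>UNIV. \<Sum>c\<in>UNIV. comult2_left \<Delta> x (a, b, c) * T (bvec a) (bvec b) (bvec c))"
proof -
  have "sw \<Delta> (\<lambda>p q. sw \<Delta> (\<lambda>p1 p2. T p1 p2 q) p) x =
    (\<Sum>i\<in>UNIV. \<Sum>c\<in>UNIV. \<Sum>a\<in>UNIV. \<Sum>b\<in>UNIV. \<Delta> x (i, c) * (\<Delta> (bvec i) (a, b) * T (bvec a) (bvec b) (bvec c)))"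
    by (simp add: sw_def sum_distrib_left)
  also have "\<dots> = (\<Sum>a\<in>UNIV. \<Sum>b\<in>UNIV. \<Sum>i\<in>UNIV. \<Sum>c\<in>UNIV. \<Delta> x (i, c) * (\<Delta> (bvec i) (a, b) * T (bvec a) (bvec b) (bvec c)))"
    by (rule sum_swap22)
  also have "\<dots> = (\<Sum>a\<in>UNIV. \<Sum>b\<in>UNIV. \<Sum>c\<in>UNIV. \<Sum>i\<in>UNIV. \<Delta> x (i, c) * (\<Delta> (bvec i) (a, b) * T (bvec a) (bvec b) (bvec c)))"
    by (rule sum.cong[OF refl], rule sum.cong[OF refl], rule sum.swap)
  also have "\<dots> = (\<Sum>a\<in>UNIV. \<Sum>b\<in>UNIV. \<Sum>c\<in>UNIV. comult2_left \<Delta> x (a, b, c) * T (bvec a) (bvec b) (bvec c))"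
    by (simp add: comult2_left_def sum_distrib_right[symmetric] mult.assoc[symmetric])
  finally show ?thesis .
qed

lemma sw_right_iter:
  "sw \<Delta> (\<lambda>p q. sw \<Delta> (\<lambda>q1 q2. T p q1 q2) q) x =
   (\<Sum>a\<in>UNIV. \<Sum>b\<in>UNIV. \<Sum>c\<in>UNIV. comult2_right \<Delta> x (a, b, c) * T (bvec a) (bvec b) (bvec c))"
proof -
  have l: "comult2_right \<Delta> x (a, b, c) = (\<Sum>j\<in>UNIV. \<Delta> x (a, j) * \<Delta> (bvec j) (b, c))" for a b c
  proof -
    have "comult2_right \<Delta> x (a, b, c) = (\<Sum>j\<in>UNIV. \<Sum>i\<in>UNIV. (\<Delta> x (i, j) * \<Delta> (bvec j) (b, c)) * bvec i a)"
      unfolding comult2_right_def prod.case by (subst sum.swap) (simp add: mult_ac)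
    thus ?thesis by simp
  qed
  have "sw \<Delta> (\<lambda>p q. sw \<Delta> (\<lambda>q1 q2. T p q1 q2) q) x =
    (\<Sum>a\<in>UNIV. \<Sum>i\<in>UNIV. \<Sum>b\<in>UNIV. \<Sum>c\<in>UNIV. \<Delta> x (a, i) * (\<Delta> (bvec i) (b, c) * T (bvec a) (bvec b) (bvec c)))"
    by (simp add: sw_def sum_distrib_left)
  also have "\<dots> = (\<Sum>a\<in>UNIV. \<Sum>b\<in>UNIV. \<Sum>i\<in>UNIV. \<Sum>c\<in>UNIV. \<Delta> x (a, i) * (\<Delta> (bvec i) (b, c) * T (bvec a) (bvec b) (bvec c)))"
    by (rule sum.cong[OF refl], rule sum.swap)
  also have "\<dots> = (\<Sum>a\<in>UNIV. \<Sum>b\<in>UNIV. \<Sum>c\<in>UNIV. \<Sum>i\<in>UNIV. \<Delta> x (a, i) * (\<Delta> (bvec i) (b, c) * T (bvec a) (bvec b) (bvec c)))"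
    by (rule sum.cong[OF refl], rule sum.cong[OF refl], rule sum.swap)
  also have "\<dots> = (\<Sum>a\<in>UNIV. \<Sum>b\<in>UNIV. \<Sum>c\<in>UNIV. comult2_right \<Delta> x (a, b, c) * T (bvec a) (bvec b) (bvec c))"
    by (simp add: l sum_distrib_left sum_distrib_right mult.assoc)
  finally show ?thesis .
qed

text \<open>The units in the outer legs are absorbed, so only the middle leg keeps a genuine
  product. The other order, \<open>mult3_rl\<close>, is this statement for the opposite
  product.\<close>

lemma mult3_lr:
  assumes "\<And>y. linear_fun (\<lambda>x. m x y)" "\<And>x. linear_fun (m x)" "\<And>x. m un x = x" "\<And>x. m x un = x"
  shows "mult3 m (tens_l un X) (tens_r Y un) (p, q, r) =
    (\<Sum>i\<in>UNIV. \<Sum>j\<in>UNIV. X (i, r) * Y (p, j) * m (bvec i) (bvec j) q)"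
proof -
  have e1: "(\<Sum>i\<in>UNIV. un i * m (bvec i) y p) = y p" for y p
    using linear_fun_expand[OF assms(1), of un y p] assms(3) by simp
  have e2: "(\<Sum>i\<in>UNIV. un i * m y (bvec i) p) = y p" for y p
    using linear_fun_expand[OF assms(2), of y un p] assms(4) by simp
  have "mult3 m (tens_l un X) (tens_r Y un) (p, q, r) =
     (\<Sum>i\<in>UNIV. \<Sum>j\<in>UNIV. \<Sum>k\<in>UNIV. \<Sum>i'\<in>UNIV. \<Sum>j'\<in>UNIV. 
        X (j, k) * Y (i', j') * m (bvec j) (bvec j') q * (un i * m (bvec i) (bvec i') p) * (\<Sum>k'\<in>UNIV. un k' * m (bvec k) (bvec k') r))"
    by (simp add: mult3_def tens_l_def tens_r_def sum_distrib_left mult_ac)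
  also have "\<dots> = (\<Sum>j\<in>UNIV. \<Sum>k\<in>UNIV. \<Sum>i'\<in>UNIV. \<Sum>j'\<in>UNIV. \<Sum>i\<in>UNIV. 
        X (j, k) * Y (i', j') * m (bvec j) (bvec j') q * (un i * m (bvec i) (bvec i') p) * bvec k r)"
    unfolding e2 by (rule sum_move5)
  also have "\<dots> = (\<Sum>j\<in>UNIV. \<Sum>k\<in>UNIV. \<Sum>i'\<in>UNIV. \<Sum>j'\<in>UNIV. 
        X (j, k) * Y (i', j') * m (bvec j) (bvec j') q * bvec i' p * bvec k r)"
    by (simp add: sum_distrib_left[symmetric] sum_distrib_right[symmetric] e1)
  also have "\<dots> = (\<Sum>j\<in>UNIV. \<Sum>k\<in>UNIV. (\<Sum>j'\<in>UNIV. \<Sum>i'\<in>UNIV. 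
        (X (j, k) * Y (i', j') * m (bvec j) (bvec j') q) * bvec i' p) * bvec k r)"
    by (subst (3) sum.swap) (simp add: sum_distrib_right)
  also have "\<dots> = (\<Sum>i\<in>UNIV. \<Sum>j\<in>UNIV. X (i, r) * Y (p, j) * m (bvec i) (bvec j) q)"
    by simp
  finally show ?thesis .
qed

lemma mult3_rl:
  assumes "\<And>y. linear_fun (\<lambda>x. m x y)" "\<And>x. linear_fun (m x)" "\<And>x. m un x = x" "\<And>x. m x un = x"
  shows "mult3 m (tens_r Y un) (tens_l un X) (p, q, r) =
    (\<Sum>i\<in>UNIV. \<Sum>j\<in>UNIV. Y (p, i) * X (j, r) * m (bvec i) (bvec j) q)"
proof -
  have "mult3 m (tens_r Y un) (tens_l un X) (p, q, r) = mult3 (\<lambda>x y. m y x) (tens_l un X) (tens_r Y un) (p, q, r)"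
    unfolding mult3_def prod.case by (subst sum_swap33) (simp add: mult_ac)
  also have "\<dots> = (\<Sum>i\<in>UNIV. \<Sum>j\<in>UNIV. X (i, r) * Y (p, j) * m (bvec j) (bvec i) q)"
    by (rule mult3_lr) (use assms in auto)
  finally show ?thesis by (subst sum.swap) (simp add: mult.commute)
qed

theorem weak_hopf_intro:
  assumes "weak_hopf_algebra m un \<Delta> \<epsilon> S"
  shows "weak_hopf m un \<Delta> \<epsilon> S"
proof -
  note A = assms[unfolded weak_hopf_algebra_def]
  have lm1: "\<And>y. linear_fun (\<lambda>x. m x y)" and lm2: "\<And>x. linear_fun (m x)" 
    and u1: "\<And>x. m un x = x" and u2: "\<And>x. m x un = x"
    and lD: "linear_fun \<Delta>" and le: "linear_functional \<epsilon>" and lS: "linear_fun S" using A by auto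
  have ass: "m (m x y) z = m x (m y z)" for x y z using A by blast
  have co: "comult2_left \<Delta> x = comult2_right \<Delta> x" for x using A by blast
  have c1: "(\<lambda>q. \<Sum>p\<in>UNIV. \<epsilon> (bvec p) * \<Delta> x (p, q)) = x" for x using A by blast
  have c2: "(\<lambda>p. \<Sum>q\<in>UNIV. \<Delta> x (p, q) * \<epsilon> (bvec q)) = x" for x using A by blast
  have mu: "\<Delta> (m x y) = mult2 m (\<Delta> x) (\<Delta> y)" for x y using A by blast
  have w1: "comult2_left \<Delta> un = mult3 m (tens_l un (\<Delta> un)) (tens_r (\<Delta> un) un)"
    and w2: "comult2_left \<Delta> un = mult3 m (tens_r (\<Delta> un) un) (tens_l un (\<Delta> un))" using A by blast+
  have k1: "\<epsilon> (m (m x y) z) =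
        (\<Sum>i\<in>UNIV. \<Sum>j\<in>UNIV. \<Delta> y (i, j) * \<epsilon> (m x (bvec i)) * \<epsilon> (m (bvec j) z))" for x y z using A by blast
  have k2: "\<epsilon> (m (m x y) z) =
        (\<Sum>i\<in>UNIV. \<Sum>j\<in>UNIV. \<Delta> y (i, j) * \<epsilon> (m x (bvec j)) * \<epsilon> (m (bvec i) z))" for x y z using A by blast
  have a1: "(\<lambda>k. \<Sum>i\<in>UNIV. \<Sum>j\<in>UNIV. \<Delta> x (i, j) * m (S (bvec i)) (bvec j) k) =
          (\<lambda>k. \<Sum>i\<in>UNIV. \<Sum>j\<in>UNIV. \<Delta> un (i, j) * \<epsilon> (m x (bvec j)) * bvec i k)" for x using A by blast
  have a2: "(\<lambda>k. \<Sum>i\<in>UNIV. \<Sum>j\<in>UNIV. \<Delta> x (i, j) * m (bvec i) (S (bvec j)) k) =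
          (\<lambda>k. \<Sum>i\<in>UNIV. \<Sum>j\<in>UNIV. \<Delta> un (i, j) * \<epsilon> (m (bvec i) x) * bvec j k)" for x using A by blast
  have a3: "(\<lambda>k. \<Sum>i\<in>UNIV. \<Sum>j\<in>UNIV. \<Sum>l\<in>UNIV. comult2_left \<Delta> x (i, j, l) * m (m (S (bvec i)) (bvec j)) (S (bvec l)) k)
          = S x" for x using A by blast
  show ?thesis
  proof (unfold_locales, goal_cases)
    case (9 T x) show ?case unfolding sw_left_iter sw_right_iter co ..
  next
    case (10 \<phi> x)
    have "sw \<Delta> (\<lambda>p q. \<epsilon> p * \<phi> q) x = (\<Sum>q\<in>UNIV. (\<Sum>p\<in>UNIV. \<epsilon> (bvec p) * \<Delta> x (p, q)) * \<phi> (bvec q))"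
      unfolding sw_def by (subst sum.swap) (simp add: sum_distrib_left sum_distrib_right mult_ac)
    thus ?case using linear_functional_expand[OF 10, of x] fun_cong[OF c1] by simp
  next
    case (11 \<phi> x)
    have "sw \<Delta> (\<lambda>p q. \<phi> p * \<epsilon> q) x = (\<Sum>p\<in>UNIV. (\<Sum>q\<in>UNIV. \<Delta> x (p, q) * \<epsilon> (bvec q)) * \<phi> (bvec p))"
      unfolding sw_def by (simp add: sum_distrib_left sum_distrib_right mult_ac)
    thus ?case using linear_functional_expand[OF 11, of x] fun_cong[OF c2] by simp
  next
    case (12 B x y)
    have "sw \<Delta> B (m x y) = (\<Sum>p\<in>UNIV. \<Sum>q\<in>UNIV. \<Sum>i\<in>UNIV. \<Sum>j\<in>UNIV. \<Sum>k\<in>UNIV. \<Sum>l\<in>UNIV. 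
        \<Delta> x (i, j) * (\<Delta> y (k, l) * (m (bvec i) (bvec k) p * m (bvec j) (bvec l) q * B (bvec p) (bvec q))))"
      by (simp add: sw_def mu mult2_def sum_distrib_left sum_distrib_right mult_ac)
    also have "\<dots> = (\<Sum>i\<in>UNIV. \<Sum>j\<in>UNIV. \<Sum>p\<in>UNIV. \<Sum>q\<in>UNIV. \<Sum>k\<in>UNIV. \<Sum>l\<in>UNIV. 
        \<Delta> x (i, j) * (\<Delta> y (k, l) * (m (bvec i) (bvec k) p * m (bvec j) (bvec l) q * B (bvec p) (bvec q))))"
      by (rule sum_swap22)
    also have "\<dots> = (\<Sum>i\<in>UNIV. \<Sum>j\<in>UNIV. \<Sum>k\<in>UNIV. \<Sum>l\<in>UNIV. \<Sum>p\<in>UNIV. \<Sum>q\<in>UNIV. 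
        \<Delta> x (i, j) * (\<Delta> y (k, l) * (m (bvec i) (bvec k) p * m (bvec j) (bvec l) q * B (bvec p) (bvec q))))"
      by (rule sum.cong[OF refl], rule sum.cong[OF refl], rule sum_swap22)
    also have "\<dots> = sw \<Delta> (\<lambda>p q. sw \<Delta> (\<lambda>p' q'. B (m p p') (m q q')) y) x"
      unfolding sw_def by (subst bilin_expand[OF 12]) (simp add: sum_distrib_left)
    finally show ?case .
  next
    case (13 T)
    have e: "T a (m x y) c = (\<Sum>b\<in>UNIV. m x y b * T a (bvec b) c)" for a c x y
      by (rule linear_functional_expand[OF 13])
    have "sw \<Delta> (\<lambda>p q. sw \<Delta> (\<lambda>p1 p2. T p1 p2 q) p) un = 
      (\<Sum>a\<in>UNIV. \<Sum>b\<in>UNIV. \<Sum>c\<in>UNIV. \<Sum>i\<in>UNIV. \<Sum>j\<in>UNIV. 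
         \<Delta> un (i, c) * \<Delta> un (a, j) * m (bvec i) (bvec j) b * T (bvec a) (bvec b) (bvec c))"
      unfolding sw_left_iter w1 mult3_lr[OF lm1 lm2 u1 u2] sum_distrib_right ..
    also have "\<dots> = (\<Sum>a\<in>UNIV. \<Sum>j\<in>UNIV. \<Sum>i\<in>UNIV. \<Sum>c\<in>UNIV. \<Sum>b\<in>UNIV. 
         \<Delta> un (i, c) * \<Delta> un (a, j) * m (bvec i) (bvec j) b * T (bvec a) (bvec b) (bvec c))"
      by (rule sum.cong[OF refl], subst sum_swap22, subst sum.swap, rule sum.cong[OF refl], rule sum.cong[OF refl], rule sum.swap)
    also have "\<dots> = (\<Sum>a\<in>UNIV. \<Sum>j\<in>UNIV. \<Sum>i\<in>UNIV. \<Sum>c\<in>UNIV. 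
         \<Delta> un (a, j) * (\<Delta> un (i, c) * T (bvec a) (m (bvec i) (bvec j)) (bvec c)))"
      by (simp add: e sum_distrib_left mult_ac)
    finally show ?case by (simp add: sw_def sum_distrib_left)
  next
    case (14 T)
    have e: "T a (m x y) c = (\<Sum>b\<in>UNIV. m x y b * T a (bvec b) c)" for a c x y
      by (rule linear_functional_expand[OF 14])
    have "sw \<Delta> (\<lambda>p q. sw \<Delta> (\<lambda>p1 p2. T p1 p2 q) p) un = 
      (\<Sum>a\<in>UNIV. \<Sum>b\<in>UNIV. \<Sum>c\<in>UNIV. \<Sum>i\<in>UNIV. \<Sum>j\<in>UNIV. 
         \<Delta> un (a, i) * \<Delta> un (j, c) * m (bvec i) (bvec j) b * T (bvec a) (bvec b) (bvec c))"
      unfolding sw_left_iter w2 mult3_rl[OF lm1 lm2 u1 u2] sum_distrib_right ..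
    also have "\<dots> = (\<Sum>a\<in>UNIV. \<Sum>i\<in>UNIV. \<Sum>j\<in>UNIV. \<Sum>c\<in>UNIV. \<Sum>b\<in>UNIV. 
         \<Delta> un (a, i) * \<Delta> un (j, c) * m (bvec i) (bvec j) b * T (bvec a) (bvec b) (bvec c))"
      by (rule sum.cong[OF refl], subst sum_swap22, rule sum.cong[OF refl], rule sum.cong[OF refl], rule sum.swap)
    also have "\<dots> = (\<Sum>a\<in>UNIV. \<Sum>j\<in>UNIV. \<Sum>i\<in>UNIV. \<Sum>c\<in>UNIV. 
         \<Delta> un (a, j) * (\<Delta> un (i, c) * T (bvec a) (m (bvec j) (bvec i)) (bvec c)))"
      by (simp add: e sum_distrib_left mult_ac)
    finally show ?case by (simp add: sw_def sum_distrib_left)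
  next
    case (15 x y z) show ?case unfolding k1 sw_def by (simp add: mult.assoc)
  next
    case (16 x y z) show ?case unfolding k2 sw_def by (simp add: mult.assoc)
  next
    case (17 \<phi> x)
    have "sw \<Delta> (\<lambda>p q. \<phi> (m (S p) q)) x = \<phi> (\<lambda>k. \<Sum>i\<in>UNIV. \<Sum>j\<in>UNIV. \<Delta> x (i, j) * m (S (bvec i)) (bvec j) k)"
      unfolding linear_functional_sw_fun[OF 17, symmetric] sw_def ..
    also have "\<dots> = \<phi> (\<lambda>k. sw \<Delta> (\<lambda>p q. (\<epsilon> (m x q) *v p) k) un)"
      unfolding a1 by (simp add: sw_def mult.assoc)
    finally show ?case using 17 unfolding linear_functional_sw_fun[OF 17] linear_functional_iff by simp
  next
    case (18 \<phi> x)
    have "sw \<Delta> (\<lambda>p q. \<phi> (m p (S q))) x = \<phi> (\<lambda>k. \<Sum>i\<in>UNIV. \<Sum>j\<in>UNIV. \<Delta> x (i, j) * m (bvec i) (S (bvec j)) k)"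
      unfolding linear_functional_sw_fun[OF 18, symmetric] sw_def ..
    also have "\<dots> = \<phi> (\<lambda>k. sw \<Delta> (\<lambda>p q. (\<epsilon> (m p x) *v q) k) un)"
      unfolding a2 by (simp add: sw_def mult.assoc)
    finally show ?case using 18 unfolding linear_functional_sw_fun[OF 18] by (simp add: linear_functional_def)
  next
    case (19 \<phi> x)
    have "sw \<Delta> (\<lambda>p q. sw \<Delta> (\<lambda>p1 p2. \<phi> (m (m (S p1) p2) (S q))) p) x = 
       \<phi> (\<lambda>k. sw \<Delta> (\<lambda>p q. (\<lambda>k. sw \<Delta> (\<lambda>p1 p2. m (m (S p1) p2) (S q) k) p) k) x)"
      unfolding linear_functional_sw_fun[OF 19] ..
    also have "\<dots> = \<phi> (S x)" using a3 by (simp add: sw_left_iter)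
    finally show ?case .
  qed (simp_all add: lm1 lm2 ass u1 u2 lD le lS)
qed

section \<open>Linear algebra: function spaces, traces of idempotents, Schur's lemma\<close>

declare plus_fun_def [simp del] zero_fun_def [simp del]

lemma inj_bvec: "inj bvec"
  by (rule injI) (metis bvec_def one_neq_zero)

interpretation fv: vector_space "vscale :: complex \<Rightarrow> ('n::finite \<Rightarrow> complex) \<Rightarrow> 'n \<Rightarrow> complex"
  by unfold_locales (auto simp: fun_eq_iff algebra_simps)

interpretation fv: finite_dimensional_vector_space "vscale :: complex \<Rightarrow> ('n::finite \<Rightarrow> complex) \<Rightarrow> 'n \<Rightarrow> complex" "range bvec"
proof
  show "finite (range bvec :: ('n \<Rightarrow> complex) set)" by simp
  show "fv.independent (range bvec :: ('n \<Rightarrow> complex) set)"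
  proof (subst fv.dependent_finite, simp, clarify)
    fix u and k :: 'n assume u: "(\<Sum>v\<in>range bvec. u v *v v) = 0" "u (bvec k) \<noteq> 0"
    have "(\<Sum>v\<in>range bvec. u v *v v) = (\<Sum>i\<in>UNIV. u (bvec i) *v bvec i)"
      by (subst sum.reindex[OF inj_bvec]) simp
    hence "(\<Sum>v\<in>range bvec. u v *v v) k = u (bvec k)"
      by (simp add: sum_fun_apply)
    thus False using u by simp
  qed
  show "fv.span (range bvec) = (UNIV :: ('n \<Rightarrow> complex) set)"
  proof -
    have "x \<in> fv.span (range bvec)" for x :: "'n \<Rightarrow> complex"
      by (subst bvec_expand) (intro fv.span_sum fv.span_scale fv.span_base, simp)
    thus ?thesis by blast
  qed
qed

text \<open>Reduces the non-degeneracy of \<Lambda> to the injectivity of the two contraction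
  maps.\<close>

lemma linear_injective_surj:
  assumes F: "linear_fun (F :: ('n::finite \<Rightarrow> complex) \<Rightarrow> ('n \<Rightarrow> complex))" 
    and inj: "\<And>x. F x = 0 \<Longrightarrow> x = 0"
  shows "surj F"
proof -
  interpret fp: finite_dimensional_vector_space_pair_1 
    "vscale :: complex \<Rightarrow> ('n \<Rightarrow> complex) \<Rightarrow> 'n \<Rightarrow> complex" "range bvec"
    "vscale :: complex \<Rightarrow> ('n \<Rightarrow> complex) \<Rightarrow> 'n \<Rightarrow> complex" ..
  interpret fp2: finite_dimensional_vector_space_pair 
    "vscale :: complex \<Rightarrow> ('n \<Rightarrow> complex) \<Rightarrow> 'n \<Rightarrow> complex" "range bvec"
    "vscale :: complex \<Rightarrow> ('n \<Rightarrow> complex) \<Rightarrow> 'n \<Rightarrow> complex" "range bvec" ..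
  have lin: "Vector_Spaces.linear vscale vscale F"
    using F unfolding linear_fun_iff by unfold_locales auto
  interpret l: Vector_Spaces.linear vscale vscale F by (rule lin)
  have "inj F" using inj l.inj_iff_eq_0 by blast
  thus ?thesis using fp2.linear_injective_imp_surjective[OF lin] by blast
qed

lemma mtrace_mult_commute:
  assumes "A \<in> carrier_mat n k" "B \<in> carrier_mat k n"
  shows "mtrace (A * B) = mtrace (B * A)"
proof -
  have "mtrace (A * B) = (\<Sum>i<n. \<Sum>j<k. A $$ (i,j) * B $$ (j,i))"
    using assms by (simp add: mtrace_def scalar_prod_def lessThan_atLeast0)
  also have "\<dots> = (\<Sum>j<k. \<Sum>i<n. B $$ (j,i) * A $$ (i,j))"
    by (subst sum.swap) (simp add: mult.commute)
  also have "\<dots> = mtrace (B * A)"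
    using assms by (simp add: mtrace_def scalar_prod_def lessThan_atLeast0)
  finally show ?thesis .
qed

text \<open>Up to similarity the matrix is upper triangular, and the diagonal entries of a
  triangular idempotent satisfy z z = z. The bound serves to compare multiplicities, integrality to
  obtain real traces of involutions.\<close>

lemma mtrace_idempotent:
  assumes P: "P \<in> carrier_mat n n" and idem: "P * P = P"
  shows "\<exists>k\<le>n. mtrace P = of_nat k"
proof -
  from char_poly_factorized[OF P] obtain as where "char_poly P = (\<Prod>a\<leftarrow>as. [:- a, 1:])" by blast
  from schur_decomposition_exists[OF P this] obtain B where B: "B \<in> carrier_mat n n"
    and tri: "upper_triangular B" and sim: "similar_mat P B" by blast
  from sim obtain X Y where w: "similar_mat_wit P B X Y" unfolding similar_mat_def by blast
  note D = similar_mat_witD2[OF P w]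
  have B': "B = Y * P * X"
  proof -
    have "Y * P * X = Y * (X * B * Y) * X" using D(3) by simp
    also have "\<dots> = (Y * X) * B * (Y * X)" using D(4-7) by (simp add: assoc_mult_mat[of _ n n _ n _ n])
    also have "\<dots> = B" using D B by simp
    finally show ?thesis ..
  qed
  have BB: "B * B = B"
  proof -
    have "B * B = Y * P * (X * Y) * P * X" unfolding B' using D(4,6,7) by (simp add: assoc_mult_mat[of _ n n _ n _ n])
    also have "\<dots> = Y * (P * P) * X" unfolding D(1) using D(4,6,7) by (simp add: assoc_mult_mat[of _ n n _ n _ n])
    also have "\<dots> = B" using idem B' by simp
    finally show ?thesis .
  qed
  have diag: "B $$ (i,i) = 0 \<or> B $$ (i,i) = 1" if i: "i < n" for i
  proof -
    have "(B * B) $$ (i,i) = (\<Sum>j<n. B $$ (i,j) * B $$ (j,i))"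
      using i B by (simp add: scalar_prod_def lessThan_atLeast0)
    also have "\<dots> = (\<Sum>j<n. if j = i then B $$ (i,i) * B $$ (i,i) else 0)"
    proof (rule sum.cong[OF refl])
      fix j assume j: "j \<in> {..<n}"
      show "B $$ (i,j) * B $$ (j,i) = (if j = i then B $$ (i,i) * B $$ (i,i) else 0)"
      proof (cases "j < i")
        case True thus ?thesis using upper_triangularD[OF tri, of j i] i B by simp
      next
        case False thus ?thesis using upper_triangularD[OF tri, of i j] j B by auto
      qed
    qed
    also have "\<dots> = B $$ (i,i) * B $$ (i,i)" using i by simp
    finally show ?thesis using BB by simp
  qed
  have "mtrace B = mtrace (X * (Y * P))"
    unfolding B' by (rule mtrace_mult_commute) (use D(4,6,7) in auto)
  also have "X * (Y * P) = P"
    using D(4,6,7) assoc_mult_mat[OF D(6,7,4)] D(1) by simp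
  finally have "mtrace P = mtrace B" ..
  also have "\<dots> = (\<Sum>i<n. if B $$ (i,i) = 1 then 1 else 0)"
    unfolding mtrace_def using B by (intro sum.cong) (use diag in fastforce)+
  also have "\<dots> = of_nat (card {i\<in>{..<n}. B $$ (i,i) = 1})"
    by (simp add: sum.If_cases Int_def)
  finally show ?thesis
    by (intro exI[of _ "card {i\<in>{..<n}. B $$ (i,i) = 1}"]) (auto intro: order.trans[OF card_mono[of "{..<n}"]])
qed

lemma vec_subspace_kernel:
  "T \<in> carrier_mat k n \<Longrightarrow> vec_subspace n {x \<in> carrier_vec n. T *\<^sub>v x = 0\<^sub>v k}"
  unfolding vec_subspace_def
  by (auto simp: mult_add_distrib_mat_vec mult_mat_vec)

lemma vec_subspace_image:
  assumes T: "T \<in> carrier_mat k n" shows "vec_subspace k ((*\<^sub>v) T ` carrier_vec n)"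
  unfolding vec_subspace_def
proof (intro conjI ballI allI)
  show "(*\<^sub>v) T ` carrier_vec n \<subseteq> carrier_vec k" using T by auto
  show "0\<^sub>v k \<in> (*\<^sub>v) T ` carrier_vec n" using T by (intro image_eqI[of _ _ "0\<^sub>v n"]) auto
next
  fix x y assume "x \<in> (*\<^sub>v) T ` carrier_vec n" "y \<in> (*\<^sub>v) T ` carrier_vec n"
  then obtain x' y' where *: "x' \<in> carrier_vec n" "y' \<in> carrier_vec n" "x = T *\<^sub>v x'" "y = T *\<^sub>v y'" by auto
  show "x + y \<in> (*\<^sub>v) T ` carrier_vec n"
    using * mult_add_distrib_mat_vec[OF T *(1,2)] by (intro image_eqI[of _ _ "x' + y'"]) auto
next
  fix c x assume "x \<in> (*\<^sub>v) T ` carrier_vec n"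
  then obtain x' where *: "x' \<in> carrier_vec n" "x = T *\<^sub>v x'" by auto
  show "c \<cdot>\<^sub>v x \<in> (*\<^sub>v) T ` carrier_vec n"
    using * mult_mat_vec[OF T *(1)] by (intro image_eqI[of _ _ "c \<cdot>\<^sub>v x'"]) auto
qed

lemma mat_eq_zeroI:
  assumes T: "T \<in> carrier_mat k n" and z: "\<And>x. x \<in> carrier_vec n \<Longrightarrow> T *\<^sub>v x = 0\<^sub>v k"
  shows "T = (0\<^sub>m k n :: complex mat)"
proof (rule eq_matI)
  fix i j assume ij: "i < dim_row (0\<^sub>m k n :: complex mat)" "j < dim_col (0\<^sub>m k n :: complex mat)"
  have "(T *\<^sub>v unit_vec n j) $ i = T $$ (i,j)"
    using T ij by simp
  thus "T $$ (i,j) = 0\<^sub>m k n $$ (i,j)" using z[of "unit_vec n j"] ij by simp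
qed (use T in auto)

text \<open>Kernel and range are invariant subspaces, hence trivial. A right inverse
  \<open>B\<close> is assembled from preimages of the unit vectors, and injectivity makes it a left
  inverse; equality of the dimensions comes from the traces of T B and B T.\<close>

lemma schur_invertible:
  assumes r: "\<And>f. \<rho> f \<in> carrier_mat n n" and s: "\<And>f. \<sigma> f \<in> carrier_mat k k"
    and ir: "irreducible_rep \<rho> n" and irs: "irreducible_rep \<sigma> k"
    and T: "T \<in> carrier_mat k n" and comm: "\<And>f. T * \<rho> f = \<sigma> f * T" and nz: "T \<noteq> 0\<^sub>m k n"
  shows "n = k \<and> invertible_mat T"
proof -
  let ?K = "{x \<in> carrier_vec n. T *\<^sub>v x = 0\<^sub>v k}"
  have "\<rho> f *\<^sub>v x \<in> ?K" if x: "x \<in> ?K" for f x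
  proof -
    have "T *\<^sub>v (\<rho> f *\<^sub>v x) = \<sigma> f *\<^sub>v (T *\<^sub>v x)"
      using x comm[of f] assoc_mult_mat_vec[OF T r[of f], of x] assoc_mult_mat_vec[OF s[of f] T, of x] by simp
    thus ?thesis using x r[of f] s[of f] by auto
  qed
  hence "?K = {0\<^sub>v n} \<or> ?K = carrier_vec n"
    using ir vec_subspace_kernel[OF T] unfolding irreducible_rep_def by blast
  hence K: "?K = {0\<^sub>v n}" using nz mat_eq_zeroI[OF T] by blast
  let ?I = "(*\<^sub>v) T ` carrier_vec n"
  have "\<sigma> f *\<^sub>v y \<in> ?I" if "y \<in> ?I" for f y
  proof -
    from that obtain x where x: "x \<in> carrier_vec n" "y = T *\<^sub>v x" by auto
    have "\<sigma> f *\<^sub>v y = T *\<^sub>v (\<rho> f *\<^sub>v x)"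
      using x comm[of f] assoc_mult_mat_vec[OF T r[of f], of x] assoc_mult_mat_vec[OF s[of f] T, of x] by simp
    thus ?thesis using x r[of f] by auto
  qed
  hence "?I = {0\<^sub>v k} \<or> ?I = carrier_vec k"
    using irs vec_subspace_image[OF T] unfolding irreducible_rep_def by blast
  hence I: "?I = carrier_vec k" using nz mat_eq_zeroI[OF T] by blast
  have "\<forall>j. \<exists>x. j < k \<longrightarrow> x \<in> carrier_vec n \<and> T *\<^sub>v x = unit_vec k j"
    using I by (metis (no_types, lifting) imageE unit_vec_carrier)
  then obtain X where X: "\<And>j. j < k \<Longrightarrow> X j \<in> carrier_vec n \<and> T *\<^sub>v X j = unit_vec k j" by metis
  define B where "B = mat n k (\<lambda>(i,j). X j $ i)"
  have B: "B \<in> carrier_mat n k" by (simp add: B_def)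
  have colB: "col B j = X j" if "j < k" for j
    using X[OF that] that by (intro eq_vecI) (auto simp: B_def)
  have TB: "T * B = 1\<^sub>m k"
  proof (rule eq_matI)
    fix i j assume ij: "i < dim_row (1\<^sub>m k :: complex mat)" "j < dim_col (1\<^sub>m k :: complex mat)"
    have "(T * B) $$ (i,j) = (T *\<^sub>v X j) $ i" using ij T B colB by simp
    thus "(T * B) $$ (i,j) = 1\<^sub>m k $$ (i,j)" using X[of j] ij by simp
  qed (use T B in auto)
  have "B * T - 1\<^sub>m n = 0\<^sub>m n n"
  proof (rule mat_eq_zeroI)
    show "B * T - 1\<^sub>m n \<in> carrier_mat n n" by (intro minus_carrier_mat one_carrier_mat)
    fix x :: "complex vec" assume x: "x \<in> carrier_vec n"
    have e: "(B * T - 1\<^sub>m n) *\<^sub>v x = B *\<^sub>v (T *\<^sub>v x) - x"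
      using x B T by (simp add: minus_mult_distrib_mat_vec[of _ n n] assoc_mult_mat_vec[of _ n k])
    have "T *\<^sub>v (B *\<^sub>v (T *\<^sub>v x) - x) = (T * B) *\<^sub>v (T *\<^sub>v x) - T *\<^sub>v x"
      using x B T by (simp add: mult_minus_distrib_mat_vec[of _ k n] assoc_mult_mat_vec[of _ k n])
    also have "\<dots> = 0\<^sub>v k" using TB x T by simp
    finally have "B *\<^sub>v (T *\<^sub>v x) - x \<in> ?K" using x B T by auto
    thus "(B * T - 1\<^sub>m n) *\<^sub>v x = 0\<^sub>v n" using K e by simp
  qed
  hence BT: "B * T = 1\<^sub>m n"
  proof -
    assume "B * T - 1\<^sub>m n = 0\<^sub>m n n"
    hence "(B * T - 1\<^sub>m n) $$ (i,j) = 0" if "i < n" "j < n" for i j using that by simp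
    thus ?thesis using B T by (intro eq_matI) auto
  qed
  have "of_nat k = mtrace (T * B)" unfolding TB by (simp add: mtrace_def)
  also have "\<dots> = of_nat n" unfolding mtrace_mult_commute[OF T B] BT by (simp add: mtrace_def)
  finally have nk: "n = k" by simp
  have "invertible_mat T" unfolding invertible_mat_def inverts_mat_def
    using T B TB BT nk by (intro conjI exI[of _ B]) auto
  with nk show ?thesis by simp
qed

lemma invertible_left_inverse:
  assumes A: "A \<in> carrier_mat n n" and "invertible_mat A"
  obtains B where "B * A = 1\<^sub>m n" "B \<in> carrier_mat n n" "A * B = (1\<^sub>m n :: 'a :: semiring_1 mat)"
proof -
  from assms obtain B where B: "A * B = 1\<^sub>m n" "B * A = 1\<^sub>m (dim_row B)"
    unfolding invertible_mat_def inverts_mat_def by auto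
  have "dim_col B = n" using B(1) by (metis index_mult_mat(3) index_one_mat(3))
  moreover have "dim_row B = n" using B(2) A by (metis carrier_matD(2) index_mult_mat(3) index_one_mat(3))
  ultimately show ?thesis using B by (intro that[of B]) auto
qed

text \<open>An eigenvalue exists over the complex numbers. Subtracting it leaves an intertwiner with
  an eigenvector in its kernel, which is not invertible and therefore zero.\<close>

lemma schur_scalar:
  assumes r: "\<And>f. \<rho> f \<in> carrier_mat n n" and ir: "irreducible_rep \<rho> n"
    and T: "T \<in> carrier_mat n n" and comm: "\<And>f. T * \<rho> f = \<rho> f * T"
  shows "\<exists>c. T = c \<cdot>\<^sub>m 1\<^sub>m n"
proof -
  have n: "n > 0" using ir by (simp add: irreducible_rep_def)
  obtain c v where v: "v \<in> carrier_vec n" "v \<noteq> 0\<^sub>v n" "T *\<^sub>v v = c \<cdot>\<^sub>v v"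
    using spectrum_non_empty[OF T n] T unfolding spectrum_def eigenvalue_def eigenvector_def by auto
  define R where "R = T - c \<cdot>\<^sub>m 1\<^sub>m n"
  have R: "R \<in> carrier_mat n n" unfolding R_def by (intro minus_carrier_mat smult_carrier_mat one_carrier_mat)
  have cR: "R * \<rho> f = \<rho> f * R" for f
    unfolding R_def using T r[of f] comm[of f]
    by (simp add: minus_mult_distrib_mat[of _ n n] mult_minus_distrib_mat[of _ n n]
        mult_smult_assoc_mat[of _ n n] mult_smult_distrib[OF r[of f] one_carrier_mat])
  have "(c \<cdot>\<^sub>m 1\<^sub>m n) *\<^sub>v v = c \<cdot>\<^sub>v v"
    using v(1) by (intro eq_vecI) (auto simp: row_smult)
  hence Rv: "R *\<^sub>v v = 0\<^sub>v n" unfolding R_def using T v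
    by (simp add: minus_mult_distrib_mat_vec[of _ n n])
  have "R = 0\<^sub>m n n"
  proof (rule ccontr)
    assume "R \<noteq> 0\<^sub>m n n"
    from schur_invertible[OF r r ir ir R cR this] have "invertible_mat R" by simp
    then obtain B where B: "B * R = 1\<^sub>m n" "B \<in> carrier_mat n n"
      by (rule invertible_left_inverse[OF R])
    have "v = (B * R) *\<^sub>v v" using B v by simp
    also have "\<dots> = B *\<^sub>v (R *\<^sub>v v)" by (rule assoc_mult_mat_vec[OF B(2) R v(1)])
    also have "\<dots> = 0\<^sub>v n" unfolding Rv using B(2) by (intro eq_vecI) auto
    finally show False using v by simp
  qed
  hence "(T - c \<cdot>\<^sub>m 1\<^sub>m n) $$ (i,j) = 0" if "i < n" "j < n" for i j using that unfolding R_def by simp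
  hence "T = c \<cdot>\<^sub>m 1\<^sub>m n" using T by (intro eq_matI) auto
  thus ?thesis ..
qed

text \<open>A relation is regarded as a family of vectors, one for each row (a, i) of each
  representation; right translation of the argument \<open>f\<close> acts on these vectors through
  \<psi>. Rows are removed one at a time: the vectors occurring at a fixed row form an invariant
  subspace, and if this were the whole space, Schur's lemma and evaluation at the unit would
  contradict each other.\<close>

lemma coefficients_independent:
  fixes \<psi> :: "'i::finite \<Rightarrow> ('n \<Rightarrow> complex) \<Rightarrow> complex mat" and D :: "'i \<Rightarrow> nat"
  assumes rep: "\<And>a. is_rep mul un (\<psi> a) (D a)" and irr: "\<And>a. irreducible_rep (\<psi> a) (D a)"
    and dist: "\<And>a a'. rep_iso (\<psi> a) (D a) (\<psi> a') (D a') \<Longrightarrow> a = a'"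
    and rel: "\<And>f. (\<Sum>a\<in>UNIV. \<Sum>i<D a. \<Sum>j<D a. c a i j * \<psi> a f $$ (i,j)) = 0"
    and ij: "i < D a" "j < D a"
  shows "c a i j = 0"
proof -
  have car: "\<psi> a f \<in> carrier_mat (D a) (D a)" for a f using rep[of a] by (simp add: is_rep_def)
  have mul: "\<psi> a (mul f g) = \<psi> a f * \<psi> a g" and one: "\<psi> a un = 1\<^sub>m (D a)" for a f g
    using rep[of a] by (simp_all add: is_rep_def)
  have mulij: "\<psi> a (mul f g) $$ (i,j) = (\<Sum>k<D a. \<psi> a f $$ (i,k) * \<psi> a g $$ (k,j))" 
    if "i < D a" "j < D a" for a f g i j
    using that car[of a f] car[of a g] unfolding mul by (simp add: scalar_prod_def lessThan_atLeast0)
  define R where "R X e \<longleftrightarrow> (\<forall>f. (\<Sum>p\<in>X. \<Sum>j<D (fst p). e p j * \<psi> (fst p) f $$ (snd p, j)) = 0)"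
    for X and e :: "'i \<times> nat \<Rightarrow> nat \<Rightarrow> complex"
  have R_comb: "R X (\<lambda>p j. x * e p j + y * e' p j)" if "R X e" "R X e'" for X e e' x y
  proof -
    have "(\<Sum>p\<in>X. \<Sum>j<D (fst p). (x * e p j + y * e' p j) * \<psi> (fst p) f $$ (snd p, j)) = 
      x * (\<Sum>p\<in>X. \<Sum>j<D (fst p). e p j * \<psi> (fst p) f $$ (snd p, j)) + 
      y * (\<Sum>p\<in>X. \<Sum>j<D (fst p). e' p j * \<psi> (fst p) f $$ (snd p, j))" for f
      by (simp add: sum_distrib_left sum.distrib algebra_simps)
    thus ?thesis using that by (simp add: R_def)
  qed
  have R_zero: "R X (\<lambda>p j. 0)" for X by (simp add: R_def)
  have R_sum: "R X (\<lambda>p j. \<Sum>k\<in>K. x k * e k p j)" if "\<And>k. k \<in> K \<Longrightarrow> R X (e k)" "finite K" 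
    for X and K :: "nat set" and e x
    using that(2,1)
  proof (induction K rule: finite_induct)
    case (insert k K)
    show ?case using R_comb[of X "e k" "\<lambda>p j. \<Sum>k\<in>K. x k * e k p j" "x k" 1] insert by simp
  qed (simp add: R_zero)
  \<comment> \<open>Replacing \<open>f\<close> by \<open>mul f h\<close> shifts the factor \<psi>(h)
    onto the coefficient vectors.\<close>
  have R_act: "R X (\<lambda>p j. \<Sum>j'<D (fst p). \<psi> (fst p) h $$ (j,j') * e p j')" 
    if R: "R X e" and X: "X \<subseteq> (SIGMA a:UNIV. {..<D a})" for X e h
    unfolding R_def
  proof
    fix f
    have "(\<Sum>j<D (fst p). (\<Sum>j'<D (fst p). \<psi> (fst p) h $$ (j,j') * e p j') * \<psi> (fst p) f $$ (snd p, j)) =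
       (\<Sum>j'<D (fst p). e p j' * \<psi> (fst p) (mul f h) $$ (snd p, j'))" if p: "p \<in> X" for p
    proof -
      have sp: "snd p < D (fst p)" using p X by auto
      have "(\<Sum>j<D (fst p). (\<Sum>j'<D (fst p). \<psi> (fst p) h $$ (j,j') * e p j') * \<psi> (fst p) f $$ (snd p, j)) =
        (\<Sum>j'<D (fst p). \<Sum>j<D (fst p). e p j' * (\<psi> (fst p) f $$ (snd p, j) * \<psi> (fst p) h $$ (j,j')))"
        by (subst sum.swap) (simp add: sum_distrib_left sum_distrib_right mult_ac)
      also have "\<dots> = (\<Sum>j'<D (fst p). e p j' * \<psi> (fst p) (mul f h) $$ (snd p, j'))"
        by (intro sum.cong refl) (simp add: mulij[OF sp] sum_distrib_left)
      finally show ?thesis .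
    qed
    hence "(\<Sum>p\<in>X. \<Sum>j<D (fst p). (\<Sum>j'<D (fst p). \<psi> (fst p) h $$ (j,j') * e p j') * \<psi> (fst p) f $$ (snd p, j)) =
       (\<Sum>p\<in>X. \<Sum>j'<D (fst p). e p j' * \<psi> (fst p) (mul f h) $$ (snd p, j'))" by (rule sum.cong[OF refl])
    thus "(\<Sum>p\<in>X. \<Sum>j<D (fst p). (\<Sum>j'<D (fst p). \<psi> (fst p) h $$ (j,j') * e p j') * \<psi> (fst p) f $$ (snd p, j)) = 0"
      using R by (simp add: R_def)
  qed
  have main: "\<forall>e. R X e \<longrightarrow> (\<forall>p\<in>X. \<forall>j<D (fst p). e p j = 0)" 
    if "finite X" "X \<subseteq> (SIGMA a:UNIV. {..<D a})" for X
    using that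
  proof (induction X rule: finite_induct)
    case empty thus ?case by simp
  next
    case (insert q X)
    let ?a = "fst q"
    have q: "snd q < D ?a" using insert by auto
    have IH: "R X e \<Longrightarrow> p \<in> X \<Longrightarrow> j < D (fst p) \<Longrightarrow> e p j = 0" for e p j using insert by auto
    have red: "R X e" if "R (insert q X) e" "\<And>j. j < D ?a \<Longrightarrow> e q j = 0" for e
      using that insert(1,2) by (simp add: R_def)
    \<comment> \<open>The values at the row \<open>q\<close> of all relations on
      \<open>insert q X\<close>. This subspace is invariant by \<open>R_act\<close>, hence zero or
      everything.\<close>
    define U where "U = (\<lambda>e. vec (D ?a) (e q)) ` Collect (R (insert q X))"
    have "vec_subspace (D ?a) U"
      unfolding vec_subspace_def
    proof (intro conjI ballI allI)
      show "U \<subseteq> carrier_vec (D ?a)" by (auto simp: U_def)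
      show "0\<^sub>v (D ?a) \<in> U" unfolding U_def by (rule image_eqI[of _ _ "\<lambda>p j. 0"]) (auto simp: R_zero)
    next
      fix x y assume "x \<in> U" "y \<in> U"
      then obtain e e' where *: "R (insert q X) e" "R (insert q X) e'" "x = vec (D ?a) (e q)" "y = vec (D ?a) (e' q)"
        by (auto simp: U_def)
      show "x + y \<in> U" unfolding U_def
        by (rule image_eqI[of _ _ "\<lambda>p j. 1 * e p j + 1 * e' p j"]) (use * R_comb[of "insert q X" e e' 1 1] in auto)
    next
      fix k x assume "x \<in> U"
      then obtain e where *: "R (insert q X) e" "x = vec (D ?a) (e q)" by (auto simp: U_def)
      show "k \<cdot>\<^sub>v x \<in> U" unfolding U_def
        by (rule image_eqI[of _ _ "\<lambda>p j. k * e p j + 0 * e p j"]) (use * R_comb[of "insert q X" e e k 0] in auto)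
    qed
    moreover have "\<psi> ?a h *\<^sub>v x \<in> U" if x: "x \<in> U" for h x
    proof -
      obtain e where *: "R (insert q X) e" "x = vec (D ?a) (e q)" using x by (auto simp: U_def)
      have "\<psi> ?a h *\<^sub>v x = vec (D ?a) (\<lambda>j. \<Sum>j'<D ?a. \<psi> ?a h $$ (j,j') * e q j')"
        using car[of ?a h] * by (intro eq_vecI) (auto simp: scalar_prod_def lessThan_atLeast0)
      thus ?thesis unfolding U_def using R_act[OF *(1) insert(4), of h]
        by (intro image_eqI[of _ _ "\<lambda>p j. \<Sum>j'<D (fst p). \<psi> (fst p) h $$ (j,j') * e p j'"]) auto
    qed
    ultimately have U: "U = {0\<^sub>v (D ?a)} \<or> U = carrier_vec (D ?a)"
      using irr[of ?a] unfolding irreducible_rep_def by blast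
    have "U \<noteq> carrier_vec (D ?a)"
    proof
      assume U: "U = carrier_vec (D ?a)"
      have "\<forall>k. \<exists>e. R (insert q X) e \<and> (k < D ?a \<longrightarrow> vec (D ?a) (e q) = unit_vec (D ?a) k)"
      proof
        fix k have "unit_vec (D ?a) k \<in> U" unfolding U by simp
        thus "\<exists>e. R (insert q X) e \<and> (k < D ?a \<longrightarrow> vec (D ?a) (e q) = unit_vec (D ?a) k)"
          unfolding U_def by force
      qed
      then obtain C where C: "\<And>k. R (insert q X) (C k)" 
        "\<And>k. k < D ?a \<Longrightarrow> vec (D ?a) (C k q) = unit_vec (D ?a) k" by metis
      have Cq: "C k q j = (if j = k then 1 else 0)" if "k < D ?a" "j < D ?a" for k j
        using arg_cong[OF C(2)[OF that(1)], of "\<lambda>v. v $ j"] that by auto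
      \<comment> \<open>By the induction hypothesis a relation on \<open>insert q X\<close> is
        determined by its vector at \<open>q\<close>. Acting with \<open>h\<close> on
        \<open>C k\<close>, and combining the \<open>C k'\<close> with entries of \<psi>(h), give
        the same vector there.\<close>
      have eqv: "(\<Sum>j'<D (fst p). \<psi> (fst p) h $$ (j,j') * C k p j') = (\<Sum>k'<D ?a. \<psi> ?a h $$ (k',k) * C k' p j)"
        if p: "p \<in> X" and j: "j < D (fst p)" and k: "k < D ?a" for p j k h
      proof -
        let ?e = "\<lambda>p j. 1 * (\<Sum>j'<D (fst p). \<psi> (fst p) h $$ (j,j') * C k p j') + (-1) * (\<Sum>k'<D ?a. \<psi> ?a h $$ (k',k) * C k' p j)"
        have "R (insert q X) ?e"
          by (rule R_comb[OF R_act[OF C(1) insert(4)] R_sum]) (auto simp: C)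
        moreover have "?e q j = 0" if j: "j < D ?a" for j
        proof -
          have "(\<Sum>j'<D ?a. \<psi> ?a h $$ (j,j') * C k q j') = \<psi> ?a h $$ (j,k)"
            using k by (simp add: Cq if_distrib[of "\<lambda>z. _ * z"] cong: if_cong)
          moreover have "(\<Sum>k'<D ?a. \<psi> ?a h $$ (k',k) * C k' q j) = \<psi> ?a h $$ (j,k)"
            using j by (simp add: Cq if_distrib[of "\<lambda>z. _ * z"] cong: if_cong)
          ultimately show ?thesis by simp
        qed
        ultimately have "R X ?e" by (rule red)
        from IH[OF this p j] show ?thesis by simp
      qed
      \<comment> \<open>At another row \<open>p\<close>, the columns \<open>C k p\<close> form an
        intertwiner. It vanishes between different representations and is scalar within one, where
        distinct rows select an off-diagonal entry.\<close>
      have zero: "C (snd q) p (snd p) = 0" if p: "p \<in> X" for p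
      proof -
        let ?b = "fst p"
        have sp: "snd p < D ?b" using p insert(4) by auto
        define T where "T = mat (D ?b) (D ?a) (\<lambda>(j,k). C k p j)"
        have T: "T \<in> carrier_mat (D ?b) (D ?a)" by (simp add: T_def)
        have comm: "T * \<psi> ?a h = \<psi> ?b h * T" for h
        proof (rule eq_matI)
          fix j k assume jk: "j < dim_row (\<psi> ?b h * T)" "k < dim_col (\<psi> ?b h * T)"
          thus "(T * \<psi> ?a h) $$ (j,k) = (\<psi> ?b h * T) $$ (j,k)"
            using eqv[OF p, of j k h] car[of ?a h] car[of ?b h]
            by (simp add: T_def scalar_prod_def lessThan_atLeast0 mult.commute)
        qed (use T car[of ?a h] car[of ?b h] in auto)
        show ?thesis
        proof (cases "?b = ?a")
          case True
          hence ne: "snd p \<noteq> snd q" using p insert(2) by (metis prod_eqI)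
          have T': "T \<in> carrier_mat (D ?a) (D ?a)" using T True by simp
          have "\<exists>c. T = c \<cdot>\<^sub>m 1\<^sub>m (D ?a)"
            by (rule schur_scalar[OF car irr T']) (use comm True in simp)
          then obtain c where "T = c \<cdot>\<^sub>m 1\<^sub>m (D ?a)" ..
          hence "T $$ (snd p, snd q) = 0" using ne sp q True by simp
          thus ?thesis using sp q by (simp add: T_def)
        next
          case False
          have "T = 0\<^sub>m (D ?b) (D ?a)"
          proof (rule ccontr)
            assume "T \<noteq> 0\<^sub>m (D ?b) (D ?a)"
            hence "invertible_mat T" using schur_invertible[OF car car irr irr T comm] by blast
            hence "rep_iso (\<psi> ?a) (D ?a) (\<psi> ?b) (D ?b)"
              unfolding rep_iso_def using T comm by blast
            thus False using dist False by metis
          qed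
          hence "T $$ (snd p, snd q) = 0" using sp q by simp
          thus ?thesis using sp q by (simp add: T_def)
        qed
      qed
      \<comment> \<open>At the unit, each row contributes the diagonal coordinate of its vector.
        Only \<open>q\<close> survives, and there the coordinate is 1.\<close>
      have "(\<Sum>p\<in>insert q X. \<Sum>j<D (fst p). C (snd q) p j * \<psi> (fst p) un $$ (snd p, j)) = 0"
        using C(1)[of "snd q"] by (simp add: R_def)
      moreover have "(\<Sum>j<D (fst p). C (snd q) p j * \<psi> (fst p) un $$ (snd p, j)) = C (snd q) p (snd p)"
        if "p \<in> insert q X" for p
      proof -
        have sp: "snd p < D (fst p)" using that insert(4) by auto
        have "(\<Sum>j<D (fst p). C (snd q) p j * \<psi> (fst p) un $$ (snd p, j)) = (\<Sum>j<D (fst p). if j = snd p then C (snd q) p j else 0)"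
          unfolding one using sp by (intro sum.cong) auto
        thus ?thesis using sp by simp
      qed
      ultimately have "(\<Sum>p\<in>insert q X. C (snd q) p (snd p)) = 0" by simp
      hence "C (snd q) q (snd q) = 0" using insert(1,2) zero by simp
      thus False using Cq[OF q q] by simp
    qed
    hence U0: "U = {0\<^sub>v (D ?a)}" using U by blast
    show ?case
    proof (intro allI impI ballI)
      fix e p j assume e: "R (insert q X) e" and p: "p \<in> insert q X" and j: "j < D (fst p)"
      have "vec (D ?a) (e q) \<in> U" using e by (simp add: U_def)
      hence v0: "vec (D ?a) (e q) = 0\<^sub>v (D ?a)" using U0 by simp
      have eq: "e q j = 0" if "j < D ?a" for j using arg_cong[OF v0, of "\<lambda>v. v $ j"] that by simp
      show "e p j = 0"
        using IH[OF red[OF e eq], of p j] eq p j by (cases "p = q") auto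
    qed
  qed
  have "(\<Sum>p\<in>(SIGMA a:UNIV. {..<D a}). h p) = (\<Sum>a\<in>UNIV. \<Sum>i<D a. h (a,i))" for h :: "'i \<times> nat \<Rightarrow> complex"
    by (subst sum.Sigma) auto
  hence "R (SIGMA a:UNIV. {..<D a}) (\<lambda>p. c (fst p) (snd p))"
    unfolding R_def using rel by simp
  with main[of "SIGMA a:UNIV. {..<D a}"] ij show ?thesis by force
qed

definition left_ideal :: "(('n::finite \<Rightarrow> complex) \<Rightarrow> ('n \<Rightarrow> complex) \<Rightarrow> ('n \<Rightarrow> complex)) \<Rightarrow> ('n \<Rightarrow> complex) set \<Rightarrow> bool" where
  "left_ideal mul U \<longleftrightarrow> fv.subspace U \<and> (\<forall>h. \<forall>x\<in>U. mul h x \<in> U)"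

section \<open>Faithfulness of the irreducible representations\<close>

locale complete_irreps =
  fixes mul :: "('n::finite \<Rightarrow> complex) \<Rightarrow> ('n \<Rightarrow> complex) \<Rightarrow> ('n \<Rightarrow> complex)" and un
    and \<psi> :: "'i \<Rightarrow> ('n \<Rightarrow> complex) \<Rightarrow> complex mat" and D :: "'i \<Rightarrow> nat"
  assumes lin1: "linear_fun (\<lambda>x. mul x y)" and lin2: "linear_fun (mul x)"
    and assoc: "mul (mul x y) z = mul x (mul y z)" and unit1: "mul un x = x" and unit2: "mul x un = x"
    and semisimple: "semisimple_alg mul un"
    and rep: "is_rep mul un (\<psi> a) (D a)"
    and complete: "is_rep mul un \<rho> k \<Longrightarrow> irreducible_rep \<rho> k \<Longrightarrow> \<exists>a. rep_iso \<rho> k (\<psi> a) (D a)"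
begin

definition ker where "ker = {f. \<forall>a. \<psi> a f = 0\<^sub>m (D a) (D a)}"

lemma mul_add1: "mul (x + x') y = mul x y + mul x' y" and mul_sc1: "mul (c *v x) y = c *v mul x y"
  and mul_add2: "mul y (x + x') = mul y x + mul y x'" and mul_sc2: "mul y (c *v x) = c *v mul y x"
  using lin1[of y] lin2[of y] unfolding linear_fun_iff by auto

lemma mul_zero2: "mul y 0 = 0"
  using mul_sc2[of y 0 0] by (simp add: vscale_def zero_fun_def)

lemma mul_sum2: "mul y (\<Sum>i\<in>K. f i) = (\<Sum>i\<in>K. mul y (f i))"
  by (rule linear_fun_sum[OF lin2])

lemma psi_carrier: "\<psi> a f \<in> carrier_mat (D a) (D a)"
  and psi_add: "\<psi> a (f + g) = \<psi> a f + \<psi> a g"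
  and psi_scale: "\<psi> a (c *v f) = c \<cdot>\<^sub>m \<psi> a f"
  and psi_mul: "\<psi> a (mul f g) = \<psi> a f * \<psi> a g" and psi_un: "\<psi> a un = 1\<^sub>m (D a)"
  using rep[of a] by (auto simp: is_rep_def vscale_def plus_fun_def)

text \<open>The simple quotient of \<open>U\<close> by \<open>U'\<close> is an irreducible
  representation, isomorphic by completeness to some \<psi> a, and there \<open>f\<close> acts as
  zero. The quotient is realized in coordinates: a basis of \<open>U'\<close> is extended to one of
  \<open>U\<close>, and \<kappa> reads off the additional coordinates.\<close>

lemma kernel_kills_simple_quotient:
  assumes U: "left_ideal mul U" and U': "left_ideal mul U'" and sub: "U' \<subset> U"
    and simple: "\<And>X. left_ideal mul X \<Longrightarrow> U' \<subseteq> X \<Longrightarrow> X \<subseteq> U \<Longrightarrow> X = U' \<or> X = U"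
    and f: "f \<in> ker" and x: "x \<in> U"
  shows "mul f x \<in> U'"
proof -
  have sU: "fv.subspace U" and sU': "fv.subspace U'" and mU: "\<And>h x. x \<in> U \<Longrightarrow> mul h x \<in> U"
    and mU': "\<And>h x. x \<in> U' \<Longrightarrow> mul h x \<in> U'"
    using U U' by (auto simp: left_ideal_def)
  obtain B where B: "B \<subseteq> U'" "fv.independent B" "U' \<subseteq> fv.span B" "card B = fv.dim U'"
    by (rule fv.basis_exists)
  obtain C where C: "B \<subseteq> C" "C \<subseteq> U" "fv.independent C" "U \<subseteq> fv.span C"
    using fv.maximal_independent_subset_extend[of B U] B sub by blast
  have spC: "fv.span C = U" using C sU by (simp add: fv.span_minimal subset_antisym)
  have spB: "fv.span B = U'" using B sU' by (simp add: fv.span_minimal subset_antisym)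
  have finC: "finite C" using C(3) by (rule fv.finiteI_independent)
  define r where "r = card (C - B)"
  obtain c where c: "bij_betw c {..<r} (C - B)"
    using ex_bij_betw_nat_finite[of "C - B"] finC unfolding r_def lessThan_atLeast0 by blast
  have cC: "c i \<in> C" "c i \<notin> B" if "i < r" for i using bij_betwE[OF c] that by auto
  define \<kappa> where "\<kappa> y i = fv.representation C y (c i)" for y i
  have k_add: "\<kappa> (y + z) i = \<kappa> y i + \<kappa> z i" if "y \<in> U" "z \<in> U" for y z i
    unfolding \<kappa>_def using fv.representation_add[OF C(3), of z y] that spC by simp
  have k_sc: "\<kappa> (t *v y) i = t * \<kappa> y i" if "y \<in> U" for y t i
    unfolding \<kappa>_def using fv.representation_scale[OF C(3), of y t] that spC by simp
  have k_c: "\<kappa> (c j) i = (if i = j then 1 else 0)" if "i < r" "j < r" for i j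
    unfolding \<kappa>_def using fv.representation_basis[OF C(3) cC(1)[OF that(2)]] c that
    by (auto simp: bij_betw_def inj_on_def)
  have dec: "(\<Sum>i<r. \<kappa> y i *v c i) + (\<Sum>b\<in>B. fv.representation C y b *v b) = y" if "y \<in> U" for y
  proof -
    have "(\<Sum>i<r. \<kappa> y i *v c i) = (\<Sum>b\<in>C - B. fv.representation C y b *v b)"
      unfolding \<kappa>_def by (rule sum.reindex_bij_betw[OF c])
    moreover have "(\<Sum>b\<in>C - B. fv.representation C y b *v b) + (\<Sum>b\<in>B. fv.representation C y b *v b) = 
       (\<Sum>b\<in>C. fv.representation C y b *v b)"
      using C(1) finC by (simp add: sum.subset_diff)
    moreover have "\<dots> = y"
      by (rule fv.sum_representation_eq[OF C(3)]) (use that spC finC in auto)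
    ultimately show ?thesis by simp
  qed
  have inB: "(\<Sum>b\<in>B. t b *v b) \<in> U'" for t
    unfolding spB[symmetric] by (intro fv.span_sum fv.span_scale fv.span_base)
  have k0: "\<kappa> y i = 0" if y: "y \<in> U'" and i: "i < r" for y i
  proof -
    have "fv.representation C y = fv.representation B y"
      using fv.representation_extend[OF C(3) _ C(1)] y spB by blast
    thus ?thesis unfolding \<kappa>_def using fv.representation_ne_zero[of B y "c i"] cC[OF i] by auto
  qed
  have k0': "y \<in> U'" if y: "y \<in> U" "\<And>i. i < r \<Longrightarrow> \<kappa> y i = 0" for y
  proof -
    have "(\<Sum>i<r. \<kappa> y i *v c i) = 0" using y(2) by (intro sum.neutral) (simp add: fun_eq_iff)
    thus ?thesis using dec[OF y(1)] inB[of "fv.representation C y"] by simp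
  qed
  have k_sum: "\<kappa> (\<Sum>j\<in>K. y j) i = (\<Sum>j\<in>K. \<kappa> (y j) i)" if "finite K" "\<And>j. j \<in> K \<Longrightarrow> y j \<in> U" "i < r" for K :: "nat set" and y i
    using that
  proof (induction K rule: finite_induct)
    case empty
    show ?case unfolding sum.empty by (rule k0[OF fv.subspace_0[OF sU'] empty(2)])
  next
    case (insert j K)
    have "(\<Sum>j\<in>K. y j) \<in> U" by (rule fv.subspace_sum[OF sU]) (use insert in blast)
    moreover have "y j \<in> U" using insert by blast
    ultimately have "\<kappa> (y j + (\<Sum>j\<in>K. y j)) i = \<kappa> (y j) i + \<kappa> (\<Sum>j\<in>K. y j) i" by (rule k_add[rotated])
    also have "\<kappa> (\<Sum>j\<in>K. y j) i = (\<Sum>j\<in>K. \<kappa> (y j) i)" using insert by blast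
    finally show ?case unfolding sum.insert[OF insert(1,2)] .
  qed
  have cU: "c j \<in> U" if "j < r" for j using cC[OF that] C by blast
  have k_mul: "\<kappa> (mul h y) i = (\<Sum>j<r. \<kappa> (mul h (c j)) i * \<kappa> y j)" if y: "y \<in> U" and i: "i < r" for h y i
  proof -
    let ?z = "\<Sum>b\<in>B. fv.representation C y b *v b"
    have s: "(\<Sum>j<r. \<kappa> y j *v mul h (c j)) \<in> U" by (intro fv.subspace_sum[OF sU] fv.subspace_scale[OF sU] mU cU) auto
    have "mul h y = mul h ((\<Sum>j<r. \<kappa> y j *v c j) + ?z)" using dec[OF y] by simp
    also have "\<dots> = (\<Sum>j<r. \<kappa> y j *v mul h (c j)) + mul h ?z"
      by (simp add: mul_add2 mul_sum2 mul_sc2)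
    finally have "\<kappa> (mul h y) i = \<kappa> (\<Sum>j<r. \<kappa> y j *v mul h (c j)) i + \<kappa> (mul h ?z) i"
      using k_add[OF s, of "mul h ?z" i] mU'[OF inB] sub by auto
    also have "\<kappa> (mul h ?z) i = 0" by (rule k0[OF mU'[OF inB] i])
    also have "\<kappa> (\<Sum>j<r. \<kappa> y j *v mul h (c j)) i = (\<Sum>j<r. \<kappa> (\<kappa> y j *v mul h (c j)) i)"
      by (rule k_sum) (auto intro!: fv.subspace_scale[OF sU] mU cU i)
    also have "\<dots> = (\<Sum>j<r. \<kappa> (mul h (c j)) i * \<kappa> y j)"
      by (intro sum.cong refl) (simp add: k_sc mU cU mult.commute)
    finally show ?thesis by simp
  qed
  define \<sigma> where "\<sigma> h = mat r r (\<lambda>(i,j). \<kappa> (mul h (c j)) i)" for h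
  have \<sigma>_car: "\<sigma> h \<in> carrier_mat r r" for h by (simp add: \<sigma>_def)
  have \<sigma>_vec: "\<sigma> h *\<^sub>v vec r (\<kappa> y) = vec r (\<kappa> (mul h y))" if "y \<in> U" for h y
    by (rule eq_vecI) (auto simp: \<sigma>_def scalar_prod_def lessThan_atLeast0[symmetric] k_mul[OF that])
  have rep: "is_rep mul un \<sigma> r"
    unfolding is_rep_def
  proof (intro conjI allI)
    fix h k show "\<sigma> h \<in> carrier_mat r r" by (rule \<sigma>_car)
    have "\<sigma> (h + k) = \<sigma> h + \<sigma> k"
      by (rule eq_matI) (auto simp: \<sigma>_def mul_add1 k_add mU cU)
    thus "\<sigma> (\<lambda>i. h i + k i) = \<sigma> h + \<sigma> k" by (simp add: plus_fun_def)
    show "\<sigma> (mul h k) = \<sigma> h * \<sigma> k"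
      by (rule eq_matI) (simp_all add: \<sigma>_def assoc scalar_prod_def lessThan_atLeast0[symmetric] k_mul[OF mU[OF cU]])
    fix t have "\<sigma> (t *v h) = t \<cdot>\<^sub>m \<sigma> h"
      by (rule eq_matI) (auto simp: \<sigma>_def mul_sc1 k_sc mU cU)
    thus "\<sigma> (\<lambda>k. t * h k) = t \<cdot>\<^sub>m \<sigma> h" by (simp add: vscale_def)
  next
    show "\<sigma> un = 1\<^sub>m r" by (rule eq_matI) (auto simp: \<sigma>_def unit1 k_c)
  qed
  have "r > 0"
  proof (rule ccontr)
    assume "\<not> r > 0"
    hence "U \<subseteq> U'" using k0' by auto
    thus False using sub by blast
  qed
  have irr: "irreducible_rep \<sigma> r"
    unfolding irreducible_rep_def
  proof (intro conjI allI impI, fact)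
    fix X assume X: "vec_subspace r X \<and> (\<forall>h. \<forall>x\<in>X. \<sigma> h *\<^sub>v x \<in> X)"
    \<comment> \<open>The preimage in \<open>U\<close> of an invariant subspace of the quotient is a
      left ideal between \<open>U'\<close> and \<open>U\<close>, so simplicity applies to
      it.\<close>
    define X' where "X' = {y \<in> U. vec r (\<kappa> y) \<in> X}"
    have vz: "vec r (\<kappa> y) = 0\<^sub>v r" if "y \<in> U'" for y using k0[OF that] by (intro eq_vecI) auto
    have "fv.subspace X'"
      unfolding fv.subspace_def
    proof (intro conjI ballI allI)
      show "0 \<in> X'" using vz[of 0] X fv.subspace_0[OF sU] fv.subspace_0[OF sU'] 
        by (simp add: X'_def vec_subspace_def)
    next
      fix y z assume yz: "y \<in> X'" "z \<in> X'"
      have "vec r (\<kappa> (y + z)) = vec r (\<kappa> y) + vec r (\<kappa> z)"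
        using yz by (intro eq_vecI) (auto simp: X'_def k_add)
      thus "y + z \<in> X'" using yz X fv.subspace_add[OF sU] by (auto simp: X'_def vec_subspace_def)
    next
      fix t y assume y: "y \<in> X'"
      have "vec r (\<kappa> (t *v y)) = t \<cdot>\<^sub>v vec r (\<kappa> y)"
        using y by (intro eq_vecI) (auto simp: X'_def k_sc)
      thus "t *v y \<in> X'" using y X fv.subspace_scale[OF sU] by (auto simp: X'_def vec_subspace_def)
    qed
    moreover have "mul h y \<in> X'" if "y \<in> X'" for h y
    proof -
      have y: "y \<in> U" "vec r (\<kappa> y) \<in> X" using that by (auto simp: X'_def)
      hence "\<sigma> h *\<^sub>v vec r (\<kappa> y) \<in> X" using X by blast
      thus ?thesis unfolding \<sigma>_vec[OF y(1)] using mU[OF y(1)] by (simp add: X'_def)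
    qed
    ultimately have "left_ideal mul X'" unfolding left_ideal_def by blast
    moreover have "U' \<subseteq> X'" using vz X sub by (auto simp: X'_def vec_subspace_def)
    ultimately have cases: "X' = U' \<or> X' = U" using simple by (auto simp: X'_def)
    have lift: "\<exists>y\<in>U. vec r (\<kappa> y) = w" if w: "w \<in> carrier_vec r" for w
    proof -
      let ?y = "\<Sum>j<r. w $ j *v c j"
      have "?y \<in> U" by (intro fv.subspace_sum[OF sU] fv.subspace_scale[OF sU] cU) auto
      moreover have "\<kappa> ?y i = w $ i" if i: "i < r" for i
      proof -
        have "\<kappa> ?y i = (\<Sum>j<r. \<kappa> (w $ j *v c j) i)"
          by (rule k_sum) (auto intro!: fv.subspace_scale[OF sU] cU i)
        also have "\<dots> = (\<Sum>j<r. if j = i then w $ j else 0)"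
          by (intro sum.cong refl) (use i in \<open>auto simp: k_sc cU k_c\<close>)
        finally show ?thesis using i by simp
      qed
      ultimately show ?thesis using w by (intro bexI[of _ ?y]) auto
    qed
    show "X = {0\<^sub>v r} \<or> X = carrier_vec r"
      using cases
    proof
      assume e: "X' = U'"
      have "w = 0\<^sub>v r" if w: "w \<in> X" for w
      proof -
        have "w \<in> carrier_vec r" using X w by (auto simp: vec_subspace_def)
        then obtain y where y: "y \<in> U" "vec r (\<kappa> y) = w" using lift by blast
        hence "y \<in> U'" using w e by (auto simp: X'_def)
        thus ?thesis using vz y by simp
      qed
      moreover have "0\<^sub>v r \<in> X" using X by (simp add: vec_subspace_def)
      ultimately show ?thesis by blast
    next
      assume e: "X' = U"
      have "w \<in> X" if w: "w \<in> carrier_vec r" for w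
        using lift[OF w] e by (auto simp: X'_def)
      thus ?thesis using X by (auto simp: vec_subspace_def)
    qed
  qed
  from complete[OF rep irr] obtain a T where T: "T \<in> carrier_mat (D a) r" "invertible_mat T" 
    "T * \<sigma> f = \<psi> a f * T" unfolding rep_iso_def by blast
  have dr: "D a = r" using T(1,2) by (auto simp: invertible_mat_def)
  obtain B' where B': "B' * T = 1\<^sub>m r" "B' \<in> carrier_mat r r"
    using invertible_left_inverse[of T r] T dr by metis
  have "\<sigma> f = (B' * T) * \<sigma> f" unfolding B'(1) using left_mult_one_mat[OF \<sigma>_car] by simp
  also have "\<dots> = B' * (T * \<sigma> f)" using T(1) dr by (intro assoc_mult_mat[OF B'(2) _ \<sigma>_car]) simp
  also have "\<dots> = 0\<^sub>m r r"
  proof -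
    have "\<psi> a f = 0\<^sub>m r r" using f dr by (simp add: ker_def)
    thus ?thesis unfolding T(3) using B' T(1) dr by simp
  qed
  finally have z: "\<sigma> f = 0\<^sub>m r r" .
  have "0\<^sub>m r r *\<^sub>v vec r (\<kappa> x) = 0\<^sub>v r" by (intro eq_vecI) auto
  hence v: "vec r (\<kappa> (mul f x)) = 0\<^sub>v r" using \<sigma>_vec[OF x, of f] unfolding z by simp
  have "\<kappa> (mul f x) i = 0" if "i < r" for i using arg_cong[OF v, of "\<lambda>v. v $ i"] that by simp
  thus ?thesis using k0'[OF mU[OF x]] by blast
qed

text \<open>A proper left subideal of largest dimension has a simple quotient. One factor from the
  kernel moves \<open>U\<close> into it, and the induction hypothesis provides the number of factors
  that kill it.\<close>

lemma kernel_nilpotent_on_ideal: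
  "left_ideal mul U \<Longrightarrow> \<exists>k. \<forall>xs. length xs = k \<and> set xs \<subseteq> ker \<longrightarrow> (\<forall>x\<in>U. foldr mul xs x = 0)"
proof (induction "fv.dim U" arbitrary: U rule: less_induct)
  case less
  show ?case
  proof (cases "U = {0}")
    case True thus ?thesis by (intro exI[of _ 0]) auto
  next
    case False
    have sU: "fv.subspace U" using less(2) by (simp add: left_ideal_def)
    let ?P = "\<lambda>X. left_ideal mul X \<and> X \<subset> U"
    have "?P {0}" using False fv.subspace_0[OF sU] by (auto simp: left_ideal_def mul_zero2)
    moreover have "\<forall>X. ?P X \<longrightarrow> fv.dim X \<le> fv.dim U" by (auto intro: fv.dim_subset)
    ultimately have "\<exists>X. ?P X \<and> (\<forall>Y. ?P Y \<longrightarrow> fv.dim Y \<le> fv.dim X)"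
      by (intro ex_has_greatest_nat[of ?P "{0}" fv.dim "Suc (fv.dim U)"]) (simp_all add: less_Suc_eq_le)
    then obtain U' where U': "?P U'" and max: "\<And>X. ?P X \<Longrightarrow> fv.dim X \<le> fv.dim U'"
      by blast
    have simple: "X = U' \<or> X = U" if X: "left_ideal mul X" "U' \<subseteq> X" "X \<subseteq> U" for X
    proof (rule ccontr)
      assume "\<not> (X = U' \<or> X = U)"
      hence "fv.dim X \<le> fv.dim U'" using max X by blast
      hence "U' = X" using fv.subspace_dim_equal[of U' X] U' X by (auto simp: left_ideal_def)
      thus False using \<open>\<not> (X = U' \<or> X = U)\<close> by simp
    qed
    have "fv.dim U' < fv.dim U"
    proof (rule fv.dim_psubset)
      have "fv.subspace U'" using U' by (simp add: left_ideal_def)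
      thus "fv.span U' \<subset> fv.span U" using U' sU by (metis fv.span_eq_iff)
    qed
    then obtain k where k: "\<And>xs x. length xs = k \<Longrightarrow> set xs \<subseteq> ker \<Longrightarrow> x \<in> U' \<Longrightarrow> foldr mul xs x = 0"
      using less(1)[of U'] U' by blast
    show ?thesis
    proof (intro exI[of _ "Suc k"] allI impI ballI)
      fix xs x assume xs: "length xs = Suc k \<and> set xs \<subseteq> ker" and x: "x \<in> U"
      \<comment> \<open>\<open>foldr\<close> applies the last entry of the list before all others,
        so this is the factor that moves \<open>x\<close> into \<open>U'\<close>.\<close>
      then obtain ys y where ys: "xs = ys @ [y]" by (metis append_butlast_last_id length_0_conv nat.distinct(1))
      have "mul y x \<in> U'"
        by (rule kernel_kills_simple_quotient[OF less(2) conjunct1[OF U'] conjunct2[OF U'] simple _ x])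
          (use xs ys in simp_all)
      thus "foldr mul xs x = 0" using k[of ys "mul y x"] xs ys by auto
    qed
  qed
qed

text \<open>The common kernel of all \<psi> a is a two-sided ideal acting nilpotently on the regular
  module, hence nilpotent; semisimplicity leaves only zero.\<close>

theorem faithful:
  assumes "\<And>a. \<psi> a f = 0\<^sub>m (D a) (D a)"
  shows "f = 0"
proof -
  have "two_sided_ideal mul ker"
    unfolding two_sided_ideal_def fun_subspace_def
  proof (intro conjI ballI allI impI)
    have z: "0 *v x = (\<lambda>_. 0)" for x :: "'n \<Rightarrow> complex" by (simp add: fun_eq_iff)
    have "\<psi> a (0 *v un) = 0\<^sub>m (D a) (D a)" for a
      unfolding psi_scale psi_un by (intro eq_matI) auto
    thus "(\<lambda>_. 0) \<in> ker" unfolding z ker_def by simp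
  next
    fix x y assume "x \<in> ker" "y \<in> ker"
    thus "(\<lambda>k. x k + y k) \<in> ker" using psi_add[of _ x y] by (simp add: ker_def plus_fun_def)
  next
    fix c x assume "x \<in> ker"
    thus "(\<lambda>k. c * x k) \<in> ker" using psi_scale[of _ c x] by (simp add: ker_def vscale_def)
  next
    fix a x assume x: "x \<in> ker"
    show "mul a x \<in> ker" "mul x a \<in> ker" 
      using x by (simp_all add: ker_def psi_mul right_mult_zero_mat[OF psi_carrier] left_mult_zero_mat[OF psi_carrier])
  qed
  moreover have "nilpotent_ideal mul un ker"
  proof -
    have "left_ideal mul UNIV" by (simp add: left_ideal_def)
    then obtain k where k: "\<And>xs x. length xs = k \<Longrightarrow> set xs \<subseteq> ker \<Longrightarrow> foldr mul xs x = 0"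
      using kernel_nilpotent_on_ideal by blast
    \<comment> \<open>One more factor than the bound \<open>k\<close> ensures the positive exponent
      required by \<open>nilpotent_ideal\<close>.\<close>
    have "foldr mul xs un = 0" if "length xs = Suc k" "set xs \<subseteq> ker" for xs
    proof -
      obtain y ys where "xs = y # ys" using \<open>length xs = Suc k\<close> by (cases xs) auto
      thus ?thesis using that k[of ys un] by (simp add: mul_zero2)
    qed
    thus ?thesis unfolding nilpotent_ideal_def by (intro exI[of _ "Suc k"]) (simp add: zero_fun_def)
  qed
  ultimately have "ker = {\<lambda>_. 0}" using semisimple unfolding semisimple_alg_def by blast
  thus ?thesis using assms by (auto simp: ker_def zero_fun_def)
qed

end

section \<open>Fusion tensors and matrix coefficients\<close>

text \<open>An abstract model of the matrix coefficients inside an algebra. It is kept independent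
  of the concrete product so that it can be used twice, the second time with the opposite product,
  transposed coefficients, and \<open>V\<close> and \<open>W\<close> exchanged.\<close>

locale tensor_calculus = vector_space sc 
  for sc :: "complex \<Rightarrow> 'a::ab_group_add \<Rightarrow> 'a" (infixr \<open>*s\<close> 75) +
  fixes m :: "'a \<Rightarrow> 'a \<Rightarrow> 'a" (infixl \<open>\<odot>\<close> 70)
    and D :: "'i::finite \<Rightarrow> nat" and t :: "'i \<Rightarrow> nat \<Rightarrow> nat \<Rightarrow> 'a" and eps :: "'a \<Rightarrow> complex"
    and N :: "'i \<Rightarrow> 'i \<Rightarrow> 'i \<Rightarrow> nat"
    and V :: "'i \<Rightarrow> 'i \<Rightarrow> 'i \<times> nat \<Rightarrow> nat \<times> nat \<Rightarrow> nat \<Rightarrow> complex"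
    and W :: "'i \<Rightarrow> 'i \<Rightarrow> 'i \<times> nat \<Rightarrow> nat \<Rightarrow> nat \<times> nat \<Rightarrow> complex"
  assumes m_add1: "(x + x') \<odot> y = x \<odot> y + x' \<odot> y" and m_add2: "y \<odot> (x + x') = y \<odot> x + y \<odot> x'"
    and m_sc1: "(c *s x) \<odot> y = c *s (x \<odot> y)" and m_sc2: "x \<odot> (c *s y) = c *s (x \<odot> y)"
    and m_assoc: "(x \<odot> y) \<odot> z = x \<odot> (y \<odot> z)"
    and eps_add: "eps (x + y) = eps x + eps y" and eps_sc: "eps (c *s x) = c * eps x"
    and eps_t: "i < D a \<Longrightarrow> j < D a \<Longrightarrow> eps (t a i j) = (if i = j then 1 else 0)"
    and indep: "(\<Sum>a\<in>UNIV. \<Sum>i<D a. \<Sum>j<D a. f a i j *s t a i j) = 0 \<Longrightarrow> i < D a \<Longrightarrow> j < D a \<Longrightarrow> f a i j = 0"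
    and fus: "k < D b \<Longrightarrow> l < D b \<Longrightarrow> n < D a \<Longrightarrow> n' < D a \<Longrightarrow> t b k l \<odot> t a n n' =
        (\<Sum>x\<in>(SIGMA c:UNIV. {..<N b a c}). \<Sum>\<gamma><D (fst x). \<Sum>\<delta><D (fst x). 
           (V b a x (k, n) \<gamma> * W b a x \<delta> (l, n')) *s t (fst x) \<gamma> \<delta>)"
    and orth: "\<xi> \<in> (SIGMA c:UNIV. {..<N b a c}) \<Longrightarrow> \<eta> \<in> (SIGMA c:UNIV. {..<N b a c}) \<Longrightarrow> 
        \<gamma> < D (fst \<xi>) \<Longrightarrow> \<delta> < D (fst \<eta>) \<Longrightarrow>
        (\<Sum>p\<in>{..<D b} \<times> {..<D a}. W b a \<xi> \<gamma> p * V b a \<eta> p \<delta>) = (if \<xi> = \<eta> \<and> \<gamma> = \<delta> then 1 else 0)"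
begin

text \<open>\<open>J b a\<close> indexes a basis of W_b \<otimes> W_a, and \<open>X b a\<close>
  consists of its fusion channels (c, \<mu>). \<open>T b a\<close> is the coefficient matrix of the
  tensor product representation. Its image \<open>P b a\<close> under the counit is the idempotent
  whose range the channels decompose.\<close>

definition J where "J b a = {..<D b} \<times> {..<D a}"
definition X where "X b a = (SIGMA c:UNIV. {..<N b a c})"
definition T where "T b a p q = t b (fst p) (fst q) \<odot> t a (snd p) (snd q)"
definition P where "P b a p q = eps (T b a p q)"

lemma finite_J [simp]: "finite (J b a)" and finite_X [simp]: "finite (X b a)"
  by (simp_all add: J_def X_def)

lemma m_zero1: "0 \<odot> y = 0" and m_zero2: "y \<odot> 0 = 0"
  using m_sc1[of 0 0 y] m_sc2[of y 0 0] by simp_all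

lemma m_sum1: "(\<Sum>i\<in>K. f i) \<odot> y = (\<Sum>i\<in>K. f i \<odot> y)" and m_sum2: "y \<odot> (\<Sum>i\<in>K. f i) = (\<Sum>i\<in>K. y \<odot> f i)"
  by (induction K rule: infinite_finite_induct) (simp_all add: m_zero1 m_zero2 m_add1 m_add2)

lemma eps_zero: "eps 0 = 0" using eps_sc[of 0 0] by simp

lemma eps_sum: "eps (\<Sum>i\<in>K. f i) = (\<Sum>i\<in>K. eps (f i))"
  by (induction K rule: infinite_finite_induct) (simp_all add: eps_zero eps_add)

lemma sum_J: "(\<Sum>p\<in>J b a. f p) = (\<Sum>k<D b. \<Sum>n<D a. f (k, n))"
  unfolding J_def by (simp add: sum.cartesian_product)

lemma fusJ: "p \<in> J b a \<Longrightarrow> q \<in> J b a \<Longrightarrow> T b a p q =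
        (\<Sum>x\<in>X b a. \<Sum>\<gamma><D (fst x). \<Sum>\<delta><D (fst x). (V b a x p \<gamma> * W b a x \<delta> q) *s t (fst x) \<gamma> \<delta>)"
  unfolding T_def J_def X_def using fus by auto

lemma orthJ: "x \<in> X b a \<Longrightarrow> y \<in> X b a \<Longrightarrow> \<gamma> < D (fst x) \<Longrightarrow> \<delta> < D (fst y) \<Longrightarrow>
        (\<Sum>p\<in>J b a. W b a x \<gamma> p * V b a y p \<delta>) = (if x = y \<and> \<gamma> = \<delta> then 1 else 0)"
  unfolding J_def X_def by (rule orth)

lemma indep_block:
  assumes "(\<Sum>i<D a. \<Sum>j<D a. f i j *s t a i j) = (\<Sum>i<D a'. \<Sum>j<D a'. g i j *s t a' i j)" 
    and "i < D a" "j < D a"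
  shows "f i j = (if a = a' then g i j else 0)"
proof -
  have s: "(\<Sum>b\<in>UNIV. \<Sum>i<D b. \<Sum>j<D b. (if b = a0 then h i j else 0) *s t b i j) = (\<Sum>i<D a0. \<Sum>j<D a0. h i j *s t a0 i j)" for a0 h
  proof -
    have "(\<Sum>b\<in>UNIV. \<Sum>i<D b. \<Sum>j<D b. (if b = a0 then h i j else 0) *s t b i j) = 
       (\<Sum>b\<in>UNIV. if b = a0 then (\<Sum>i<D b. \<Sum>j<D b. h i j *s t b i j) else 0)"
      by (intro sum.cong refl) simp
    thus ?thesis by simp
  qed
  have "(\<Sum>b\<in>UNIV. \<Sum>i<D b. \<Sum>j<D b. ((if b = a then f i j else 0) - (if b = a' then g i j else 0)) *s t b i j) = 0"
    unfolding scale_left_diff_distrib sum_subtractf s using assms(1) by simp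
  from indep[OF this assms(2,3)] show ?thesis by (auto split: if_splits)
qed

text \<open>Schur's lemma for coefficient matrices: on both sides of M t = t M the coefficients of
  the independent elements \<open>t c i j\<close> can be compared directly.\<close>

lemma schur_t:
  assumes "\<And>\<gamma> \<delta>. \<gamma> < D c' \<Longrightarrow> \<delta> < D c \<Longrightarrow> 
     (\<Sum>\<gamma>'<D c. M \<gamma> \<gamma>' *s t c \<gamma>' \<delta>) = (\<Sum>\<delta>'<D c'. M \<delta>' \<delta> *s t c' \<gamma> \<delta>')"
  obtains \<alpha> where "\<And>\<gamma> \<delta>. \<gamma> < D c' \<Longrightarrow> \<delta> < D c \<Longrightarrow> M \<gamma> \<delta> = (if c = c' \<and> \<gamma> = \<delta> then \<alpha> else 0)"
proof -
  have e: "(if \<delta> = j then M \<gamma> i else 0) = (if c = c' then if i = \<gamma> then M j \<delta> else 0 else 0)"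
    if "\<gamma> < D c'" "\<delta> < D c" "i < D c" "j < D c" for \<gamma> \<delta> i j
  proof -
    have "(\<Sum>i<D c. \<Sum>j<D c. (if \<delta> = j then M \<gamma> i else 0) *s t c i j) = (\<Sum>\<gamma>'<D c. M \<gamma> \<gamma>' *s t c \<gamma>' \<delta>)"
    proof (rule sum.cong[OF refl])
      fix i
      have "(\<Sum>j<D c. (if \<delta> = j then M \<gamma> i else 0) *s t c i j) = (\<Sum>j<D c. if \<delta> = j then M \<gamma> i *s t c i j else 0)"
        by (intro sum.cong) auto
      thus "(\<Sum>j<D c. (if \<delta> = j then M \<gamma> i else 0) *s t c i j) = M \<gamma> i *s t c i \<delta>" using that by simp
    qed
    also have "\<dots> = (\<Sum>\<delta>'<D c'. M \<delta>' \<delta> *s t c' \<gamma> \<delta>')" using assms that by blast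
    also have "\<dots> = (\<Sum>i<D c'. if i = \<gamma> then (\<Sum>j<D c'. M j \<delta> *s t c' i j) else 0)" using that by simp
    also have "\<dots> = (\<Sum>i<D c'. \<Sum>j<D c'. (if i = \<gamma> then M j \<delta> else 0) *s t c' i j)"
      by (intro sum.cong) auto
    finally show ?thesis using indep_block[where a = c and a' = c' and f = "\<lambda>i j. if \<delta> = j then M \<gamma> i else 0" 
        and g = "\<lambda>i j. if i = \<gamma> then M j \<delta> else 0" and i = i and j = j] that
      by simp
  qed
  show ?thesis
  \<comment> \<open>Whenever there is an entry to consider, both dimensions are positive, so the
    corner entry can serve as the scalar.\<close>
  proof (rule that[of "M 0 0"])
    fix \<gamma> \<delta> assume gd: "\<gamma> < D c'" "\<delta> < D c"
    show "M \<gamma> \<delta> = (if c = c' \<and> \<gamma> = \<delta> then M 0 0 else 0)"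
      using e[OF gd(1) gd(2) gd(2) gd(2)] e[of 0 0 \<gamma> \<gamma>] e[of \<gamma> \<delta> \<gamma> \<delta>] e[of \<gamma> 0 \<gamma> 0] e[of \<gamma> \<gamma> 0 0] gd
      by (auto split: if_splits)
  qed
qed

text \<open>The intertwiner condition T Y = Y t^c for a map from W_c to W_b \<otimes> W_a, as
  matrices over the algebra. \<open>Wmor\<close> is the condition Y T = t^c Y for the opposite
  direction.\<close>

definition Vmor where "Vmor b a c Y \<longleftrightarrow> (\<forall>p\<in>J b a. \<forall>\<delta><D c. 
   (\<Sum>q\<in>J b a. Y q \<delta> *s T b a p q) = (\<Sum>\<gamma><D c. Y p \<gamma> *s t c \<gamma> \<delta>))"
definition Wmor where "Wmor b a c Y \<longleftrightarrow> (\<forall>q\<in>J b a. \<forall>\<gamma><D c. 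
   (\<Sum>p\<in>J b a. Y \<gamma> p *s T b a p q) = (\<Sum>\<delta><D c. Y \<delta> q *s t c \<gamma> \<delta>))"

lemma Vmor_V: assumes x: "x \<in> X b a" shows "Vmor b a (fst x) (V b a x)"
  unfolding Vmor_def
proof (intro ballI allI impI)
  fix p \<delta> assume p: "p \<in> J b a" and d: "\<delta> < D (fst x)"
  have "(\<Sum>q\<in>J b a. V b a x q \<delta> *s T b a p q) = 
    (\<Sum>q\<in>J b a. \<Sum>y\<in>X b a. \<Sum>\<gamma><D (fst y). \<Sum>\<epsilon><D (fst y). (V b a y p \<gamma> * (W b a y \<epsilon> q * V b a x q \<delta>)) *s t (fst y) \<gamma> \<epsilon>)"
    by (intro sum.cong refl) (simp add: fusJ[OF p] scale_sum_right mult_ac)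
  also have "\<dots> = (\<Sum>y\<in>X b a. \<Sum>\<gamma><D (fst y). \<Sum>\<epsilon><D (fst y). (V b a y p \<gamma> * (\<Sum>q\<in>J b a. W b a y \<epsilon> q * V b a x q \<delta>)) *s t (fst y) \<gamma> \<epsilon>)"
    by (subst sum.swap, rule sum.cong[OF refl], subst sum.swap, rule sum.cong[OF refl], subst sum.swap, rule sum.cong[OF refl])
       (simp add: sum_distrib_left scale_sum_left)
  also have "\<dots> = (\<Sum>y\<in>X b a. if y = x then (\<Sum>\<gamma><D (fst x). V b a x p \<gamma> *s t (fst x) \<gamma> \<delta>) else 0)"
  proof (intro sum.cong refl)
    fix y assume y: "y \<in> X b a"
    show "(\<Sum>\<gamma><D (fst y). \<Sum>\<epsilon><D (fst y). (V b a y p \<gamma> * (\<Sum>q\<in>J b a. W b a y \<epsilon> q * V b a x q \<delta>)) *s t (fst y) \<gamma> \<epsilon>) =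
      (if y = x then (\<Sum>\<gamma><D (fst x). V b a x p \<gamma> *s t (fst x) \<gamma> \<delta>) else 0)"
    proof (cases "y = x")
      case True
      have "(\<Sum>\<epsilon><D (fst x). (V b a x p \<gamma> * (\<Sum>q\<in>J b a. W b a x \<epsilon> q * V b a x q \<delta>)) *s t (fst x) \<gamma> \<epsilon>) =
         (\<Sum>\<epsilon><D (fst x). if \<epsilon> = \<delta> then V b a x p \<gamma> *s t (fst x) \<gamma> \<epsilon> else 0)" for \<gamma>
        by (intro sum.cong refl) (use x d orthJ[OF x x] in auto)
      thus ?thesis using True d by simp
    next
      case False thus ?thesis using orthJ[OF y x] d by simp
    qed
  qed
  also have "\<dots> = (\<Sum>\<gamma><D (fst x). V b a x p \<gamma> *s t (fst x) \<gamma> \<delta>)" using x by simp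
  finally show "(\<Sum>q\<in>J b a. V b a x q \<delta> *s T b a p q) = (\<Sum>\<gamma><D (fst x). V b a x p \<gamma> *s t (fst x) \<gamma> \<delta>)" .
qed

lemma Wmor_W: assumes x: "x \<in> X b a" shows "Wmor b a (fst x) (W b a x)"
  unfolding Wmor_def
proof (intro ballI allI impI)
  fix q \<gamma> assume q: "q \<in> J b a" and d: "\<gamma> < D (fst x)"
  have "(\<Sum>p\<in>J b a. W b a x \<gamma> p *s T b a p q) = 
    (\<Sum>p\<in>J b a. \<Sum>y\<in>X b a. \<Sum>\<epsilon><D (fst y). \<Sum>\<delta><D (fst y). (W b a y \<delta> q * (W b a x \<gamma> p * V b a y p \<epsilon>)) *s t (fst y) \<epsilon> \<delta>)"
    by (intro sum.cong refl) (simp add: fusJ[OF _ q] scale_sum_right mult_ac)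
  also have "\<dots> = (\<Sum>y\<in>X b a. \<Sum>\<epsilon><D (fst y). \<Sum>\<delta><D (fst y). (W b a y \<delta> q * (\<Sum>p\<in>J b a. W b a x \<gamma> p * V b a y p \<epsilon>)) *s t (fst y) \<epsilon> \<delta>)"
    by (subst sum.swap, rule sum.cong[OF refl], subst sum.swap, rule sum.cong[OF refl], subst sum.swap, rule sum.cong[OF refl])
       (simp add: sum_distrib_left scale_sum_left)
  also have "\<dots> = (\<Sum>y\<in>X b a. if y = x then (\<Sum>\<delta><D (fst x). W b a x \<delta> q *s t (fst x) \<gamma> \<delta>) else 0)"
  proof (intro sum.cong refl)
    fix y assume y: "y \<in> X b a"
    show "(\<Sum>\<epsilon><D (fst y). \<Sum>\<delta><D (fst y). (W b a y \<delta> q * (\<Sum>p\<in>J b a. W b a x \<gamma> p * V b a y p \<epsilon>)) *s t (fst y) \<epsilon> \<delta>) =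
      (if y = x then (\<Sum>\<delta><D (fst x). W b a x \<delta> q *s t (fst x) \<gamma> \<delta>) else 0)"
    proof (cases "y = x")
      case True
      have "(\<Sum>\<epsilon><D (fst x). \<Sum>\<delta><D (fst x). (W b a x \<delta> q * (\<Sum>p\<in>J b a. W b a x \<gamma> p * V b a x p \<epsilon>)) *s t (fst x) \<epsilon> \<delta>) =
         (\<Sum>\<epsilon><D (fst x). if \<epsilon> = \<gamma> then \<Sum>\<delta><D (fst x). W b a x \<delta> q *s t (fst x) \<epsilon> \<delta> else 0)"
        by (intro sum.cong refl) (use x d orthJ[OF x x] in auto)
      thus ?thesis using True d by simp
    next
      case False thus ?thesis using orthJ[OF x y] d by simp
    qed
  qed
  also have "\<dots> = (\<Sum>\<delta><D (fst x). W b a x \<delta> q *s t (fst x) \<gamma> \<delta>)" using x by simp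
  finally show "(\<Sum>p\<in>J b a. W b a x \<gamma> p *s T b a p q) = (\<Sum>\<delta><D (fst x). W b a x \<delta> q *s t (fst x) \<gamma> \<delta>)" .
qed

lemma comp_scalar:
  assumes W: "Wmor b a c' Y'" and V: "Vmor b a c Y"
  shows "\<exists>\<alpha>. \<forall>\<gamma><D c'. \<forall>\<delta><D c. (\<Sum>p\<in>J b a. Y' \<gamma> p * Y p \<delta>) = (if c = c' \<and> \<gamma> = \<delta> then \<alpha> else 0)"
proof -
  let ?M = "\<lambda>\<gamma> \<delta>. \<Sum>p\<in>J b a. Y' \<gamma> p * Y p \<delta>"
  have "(\<Sum>\<gamma>'<D c. ?M \<gamma> \<gamma>' *s t c \<gamma>' \<delta>) = (\<Sum>\<delta>'<D c'. ?M \<delta>' \<delta> *s t c' \<gamma> \<delta>')"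
    if g: "\<gamma> < D c'" "\<delta> < D c" for \<gamma> \<delta>
  proof -
    have "(\<Sum>\<gamma>'<D c. ?M \<gamma> \<gamma>' *s t c \<gamma>' \<delta>) = (\<Sum>p\<in>J b a. Y' \<gamma> p *s (\<Sum>\<gamma>'<D c. Y p \<gamma>' *s t c \<gamma>' \<delta>))"
      by (simp add: scale_sum_left scale_sum_right) (rule sum.swap)
    also have "\<dots> = (\<Sum>p\<in>J b a. Y' \<gamma> p *s (\<Sum>q\<in>J b a. Y q \<delta> *s T b a p q))"
      using V g unfolding Vmor_def by simp
    also have "\<dots> = (\<Sum>q\<in>J b a. Y q \<delta> *s (\<Sum>p\<in>J b a. Y' \<gamma> p *s T b a p q))"
      unfolding scale_sum_right by (subst sum.swap) (simp add: mult.commute)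
    also have "\<dots> = (\<Sum>q\<in>J b a. Y q \<delta> *s (\<Sum>\<delta>'<D c'. Y' \<delta>' q *s t c' \<gamma> \<delta>'))"
      using W g unfolding Wmor_def by simp
    also have "\<dots> = (\<Sum>\<delta>'<D c'. ?M \<delta>' \<delta> *s t c' \<gamma> \<delta>')"
      unfolding scale_sum_left scale_sum_right by (subst sum.swap) (simp add: mult.commute)
    finally show ?thesis .
  qed
  from schur_t[of c' c ?M, OF this] obtain \<alpha> where 
    "\<And>\<gamma> \<delta>. \<gamma> < D c' \<Longrightarrow> \<delta> < D c \<Longrightarrow> ?M \<gamma> \<delta> = (if c = c' \<and> \<gamma> = \<delta> then \<alpha> else 0)" by blast
  thus ?thesis by (intro exI[of _ \<alpha>]) simp
qed

lemma P_expand: "p \<in> J b a \<Longrightarrow> q \<in> J b a \<Longrightarrow> P b a p q = (\<Sum>x\<in>X b a. \<Sum>\<gamma><D (fst x). V b a x p \<gamma> * W b a x \<gamma> q)"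
proof -
  assume pq: "p \<in> J b a" "q \<in> J b a"
  have "(\<Sum>\<delta><D c. (v * w \<delta>) * eps (t c \<gamma> \<delta>)) = v * w \<gamma>" if "\<gamma> < D c" for c \<gamma> v and w :: "nat \<Rightarrow> complex"
  proof -
    have "(\<Sum>\<delta><D c. (v * w \<delta>) * eps (t c \<gamma> \<delta>)) = (\<Sum>\<delta><D c. if \<gamma> = \<delta> then v * w \<delta> else 0)"
      using that by (intro sum.cong refl) (auto simp: eps_t)
    thus ?thesis using that by simp
  qed
  thus ?thesis unfolding P_def fusJ[OF pq] eps_sum eps_sc by (intro sum.cong refl) auto
qed

text \<open>The counit sends t^c to the identity matrix and \<open>T\<close> to \<open>P\<close>.
  Applied to the intertwiner condition, it shows that intertwiners land in the range of the
  idempotent automatically.\<close>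

lemma Vmor_P:
  assumes V: "Vmor b a c Y" and p: "p \<in> J b a" and d: "\<delta> < D c"
  shows "(\<Sum>q\<in>J b a. P b a p q * Y q \<delta>) = Y p \<delta>"
proof -
  have "(\<Sum>q\<in>J b a. P b a p q * Y q \<delta>) = eps (\<Sum>q\<in>J b a. Y q \<delta> *s T b a p q)"
    by (simp add: eps_sum eps_sc P_def mult.commute)
  also have "\<dots> = (\<Sum>\<gamma><D c. Y p \<gamma> * eps (t c \<gamma> \<delta>))"
    using V p d by (simp add: Vmor_def eps_sum eps_sc)
  also have "\<dots> = (\<Sum>\<gamma><D c. if \<gamma> = \<delta> then Y p \<gamma> else 0)"
    using d by (intro sum.cong refl) (auto simp: eps_t)
  finally show ?thesis using d by simp
qed

lemma Wmor_P:
  assumes V: "Wmor b a c Y" and q: "q \<in> J b a" and d: "\<gamma> < D c"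
  shows "(\<Sum>p\<in>J b a. Y \<gamma> p * P b a p q) = Y \<gamma> q"
proof -
  have "(\<Sum>p\<in>J b a. Y \<gamma> p * P b a p q) = eps (\<Sum>p\<in>J b a. Y \<gamma> p *s T b a p q)"
    by (simp add: eps_sum eps_sc P_def)
  also have "\<dots> = (\<Sum>\<delta><D c. Y \<delta> q * eps (t c \<gamma> \<delta>))"
    using V q d by (simp add: Wmor_def eps_sum eps_sc)
  also have "\<dots> = (\<Sum>\<delta><D c. if \<gamma> = \<delta> then Y \<delta> q else 0)"
    using d by (intro sum.cong refl) (auto simp: eps_t)
  finally show ?thesis using d by simp
qed

lemma sum_X_fst: 
  "(\<Sum>x\<in>X b a. if c = fst x then f x else 0) = (\<Sum>\<mu><N b a c. f (c, \<mu>) :: complex)"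
proof -
  have "(\<Sum>x\<in>X b a. if c = fst x then f x else 0) = (\<Sum>c'\<in>UNIV. \<Sum>\<mu><N b a c'. if c = c' then f (c', \<mu>) else 0)"
    unfolding X_def by (subst sum.Sigma) (auto intro!: sum.cong)
  also have "\<dots> = (\<Sum>c'\<in>UNIV. if c = c' then (\<Sum>\<mu><N b a c'. f (c', \<mu>)) else 0)"
    by (intro sum.cong refl) auto
  finally show ?thesis by simp
qed

text \<open>Insert the decomposition of \<open>P\<close> as the sum of V W over all channels. By
  Schur's lemma each composite of \<open>W\<close> with \<open>Y\<close> is a scalar, and it
  vanishes unless the channel ends in \<open>c\<close>.\<close>

lemma Vmor_expand:
  assumes V: "Vmor b a c Y"
  obtains \<alpha> where "\<And>p \<gamma>. p \<in> J b a \<Longrightarrow> \<gamma> < D c \<Longrightarrow> Y p \<gamma> = (\<Sum>\<mu><N b a c. \<alpha> \<mu> * V b a (c, \<mu>) p \<gamma>)"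
    "\<And>\<mu> \<gamma> \<delta>. \<mu> < N b a c \<Longrightarrow> \<gamma> < D c \<Longrightarrow> \<delta> < D c \<Longrightarrow> (\<Sum>p\<in>J b a. W b a (c, \<mu>) \<gamma> p * Y p \<delta>) = (if \<gamma> = \<delta> then \<alpha> \<mu> else 0)"
proof -
  have "\<forall>x. \<exists>\<alpha>. x \<in> X b a \<longrightarrow> (\<forall>\<gamma><D (fst x). \<forall>\<delta><D c. (\<Sum>p\<in>J b a. W b a x \<gamma> p * Y p \<delta>) = (if c = fst x \<and> \<gamma> = \<delta> then \<alpha> else 0))"
  proof
    fix x show "\<exists>\<alpha>. x \<in> X b a \<longrightarrow> (\<forall>\<gamma><D (fst x). \<forall>\<delta><D c. (\<Sum>p\<in>J b a. W b a x \<gamma> p * Y p \<delta>) = (if c = fst x \<and> \<gamma> = \<delta> then \<alpha> else 0))"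
    proof (cases "x \<in> X b a")
      case True thus ?thesis using comp_scalar[OF Wmor_W[OF True] V] by simp
    qed simp
  qed
  from choice[OF this] obtain \<alpha> where \<alpha>: "\<And>x \<gamma> \<delta>. x \<in> X b a \<Longrightarrow> \<gamma> < D (fst x) \<Longrightarrow> \<delta> < D c \<Longrightarrow> 
      (\<Sum>p\<in>J b a. W b a x \<gamma> p * Y p \<delta>) = (if c = fst x \<and> \<gamma> = \<delta> then \<alpha> x else 0)" by blast
  show ?thesis
  proof (rule that[of "\<lambda>\<mu>. \<alpha> (c, \<mu>)"])
    fix p \<gamma> assume p: "p \<in> J b a" and g: "\<gamma> < D c"
    have "Y p \<gamma> = (\<Sum>q\<in>J b a. (\<Sum>x\<in>X b a. \<Sum>\<epsilon><D (fst x). V b a x p \<epsilon> * W b a x \<epsilon> q) * Y q \<gamma>)"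
      using Vmor_P[OF V p g] P_expand[OF p] by simp
    also have "\<dots> = (\<Sum>x\<in>X b a. \<Sum>\<epsilon><D (fst x). V b a x p \<epsilon> * (\<Sum>q\<in>J b a. W b a x \<epsilon> q * Y q \<gamma>))"
      unfolding sum_distrib_right sum_distrib_left
      by (subst sum.swap, rule sum.cong[OF refl], subst sum.swap) (simp add: mult.assoc)
    also have "\<dots> = (\<Sum>x\<in>X b a. if c = fst x then \<alpha> x * V b a x p \<gamma> else 0)"
    proof (intro sum.cong refl)
      fix x assume x: "x \<in> X b a"
      have "(\<Sum>\<epsilon><D (fst x). V b a x p \<epsilon> * (\<Sum>q\<in>J b a. W b a x \<epsilon> q * Y q \<gamma>)) = 
        (\<Sum>\<epsilon><D (fst x). if \<epsilon> = \<gamma> then (if c = fst x then \<alpha> x * V b a x p \<epsilon> else 0) else 0)"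
        by (intro sum.cong refl) (use \<alpha>[OF x] g in auto)
      thus "(\<Sum>\<epsilon><D (fst x). V b a x p \<epsilon> * (\<Sum>q\<in>J b a. W b a x \<epsilon> q * Y q \<gamma>)) = (if c = fst x then \<alpha> x * V b a x p \<gamma> else 0)"
        using g by auto
    qed
    also have "\<dots> = (\<Sum>\<mu><N b a c. \<alpha> (c, \<mu>) * V b a (c, \<mu>) p \<gamma>)" by (rule sum_X_fst)
    finally show "Y p \<gamma> = (\<Sum>\<mu><N b a c. \<alpha> (c, \<mu>) * V b a (c, \<mu>) p \<gamma>)" .
  next
    fix \<mu> \<gamma> \<delta> assume "\<mu> < N b a c" "\<gamma> < D c" "\<delta> < D c"
    thus "(\<Sum>p\<in>J b a. W b a (c, \<mu>) \<gamma> p * Y p \<delta>) = (if \<gamma> = \<delta> then \<alpha> (c, \<mu>) else 0)"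
      using \<alpha>[of "(c,\<mu>)" \<gamma> \<delta>] by (auto simp: X_def)
  qed
qed

lemma Wmor_expand:
  assumes W: "Wmor b a c Y"
  obtains \<alpha> where "\<And>p \<gamma>. p \<in> J b a \<Longrightarrow> \<gamma> < D c \<Longrightarrow> Y \<gamma> p = (\<Sum>\<mu><N b a c. \<alpha> \<mu> * W b a (c, \<mu>) \<gamma> p)"
    "\<And>\<mu> \<gamma> \<delta>. \<mu> < N b a c \<Longrightarrow> \<gamma> < D c \<Longrightarrow> \<delta> < D c \<Longrightarrow> (\<Sum>p\<in>J b a. Y \<gamma> p * V b a (c, \<mu>) p \<delta>) = (if \<gamma> = \<delta> then \<alpha> \<mu> else 0)"
proof -
  have "\<forall>x. \<exists>\<alpha>. x \<in> X b a \<longrightarrow> (\<forall>\<gamma><D c. \<forall>\<delta><D (fst x). (\<Sum>p\<in>J b a. Y \<gamma> p * V b a x p \<delta>) = (if fst x = c \<and> \<gamma> = \<delta> then \<alpha> else 0))"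
  proof
    fix x show "\<exists>\<alpha>. x \<in> X b a \<longrightarrow> (\<forall>\<gamma><D c. \<forall>\<delta><D (fst x). (\<Sum>p\<in>J b a. Y \<gamma> p * V b a x p \<delta>) = (if fst x = c \<and> \<gamma> = \<delta> then \<alpha> else 0))"
    proof (cases "x \<in> X b a")
      case True thus ?thesis using comp_scalar[OF W Vmor_V[OF True]] by (simp add: eq_commute[of c])
    qed simp
  qed
  from choice[OF this] obtain \<alpha> where \<alpha>: "\<And>x \<gamma> \<delta>. x \<in> X b a \<Longrightarrow> \<gamma> < D c \<Longrightarrow> \<delta> < D (fst x) \<Longrightarrow> 
      (\<Sum>p\<in>J b a. Y \<gamma> p * V b a x p \<delta>) = (if fst x = c \<and> \<gamma> = \<delta> then \<alpha> x else 0)" by blast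
  show ?thesis
  proof (rule that[of "\<lambda>\<mu>. \<alpha> (c, \<mu>)"])
    fix q \<gamma> assume q: "q \<in> J b a" and g: "\<gamma> < D c"
    have "Y \<gamma> q = (\<Sum>p\<in>J b a. Y \<gamma> p * (\<Sum>x\<in>X b a. \<Sum>\<epsilon><D (fst x). V b a x p \<epsilon> * W b a x \<epsilon> q))"
      using Wmor_P[OF W q g] P_expand[OF _ q] by simp
    also have "\<dots> = (\<Sum>x\<in>X b a. \<Sum>\<epsilon><D (fst x). (\<Sum>p\<in>J b a. Y \<gamma> p * V b a x p \<epsilon>) * W b a x \<epsilon> q)"
      unfolding sum_distrib_right sum_distrib_left
      by (subst sum.swap, rule sum.cong[OF refl], subst sum.swap) (simp add: mult.assoc)
    also have "\<dots> = (\<Sum>x\<in>X b a. if c = fst x then \<alpha> x * W b a x \<gamma> q else 0)"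
    proof (intro sum.cong refl)
      fix x assume x: "x \<in> X b a"
      have "(\<Sum>\<epsilon><D (fst x). (\<Sum>p\<in>J b a. Y \<gamma> p * V b a x p \<epsilon>) * W b a x \<epsilon> q) = 
        (\<Sum>\<epsilon><D (fst x). if \<epsilon> = \<gamma> then (if c = fst x then \<alpha> x * W b a x \<epsilon> q else 0) else 0)"
        by (intro sum.cong refl) (use \<alpha>[OF x] g in auto)
      thus "(\<Sum>\<epsilon><D (fst x). (\<Sum>p\<in>J b a. Y \<gamma> p * V b a x p \<epsilon>) * W b a x \<epsilon> q) = (if c = fst x then \<alpha> x * W b a x \<gamma> q else 0)"
        using g by auto
    qed
    also have "\<dots> = (\<Sum>\<mu><N b a c. \<alpha> (c, \<mu>) * W b a (c, \<mu>) \<gamma> q)" by (rule sum_X_fst)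
    finally show "Y \<gamma> q = (\<Sum>\<mu><N b a c. \<alpha> (c, \<mu>) * W b a (c, \<mu>) \<gamma> q)" .
  next
    fix \<mu> \<gamma> \<delta> assume "\<mu> < N b a c" "\<gamma> < D c" "\<delta> < D c"
    thus "(\<Sum>p\<in>J b a. Y \<gamma> p * V b a (c, \<mu>) p \<delta>) = (if \<gamma> = \<delta> then \<alpha> (c, \<mu>) else 0)"
      using \<alpha>[of "(c,\<mu>)" \<gamma> \<delta>] by (auto simp: X_def)
  qed
qed

end

lemma sum6_perm: "(\<Sum>a\<in>A. \<Sum>b\<in>B. \<Sum>c\<in>C. \<Sum>d\<in>D. \<Sum>e\<in>E. \<Sum>f\<in>F. g a b c d e f) = 
  (\<Sum>c\<in>C. \<Sum>e\<in>E. \<Sum>f\<in>F. \<Sum>b\<in>B. \<Sum>d\<in>D. \<Sum>a\<in>A. g a b c d e f)"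
  unfolding sum.cartesian_product
  by (rule sum.reindex_bij_witness[where i="\<lambda>(c,e,f,b,d,a). (a,b,c,d,e,f)" and j="\<lambda>(a,b,c,d,e,f). (c,e,f,b,d,a)"]) auto

lemma sum4_perm: "(\<Sum>a\<in>A. \<Sum>b\<in>B. \<Sum>c\<in>C. \<Sum>d\<in>D. g a b c d) = (\<Sum>b\<in>B. \<Sum>c\<in>C. \<Sum>d\<in>D. \<Sum>a\<in>A. g a b c d)"
  unfolding sum.cartesian_product
  by (rule sum.reindex_bij_witness[where i="\<lambda>(b,c,d,a). (a,b,c,d)" and j="\<lambda>(a,b,c,d). (b,c,d,a)"]) auto

lemma sum3_perm: "(\<Sum>a\<in>A. \<Sum>b\<in>B. \<Sum>c\<in>C. g a b c) = (\<Sum>c\<in>C. \<Sum>a\<in>A. \<Sum>b\<in>B. g a b c)"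
  unfolding sum.cartesian_product
  by (rule sum.reindex_bij_witness[where i="\<lambda>(c,a,b). (a,b,c)" and j="\<lambda>(a,b,c). (c,a,b)"]) auto

section \<open>Rotation of fusion tensors\<close>

text \<open>\<open>ES\<close> is the source counital map and \<open>ou c\<close> a vacuum component
  of the unit. The conditions \<open>w1\<close>, \<open>w3\<close>, \<open>w5\<close> are counital
  identities written on coefficients; \<open>chi\<close> says that the weighted trace of
  \<open>ES\<close> is a multiple of the vacuum. The list is closed under passing to the opposite
  product with transposed coefficients, the target counital map taking the place of
  \<open>ES\<close>.\<close>

locale left_rotation = tensor_calculus sc m D t eps N V W
  for sc :: "complex \<Rightarrow> 'a::ab_group_add \<Rightarrow> 'a" (infixr \<open>*s\<close> 75) 
    and m :: "'a \<Rightarrow> 'a \<Rightarrow> 'a" (infixl \<open>\<odot>\<close> 70)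
    and D :: "'i::finite \<Rightarrow> nat" and t :: "'i \<Rightarrow> nat \<Rightarrow> nat \<Rightarrow> 'a" and eps :: "'a \<Rightarrow> complex"
    and N :: "'i \<Rightarrow> 'i \<Rightarrow> 'i \<Rightarrow> nat"
    and V :: "'i \<Rightarrow> 'i \<Rightarrow> 'i \<times> nat \<Rightarrow> nat \<times> nat \<Rightarrow> nat \<Rightarrow> complex"
    and W :: "'i \<Rightarrow> 'i \<Rightarrow> 'i \<times> nat \<Rightarrow> nat \<Rightarrow> nat \<times> nat \<Rightarrow> complex" +
  fixes S :: "'a \<Rightarrow> 'a" and ES :: "'a \<Rightarrow> 'a" and bar :: "'i \<Rightarrow> 'i" 
    and Z Zi :: "'i \<Rightarrow> nat \<Rightarrow> nat \<Rightarrow> complex" and w :: "'i \<Rightarrow> complex" and ou :: "'i \<Rightarrow> 'a"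
  assumes conjA: "p < D b \<Longrightarrow> s' < D (bar b) \<Longrightarrow>
      (\<Sum>s<D (bar b). Z b p s *s t (bar b) s s') = (\<Sum>p'<D b. Z b p' s' *s S (t b p' p))"
    and conjB: "s < D (bar b) \<Longrightarrow> p < D b \<Longrightarrow>
      (\<Sum>s'<D (bar b). Zi b s' p *s t (bar b) s s') = (\<Sum>p'<D b. Zi b s p' *s S (t b p p'))"
    and bar_bar: "bar (bar b) = b"
    and w1: "k < D b \<Longrightarrow> l < D b \<Longrightarrow> n < D a \<Longrightarrow> n' < D a \<Longrightarrow> 
      (\<Sum>j<D b. S (t b k j) \<odot> t b j l) \<odot> t a n n' = (\<Sum>n''<D a. eps (t b k l \<odot> t a n'' n') *s t a n n'')"
    and w3: "k < D b \<Longrightarrow> l < D b \<Longrightarrow> n < D a \<Longrightarrow> n' < D a \<Longrightarrow> 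
      (\<Sum>j<D b. t b k j \<odot> S (t b j l)) \<odot> t a n n' = (\<Sum>n''<D a. eps (S (t b k l) \<odot> t a n n'') *s t a n'' n')"
    and ES_add: "ES (x + y) = ES x + ES y" and ES_sc: "ES (z *s x) = z *s ES x"
    and w5: "k < D b \<Longrightarrow> l < D b \<Longrightarrow> n < D a \<Longrightarrow> n' < D a \<Longrightarrow> 
      ES (t b k l \<odot> t a n n') = (\<Sum>n''<D a. eps (t b k l \<odot> t a n'' n') *s ES (t a n n''))"
    and chi: "(\<Sum>i<D c. \<Sum>j<D c. (\<Sum>s<D (bar c). Zi (bar c) j s * Z c i s) *s ES (t c i j)) = w c *s ou c"
begin

text \<open>The matrix Z_{bar c}^{-1} times the transpose of Z_c, which is the inverse of
  \<open>G\<close>. It arises when a bent leg is closed again, see \<open>What_Vhat\<close>.\<close>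

definition Gi where "Gi c j i = (\<Sum>s<D (bar c). Zi (bar c) j s * Z c i s)"

lemma ES_zero: "ES 0 = 0" using ES_sc[of 0 0] by simp

lemma ES_sum: "ES (\<Sum>i\<in>K. f i) = (\<Sum>i\<in>K. ES (f i))"
  by (induction K rule: infinite_finite_induct) (simp_all add: ES_zero ES_add)

lemma m_bilin: "(\<Sum>i\<in>I. f i *s x i) \<odot> (\<Sum>j\<in>K. g j *s y j) = (\<Sum>i\<in>I. \<Sum>j\<in>K. (f i * g j) *s (x i \<odot> y j))"
  unfolding m_sum1 m_sc1 unfolding m_sum2 m_sc2 scale_sum_right scale_scale ..

text \<open>Legs bent with \<open>Z\<close>: \<open>What\<close> turns V : W_c \<rightarrow> W_b
  \<otimes> W_a into a map W_{bar b} \<otimes> W_c \<rightarrow> W_a, and \<open>Vhat\<close> turns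
  W : W_b \<otimes> W_a \<rightarrow> W_c into a map W_a \<rightarrow> W_{bar b} \<otimes>
  W_c.\<close>

definition What where "What b a x k q = (\<Sum>p<D b. Z b p (fst q) * V b a x (p, k) (snd q))"
definition Vhat where "Vhat b a x q i = (\<Sum>r<D b. W b a x (snd q) (r, i) * Zi (bar b) r (fst q))"

text \<open>\<open>conjA\<close> turns t^{bar b} into S(t^b), and the intertwiner condition for
  \<open>V\<close> replaces t^c by t^b t^a. The product of S(t^b) and t^b is evaluated by
  \<open>w1\<close>, which produces the idempotent \<open>P\<close>; \<open>V\<close> absorbs
  it.\<close>

lemma What_mor:
  assumes x: "x \<in> X b a"
  shows "Wmor (bar b) (fst x) a (What b a x)"
  unfolding Wmor_def
proof (intro ballI allI impI)
  fix q' k assume q': "q' \<in> J (bar b) (fst x)" and k: "k < D a"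
  obtain s' g' where q'e: "q' = (s', g')" and s': "s' < D (bar b)" and g': "g' < D (fst x)"
    using q' by (auto simp: J_def)
  let ?c = "fst x"
  have "(\<Sum>q\<in>J (bar b) ?c. What b a x k q *s T (bar b) ?c q q') = 
     (\<Sum>s<D (bar b). \<Sum>g<D ?c. \<Sum>p<D b. (Z b p s * V b a x (p, k) g) *s (t (bar b) s s' \<odot> t ?c g g'))"
    by (simp add: sum_J What_def T_def q'e scale_sum_left)
  also have "\<dots> = (\<Sum>p<D b. \<Sum>s<D (bar b). \<Sum>g<D ?c. (Z b p s * V b a x (p, k) g) *s (t (bar b) s s' \<odot> t ?c g g'))"
    by (rule sum3_perm)
  also have "\<dots> = (\<Sum>p<D b. (\<Sum>s<D (bar b). Z b p s *s t (bar b) s s') \<odot> (\<Sum>g<D ?c. V b a x (p, k) g *s t ?c g g'))"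
    by (simp only: m_bilin)
  also have "\<dots> = (\<Sum>p<D b. (\<Sum>p'<D b. Z b p' s' *s S (t b p' p)) \<odot> (\<Sum>q\<in>J b a. V b a x q g' *s T b a (p, k) q))"
  proof (rule sum.cong[OF refl])
    fix p assume p: "p \<in> {..<D b}"
    have "(p, k) \<in> J b a" using p k by (simp add: J_def)
    hence "(\<Sum>g<D ?c. V b a x (p, k) g *s t ?c g g') = (\<Sum>q\<in>J b a. V b a x q g' *s T b a (p, k) q)"
      using Vmor_V[OF x] g' by (simp add: Vmor_def)
    thus "(\<Sum>s<D (bar b). Z b p s *s t (bar b) s s') \<odot> (\<Sum>g<D ?c. V b a x (p, k) g *s t ?c g g') = 
       (\<Sum>p'<D b. Z b p' s' *s S (t b p' p)) \<odot> (\<Sum>q\<in>J b a. V b a x q g' *s T b a (p, k) q)"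
      using conjA[of p b s'] p s' by simp
  qed
  also have "\<dots> = (\<Sum>p<D b. \<Sum>p'<D b. \<Sum>l<D b. \<Sum>k'<D a. (Z b p' s' * V b a x (l, k') g') *s ((S (t b p' p) \<odot> t b p l) \<odot> t a k k'))"
    unfolding m_bilin by (simp add: T_def m_assoc sum_J)
  also have "\<dots> = (\<Sum>p'<D b. \<Sum>l<D b. \<Sum>k'<D a. \<Sum>p<D b. (Z b p' s' * V b a x (l, k') g') *s ((S (t b p' p) \<odot> t b p l) \<odot> t a k k'))"
    by (rule sum4_perm)
  also have "\<dots> = (\<Sum>p'<D b. \<Sum>l<D b. \<Sum>k'<D a. (Z b p' s' * V b a x (l, k') g') *s ((\<Sum>p<D b. S (t b p' p) \<odot> t b p l) \<odot> t a k k'))"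
    by (simp add: m_sum1 scale_sum_right)
  also have "\<dots> = (\<Sum>p'<D b. \<Sum>l<D b. \<Sum>k'<D a. \<Sum>k''<D a. (Z b p' s' * (P b a (p', k'') (l, k') * V b a x (l, k') g')) *s t a k k'')"
    by (intro sum.cong refl) (use k in \<open>simp add: w1 scale_sum_right P_def T_def mult_ac\<close>)
  also have "\<dots> = (\<Sum>k''<D a. \<Sum>p'<D b. \<Sum>l<D b. \<Sum>k'<D a. (Z b p' s' * (P b a (p', k'') (l, k') * V b a x (l, k') g')) *s t a k k'')"
    by (rule sum4_perm[symmetric])
  also have "\<dots> = (\<Sum>k''<D a. \<Sum>p'<D b. (Z b p' s' * (\<Sum>q\<in>J b a. P b a (p', k'') q * V b a x q g')) *s t a k k'')"
    by (simp add: sum_J scale_sum_left sum_distrib_left)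
  also have "\<dots> = (\<Sum>k''<D a. \<Sum>p'<D b. (Z b p' s' * V b a x (p', k'') g') *s t a k k'')"
    by (intro sum.cong refl) (use Vmor_P[OF Vmor_V[OF x]] g' in \<open>simp add: J_def\<close>)
  also have "\<dots> = (\<Sum>k''<D a. What b a x k'' q' *s t a k k'')"
    by (simp add: What_def q'e scale_sum_left)
  finally show "(\<Sum>q\<in>J (bar b) ?c. What b a x k q *s T (bar b) ?c q q') = (\<Sum>k''<D a. What b a x k'' q' *s t a k k'')" .
qed

text \<open>The counterpart with t S(t) and \<open>w3\<close>. The relation \<open>conjB\<close> is
  used at \<open>bar b\<close> in both directions: to create S(t^{bar b}), and afterwards to
  recognize the counit term as an entry of \<open>P\<close>.\<close>

lemma Vhat_mor:
  assumes x: "x \<in> X b a"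
  shows "Vmor (bar b) (fst x) a (Vhat b a x)"
  unfolding Vmor_def
proof (intro ballI allI impI)
  fix p i assume p: "p \<in> J (bar b) (fst x)" and i: "i < D a"
  obtain s g where pe: "p = (s, g)" and s: "s < D (bar b)" and g: "g < D (fst x)"
    using p by (auto simp: J_def)
  let ?c = "fst x"
  have cB: "(\<Sum>r<D b. Zi (bar b) r s' *s t b r' r) = (\<Sum>p'<D (bar b). Zi (bar b) r' p' *s S (t (bar b) s' p'))"
    if "r' < D b" "s' < D (bar b)" for r' s'
    using conjB[of r' "bar b" s'] that unfolding bar_bar by simp
  have "(\<Sum>q\<in>J (bar b) ?c. Vhat b a x q i *s T (bar b) ?c p q) = 
     (\<Sum>s'<D (bar b). \<Sum>g'<D ?c. \<Sum>r<D b. (W b a x g' (r, i) * Zi (bar b) r s') *s (t (bar b) s s' \<odot> t ?c g g'))"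
    by (simp add: sum_J Vhat_def T_def pe scale_sum_left)
  also have "\<dots> = (\<Sum>r<D b. \<Sum>s'<D (bar b). \<Sum>g'<D ?c. (W b a x g' (r, i) * Zi (bar b) r s') *s (t (bar b) s s' \<odot> t ?c g g'))"
    by (rule sum3_perm)
  also have "\<dots> = (\<Sum>r<D b. (\<Sum>s'<D (bar b). Zi (bar b) r s' *s t (bar b) s s') \<odot> (\<Sum>g'<D ?c. W b a x g' (r, i) *s t ?c g g'))"
    by (simp add: m_bilin mult.commute)
  also have "\<dots> = (\<Sum>r<D b. (\<Sum>s'<D (bar b). Zi (bar b) r s' *s t (bar b) s s') \<odot> (\<Sum>q\<in>J b a. W b a x g q *s T b a q (r, i)))"
  proof (rule sum.cong[OF refl])
    fix r assume r: "r \<in> {..<D b}"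
    have "(r, i) \<in> J b a" using r i by (simp add: J_def)
    hence "(\<Sum>g'<D ?c. W b a x g' (r, i) *s t ?c g g') = (\<Sum>q\<in>J b a. W b a x g q *s T b a q (r, i))"
      using Wmor_W[OF x] g by (simp add: Wmor_def)
    thus "(\<Sum>s'<D (bar b). Zi (bar b) r s' *s t (bar b) s s') \<odot> (\<Sum>g'<D ?c. W b a x g' (r, i) *s t ?c g g') = 
       (\<Sum>s'<D (bar b). Zi (bar b) r s' *s t (bar b) s s') \<odot> (\<Sum>q\<in>J b a. W b a x g q *s T b a q (r, i))" by simp
  qed
  also have "\<dots> = (\<Sum>r<D b. \<Sum>s'<D (bar b). \<Sum>r'<D b. \<Sum>i'<D a. (W b a x g (r', i') * Zi (bar b) r s') *s (t (bar b) s s' \<odot> (t b r' r \<odot> t a i' i)))"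
    unfolding m_bilin by (simp add: T_def sum_J mult.commute)
  also have "\<dots> = (\<Sum>s'<D (bar b). \<Sum>r'<D b. \<Sum>i'<D a. \<Sum>r<D b. (W b a x g (r', i') * Zi (bar b) r s') *s (t (bar b) s s' \<odot> (t b r' r \<odot> t a i' i)))"
    by (rule sum4_perm)
  also have "\<dots> = (\<Sum>s'<D (bar b). \<Sum>r'<D b. \<Sum>i'<D a. W b a x g (r', i') *s (t (bar b) s s' \<odot> ((\<Sum>r<D b. Zi (bar b) r s' *s t b r' r) \<odot> t a i' i)))"
    by (simp add: m_sum1 m_sum2 m_sc1 m_sc2 scale_sum_right)
  also have "\<dots> = (\<Sum>s'<D (bar b). \<Sum>r'<D b. \<Sum>i'<D a. W b a x g (r', i') *s (t (bar b) s s' \<odot> ((\<Sum>p'<D (bar b). Zi (bar b) r' p' *s S (t (bar b) s' p')) \<odot> t a i' i)))"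
    by (intro sum.cong refl) (simp add: cB)
  also have "\<dots> = (\<Sum>s'<D (bar b). \<Sum>r'<D b. \<Sum>i'<D a. \<Sum>p'<D (bar b). (W b a x g (r', i') * Zi (bar b) r' p') *s ((t (bar b) s s' \<odot> S (t (bar b) s' p')) \<odot> t a i' i))"
    by (simp add: m_sum1 m_sum2 m_sc1 m_sc2 scale_sum_right m_assoc)
  also have "\<dots> = (\<Sum>r'<D b. \<Sum>i'<D a. \<Sum>p'<D (bar b). \<Sum>s'<D (bar b). (W b a x g (r', i') * Zi (bar b) r' p') *s ((t (bar b) s s' \<odot> S (t (bar b) s' p')) \<odot> t a i' i))"
    by (rule sum4_perm)
  also have "\<dots> = (\<Sum>r'<D b. \<Sum>i'<D a. \<Sum>p'<D (bar b). (W b a x g (r', i') * Zi (bar b) r' p') *s ((\<Sum>s'<D (bar b). t (bar b) s s' \<odot> S (t (bar b) s' p')) \<odot> t a i' i))"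
    by (simp add: m_sum1 scale_sum_right)
  also have "\<dots> = (\<Sum>r'<D b. \<Sum>i'<D a. \<Sum>p'<D (bar b). \<Sum>j<D a. (W b a x g (r', i') * (Zi (bar b) r' p' * eps (S (t (bar b) s p') \<odot> t a i' j))) *s t a j i)"
    by (intro sum.cong refl) (use i s in \<open>simp add: w3 scale_sum_right mult_ac\<close>)
  also have "\<dots> = (\<Sum>r'<D b. \<Sum>i'<D a. \<Sum>j<D a. (W b a x g (r', i') * (\<Sum>p'<D (bar b). Zi (bar b) r' p' * eps (S (t (bar b) s p') \<odot> t a i' j))) *s t a j i)"
    by (rule sum.cong[OF refl], rule sum.cong[OF refl], subst sum.swap) (simp add: scale_sum_left sum_distrib_left)
  also have "\<dots> = (\<Sum>r'<D b. \<Sum>i'<D a. \<Sum>j<D a. (W b a x g (r', i') * (\<Sum>r<D b. P b a (r', i') (r, j) * Zi (bar b) r s)) *s t a j i)"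
  proof (intro sum.cong refl)
    fix r' i' j assume *: "r' \<in> {..<D b}"
    have "(\<Sum>p'<D (bar b). Zi (bar b) r' p' * eps (S (t (bar b) s p') \<odot> t a i' j)) = 
       eps ((\<Sum>p'<D (bar b). Zi (bar b) r' p' *s S (t (bar b) s p')) \<odot> t a i' j)"
      by (simp add: eps_sum eps_sc m_sum1 m_sc1)
    also have "\<dots> = eps ((\<Sum>r<D b. Zi (bar b) r s *s t b r' r) \<odot> t a i' j)" using cB[of r' s] s * by simp
    also have "\<dots> = (\<Sum>r<D b. P b a (r', i') (r, j) * Zi (bar b) r s)"
      by (simp add: eps_sum eps_sc m_sum1 m_sc1 P_def T_def mult.commute)
    finally show "(W b a x g (r', i') * (\<Sum>p'<D (bar b). Zi (bar b) r' p' * eps (S (t (bar b) s p') \<odot> t a i' j))) *s t a j i =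
       (W b a x g (r', i') * (\<Sum>r<D b. P b a (r', i') (r, j) * Zi (bar b) r s)) *s t a j i" by simp
  qed
  also have "\<dots> = (\<Sum>r'<D b. \<Sum>i'<D a. \<Sum>j<D a. \<Sum>r<D b. (W b a x g (r', i') * P b a (r', i') (r, j) * Zi (bar b) r s) *s t a j i)"
    by (simp add: sum_distrib_left scale_sum_left mult.assoc)
  also have "\<dots> = (\<Sum>j<D a. \<Sum>r<D b. \<Sum>r'<D b. \<Sum>i'<D a. (W b a x g (r', i') * P b a (r', i') (r, j) * Zi (bar b) r s) *s t a j i)"
    by (rule sum_swap22)
  also have "\<dots> = (\<Sum>j<D a. \<Sum>r<D b. ((\<Sum>q\<in>J b a. W b a x g q * P b a q (r, j)) * Zi (bar b) r s) *s t a j i)"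
    by (simp add: sum_J sum_distrib_right scale_sum_left)
  also have "\<dots> = (\<Sum>j<D a. \<Sum>r<D b. (W b a x g (r, j) * Zi (bar b) r s) *s t a j i)"
    by (intro sum.cong refl) (use Wmor_P[OF Wmor_W[OF x]] g in \<open>simp add: J_def\<close>)
  also have "\<dots> = (\<Sum>j<D a. Vhat b a x p j *s t a j i)"
    by (simp add: Vhat_def pe scale_sum_left)
  finally show "(\<Sum>q\<in>J (bar b) ?c. Vhat b a x q i *s T (bar b) ?c p q) = (\<Sum>j<D a. Vhat b a x p j *s t a j i)" .
qed

lemma What_Vhat:
  assumes "fst y = fst x"
  shows "(\<Sum>q\<in>J (bar b) (fst x). What b a x k q * Vhat b a y q i) = 
    (\<Sum>p<D b. \<Sum>r<D b. \<Sum>g<D (fst x). V b a x (p, k) g * W b a y g (r, i) * Gi b r p)"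
proof -
  have "(\<Sum>q\<in>J (bar b) (fst x). What b a x k q * Vhat b a y q i) = 
     (\<Sum>s<D (bar b). \<Sum>g<D (fst x). \<Sum>p<D b. \<Sum>r<D b. V b a x (p, k) g * W b a y g (r, i) * (Zi (bar b) r s * Z b p s))"
    by (simp add: sum_J What_def Vhat_def sum_product mult_ac)
  also have "\<dots> = (\<Sum>p<D b. \<Sum>r<D b. \<Sum>s<D (bar b). \<Sum>g<D (fst x). V b a x (p, k) g * W b a y g (r, i) * (Zi (bar b) r s * Z b p s))"
    by (rule sum_swap22)
  also have "\<dots> = (\<Sum>p<D b. \<Sum>r<D b. \<Sum>g<D (fst x). V b a x (p, k) g * W b a y g (r, i) * Gi b r p)"
    by (rule sum.cong[OF refl], rule sum.cong[OF refl], subst sum.swap) (simp add: Gi_def sum_distrib_left)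
  finally show ?thesis .
qed

text \<open>The weighted partial trace of V_x W_y over W_b is the composite of \<open>What\<close>
  and \<open>Vhat\<close>, an endomorphism of W_a, hence a scalar s. Its value comes from evaluating
  one weighted sum of \<open>ES\<close> twice: reduction to the channel c by the intertwiner
  condition gives \<kappa> w_c, reduction to the leg a by \<open>w5\<close> gives s w_a.\<close>

theorem partial_trace:
  assumes x: "x \<in> X b a" and y: "y \<in> X b a" and xy: "fst y = fst x"
    and kap: "\<And>\<gamma> \<delta>. \<gamma> < D (fst x) \<Longrightarrow> \<delta> < D (fst x) \<Longrightarrow>
       (\<Sum>k<D b. \<Sum>n<D a. \<Sum>k'<D b. \<Sum>n'<D a. W b a y \<delta> (k', n') * Gi b k' k * Gi a n' n * V b a x (k, n) \<gamma>) = \<kappa> * Gi (fst x) \<delta> \<gamma>"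
  shows "\<exists>s. (\<forall>k<D a. \<forall>i<D a. (\<Sum>p<D b. \<Sum>r<D b. \<Sum>g<D (fst x). V b a x (p, k) g * W b a y g (r, i) * Gi b r p) = (if k = i then s else 0))
     \<and> (s * w a) *s ou a = (\<kappa> * w (fst x)) *s ou (fst x)"
proof -
  let ?c = "fst x"
  obtain s where s: "\<And>k i. k < D a \<Longrightarrow> i < D a \<Longrightarrow> 
     (\<Sum>p<D b. \<Sum>r<D b. \<Sum>g<D ?c. V b a x (p, k) g * W b a y g (r, i) * Gi b r p) = (if k = i then s else 0)"
    using comp_scalar[OF What_mor[OF x] Vhat_mor[OF y, unfolded xy]] unfolding What_Vhat[OF xy] by auto
  define C where "C g k n k' n' = W b a y g (k', n') * Gi b k' k * Gi a n' n" for g k n k' n'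
  define E where "E = (\<Sum>g<D ?c. \<Sum>k<D b. \<Sum>n<D a. \<Sum>k'<D b. \<Sum>n'<D a. C g k n k' n' *s ES (\<Sum>q\<in>J b a. V b a x q g *s T b a (k, n) q))"
  have kn: "(k, n) \<in> J b a" if "k < D b" "n < D a" for k n using that by (simp add: J_def)
  have e1: "ES (\<Sum>q\<in>J b a. V b a x q g *s T b a (k, n) q) = (\<Sum>d<D ?c. V b a x (k, n) d *s ES (t ?c d g))"
    if "g < D ?c" "k < D b" "n < D a" for g k n
    using Vmor_V[OF x] that kn by (simp add: Vmor_def ES_sum ES_sc)
  have e2: "ES (\<Sum>q\<in>J b a. V b a x q g *s T b a (k, n) q) = (\<Sum>n''<D a. V b a x (k, n'') g *s ES (t a n n''))"
    if g: "g < D ?c" and k: "k < D b" and n: "n < D a" for g k n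
  proof -
    have "ES (\<Sum>q\<in>J b a. V b a x q g *s T b a (k, n) q) = (\<Sum>q\<in>J b a. \<Sum>n''<D a. (P b a (k, n'') q * V b a x q g) *s ES (t a n n''))"
      unfolding ES_sum ES_sc T_def P_def 
      by (intro sum.cong refl) (use k n in \<open>auto simp: J_def w5 scale_sum_right mult.commute\<close>)
    also have "\<dots> = (\<Sum>n''<D a. (\<Sum>q\<in>J b a. P b a (k, n'') q * V b a x q g) *s ES (t a n n''))"
      by (subst sum.swap) (simp add: scale_sum_left)
    also have "\<dots> = (\<Sum>n''<D a. V b a x (k, n'') g *s ES (t a n n''))"
      by (intro sum.cong refl) (use Vmor_P[OF Vmor_V[OF x]] g k kn in simp)
    finally show ?thesis .
  qed
  have "E = (\<Sum>g<D ?c. \<Sum>k<D b. \<Sum>n<D a. \<Sum>k'<D b. \<Sum>n'<D a. \<Sum>d<D ?c. (C g k n k' n' * V b a x (k, n) d) *s ES (t ?c d g))"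
    unfolding E_def by (intro sum.cong refl) (simp add: e1 scale_sum_right)
  also have "\<dots> = (\<Sum>g<D ?c. \<Sum>d<D ?c. \<Sum>k<D b. \<Sum>n<D a. \<Sum>k'<D b. \<Sum>n'<D a. (C g k n k' n' * V b a x (k, n) d) *s ES (t ?c d g))"
    by (rule sum.cong[OF refl], rule sum_move5[symmetric])
  also have "\<dots> = (\<Sum>g<D ?c. \<Sum>d<D ?c. (\<Sum>k<D b. \<Sum>n<D a. \<Sum>k'<D b. \<Sum>n'<D a. C g k n k' n' * V b a x (k, n) d) *s ES (t ?c d g))"
    by (simp add: scale_sum_left)
  also have "\<dots> = (\<Sum>g<D ?c. \<Sum>d<D ?c. \<kappa> *s Gi ?c g d *s ES (t ?c d g))"
    by (intro sum.cong refl) (use kap in \<open>simp add: C_def\<close>)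
  also have "\<dots> = \<kappa> *s (\<Sum>d<D ?c. \<Sum>g<D ?c. Gi ?c g d *s ES (t ?c d g))"
    by (subst sum.swap) (simp add: scale_sum_right)
  also have "\<dots> = (\<kappa> * w ?c) *s ou ?c"
    using chi[of ?c] by (simp add: Gi_def)
  finally have E1: "E = (\<kappa> * w ?c) *s ou ?c" .
  have "E = (\<Sum>g<D ?c. \<Sum>k<D b. \<Sum>n<D a. \<Sum>k'<D b. \<Sum>n'<D a. \<Sum>j<D a. (C g k n k' n' * V b a x (k, j) g) *s ES (t a n j))"
    unfolding E_def by (intro sum.cong refl) (simp add: e2 scale_sum_right)
  also have "\<dots> = (\<Sum>n<D a. \<Sum>n'<D a. \<Sum>j<D a. \<Sum>k<D b. \<Sum>k'<D b. \<Sum>g<D ?c. (C g k n k' n' * V b a x (k, j) g) *s ES (t a n j))"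
    by (rule sum6_perm)
  also have "\<dots> = (\<Sum>n<D a. \<Sum>n'<D a. \<Sum>j<D a. (Gi a n' n * (\<Sum>k<D b. \<Sum>k'<D b. \<Sum>g<D ?c. V b a x (k, j) g * W b a y g (k', n') * Gi b k' k)) *s ES (t a n j))"
    by (simp add: scale_sum_left sum_distrib_left C_def mult_ac)
  also have "\<dots> = (\<Sum>n<D a. \<Sum>n'<D a. \<Sum>j<D a. if j = n' then (s * Gi a n' n) *s ES (t a n n') else 0)"
    by (intro sum.cong refl) (use s in \<open>simp add: mult.commute\<close>)
  also have "\<dots> = s *s (\<Sum>n<D a. \<Sum>n'<D a. Gi a n' n *s ES (t a n n'))"
    by (simp add: scale_sum_right)
  also have "\<dots> = (s * w a) *s ou a"
    using chi[of a] by (simp add: Gi_def)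
  finally show ?thesis using E1 s by (intro exI[of _ s]) simp
qed

end

section \<open>Two-sided structure and the automorphism implemented by G\<close>

locale fusion_core = left_rotation sc m D t eps N V W S ES bar Z Zi w "\<lambda>c. ou (r c)"
  for sc :: "complex \<Rightarrow> 'a::ab_group_add \<Rightarrow> 'a" (infixr \<open>*s\<close> 75) 
    and m :: "'a \<Rightarrow> 'a \<Rightarrow> 'a" (infixl \<open>\<odot>\<close> 70)
    and D :: "'i::finite \<Rightarrow> nat" and t :: "'i \<Rightarrow> nat \<Rightarrow> nat \<Rightarrow> 'a" and eps :: "'a \<Rightarrow> complex"
    and N :: "'i \<Rightarrow> 'i \<Rightarrow> 'i \<Rightarrow> nat"
    and V :: "'i \<Rightarrow> 'i \<Rightarrow> 'i \<times> nat \<Rightarrow> nat \<times> nat \<Rightarrow> nat \<Rightarrow> complex"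
    and W :: "'i \<Rightarrow> 'i \<Rightarrow> 'i \<times> nat \<Rightarrow> nat \<Rightarrow> nat \<times> nat \<Rightarrow> complex"
    and S :: "'a \<Rightarrow> 'a" and ES :: "'a \<Rightarrow> 'a" and bar :: "'i \<Rightarrow> 'i" 
    and Z Zi :: "'i \<Rightarrow> nat \<Rightarrow> nat \<Rightarrow> complex" and w :: "'i \<Rightarrow> complex" and ou :: "'i \<Rightarrow> 'a" and r :: "'i \<Rightarrow> 'i" +
  fixes ET :: "'a \<Rightarrow> 'a" and l :: "'i \<Rightarrow> 'i" and sig :: "'a \<Rightarrow> 'a"
  assumes mirrored: "left_rotation sc (\<lambda>x y. y \<odot> x) D (\<lambda>a i j. t a j i) eps (\<lambda>b a c. N a b c)
      (\<lambda>b a x p \<gamma>. W a b x \<gamma> (prod.swap p)) (\<lambda>b a x \<gamma> p. V a b x (prod.swap p) \<gamma>) S ET bar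
      (\<lambda>b p s. Zi b s p) (\<lambda>b s p. Z b p s) (\<lambda>c. w (bar c)) (\<lambda>c. ou (l c))"
    and D_pos: "D c > 0"
    and ZZi: "i < D c \<Longrightarrow> j < D c \<Longrightarrow> (\<Sum>s<D (bar c). Z c i s * Zi c s j) = (if i = j then 1 else 0)"
    and ZiZ: "s < D (bar c) \<Longrightarrow> s' < D (bar c) \<Longrightarrow> (\<Sum>i<D c. Zi c s i * Z c i s') = (if s = s' then 1 else 0)"
    and ES_t: "i < D c \<Longrightarrow> j < D c \<Longrightarrow> ES (t c i j) = (\<Sum>k<D c. S (t c i k) \<odot> t c k j)"
    and ET_t: "i < D c \<Longrightarrow> j < D c \<Longrightarrow> ET (t c i j) = (\<Sum>k<D c. t c i k \<odot> S (t c k j))"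
    and sig_add: "sig (x + y) = sig x + sig y" and sig_sc: "sig (z *s x) = z *s sig x"
    and sig_mult: "sig (x \<odot> y) = sig x \<odot> sig y"
    and sig_t: "i < D c \<Longrightarrow> j < D c \<Longrightarrow> (\<Sum>k<D c. (\<Sum>s<D (bar c). Zi (bar c) i s * Z c k s) *s sig (t c k j)) = 
         (\<Sum>k<D c. (\<Sum>s<D (bar c). Zi (bar c) k s * Z c j s) *s t c i k)"
    and ou_left: "i < D a \<Longrightarrow> j < D a \<Longrightarrow> ou (l a) \<odot> t a i j = t a i j"
    and ou_nz: "ou (r c) \<noteq> 0"
    and sel: "N b a c \<noteq> 0 \<Longrightarrow> r b = l a \<and> l c = l b \<and> r c = r a"
    and l_bar: "l (bar c) = r c"
    and w_nz: "w c \<noteq> 0"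
begin

interpretation mir: left_rotation sc "\<lambda>x y. y \<odot> x" D "\<lambda>a i j. t a j i" eps "\<lambda>b a c. N a b c"
      "\<lambda>b a x p \<gamma>. W a b x \<gamma> (prod.swap p)" "\<lambda>b a x \<gamma> p. V a b x (prod.swap p) \<gamma>" S ET bar
      "\<lambda>b p s. Zi b s p" "\<lambda>b s p. Z b p s" "\<lambda>c. w (bar c)" "\<lambda>c. ou (l c)"
  by (rule mirrored)

definition G where "G c i j = (\<Sum>s<D (bar c). Zi c s i * Z (bar c) s j)"

text \<open>The mirror image exchanges \<open>G\<close> with its inverse, up to transposition. Hence
  left partial traces are weighted by \<open>Gi\<close> and right partial traces by
  \<open>G\<close>.\<close>

lemma mir_Gi: "mir.Gi c j i = G c i j"
  by (simp add: mir.Gi_def G_def mult.commute)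

lemma r_bar: "r (bar c) = l c" using l_bar[of "bar c"] by (simp add: bar_bar)

lemma delta_mult1: "(if (i::nat) = j then 1 else 0) * (x :: complex) = (if i = j then x else 0)" 
  and delta_mult2: "(x :: complex) * (if (i::nat) = j then 1 else 0) = (if i = j then x else 0)" by auto

lemma GGi_inv: assumes i: "i < D c" and j: "j < D c"
  shows "(\<Sum>k<D c. G c i k * Gi c k j) = (if i = j then 1 else 0)"
    and "(\<Sum>k<D c. Gi c i k * G c k j) = (if i = j then 1 else 0)"
proof -
  have 1: "(\<Sum>k<D c. Z (bar c) s k * Zi (bar c) k s') = (if s = s' then 1 else 0)" if "s < D (bar c)" "s' < D (bar c)" for s s'
    using ZZi[of s "bar c" s'] that by (simp add: bar_bar)
  have "(\<Sum>k<D c. G c i k * Gi c k j) = (\<Sum>k<D c. \<Sum>s<D (bar c). \<Sum>s'<D (bar c). Zi c s i * Z c j s' * (Z (bar c) s k * Zi (bar c) k s'))"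
    unfolding G_def Gi_def sum_product by (simp add: mult_ac)
  also have "\<dots> = (\<Sum>s<D (bar c). \<Sum>s'<D (bar c). Zi c s i * Z c j s' * (\<Sum>k<D c. Z (bar c) s k * Zi (bar c) k s'))"
    by (rule trans[OF sum3_perm[symmetric]]) (simp add: sum_distrib_left)
  also have "\<dots> = (\<Sum>s<D (bar c). Z c j s * Zi c s i)"
    by (intro sum.cong refl) (simp add: 1 delta_mult2)
  finally show "(\<Sum>k<D c. G c i k * Gi c k j) = (if i = j then 1 else 0)" using ZZi[OF j i] by auto
  have 2: "(\<Sum>k<D c. Z c k s * Zi c s' k) = (if s = s' then 1 else 0)" if "s < D (bar c)" "s' < D (bar c)" for s s'
    using ZiZ[of s' c s] that by (auto simp: mult.commute)
  have "(\<Sum>k<D c. Gi c i k * G c k j) = (\<Sum>k<D c. \<Sum>s<D (bar c). \<Sum>s'<D (bar c). Zi (bar c) i s * Z (bar c) s' j * (Z c k s * Zi c s' k))"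
    unfolding G_def Gi_def sum_product by (simp add: mult_ac)
  also have "\<dots> = (\<Sum>s<D (bar c). \<Sum>s'<D (bar c). Zi (bar c) i s * Z (bar c) s' j * (\<Sum>k<D c. Z c k s * Zi c s' k))"
    by (rule trans[OF sum3_perm[symmetric]]) (simp add: sum_distrib_left)
  also have "\<dots> = (\<Sum>s<D (bar c). Zi (bar c) i s * Z (bar c) s j)"
    by (intro sum.cong refl) (simp add: 2 delta_mult2)
  finally show "(\<Sum>k<D c. Gi c i k * G c k j) = (if i = j then 1 else 0)"
    using ZiZ[of i "bar c" j] i j by (simp add: bar_bar)
qed

lemma sig_zero: "sig 0 = 0" using sig_sc[of 0 0] by simp

lemma sig_sum: "sig (\<Sum>i\<in>K. f i) = (\<Sum>i\<in>K. sig (f i))"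
  by (induction K rule: infinite_finite_induct) (simp_all add: sig_zero sig_add)

lemma sig_Gi: "i < D c \<Longrightarrow> j < D c \<Longrightarrow> (\<Sum>k<D c. Gi c i k *s sig (t c k j)) = (\<Sum>k<D c. Gi c k j *s t c i k)"
  unfolding Gi_def by (rule sig_t)

lemma sig_G:
  assumes i: "i < D c" and j: "j < D c"
  shows "(\<Sum>k<D c. G c k j *s sig (t c i k)) = (\<Sum>k<D c. G c i k *s t c k j)"
proof -
  have e: "sig (t c i k) = (\<Sum>a<D c. \<Sum>b<D c. (G c i a * Gi c b k) *s t c a b)" if k: "k < D c" for k
  proof -
    have "(\<Sum>a<D c. \<Sum>b<D c. (G c i a * Gi c b k) *s t c a b) = (\<Sum>a<D c. G c i a *s (\<Sum>b<D c. Gi c a b *s sig (t c b k)))"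
      using k by (simp add: sig_Gi scale_sum_right)
    also have "\<dots> = (\<Sum>b<D c. (\<Sum>a<D c. G c i a * Gi c a b) *s sig (t c b k))"
      unfolding scale_sum_right scale_sum_left by (subst sum.swap) simp
    also have "\<dots> = (\<Sum>b<D c. if i = b then sig (t c b k) else 0)"
      by (intro sum.cong refl) (use GGi_inv(1)[OF i] in auto)
    finally show ?thesis using i by simp
  qed
  have "(\<Sum>k<D c. G c k j *s sig (t c i k)) = (\<Sum>k<D c. \<Sum>a<D c. \<Sum>b<D c. (G c i a * (Gi c b k * G c k j)) *s t c a b)"
    by (intro sum.cong refl) (simp add: e scale_sum_right mult_ac)
  also have "\<dots> = (\<Sum>a<D c. \<Sum>b<D c. (G c i a * (\<Sum>k<D c. Gi c b k * G c k j)) *s t c a b)"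
    by (rule trans[OF sum3_perm[symmetric]]) (simp add: scale_sum_left sum_distrib_left)
  also have "\<dots> = (\<Sum>a<D c. \<Sum>b<D c. if b = j then G c i a *s t c a b else 0)"
    by (intro sum.cong refl) (use GGi_inv(2)[OF _ j] in auto)
  finally show ?thesis using j by simp
qed

definition GG where "GG b a p q = G b (fst p) (fst q) * G a (snd p) (snd q)"
definition GGi where "GGi b a p q = Gi b (fst p) (fst q) * Gi a (snd p) (snd q)"

lemma sum_J_prod: "(\<Sum>k<D b. f k) * (\<Sum>n<D a. g n) = (\<Sum>p\<in>J b a. f (fst p) * g (snd p) :: complex)"
  by (simp add: sum_J sum_product)

lemma GG_inv: assumes p: "p \<in> J b a" and q: "q \<in> J b a"
  shows "(\<Sum>u\<in>J b a. GG b a p u * GGi b a u q) = (if p = q then 1 else 0)"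
    "(\<Sum>u\<in>J b a. GGi b a p u * GG b a u q) = (if p = q then 1 else 0)"
proof -
  have l: "fst p < D b" "snd p < D a" "fst q < D b" "snd q < D a" using p q by (auto simp: J_def)
  have "(\<Sum>u\<in>J b a. GG b a p u * GGi b a u q) = 
     (\<Sum>k<D b. G b (fst p) k * Gi b k (fst q)) * (\<Sum>k<D a. G a (snd p) k * Gi a k (snd q))"
    unfolding sum_J_prod by (simp add: GG_def GGi_def mult_ac)
  thus "(\<Sum>u\<in>J b a. GG b a p u * GGi b a u q) = (if p = q then 1 else 0)"
    using l by (auto simp: GGi_inv prod_eq_iff)
  have "(\<Sum>u\<in>J b a. GGi b a p u * GG b a u q) = 
     (\<Sum>k<D b. Gi b (fst p) k * G b k (fst q)) * (\<Sum>k<D a. Gi a (snd p) k * G a k (snd q))"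
    unfolding sum_J_prod by (simp add: GG_def GGi_def mult_ac)
  thus "(\<Sum>u\<in>J b a. GGi b a p u * GG b a u q) = (if p = q then 1 else 0)"
    using l by (auto simp: GGi_inv prod_eq_iff)
qed

lemma sig_GG: assumes p: "p \<in> J b a" and q: "q \<in> J b a"
  shows "(\<Sum>u\<in>J b a. GG b a u q *s sig (T b a p u)) = (\<Sum>u\<in>J b a. GG b a p u *s T b a u q)"
    "(\<Sum>u\<in>J b a. GGi b a p u *s sig (T b a u q)) = (\<Sum>u\<in>J b a. GGi b a u q *s T b a p u)"
proof -
  have l: "fst p < D b" "snd p < D a" "fst q < D b" "snd q < D a" using p q by (auto simp: J_def)
  have "(\<Sum>u\<in>J b a. GG b a u q *s sig (T b a p u)) = 
     (\<Sum>k<D b. G b k (fst q) *s sig (t b (fst p) k)) \<odot> (\<Sum>k<D a. G a k (snd q) *s sig (t a (snd p) k))"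
    unfolding m_bilin by (simp add: sum_J GG_def T_def sig_mult)
  also have "\<dots> = (\<Sum>u\<in>J b a. GG b a p u *s T b a u q)"
    unfolding sig_G[OF l(1,3)] sig_G[OF l(2,4)] m_bilin by (simp add: sum_J GG_def T_def)
  finally show "(\<Sum>u\<in>J b a. GG b a u q *s sig (T b a p u)) = (\<Sum>u\<in>J b a. GG b a p u *s T b a u q)" .
  have "(\<Sum>u\<in>J b a. GGi b a p u *s sig (T b a u q)) = 
     (\<Sum>k<D b. Gi b (fst p) k *s sig (t b k (fst q))) \<odot> (\<Sum>k<D a. Gi a (snd p) k *s sig (t a k (snd q)))"
    unfolding m_bilin by (simp add: sum_J GGi_def T_def sig_mult)
  also have "\<dots> = (\<Sum>u\<in>J b a. GGi b a u q *s T b a p u)"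
    unfolding sig_Gi[OF l(1,3)] sig_Gi[OF l(2,4)] m_bilin by (simp add: sum_J GGi_def T_def)
  finally show "(\<Sum>u\<in>J b a. GGi b a p u *s sig (T b a u q)) = (\<Sum>u\<in>J b a. GGi b a u q *s T b a p u)" .
qed

text \<open>Fusion tensors transported by the twist: \<open>GGi\<close> V \<open>G\<close> and
  \<open>Gi\<close> W \<open>GG\<close>. They would equal V and W if \<open>G\<close> were
  group-like.\<close>

definition Vtw where "Vtw b a x p \<delta> = (\<Sum>p'\<in>J b a. \<Sum>\<delta>'<D (fst x). GGi b a p p' * V b a x p' \<delta>' * G (fst x) \<delta>' \<delta>)"
definition Wtw where "Wtw b a x \<gamma> q = (\<Sum>\<gamma>'<D (fst x). \<Sum>p\<in>J b a. Gi (fst x) \<gamma> \<gamma>' * W b a x \<gamma>' p * GG b a p q)"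

text \<open>Apply \<open>sig\<close> to the intertwiner condition of \<open>W\<close>. Being
  multiplicative, \<open>sig\<close> is implemented on \<open>T\<close> by G \<otimes> G and on t^c
  by G, and these conjugations are exactly the factors in \<open>Wtw\<close>.\<close>

lemma Wmor_Wtw: assumes x: "x \<in> X b a" shows "Wmor b a (fst x) (Wtw b a x)"
  unfolding Wmor_def
proof (intro ballI allI impI)
  let ?c = "fst x"
  fix q \<gamma> assume q: "q \<in> J b a" and g: "\<gamma> < D ?c"
  have E: "(\<Sum>p\<in>J b a. W b a x g p *s sig (T b a p u)) = (\<Sum>d<D ?c. W b a x d u *s sig (t ?c g d))"
    if "g < D ?c" "u \<in> J b a" for g u
  proof -
    have "sig (\<Sum>p\<in>J b a. W b a x g p *s T b a p u) = sig (\<Sum>d<D ?c. W b a x d u *s t ?c g d)"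
      using Wmor_W[OF x] that by (simp add: Wmor_def)
    thus ?thesis by (simp add: sig_sum sig_sc)
  qed
  have "(\<Sum>p\<in>J b a. Wtw b a x \<gamma> p *s T b a p q) = 
     (\<Sum>u\<in>J b a. \<Sum>g<D ?c. \<Sum>p\<in>J b a. (Gi ?c \<gamma> g * W b a x g p) *s (GG b a p u *s T b a u q))"
    by (simp add: Wtw_def scale_sum_left)
  also have "\<dots> = (\<Sum>g<D ?c. \<Sum>p\<in>J b a. \<Sum>u\<in>J b a. (Gi ?c \<gamma> g * W b a x g p) *s (GG b a p u *s T b a u q))"
    by (rule sum3_perm[symmetric])
  also have "\<dots> = (\<Sum>g<D ?c. \<Sum>p\<in>J b a. (Gi ?c \<gamma> g * W b a x g p) *s (\<Sum>u\<in>J b a. GG b a u q *s sig (T b a p u)))"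
    by (rule sum.cong[OF refl], rule sum.cong[OF refl], subst sig_GG(1)[OF _ q], assumption) (simp add: scale_sum_right)
  also have "\<dots> = (\<Sum>g<D ?c. \<Sum>u\<in>J b a. (Gi ?c \<gamma> g * GG b a u q) *s (\<Sum>p\<in>J b a. W b a x g p *s sig (T b a p u)))"
    unfolding scale_sum_right by (rule sum.cong[OF refl], subst sum.swap) (simp add: mult_ac)
  also have "\<dots> = (\<Sum>g<D ?c. \<Sum>u\<in>J b a. (Gi ?c \<gamma> g * GG b a u q) *s (\<Sum>d<D ?c. W b a x d u *s sig (t ?c g d)))"
    by (intro sum.cong refl) (simp add: E)
  also have "\<dots> = (\<Sum>g<D ?c. \<Sum>u\<in>J b a. \<Sum>d<D ?c. (GG b a u q * W b a x d u) *s (Gi ?c \<gamma> g *s sig (t ?c g d)))"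
    by (simp add: scale_sum_right mult_ac)
  also have "\<dots> = (\<Sum>u\<in>J b a. \<Sum>d<D ?c. (GG b a u q * W b a x d u) *s (\<Sum>g<D ?c. Gi ?c \<gamma> g *s sig (t ?c g d)))"
    unfolding scale_sum_right by (rule sum3_perm[symmetric])
  also have "\<dots> = (\<Sum>u\<in>J b a. \<Sum>d<D ?c. (GG b a u q * W b a x d u) *s (\<Sum>g<D ?c. Gi ?c g d *s t ?c \<gamma> g))"
    by (intro sum.cong refl) (use g in \<open>simp add: sig_Gi\<close>)
  also have "\<dots> = (\<Sum>g<D ?c. \<Sum>u\<in>J b a. \<Sum>d<D ?c. (Gi ?c g d * W b a x d u * GG b a u q) *s t ?c \<gamma> g)"
    unfolding scale_sum_right by (rule trans[OF sum3_perm]) (simp add: mult_ac)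
  also have "\<dots> = (\<Sum>g<D ?c. Wtw b a x g q *s t ?c \<gamma> g)"
    unfolding Wtw_def scale_sum_left by (rule sum.cong[OF refl], rule sum.swap)
  finally show "(\<Sum>p\<in>J b a. Wtw b a x \<gamma> p *s T b a p q) = (\<Sum>g<D ?c. Wtw b a x g q *s t ?c \<gamma> g)" .
qed

lemma Vmor_Vtw: assumes x: "x \<in> X b a" shows "Vmor b a (fst x) (Vtw b a x)"
  unfolding Vmor_def
proof (intro ballI allI impI)
  let ?c = "fst x"
  fix p \<delta> assume p: "p \<in> J b a" and d: "\<delta> < D ?c"
  have E: "(\<Sum>q\<in>J b a. V b a x q e *s sig (T b a u q)) = (\<Sum>g<D ?c. V b a x u g *s sig (t ?c g e))"
    if "e < D ?c" "u \<in> J b a" for e u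
  proof -
    have "sig (\<Sum>q\<in>J b a. V b a x q e *s T b a u q) = sig (\<Sum>g<D ?c. V b a x u g *s t ?c g e)"
      using Vmor_V[OF x] that by (simp add: Vmor_def)
    thus ?thesis by (simp add: sig_sum sig_sc)
  qed
  have "(\<Sum>q\<in>J b a. Vtw b a x q \<delta> *s T b a p q) = 
     (\<Sum>u\<in>J b a. \<Sum>q\<in>J b a. \<Sum>e<D ?c. (V b a x q e * G ?c e \<delta>) *s (GGi b a u q *s T b a p u))"
    by (simp add: Vtw_def scale_sum_left mult_ac)
  also have "\<dots> = (\<Sum>q\<in>J b a. \<Sum>e<D ?c. \<Sum>u\<in>J b a. (V b a x q e * G ?c e \<delta>) *s (GGi b a u q *s T b a p u))"
    by (rule sum3_perm[symmetric])
  also have "\<dots> = (\<Sum>q\<in>J b a. \<Sum>e<D ?c. (V b a x q e * G ?c e \<delta>) *s (\<Sum>u\<in>J b a. GGi b a p u *s sig (T b a u q)))"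
    by (rule sum.cong[OF refl], rule sum.cong[OF refl], subst sig_GG(2)[OF p], assumption) (simp add: scale_sum_right)
  also have "\<dots> = (\<Sum>e<D ?c. \<Sum>u\<in>J b a. (G ?c e \<delta> * GGi b a p u) *s (\<Sum>q\<in>J b a. V b a x q e *s sig (T b a u q)))"
    unfolding scale_sum_right by (rule trans[OF sum3_perm[symmetric]]) (simp add: mult_ac)
  also have "\<dots> = (\<Sum>e<D ?c. \<Sum>u\<in>J b a. (G ?c e \<delta> * GGi b a p u) *s (\<Sum>g<D ?c. V b a x u g *s sig (t ?c g e)))"
    by (intro sum.cong refl) (simp add: E)
  also have "\<dots> = (\<Sum>u\<in>J b a. \<Sum>g<D ?c. (GGi b a p u * V b a x u g) *s (\<Sum>e<D ?c. G ?c e \<delta> *s sig (t ?c g e)))"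
    unfolding scale_sum_right by (rule trans[OF sum3_perm[symmetric]]) (simp add: mult_ac)
  also have "\<dots> = (\<Sum>u\<in>J b a. \<Sum>g<D ?c. (GGi b a p u * V b a x u g) *s (\<Sum>e<D ?c. G ?c g e *s t ?c e \<delta>))"
    by (intro sum.cong refl) (use d in \<open>simp add: sig_G\<close>)
  also have "\<dots> = (\<Sum>e<D ?c. \<Sum>u\<in>J b a. \<Sum>g<D ?c. (GGi b a p u * V b a x u g * G ?c g e) *s t ?c e \<delta>)"
    unfolding scale_sum_right by (rule trans[OF sum3_perm]) (simp add: mult_ac)
  also have "\<dots> = (\<Sum>e<D ?c. Vtw b a x p e *s t ?c e \<delta>)"
    unfolding Vtw_def scale_sum_left ..
  finally show "(\<Sum>q\<in>J b a. Vtw b a x q \<delta> *s T b a p q) = (\<Sum>e<D ?c. Vtw b a x p e *s t ?c e \<delta>)" .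
qed

end

section \<open>The twist on multiplicity spaces and the two partial traces\<close>

context fusion_core
begin

interpretation mir: left_rotation sc "\<lambda>x y. y \<odot> x" D "\<lambda>a i j. t a j i" eps "\<lambda>b a c. N a b c"
      "\<lambda>b a x p \<gamma>. W a b x \<gamma> (prod.swap p)" "\<lambda>b a x \<gamma> p. V a b x (prod.swap p) \<gamma>" S ET bar
      "\<lambda>b p s. Zi b s p" "\<lambda>b s p. Z b p s" "\<lambda>c. w (bar c)" "\<lambda>c. ou (l c)"
  by (rule mirrored)

text \<open>The matrix of the twist on the multiplicity space. By Schur's lemma the composites are
  scalar matrices, so the value can be read off at position (0, 0), which exists because all
  dimensions are positive.\<close>

definition kap where "kap b a x y = (\<Sum>p\<in>J b a. W b a x 0 p * Vtw b a y p 0)"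
definition kap' where "kap' b a x y = (\<Sum>p\<in>J b a. Wtw b a x 0 p * V b a y p 0)"

lemma X_D: "x \<in> X b a \<Longrightarrow> snd x < N b a (fst x)" and X_I: "\<mu> < N b a c \<Longrightarrow> (c, \<mu>) \<in> X b a"
  by (auto simp: X_def)

lemma kap_eq:
  assumes x: "x \<in> X b a" and y: "y \<in> X b a" and xy: "fst x = fst y" and g: "\<gamma> < D (fst y)" "\<delta> < D (fst y)"
  shows "(\<Sum>p\<in>J b a. W b a x \<gamma> p * Vtw b a y p \<delta>) = (if \<gamma> = \<delta> then kap b a x y else 0)"
  using comp_scalar[OF Wmor_W[OF x] Vmor_Vtw[OF y]] g D_pos[of "fst y"] xy unfolding kap_def by force

lemma kap'_eq:
  assumes x: "x \<in> X b a" and y: "y \<in> X b a" and xy: "fst x = fst y" and g: "\<gamma> < D (fst y)" "\<delta> < D (fst y)"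
  shows "(\<Sum>p\<in>J b a. Wtw b a x \<gamma> p * V b a y p \<delta>) = (if \<gamma> = \<delta> then kap' b a x y else 0)"
  using comp_scalar[OF Wmor_Wtw[OF x] Vmor_V[OF y]] g D_pos[of "fst y"] xy unfolding kap'_def by force

lemma Vtw_expand:
  assumes y: "y \<in> X b a" and p: "p \<in> J b a" and g: "\<gamma> < D (fst y)"
  shows "Vtw b a y p \<gamma> = (\<Sum>\<mu><N b a (fst y). kap b a (fst y, \<mu>) y * V b a (fst y, \<mu>) p \<gamma>)"
proof -
  obtain \<alpha> where \<alpha>: "\<And>p \<gamma>. p \<in> J b a \<Longrightarrow> \<gamma> < D (fst y) \<Longrightarrow> Vtw b a y p \<gamma> = (\<Sum>\<mu><N b a (fst y). \<alpha> \<mu> * V b a (fst y, \<mu>) p \<gamma>)"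
    "\<And>\<mu> \<gamma> \<delta>. \<mu> < N b a (fst y) \<Longrightarrow> \<gamma> < D (fst y) \<Longrightarrow> \<delta> < D (fst y) \<Longrightarrow> 
       (\<Sum>p\<in>J b a. W b a (fst y, \<mu>) \<gamma> p * Vtw b a y p \<delta>) = (if \<gamma> = \<delta> then \<alpha> \<mu> else 0)"
    using Vmor_expand[OF Vmor_Vtw[OF y]] by blast
  have "\<alpha> \<mu> = kap b a (fst y, \<mu>) y" if "\<mu> < N b a (fst y)" for \<mu>
    using \<alpha>(2)[OF that D_pos D_pos] by (simp add: kap_def)
  thus ?thesis using \<alpha>(1)[OF p g] by simp
qed

lemma Wtw_expand:
  assumes x: "x \<in> X b a" and p: "p \<in> J b a" and g: "\<gamma> < D (fst x)"
  shows "Wtw b a x \<gamma> p = (\<Sum>\<mu><N b a (fst x). kap' b a x (fst x, \<mu>) * W b a (fst x, \<mu>) \<gamma> p)"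
proof -
  obtain \<alpha> where \<alpha>: "\<And>p \<gamma>. p \<in> J b a \<Longrightarrow> \<gamma> < D (fst x) \<Longrightarrow> Wtw b a x \<gamma> p = (\<Sum>\<mu><N b a (fst x). \<alpha> \<mu> * W b a (fst x, \<mu>) \<gamma> p)"
    "\<And>\<mu> \<gamma> \<delta>. \<mu> < N b a (fst x) \<Longrightarrow> \<gamma> < D (fst x) \<Longrightarrow> \<delta> < D (fst x) \<Longrightarrow> 
       (\<Sum>p\<in>J b a. Wtw b a x \<gamma> p * V b a (fst x, \<mu>) p \<delta>) = (if \<gamma> = \<delta> then \<alpha> \<mu> else 0)"
    using Wmor_expand[OF Wmor_Wtw[OF x]] by blast
  have "\<alpha> \<mu> = kap' b a x (fst x, \<mu>)" if "\<mu> < N b a (fst x)" for \<mu>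
    using \<alpha>(2)[OF that D_pos D_pos] by (simp add: kap'_def)
  thus ?thesis using \<alpha>(1)[OF p g] by simp
qed

lemma sum_delta_left: "i < (n::nat) \<Longrightarrow> (\<Sum>k<n. (if k = i then 1 else 0) * f k) = (f i :: complex)"
  "i < (n::nat) \<Longrightarrow> (\<Sum>k<n. (if i = k then 1 else 0) * f k) = (f i :: complex)"
  "i < (n::nat) \<Longrightarrow> (\<Sum>k<n. f k * (if k = i then 1 else 0)) = (f i :: complex)"
  "i < (n::nat) \<Longrightarrow> (\<Sum>k<n. f k * (if i = k then 1 else 0)) = (f i :: complex)"
  by (simp_all add: delta_mult1 delta_mult2)

lemma sum_delta_J: "i \<in> J b a \<Longrightarrow> (\<Sum>k\<in>J b a. f k * (if k = i then 1 else 0)) = (f i :: complex)"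
  "i \<in> J b a \<Longrightarrow> (\<Sum>k\<in>J b a. (if i = k then 1 else 0) * f k) = (f i :: complex)"
  by (simp_all add: if_distrib[of "\<lambda>z. _ * z"] if_distrib[of "\<lambda>z. z * _"] cong: if_cong)

lemma Vtw_Gi: assumes g: "\<gamma> < D (fst y)"
  shows "(\<Sum>\<delta><D (fst y). Vtw b a y p \<delta> * Gi (fst y) \<delta> \<gamma>) = (\<Sum>q\<in>J b a. GGi b a p q * V b a y q \<gamma>)"
proof -
  have "(\<Sum>\<delta><D (fst y). Vtw b a y p \<delta> * Gi (fst y) \<delta> \<gamma>) = 
     (\<Sum>\<delta><D (fst y). \<Sum>q\<in>J b a. \<Sum>e<D (fst y). GGi b a p q * V b a y q e * (G (fst y) e \<delta> * Gi (fst y) \<delta> \<gamma>))"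
    unfolding Vtw_def sum_distrib_right by (simp add: mult_ac)
  also have "\<dots> = (\<Sum>q\<in>J b a. \<Sum>e<D (fst y). GGi b a p q * V b a y q e * (\<Sum>\<delta><D (fst y). G (fst y) e \<delta> * Gi (fst y) \<delta> \<gamma>))"
    unfolding sum_distrib_left by (rule sum3_perm[symmetric])
  also have "\<dots> = (\<Sum>q\<in>J b a. GGi b a p q * V b a y q \<gamma>)"
    by (rule sum.cong[OF refl]) (use g in \<open>simp add: GGi_inv sum_delta_left\<close>)
  finally show ?thesis .
qed

lemma G_Wtw: assumes g: "\<gamma> < D (fst x)"
  shows "(\<Sum>\<delta><D (fst x). G (fst x) \<gamma> \<delta> * Wtw b a x \<delta> q) = (\<Sum>p\<in>J b a. W b a x \<gamma> p * GG b a p q)"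
proof -
  have "(\<Sum>\<delta><D (fst x). G (fst x) \<gamma> \<delta> * Wtw b a x \<delta> q) = 
     (\<Sum>\<delta><D (fst x). \<Sum>e<D (fst x). \<Sum>p\<in>J b a. G (fst x) \<gamma> \<delta> * Gi (fst x) \<delta> e * (W b a x e p * GG b a p q))"
    unfolding Wtw_def sum_distrib_left by (simp add: mult_ac)
  also have "\<dots> = (\<Sum>e<D (fst x). \<Sum>p\<in>J b a. (\<Sum>\<delta><D (fst x). G (fst x) \<gamma> \<delta> * Gi (fst x) \<delta> e) * (W b a x e p * GG b a p q))"
    unfolding sum_distrib_right by (rule sum3_perm[symmetric])
  also have "\<dots> = (\<Sum>p\<in>J b a. \<Sum>e<D (fst x). (if \<gamma> = e then 1 else 0) * (W b a x e p * GG b a p q))"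
    by (subst sum.swap) (use g in \<open>simp add: GGi_inv\<close>)
  also have "\<dots> = (\<Sum>p\<in>J b a. W b a x \<gamma> p * GG b a p q)"
    using g by (simp only: sum_delta_left)
  finally show ?thesis .
qed

text \<open>The twist with the factor \<open>G\<close> of the target moved to the other side. This
  is the form required by \<open>partial_trace\<close>; \<open>kap'_GG\<close> plays the same role
  for the mirror image.\<close>

lemma kap_GGi:
  assumes x: "x \<in> X b a" and y: "y \<in> X b a" and xy: "fst x = fst y" and g: "\<gamma> < D (fst y)" "\<delta> < D (fst y)"
  shows "(\<Sum>p\<in>J b a. \<Sum>q\<in>J b a. W b a x \<delta> p * GGi b a p q * V b a y q \<gamma>) = kap b a x y * Gi (fst y) \<delta> \<gamma>"
proof -
  have "(\<Sum>p\<in>J b a. \<Sum>q\<in>J b a. W b a x \<delta> p * GGi b a p q * V b a y q \<gamma>) = 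
     (\<Sum>p\<in>J b a. W b a x \<delta> p * (\<Sum>e<D (fst y). Vtw b a y p e * Gi (fst y) e \<gamma>))"
    unfolding Vtw_Gi[OF g(1)] by (simp add: sum_distrib_left mult.assoc)
  also have "\<dots> = (\<Sum>e<D (fst y). (\<Sum>p\<in>J b a. W b a x \<delta> p * Vtw b a y p e) * Gi (fst y) e \<gamma>)"
    unfolding sum_distrib_left sum_distrib_right by (subst sum.swap) (simp add: mult.assoc)
  also have "\<dots> = (\<Sum>e<D (fst y). if \<delta> = e then kap b a x y * Gi (fst y) e \<gamma> else 0)"
    by (intro sum.cong refl) (use g in \<open>auto simp: kap_eq[OF x y xy]\<close>)
  finally show ?thesis using g by simp
qed

lemma kap'_GG:
  assumes x: "x \<in> X b a" and y: "y \<in> X b a" and xy: "fst x = fst y" and g: "\<gamma> < D (fst y)" "\<delta> < D (fst y)"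
  shows "(\<Sum>p\<in>J b a. \<Sum>q\<in>J b a. W b a x \<delta> p * GG b a p q * V b a y q \<gamma>) = kap' b a x y * G (fst y) \<delta> \<gamma>"
proof -
  have "(\<Sum>p\<in>J b a. \<Sum>q\<in>J b a. W b a x \<delta> p * GG b a p q * V b a y q \<gamma>) = 
     (\<Sum>q\<in>J b a. (\<Sum>e<D (fst y). G (fst y) \<delta> e * Wtw b a x e q) * V b a y q \<gamma>)"
    using G_Wtw[of \<delta> x b a] g xy by (subst sum.swap) (simp add: sum_distrib_right)
  also have "\<dots> = (\<Sum>e<D (fst y). G (fst y) \<delta> e * (\<Sum>q\<in>J b a. Wtw b a x e q * V b a y q \<gamma>))"
    unfolding sum_distrib_left sum_distrib_right by (subst sum.swap) (simp add: mult.assoc)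
  also have "\<dots> = (\<Sum>e<D (fst y). if e = \<gamma> then kap' b a x y * G (fst y) \<delta> e else 0)"
    by (intro sum.cong refl) (use g in \<open>auto simp: kap'_eq[OF x y xy]\<close>)
  finally show ?thesis using g by simp
qed

lemma Wtw_GGi: assumes q: "q \<in> J b a"
  shows "(\<Sum>p\<in>J b a. Wtw b a x \<gamma> p * GGi b a p q) = (\<Sum>e<D (fst x). Gi (fst x) \<gamma> e * W b a x e q)"
proof -
  have "(\<Sum>p\<in>J b a. Wtw b a x \<gamma> p * GGi b a p q) = 
     (\<Sum>p\<in>J b a. \<Sum>e<D (fst x). \<Sum>u\<in>J b a. Gi (fst x) \<gamma> e * W b a x e u * (GG b a u p * GGi b a p q))"
    unfolding Wtw_def sum_distrib_right by (simp add: mult_ac)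
  also have "\<dots> = (\<Sum>e<D (fst x). \<Sum>u\<in>J b a. Gi (fst x) \<gamma> e * W b a x e u * (\<Sum>p\<in>J b a. GG b a u p * GGi b a p q))"
    unfolding sum_distrib_left by (rule sum3_perm[symmetric])
  also have "\<dots> = (\<Sum>e<D (fst x). \<Sum>u\<in>J b a. Gi (fst x) \<gamma> e * W b a x e u * (if u = q then 1 else 0))"
    by (intro sum.cong refl) (use q in \<open>simp add: GG_inv\<close>)
  finally show ?thesis using q by (simp only: sum_delta_J)
qed

lemma Wtw_Vtw:
  assumes x: "x \<in> X b a" and y: "y \<in> X b a" and xy: "fst x = fst y" and g: "\<gamma> < D (fst y)" "\<delta> < D (fst y)"
  shows "(\<Sum>p\<in>J b a. Wtw b a x \<gamma> p * Vtw b a y p \<delta>) = (if x = y \<and> \<gamma> = \<delta> then 1 else 0)"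
proof -
  have "(\<Sum>p\<in>J b a. Wtw b a x \<gamma> p * Vtw b a y p \<delta>) = 
     (\<Sum>p\<in>J b a. \<Sum>q\<in>J b a. \<Sum>e<D (fst y). Wtw b a x \<gamma> p * GGi b a p q * (V b a y q e * G (fst y) e \<delta>))"
    unfolding Vtw_def sum_distrib_left by (simp add: mult_ac)
  also have "\<dots> = (\<Sum>q\<in>J b a. \<Sum>e<D (fst y). (\<Sum>p\<in>J b a. Wtw b a x \<gamma> p * GGi b a p q) * (V b a y q e * G (fst y) e \<delta>))"
    unfolding sum_distrib_right by (rule sum3_perm[symmetric])
  also have "\<dots> = (\<Sum>q\<in>J b a. \<Sum>e<D (fst y). \<Sum>f<D (fst y). (Gi (fst y) \<gamma> f * G (fst y) e \<delta>) * (W b a x f q * V b a y q e))"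
    by (rule sum.cong[OF refl], rule sum.cong[OF refl], subst Wtw_GGi, assumption)
       (simp add: xy sum_distrib_left sum_distrib_right mult_ac)
  also have "\<dots> = (\<Sum>e<D (fst y). \<Sum>f<D (fst y). (Gi (fst y) \<gamma> f * G (fst y) e \<delta>) * (\<Sum>q\<in>J b a. W b a x f q * V b a y q e))"
    unfolding sum_distrib_left by (rule sum3_perm[symmetric])
  also have "\<dots> = (\<Sum>e<D (fst y). if x = y then Gi (fst y) \<gamma> e * G (fst y) e \<delta> else 0)"
  proof (rule sum.cong[OF refl])
    fix e assume e: "e \<in> {..<D (fst y)}"
    have "(\<Sum>f<D (fst y). (Gi (fst y) \<gamma> f * G (fst y) e \<delta>) * (\<Sum>q\<in>J b a. W b a x f q * V b a y q e)) =
       (\<Sum>f<D (fst y). if f = e then (if x = y then Gi (fst y) \<gamma> f * G (fst y) e \<delta> else 0) else 0)"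
      by (intro sum.cong refl) (use e in \<open>auto simp: orthJ[OF x y] xy\<close>)
    thus "(\<Sum>f<D (fst y). (Gi (fst y) \<gamma> f * G (fst y) e \<delta>) * (\<Sum>q\<in>J b a. W b a x f q * V b a y q e)) =
       (if x = y then Gi (fst y) \<gamma> e * G (fst y) e \<delta> else 0)" using e by simp
  qed
  finally show ?thesis using GGi_inv(2)[OF g] by (cases "x = y") simp_all
qed

text \<open>\<open>Wtw\<close> and \<open>Vtw\<close> are dual to each other like W and V, because
  the inserted factors cancel. Expanding \<open>Vtw\<close> in the untwisted tensors turns this
  duality into a matrix product.\<close>

lemma kap'_kap:
  assumes x: "x \<in> X b a" and y: "y \<in> X b a" and xy: "fst x = fst y"
  shows "(\<Sum>\<mu><N b a (fst y). kap' b a x (fst y, \<mu>) * kap b a (fst y, \<mu>) y) = (if x = y then 1 else 0)"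
proof -
  have "(if x = y then 1 else 0) = (\<Sum>p\<in>J b a. Wtw b a x 0 p * Vtw b a y p 0)"
    using Wtw_Vtw[OF x y xy D_pos D_pos] by simp
  also have "\<dots> = (\<Sum>p\<in>J b a. \<Sum>\<mu><N b a (fst y). kap b a (fst y, \<mu>) y * (Wtw b a x 0 p * V b a (fst y, \<mu>) p 0))"
    by (intro sum.cong refl) (simp add: Vtw_expand[OF y _ D_pos] sum_distrib_left mult_ac)
  also have "\<dots> = (\<Sum>\<mu><N b a (fst y). kap' b a x (fst y, \<mu>) * kap b a (fst y, \<mu>) y)"
    by (subst sum.swap) (simp add: sum_distrib_left[symmetric] kap'_def mult.commute)
  finally show ?thesis by simp
qed

lemma ou_eq: "x *s ou (r c) = y *s ou (r c) \<Longrightarrow> x = y"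
  using ou_nz by simp

text \<open>The selection rule r c = r a makes the two vacuum components in
  \<open>partial_trace\<close> equal, and a nonzero component can be cancelled.\<close>

lemma left_trace:
  assumes x: "x \<in> X b a" and y: "y \<in> X b a" and xy: "fst y = fst x"
  obtains s where "\<And>k i. k < D a \<Longrightarrow> i < D a \<Longrightarrow> 
      (\<Sum>p<D b. \<Sum>q<D b. \<Sum>g<D (fst x). V b a x (p, k) g * W b a y g (q, i) * Gi b q p) = (if k = i then s else 0)"
    "s * w a = kap b a y x * w (fst x)"
proof -
  have K: "(\<Sum>k<D b. \<Sum>n<D a. \<Sum>k'<D b. \<Sum>n'<D a. W b a y \<delta> (k', n') * Gi b k' k * Gi a n' n * V b a x (k, n) \<gamma>) = kap b a y x * Gi (fst x) \<delta> \<gamma>"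
    if g: "\<gamma> < D (fst x)" "\<delta> < D (fst x)" for \<gamma> \<delta>
    unfolding kap_GGi[OF y x xy g, symmetric] by (subst sum.swap) (simp add: sum_J GGi_def mult_ac)
  have "N b a (fst x) \<noteq> 0" using X_D[OF x] by simp
  hence rr: "r (fst x) = r a" using sel by blast
  from partial_trace[OF x y xy K] obtain s where
    s: "\<forall>k<D a. \<forall>i<D a. (\<Sum>p<D b. \<Sum>q<D b. \<Sum>g<D (fst x). V b a x (p, k) g * W b a y g (q, i) * Gi b q p) = (if k = i then s else 0)"
    and s': "(s * w a) *s ou (r a) = (kap b a y x * w (fst x)) *s ou (r (fst x))" by blast
  show ?thesis
  proof (rule that[of s])
    show "s * w a = kap b a y x * w (fst x)" by (rule ou_eq[OF s'[unfolded rr]])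
  qed (use s in simp)
qed

text \<open>The mirror image of \<open>left_trace\<close>. The mirrored constants are those of the
  conjugate labels, and the inverse kernel \<open>kap'\<close> appears because the weight is now
  \<open>G\<close>.\<close>

lemma right_trace:
  assumes x: "x \<in> X b a" and y: "y \<in> X b a" and xy: "fst y = fst x"
  obtains s where "\<And>k i. k < D b \<Longrightarrow> i < D b \<Longrightarrow> 
      (\<Sum>p<D a. \<Sum>q<D a. \<Sum>g<D (fst x). V b a x (i, q) g * W b a y g (k, p) * G a p q) = (if k = i then s else 0)"
    "s * w (bar b) = kap' b a y x * w (bar (fst x))"
proof -
  have X: "mir.X a b = X b a" unfolding mir.X_def X_def ..
  have mx: "x \<in> mir.X a b" and my: "y \<in> mir.X a b" using x y X by simp_all
  have K: "(\<Sum>k<D a. \<Sum>n<D b. \<Sum>k'<D a. \<Sum>n'<D b. V b a x (prod.swap (k', n')) \<delta> * mir.Gi a k' k * mir.Gi b n' n * W b a y \<gamma> (prod.swap (k, n))) = 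
      kap' b a y x * mir.Gi (fst y) \<delta> \<gamma>"
    if g: "\<gamma> < D (fst y)" "\<delta> < D (fst y)" for \<gamma> \<delta>
  proof -
    have "(\<Sum>k<D a. \<Sum>n<D b. \<Sum>k'<D a. \<Sum>n'<D b. V b a x (n', k') \<delta> * G a k k' * G b n n' * W b a y \<gamma> (n, k)) = 
      (\<Sum>n<D b. \<Sum>k<D a. \<Sum>n'<D b. \<Sum>k'<D a. W b a y \<gamma> (n, k) * (G b n n' * G a k k') * V b a x (n', k') \<delta>)"
      by (subst sum.swap, rule sum.cong[OF refl], rule sum.cong[OF refl], subst sum.swap) (simp add: mult_ac)
    also have "\<dots> = kap' b a y x * G (fst x) \<gamma> \<delta>"
      using kap'_GG[OF y x xy, of \<delta> \<gamma>] g xy by (simp add: sum_J GG_def)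
    finally show ?thesis using xy by (simp add: mir_Gi)
  qed
  have "N b a (fst x) \<noteq> 0" using X_D[OF x] by simp
  \<comment> \<open>Nonvanishing is recorded for components of the form \<open>ou (r c)\<close>, so
    the left vacuum is rewritten as the right vacuum of the conjugate label.\<close>
  hence ll: "l (fst y) = r (bar b)" using sel xy by (metis r_bar)
  from mir.partial_trace[OF my mx xy[symmetric] K] obtain s where
    s: "\<forall>k<D b. \<forall>i<D b. (\<Sum>p<D a. \<Sum>q<D a. \<Sum>g<D (fst y). W b a y g (prod.swap (p, k)) * V b a x (prod.swap (q, i)) g * mir.Gi a q p) = (if k = i then s else 0)"
    and s': "(s * w (bar b)) *s ou (l b) = (kap' b a y x * w (bar (fst y))) *s ou (l (fst y))" by blast
  show ?thesis
  proof (rule that[of s])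
    fix k i assume "k < D b" "i < D b"
    thus "(\<Sum>p<D a. \<Sum>q<D a. \<Sum>g<D (fst x). V b a x (i, q) g * W b a y g (k, p) * G a p q) = (if k = i then s else 0)"
      using s xy by (simp add: mir_Gi mult_ac)
  next
    show "s * w (bar b) = kap' b a y x * w (bar (fst x))"
      using ou_eq[OF s'[unfolded ll r_bar[symmetric, of b]]] xy by simp
  qed
qed

end

section \<open>Comparison of left and right traces\<close>

context fusion_core
begin

interpretation mir: left_rotation sc "\<lambda>x y. y \<odot> x" D "\<lambda>a i j. t a j i" eps "\<lambda>b a c. N a b c"
      "\<lambda>b a x p \<gamma>. W a b x \<gamma> (prod.swap p)" "\<lambda>b a x \<gamma> p. V a b x (prod.swap p) \<gamma>" S ET bar
      "\<lambda>b p s. Zi b s p" "\<lambda>b s p. Z b p s" "\<lambda>c. w (bar c)" "\<lambda>c. ou (l c)"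
  by (rule mirrored)

text \<open>The element \<open>Q\<close> places an intertwiner X = V_x W_y between S(t^b) and S(t^a)
  with both legs closed by weights. Contracting S(t^b) with t^b leaves the left trace of X, and the
  \<open>a\<close> leg closes to w_{bar a} times a vacuum component. Contracting t^a with S(t^a)
  leaves the right trace, and the \<open>b\<close> leg closes to w_b times a vacuum component. The
  two components agree since l a = r b.\<close>

lemma sphere:
  assumes x: "x \<in> X b a" and y: "y \<in> X b a" and xy: "fst y = fst x"
    and s: "\<And>k i. k < D a \<Longrightarrow> i < D a \<Longrightarrow> 
      (\<Sum>p<D b. \<Sum>q<D b. \<Sum>g<D (fst x). V b a x (p, k) g * W b a y g (q, i) * Gi b q p) = (if k = i then s else 0)"
    and s': "\<And>k i. k < D b \<Longrightarrow> i < D b \<Longrightarrow> 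
      (\<Sum>p<D a. \<Sum>q<D a. \<Sum>g<D (fst x). V b a x (i, q) g * W b a y g (k, p) * G a p q) = (if k = i then s' else 0)"
  shows "s * w (bar a) = s' * w b"
proof -
  let ?c = "fst x"
  define Xf where "Xf u v = (\<Sum>g<D ?c. V b a x u g * W b a y g v)" for u v
  have J_I: "(k, n) \<in> J b a" if "k < D b" "n < D a" for k n using that by (simp add: J_def)
  \<comment> \<open>X commutes with \<open>T\<close>, being a composite of intertwiners. This lets
    \<open>F\<close> be read with X on either side, one reading for each evaluation of
    \<open>Q\<close>.\<close>
  have comm: "(\<Sum>u\<in>J b a. Xf u q *s T b a p u) = (\<Sum>u\<in>J b a. Xf p u *s T b a u q)" if p: "p \<in> J b a" and q: "q \<in> J b a" for p q
  proof -
    have "(\<Sum>u\<in>J b a. Xf u q *s T b a p u) = (\<Sum>g<D ?c. W b a y g q *s (\<Sum>u\<in>J b a. V b a x u g *s T b a p u))"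
      unfolding Xf_def scale_sum_left scale_sum_right by (subst sum.swap) (simp add: mult.commute)
    also have "\<dots> = (\<Sum>g<D ?c. W b a y g q *s (\<Sum>e<D ?c. V b a x p e *s t ?c e g))"
      by (intro sum.cong refl) (use Vmor_V[OF x] p in \<open>simp add: Vmor_def\<close>)
    also have "\<dots> = (\<Sum>e<D ?c. V b a x p e *s (\<Sum>g<D ?c. W b a y g q *s t ?c e g))"
      unfolding scale_sum_right by (subst sum.swap) (simp add: mult.commute)
    also have "\<dots> = (\<Sum>e<D ?c. V b a x p e *s (\<Sum>u\<in>J b a. W b a y e u *s T b a u q))"
      by (intro sum.cong refl) (use Wmor_W[OF y] q xy in \<open>simp add: Wmor_def\<close>)
    also have "\<dots> = (\<Sum>u\<in>J b a. Xf p u *s T b a u q)"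
      unfolding Xf_def scale_sum_left scale_sum_right by (subst sum.swap) simp
    finally show ?thesis .
  qed
  have PX: "(\<Sum>u\<in>J b a. P b a p u * Xf u q) = Xf p q" if p: "p \<in> J b a" for p q
  proof -
    have "(\<Sum>u\<in>J b a. P b a p u * Xf u q) = (\<Sum>g<D ?c. (\<Sum>u\<in>J b a. P b a p u * V b a x u g) * W b a y g q)"
      unfolding Xf_def sum_distrib_left sum_distrib_right by (subst sum.swap) (simp add: mult.assoc)
    thus ?thesis using Vmor_P[OF Vmor_V[OF x] p] by (simp add: Xf_def)
  qed
  have XP: "(\<Sum>u\<in>J b a. Xf p u * P b a u q) = Xf p q" if q: "q \<in> J b a" for p q
  proof -
    have "(\<Sum>u\<in>J b a. Xf p u * P b a u q) = (\<Sum>g<D ?c. V b a x p g * (\<Sum>u\<in>J b a. W b a y g u * P b a u q))"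
      unfolding Xf_def sum_distrib_left sum_distrib_right by (subst sum.swap) (simp add: mult.assoc)
    thus ?thesis using Wmor_P[OF Wmor_W[OF y] q] xy by (simp add: Xf_def)
  qed
  define F where "F j n l' n'' = (\<Sum>u\<in>J b a. Xf u (l', n'') *s T b a (j, n) u)" for j n l' n''
  define Q where "Q = (\<Sum>k<D b. \<Sum>l'<D b. \<Sum>j<D b. \<Sum>n<D a. \<Sum>m<D a. \<Sum>n''<D a. 
     (Gi b l' k * G a m n) *s (S (t b k j) \<odot> (F j n l' n'' \<odot> S (t a n'' m))))"
  have F1: "(\<Sum>j<D b. S (t b k j) \<odot> F j n l' n'') = (\<Sum>n0<D a. Xf (k, n0) (l', n'') *s t a n n0)"
    if k: "k < D b" and n: "n < D a" for k n l' n''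
  proof -
    have "(\<Sum>j<D b. S (t b k j) \<odot> F j n l' n'') = (\<Sum>j<D b. \<Sum>u\<in>J b a. Xf u (l', n'') *s ((S (t b k j) \<odot> t b j (fst u)) \<odot> t a n (snd u)))"
      by (simp add: F_def T_def m_sum2 m_sc2 m_assoc)
    also have "\<dots> = (\<Sum>u\<in>J b a. Xf u (l', n'') *s ((\<Sum>j<D b. S (t b k j) \<odot> t b j (fst u)) \<odot> t a n (snd u)))"
      by (subst sum.swap) (simp add: m_sum1 scale_sum_right)
    also have "\<dots> = (\<Sum>u\<in>J b a. \<Sum>n0<D a. (P b a (k, n0) u * Xf u (l', n'')) *s t a n n0)"
      by (intro sum.cong refl) (use k n in \<open>auto simp: J_def w1 P_def T_def scale_sum_right mult.commute\<close>)
    also have "\<dots> = (\<Sum>n0<D a. (\<Sum>u\<in>J b a. P b a (k, n0) u * Xf u (l', n'')) *s t a n n0)"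
      by (subst sum.swap) (simp add: scale_sum_left)
    also have "\<dots> = (\<Sum>n0<D a. Xf (k, n0) (l', n'') *s t a n n0)"
      by (intro sum.cong refl) (use k in \<open>simp add: PX J_I\<close>)
    finally show ?thesis .
  qed
  have F2: "(\<Sum>n''<D a. F j n l' n'' \<odot> S (t a n'' m)) = (\<Sum>l1<D b. Xf (j, n) (l1, m) *s t b l1 l')"
    if j: "j < D b" and n: "n < D a" and l': "l' < D b" and m: "m < D a" for j n l' m
  proof -
    have Fc: "F j n l' n'' = (\<Sum>u\<in>J b a. Xf (j, n) u *s T b a u (l', n''))" if "n'' < D a" for n''
      unfolding F_def by (rule comm) (use j n l' that in \<open>simp_all add: J_I\<close>)
    have "(\<Sum>n''<D a. F j n l' n'' \<odot> S (t a n'' m)) = (\<Sum>n''<D a. \<Sum>u\<in>J b a. Xf (j, n) u *s (t b (fst u) l' \<odot> (t a (snd u) n'' \<odot> S (t a n'' m))))"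
      by (intro sum.cong refl) (simp add: Fc T_def m_sum1 m_sc1 m_assoc)
    also have "\<dots> = (\<Sum>u\<in>J b a. Xf (j, n) u *s (t b (fst u) l' \<odot> (\<Sum>n''<D a. t a (snd u) n'' \<odot> S (t a n'' m))))"
      by (subst sum.swap) (simp add: m_sum2 scale_sum_right)
    also have "\<dots> = (\<Sum>u\<in>J b a. \<Sum>l1<D b. (Xf (j, n) u * P b a u (l1, m)) *s t b l1 l')"
    proof (rule sum.cong[OF refl])
      fix u assume u: "u \<in> J b a"
      have "t b (fst u) l' \<odot> (\<Sum>n''<D a. t a (snd u) n'' \<odot> S (t a n'' m)) = (\<Sum>l1<D b. P b a u (l1, m) *s t b l1 l')"
        using mir.w1[of m a "snd u" l' b "fst u"] u l' m by (auto simp: J_def P_def T_def)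
      thus "Xf (j, n) u *s (t b (fst u) l' \<odot> (\<Sum>n''<D a. t a (snd u) n'' \<odot> S (t a n'' m))) = 
         (\<Sum>l1<D b. (Xf (j, n) u * P b a u (l1, m)) *s t b l1 l')" by (simp add: scale_sum_right)
    qed
    also have "\<dots> = (\<Sum>l1<D b. (\<Sum>u\<in>J b a. Xf (j, n) u * P b a u (l1, m)) *s t b l1 l')"
      by (subst sum.swap) (simp add: scale_sum_left)
    also have "\<dots> = (\<Sum>l1<D b. Xf (j, n) (l1, m) *s t b l1 l')"
      by (intro sum.cong refl) (use m in \<open>simp add: XP J_I\<close>)
    finally show ?thesis .
  qed
  have "Q = (\<Sum>n<D a. \<Sum>m<D a. \<Sum>n''<D a. \<Sum>k<D b. \<Sum>l'<D b. \<Sum>j<D b.  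
     (Gi b l' k * G a m n) *s (S (t b k j) \<odot> (F j n l' n'' \<odot> S (t a n'' m))))"
    unfolding Q_def by (rule sum_swap33)
  also have "\<dots> = (\<Sum>n<D a. \<Sum>m<D a. \<Sum>n''<D a. G a m n *s ((\<Sum>k<D b. \<Sum>l'<D b. Gi b l' k *s (\<Sum>j<D b. S (t b k j) \<odot> F j n l' n'')) \<odot> S (t a n'' m)))"
    by (simp add: m_sum1 m_sc1 scale_sum_right m_assoc mult.commute)
  also have "\<dots> = (\<Sum>n<D a. \<Sum>m<D a. \<Sum>n''<D a. G a m n *s ((s *s t a n n'') \<odot> S (t a n'' m)))"
  proof (rule sum.cong[OF refl], rule sum.cong[OF refl], rule sum.cong[OF refl])
    fix n m n'' assume nm: "n \<in> {..<D a}" "m \<in> {..<D a}" "n'' \<in> {..<D a}"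
    have "(\<Sum>k<D b. \<Sum>l'<D b. Gi b l' k *s (\<Sum>j<D b. S (t b k j) \<odot> F j n l' n'')) = 
      (\<Sum>k<D b. \<Sum>l'<D b. \<Sum>n0<D a. (Gi b l' k * Xf (k, n0) (l', n'')) *s t a n n0)"
      by (intro sum.cong refl) (use nm in \<open>simp add: F1 scale_sum_right\<close>)
    also have "\<dots> = (\<Sum>n0<D a. (\<Sum>k<D b. \<Sum>l'<D b. Gi b l' k * Xf (k, n0) (l', n'')) *s t a n n0)"
      by (rule trans[OF sum3_perm]) (simp add: scale_sum_left)
    also have "\<dots> = (\<Sum>n0<D a. if n0 = n'' then s *s t a n n0 else 0)"
    proof (rule sum.cong[OF refl])
      fix n0 assume n0: "n0 \<in> {..<D a}"
      have "(\<Sum>k<D b. \<Sum>l'<D b. Gi b l' k * Xf (k, n0) (l', n'')) = (if n0 = n'' then s else 0)"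
        using s[of n0 n''] n0 nm by (simp add: Xf_def sum_distrib_left mult_ac)
      thus "(\<Sum>k<D b. \<Sum>l'<D b. Gi b l' k * Xf (k, n0) (l', n'')) *s t a n n0 = (if n0 = n'' then s *s t a n n0 else 0)" by simp
    qed
    finally show "G a m n *s ((\<Sum>k<D b. \<Sum>l'<D b. Gi b l' k *s (\<Sum>j<D b. S (t b k j) \<odot> F j n l' n'')) \<odot> S (t a n'' m)) = 
       G a m n *s ((s *s t a n n'') \<odot> S (t a n'' m))" using nm by simp
  qed
  also have "\<dots> = s *s (\<Sum>n<D a. \<Sum>m<D a. G a m n *s ET (t a n m))"
    by (simp add: ET_t scale_sum_right m_sc1 mult.commute)
  also have "\<dots> = (s * w (bar a)) *s ou (l a)"
    using mir.chi[of a] by (subst sum.swap) (simp add: G_def mult.commute)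
  finally have Q1: "Q = (s * w (bar a)) *s ou (l a)" .
  have "Q = (\<Sum>k<D b. \<Sum>l'<D b. \<Sum>j<D b. Gi b l' k *s (S (t b k j) \<odot> (\<Sum>n<D a. \<Sum>m<D a. G a m n *s (\<Sum>n''<D a. F j n l' n'' \<odot> S (t a n'' m)))))"
    unfolding Q_def by (simp add: m_sum2 m_sc2 scale_sum_right)
  also have "\<dots> = (\<Sum>k<D b. \<Sum>l'<D b. \<Sum>j<D b. Gi b l' k *s (S (t b k j) \<odot> (s' *s t b j l')))"
  proof (rule sum.cong[OF refl], rule sum.cong[OF refl], rule sum.cong[OF refl])
    fix k l' j assume kl: "k \<in> {..<D b}" "l' \<in> {..<D b}" "j \<in> {..<D b}"
    have "(\<Sum>n<D a. \<Sum>m<D a. G a m n *s (\<Sum>n''<D a. F j n l' n'' \<odot> S (t a n'' m))) = 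
      (\<Sum>n<D a. \<Sum>m<D a. \<Sum>l1<D b. (G a m n * Xf (j, n) (l1, m)) *s t b l1 l')"
      by (intro sum.cong refl) (use kl in \<open>simp add: F2 scale_sum_right\<close>)
    also have "\<dots> = (\<Sum>l1<D b. (\<Sum>n<D a. \<Sum>m<D a. G a m n * Xf (j, n) (l1, m)) *s t b l1 l')"
      by (rule trans[OF sum3_perm]) (simp add: scale_sum_left)
    also have "\<dots> = (\<Sum>l1<D b. if l1 = j then s' *s t b l1 l' else 0)"
    proof (rule sum.cong[OF refl])
      fix l1 assume l1: "l1 \<in> {..<D b}"
      have "(\<Sum>n<D a. \<Sum>m<D a. G a m n * Xf (j, n) (l1, m)) = (if l1 = j then s' else 0)"
        using s'[of l1 j] l1 kl by (subst sum.swap) (simp add: Xf_def sum_distrib_left mult_ac)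
      thus "(\<Sum>n<D a. \<Sum>m<D a. G a m n * Xf (j, n) (l1, m)) *s t b l1 l' = (if l1 = j then s' *s t b l1 l' else 0)" by simp
    qed
    finally show "Gi b l' k *s (S (t b k j) \<odot> (\<Sum>n<D a. \<Sum>m<D a. G a m n *s (\<Sum>n''<D a. F j n l' n'' \<odot> S (t a n'' m)))) = 
       Gi b l' k *s (S (t b k j) \<odot> (s' *s t b j l'))" using kl by simp
  qed
  also have "\<dots> = s' *s (\<Sum>k<D b. \<Sum>l'<D b. Gi b l' k *s ES (t b k l'))"
    by (simp add: ES_t scale_sum_right m_sc2 mult.commute)
  also have "\<dots> = (s' * w b) *s ou (r b)"
    using chi[of b] by (simp add: Gi_def)
  finally have Q2: "Q = (s' * w b) *s ou (r b)" .
  have "N b a ?c \<noteq> 0" using X_D[OF x] by simp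
  hence rb: "l a = r b" using sel by metis
  show ?thesis by (rule ou_eq[of _ b], fold Q2) (rule Q1[unfolded rb, symmetric])
qed

text \<open>Eliminating the two trace values from \<open>left_trace\<close>,
  \<open>right_trace\<close> and \<open>sphere\<close>. The kernel thus becomes proportional to its
  own inverse, with a factor depending only on b, a, c; this is where the involution comes
  from.\<close>

theorem kap_relation:
  assumes x: "x \<in> X b a" and y: "y \<in> X b a" and xy: "fst y = fst x"
  shows "kap b a y x * (w (fst x) * w (bar a) * w (bar b)) = kap' b a y x * (w (bar (fst x)) * w b * w a)"
proof -
  obtain s where s: "\<And>k i. k < D a \<Longrightarrow> i < D a \<Longrightarrow> 
      (\<Sum>p<D b. \<Sum>q<D b. \<Sum>g<D (fst x). V b a x (p, k) g * W b a y g (q, i) * Gi b q p) = (if k = i then s else 0)"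
    and s1: "s * w a = kap b a y x * w (fst x)" using left_trace[OF x y xy] by blast
  obtain s' where s': "\<And>k i. k < D b \<Longrightarrow> i < D b \<Longrightarrow> 
      (\<Sum>p<D a. \<Sum>q<D a. \<Sum>g<D (fst x). V b a x (i, q) g * W b a y g (k, p) * G a p q) = (if k = i then s' else 0)"
    and s'1: "s' * w (bar b) = kap' b a y x * w (bar (fst x))" using right_trace[OF x y xy] by blast
  have e: "s * w (bar a) = s' * w b" by (rule sphere[OF x y xy s s'])
  have "kap b a y x * (w (fst x) * w (bar a) * w (bar b)) = (s * w a) * (w (bar a) * w (bar b))"
    unfolding s1 by simp
  also have "\<dots> = (s * w (bar a)) * (w a * w (bar b))" by simp
  also have "\<dots> = (s' * w (bar b)) * (w b * w a)" unfolding e by simp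
  also have "\<dots> = kap' b a y x * (w (bar (fst x)) * w b * w a)" unfolding s'1 by simp
  finally show ?thesis .
qed

text \<open>By \<open>w1\<close>, multiplying t^a by \<open>ES\<close> of t^b produces entries of
  \<open>P\<close>. Summed against \<open>Gi\<close>, \<open>ES\<close> of t^b becomes w_b times the
  vacuum component of r b, which acts as a unit on t^a because l a = r b. The claim follows by
  comparing coefficients.\<close>

lemma trace_P:
  assumes lr: "l a = r b" and i: "i < D a"
  shows "(\<Sum>p<D b. \<Sum>q<D b. Gi b q p * P b a (p, i) (q, i)) = w b"
proof -
  define c where "c n = (\<Sum>p<D b. \<Sum>q<D b. Gi b q p * P b a (p, n) (q, i))" for n
  have "(\<Sum>n<D a. c n *s t a i n) = (\<Sum>p<D b. \<Sum>q<D b. \<Sum>n<D a. (Gi b q p * P b a (p, n) (q, i)) *s t a i n)"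
    unfolding c_def scale_sum_left by (rule sum3_perm[symmetric])
  also have "\<dots> = (\<Sum>p<D b. \<Sum>q<D b. Gi b q p *s (ES (t b p q) \<odot> t a i i))"
    by (intro sum.cong refl) (use i in \<open>simp add: ES_t w1 P_def T_def scale_sum_right\<close>)
  also have "\<dots> = (\<Sum>p<D b. \<Sum>q<D b. Gi b q p *s ES (t b p q)) \<odot> t a i i"
    by (simp add: m_sum1 m_sc1)
  also have "\<dots> = w b *s t a i i"
    using chi[of b] ou_left[OF i i] lr by (simp add: Gi_def m_sc1)
  finally have e: "(\<Sum>n<D a. c n *s t a i n) = w b *s t a i i" .
  have h: "(\<Sum>k<D a. \<Sum>n<D a. (if k = i then f n else 0) *s t a k n) = (\<Sum>n<D a. f n *s t a i n)" for f
  proof -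
    have "(\<Sum>k<D a. \<Sum>n<D a. (if k = i then f n else 0) *s t a k n) = (\<Sum>k<D a. if k = i then (\<Sum>n<D a. f n *s t a k n) else 0)"
      by (intro sum.cong refl) auto
    thus ?thesis using i by simp
  qed
  have d: "(\<Sum>n<D a. (if n = i then w b else 0) *s t a i n) = w b *s t a i i"
  proof -
    have "(\<Sum>n<D a. (if n = i then w b else 0) *s t a i n) = (\<Sum>n<D a. if n = i then w b *s t a i n else 0)"
      by (intro sum.cong refl) auto
    thus ?thesis using i by simp
  qed
  have "(\<Sum>k<D a. \<Sum>n<D a. (if k = i then c n else 0) *s t a k n) = (\<Sum>k<D a. \<Sum>n<D a. (if k = i then (if n = i then w b else 0) else 0) *s t a k n)"
    unfolding h d by (rule e)
  from indep_block[OF this i i] show ?thesis by (simp add: c_def)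
qed

text \<open>The partial trace of the idempotent \<open>P\<close> is computed channel by channel with
  \<open>left_trace\<close> and as a whole with \<open>trace_P\<close>.\<close>

theorem kap_sum:
  assumes lr: "l a = r b"
  shows "(\<Sum>x\<in>X b a. kap b a x x * w (fst x)) = w b * w a"
proof -
  have "(\<Sum>x\<in>X b a. kap b a x x * w (fst x)) = 
     (\<Sum>x\<in>X b a. (\<Sum>p<D b. \<Sum>q<D b. \<Sum>g<D (fst x). V b a x (p, 0) g * W b a x g (q, 0) * Gi b q p) * w a)"
  proof (rule sum.cong[OF refl])
    fix x assume x: "x \<in> X b a"
    obtain s where s: "\<And>k i. k < D a \<Longrightarrow> i < D a \<Longrightarrow> 
      (\<Sum>p<D b. \<Sum>q<D b. \<Sum>g<D (fst x). V b a x (p, k) g * W b a x g (q, i) * Gi b q p) = (if k = i then s else 0)"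
    and s1: "s * w a = kap b a x x * w (fst x)" using left_trace[OF x x refl] by blast
    show "kap b a x x * w (fst x) = (\<Sum>p<D b. \<Sum>q<D b. \<Sum>g<D (fst x). V b a x (p, 0) g * W b a x g (q, 0) * Gi b q p) * w a"
      unfolding s1[symmetric] using s[OF D_pos D_pos] by simp
  qed
  also have "\<dots> = (\<Sum>p<D b. \<Sum>q<D b. Gi b q p * P b a (p, 0) (q, 0)) * w a"
  proof -
    have "(\<Sum>x\<in>X b a. \<Sum>p<D b. \<Sum>q<D b. \<Sum>g<D (fst x). V b a x (p, 0) g * W b a x g (q, 0) * Gi b q p) = 
      (\<Sum>p<D b. \<Sum>q<D b. \<Sum>x\<in>X b a. \<Sum>g<D (fst x). V b a x (p, 0) g * W b a x g (q, 0) * Gi b q p)"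
      by (rule sum3_perm[symmetric])
    also have "\<dots> = (\<Sum>p<D b. \<Sum>q<D b. Gi b q p * P b a (p, 0) (q, 0))"
      by (intro sum.cong refl) (use D_pos[of a] in \<open>simp add: P_expand J_def sum_distrib_left mult_ac\<close>)
    finally show ?thesis by (simp add: sum_distrib_right[symmetric])
  qed
  also have "\<dots> = w b * w a" using trace_P[OF lr D_pos] by simp
  finally show ?thesis .
qed

end

section \<open>Rotation on multiplicity spaces\<close>

context fusion_core
begin

text \<open>Coordinates of the bent V in the tensors W of the rotated channel bar b, c \<rightarrow>
  a; \<open>rotB\<close> holds those of the bent W in the corresponding tensors V.\<close>

definition rotA where "rotA b a c \<mu> \<nu> = (\<Sum>q\<in>J (bar b) c. What b a (c, \<mu>) 0 q * V (bar b) c (a, \<nu>) q 0)"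
definition rotB where "rotB b a c \<mu> \<nu> = (\<Sum>q\<in>J (bar b) c. W (bar b) c (a, \<nu>) 0 q * Vhat b a (c, \<mu>) q 0)"

lemma What_expand:
  assumes m: "\<mu> < N b a c"
  shows "q \<in> J (bar b) c \<Longrightarrow> k < D a \<Longrightarrow> What b a (c, \<mu>) k q = (\<Sum>\<nu><N (bar b) c a. rotA b a c \<mu> \<nu> * W (bar b) c (a, \<nu>) k q)"
    and "\<nu> < N (bar b) c a \<Longrightarrow> k < D a \<Longrightarrow> i < D a \<Longrightarrow> 
       (\<Sum>q\<in>J (bar b) c. What b a (c, \<mu>) k q * V (bar b) c (a, \<nu>) q i) = (if k = i then rotA b a c \<mu> \<nu> else 0)"
proof -
  have mor: "Wmor (bar b) c a (What b a (c, \<mu>))" using What_mor[OF X_I[OF m]] by simp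
  obtain \<alpha> where \<alpha>: "\<And>q k. q \<in> J (bar b) c \<Longrightarrow> k < D a \<Longrightarrow> What b a (c, \<mu>) k q = (\<Sum>\<nu><N (bar b) c a. \<alpha> \<nu> * W (bar b) c (a, \<nu>) k q)"
    "\<And>\<nu> k i. \<nu> < N (bar b) c a \<Longrightarrow> k < D a \<Longrightarrow> i < D a \<Longrightarrow> 
       (\<Sum>q\<in>J (bar b) c. What b a (c, \<mu>) k q * V (bar b) c (a, \<nu>) q i) = (if k = i then \<alpha> \<nu> else 0)"
    using Wmor_expand[OF mor] by blast
  have e: "\<alpha> \<nu> = rotA b a c \<mu> \<nu>" if "\<nu> < N (bar b) c a" for \<nu>
    using \<alpha>(2)[OF that D_pos D_pos] by (simp add: rotA_def)
  show "q \<in> J (bar b) c \<Longrightarrow> k < D a \<Longrightarrow> What b a (c, \<mu>) k q = (\<Sum>\<nu><N (bar b) c a. rotA b a c \<mu> \<nu> * W (bar b) c (a, \<nu>) k q)"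
    using \<alpha>(1) e by simp
  show "\<nu> < N (bar b) c a \<Longrightarrow> k < D a \<Longrightarrow> i < D a \<Longrightarrow> 
       (\<Sum>q\<in>J (bar b) c. What b a (c, \<mu>) k q * V (bar b) c (a, \<nu>) q i) = (if k = i then rotA b a c \<mu> \<nu> else 0)"
    using \<alpha>(2) e by simp
qed

lemma Vhat_expand:
  assumes m: "\<mu> < N b a c" and q: "q \<in> J (bar b) c" and k: "k < D a"
  shows "Vhat b a (c, \<mu>) q k = (\<Sum>\<nu><N (bar b) c a. rotB b a c \<mu> \<nu> * V (bar b) c (a, \<nu>) q k)"
proof -
  have mor: "Vmor (bar b) c a (Vhat b a (c, \<mu>))" using Vhat_mor[OF X_I[OF m]] by simp
  obtain \<alpha> where \<alpha>: "\<And>q k. q \<in> J (bar b) c \<Longrightarrow> k < D a \<Longrightarrow> Vhat b a (c, \<mu>) q k = (\<Sum>\<nu><N (bar b) c a. \<alpha> \<nu> * V (bar b) c (a, \<nu>) q k)"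
    "\<And>\<nu> k i. \<nu> < N (bar b) c a \<Longrightarrow> k < D a \<Longrightarrow> i < D a \<Longrightarrow> 
       (\<Sum>q\<in>J (bar b) c. W (bar b) c (a, \<nu>) k q * Vhat b a (c, \<mu>) q i) = (if k = i then \<alpha> \<nu> else 0)"
    using Vmor_expand[OF mor] by blast
  have e: "\<alpha> \<nu> = rotB b a c \<mu> \<nu>" if "\<nu> < N (bar b) c a" for \<nu>
    using \<alpha>(2)[OF that D_pos D_pos] by (simp add: rotB_def)
  show ?thesis using \<alpha>(1)[OF q k] e by simp
qed

text \<open>The composite of \<open>What\<close> and \<open>Vhat\<close> is a left partial trace,
  whose value \<open>left_trace\<close> expresses by the kernel; expanding \<open>Vhat\<close> in
  the rotated channels gives the matrix product.\<close>

lemma rotA_rotB: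
  assumes m: "\<mu> < N b a c" and m': "\<mu>' < N b a c"
  shows "(\<Sum>\<nu><N (bar b) c a. rotA b a c \<mu> \<nu> * rotB b a c \<mu>' \<nu>) * w a = kap b a (c, \<mu>') (c, \<mu>) * w c"
proof -
  have xy: "fst (c,\<mu>') = fst (c,\<mu>)" by simp
  obtain s where s: "\<And>k i. k < D a \<Longrightarrow> i < D a \<Longrightarrow> 
      (\<Sum>p<D b. \<Sum>q<D b. \<Sum>g<D (fst (c,\<mu>)). V b a (c,\<mu>) (p, k) g * W b a (c,\<mu>') g (q, i) * Gi b q p) = (if k = i then s else 0)"
    and s1: "s * w a = kap b a (c,\<mu>') (c,\<mu>) * w (fst (c,\<mu>))" 
    using left_trace[OF X_I[OF m] X_I[OF m'] xy] by blast
  have "s = (\<Sum>q\<in>J (bar b) c. What b a (c, \<mu>) 0 q * Vhat b a (c, \<mu>') q 0)"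
    using s[OF D_pos D_pos] What_Vhat[of "(c,\<mu>')" "(c,\<mu>)" b a 0 0] by simp
  also have "\<dots> = (\<Sum>q\<in>J (bar b) c. \<Sum>\<nu><N (bar b) c a. rotB b a c \<mu>' \<nu> * (What b a (c, \<mu>) 0 q * V (bar b) c (a, \<nu>) q 0))"
    by (intro sum.cong refl) (simp add: Vhat_expand[OF m' _ D_pos] sum_distrib_left mult_ac)
  also have "\<dots> = (\<Sum>\<nu><N (bar b) c a. rotA b a c \<mu> \<nu> * rotB b a c \<mu>' \<nu>)"
    by (subst sum.swap) (simp add: sum_distrib_left[symmetric] rotA_def mult.commute)
  finally show ?thesis using s1 by simp
qed

definition K where "K b a c = mat (N b a c) (N b a c) (\<lambda>(i, j). kap b a (c, i) (c, j))"
definition K' where "K' b a c = mat (N b a c) (N b a c) (\<lambda>(i, j). kap' b a (c, i) (c, j))"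
definition RA where "RA b a c = mat (N b a c) (N (bar b) c a) (\<lambda>(i, j). rotA b a c i j)"
text \<open>The factors w_a / w_c and \<open>kap'\<close> cancel the right-hand side of
  \<open>rotA_rotB\<close>, so that RA RB is the identity.\<close>

definition RB where "RB b a c = mat (N (bar b) c a) (N b a c) (\<lambda>(i, j). w a / w c * (\<Sum>k<N b a c. kap' b a (c, j) (c, k) * rotB b a c k i))"

lemma K_carrier [simp]: "K b a c \<in> carrier_mat (N b a c) (N b a c)" "K' b a c \<in> carrier_mat (N b a c) (N b a c)"
  "RA b a c \<in> carrier_mat (N b a c) (N (bar b) c a)" "RB b a c \<in> carrier_mat (N (bar b) c a) (N b a c)"
  by (simp_all add: K_def K'_def RA_def RB_def)

lemma K'_K: "K' b a c * K b a c = 1\<^sub>m (N b a c)"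
  by (rule eq_matI) (auto simp: K_def K'_def scalar_prod_def lessThan_atLeast0[symmetric] kap'_kap[OF X_I X_I, simplified])

lemma K_K': "K b a c * K' b a c = 1\<^sub>m (N b a c)"
  by (rule mat_mult_left_right_inverse[OF _ _ K'_K]) simp_all

lemma kap_kap':
  assumes "i < N b a c" "j < N b a c"
  shows "(\<Sum>\<mu><N b a c. kap b a (c, i) (c, \<mu>) * kap' b a (c, \<mu>) (c, j)) = (if i = j then 1 else 0)"
proof -
  have "(K b a c * K' b a c) $$ (i, j) = (if i = j then 1 else 0)" unfolding K_K' using assms by simp
  thus ?thesis using assms by (simp add: K_def K'_def scalar_prod_def lessThan_atLeast0[symmetric])
qed

lemma RA_RB: "RA b a c * RB b a c = 1\<^sub>m (N b a c)"
proof (rule eq_matI)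
  fix i j assume "i < dim_row (1\<^sub>m (N b a c) :: complex mat)" "j < dim_col (1\<^sub>m (N b a c) :: complex mat)"
  hence ij: "i < N b a c" "j < N b a c" by simp_all
  have "(RA b a c * RB b a c) $$ (i, j) = (\<Sum>\<nu><N (bar b) c a. \<Sum>k<N b a c. rotA b a c i \<nu> * (w a / w c * (kap' b a (c, j) (c, k) * rotB b a c k \<nu>)))"
    using ij by (simp add: RA_def RB_def scalar_prod_def lessThan_atLeast0[symmetric] sum_distrib_left)
  also have "\<dots> = (\<Sum>k<N b a c. kap' b a (c, j) (c, k) * ((\<Sum>\<nu><N (bar b) c a. rotA b a c i \<nu> * rotB b a c k \<nu>) * w a) / w c)"
    unfolding sum_distrib_right sum_distrib_left sum_divide_distrib by (subst sum.swap) (simp add: field_simps)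
  also have "\<dots> = (\<Sum>k<N b a c. kap' b a (c, j) (c, k) * kap b a (c, k) (c, i))"
    by (intro sum.cong refl) (use ij w_nz in \<open>simp add: rotA_rotB\<close>)
  also have "\<dots> = (if j = i then 1 else 0)"
    using kap'_kap[OF X_I[OF ij(2)] X_I[OF ij(1)]] by simp
  finally show "(RA b a c * RB b a c) $$ (i, j) = 1\<^sub>m (N b a c) $$ (i, j)" using ij by auto
qed (simp_all add: RA_def RB_def)

text \<open>RB RA is an idempotent of size \<open>N (bar b) c a\<close>, and its trace is that of RA
  RB = 1, namely \<open>N b a c\<close>. The bound in \<open>mtrace_idempotent\<close> compares the
  two. Since \<open>bar\<close> is an involution, the reverse inequality is another
  instance.\<close>

lemma N_le_rot: "N b a c \<le> N (bar b) c a"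
proof -
  let ?n = "N b a c" and ?k = "N (bar b) c a"
  have "RA b a c * (RB b a c * RA b a c) = RA b a c * RB b a c * RA b a c"
    by (rule assoc_mult_mat[OF K_carrier(3,4,3), symmetric])
  also have "\<dots> = RA b a c" unfolding RA_RB by (rule left_mult_one_mat[OF K_carrier(3)])
  finally have idem: "(RB b a c * RA b a c) * (RB b a c * RA b a c) = RB b a c * RA b a c"
    using assoc_mult_mat[OF K_carrier(4,3) mult_carrier_mat[OF K_carrier(4,3)], of b a c] by simp
  have "RB b a c * RA b a c \<in> carrier_mat ?k ?k" by (rule mult_carrier_mat[OF K_carrier(4,3)])
  from mtrace_idempotent[OF this idem] obtain j where j: "j \<le> ?k" "mtrace (RB b a c * RA b a c) = of_nat j" by blast
  have "mtrace (RB b a c * RA b a c) = mtrace (1\<^sub>m ?n)"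
    unfolding mtrace_mult_commute[OF K_carrier(4,3)] RA_RB ..
  also have "\<dots> = of_nat ?n" by (simp add: mtrace_def)
  finally show ?thesis using j by simp
qed

lemma N_rot: "N (bar b) c a = N b a c"
  using N_le_rot[of b a c] N_le_rot[of "bar b" c a] by (simp add: bar_bar)

lemma RB_RA: "RB b a c * RA b a c = 1\<^sub>m (N b a c)"
  by (rule mat_mult_left_right_inverse[OF _ _ RA_RB]) (use K_carrier(3,4)[of b a c] in \<open>simp_all add: N_rot\<close>)

text \<open>Both sides equal an entry of the transpose of Z_{bar b}. Bending a leg therefore turns
  the inverse twist on bar b into the twist on b, which is why rotation exchanges \<open>kap\<close>
  and \<open>kap'\<close>.\<close>

lemma Z_Gi: assumes p: "p < D b" and s: "s' < D (bar b)"
  shows "(\<Sum>s<D (bar b). Z b p s * Gi (bar b) s s') = (\<Sum>p'<D b. G b p' p * Z b p' s')"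
proof -
  have "(\<Sum>s<D (bar b). Z b p s * Gi (bar b) s s') = (\<Sum>s<D (bar b). \<Sum>r<D b. (Z b p s * Zi b s r) * Z (bar b) s' r)"
    by (simp add: Gi_def bar_bar sum_distrib_left mult_ac)
  also have "\<dots> = (\<Sum>r<D b. (\<Sum>s<D (bar b). Z b p s * Zi b s r) * Z (bar b) s' r)"
    by (subst sum.swap) (simp add: sum_distrib_right)
  also have "\<dots> = Z (bar b) s' p"
    using p by (simp add: ZZi sum_delta_left)
  also have "\<dots> = (\<Sum>u<D (bar b). (\<Sum>p'<D b. Zi b u p' * Z b p' s') * Z (bar b) u p)"
    using s by (simp add: ZiZ sum_delta_left)
  also have "\<dots> = (\<Sum>p'<D b. G b p' p * Z b p' s')"
    unfolding G_def sum_distrib_right by (subst sum.swap) (simp add: mult_ac)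
  finally show ?thesis .
qed

lemma V_from_Vtw:
  assumes m: "\<mu> < N b a c" and q: "q \<in> J b a" and e: "e < D c"
  shows "V b a (c, \<mu>) q e = (\<Sum>z<N b a c. kap' b a (c, z) (c, \<mu>) * Vtw b a (c, z) q e)"
proof -
  have "(\<Sum>z<N b a c. kap' b a (c, z) (c, \<mu>) * Vtw b a (c, z) q e) = 
     (\<Sum>z<N b a c. \<Sum>v<N b a c. (kap b a (c, v) (c, z) * kap' b a (c, z) (c, \<mu>)) * V b a (c, v) q e)"
    by (intro sum.cong refl) (use q e in \<open>simp add: Vtw_expand X_I sum_distrib_left mult_ac\<close>)
  also have "\<dots> = (\<Sum>v<N b a c. (if v = \<mu> then 1 else 0) * V b a (c, v) q e)"
    by (subst sum.swap) (use m in \<open>simp add: sum_distrib_right[symmetric] kap_kap'\<close>)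
  finally show ?thesis using m by (simp only: sum_delta_left)
qed

lemma GG_V_Gi:
  assumes m: "\<mu> < N b a c" and p: "p \<in> J b a" and g: "g' < D c"
  shows "(\<Sum>q\<in>J b a. \<Sum>g<D c. GG b a p q * V b a (c, \<mu>) q g * Gi c g g') = (\<Sum>z<N b a c. kap' b a (c, z) (c, \<mu>) * V b a (c, z) p g')"
proof -
  have "(\<Sum>q\<in>J b a. \<Sum>g<D c. GG b a p q * V b a (c, \<mu>) q g * Gi c g g') = 
    (\<Sum>q\<in>J b a. \<Sum>g<D c. \<Sum>z<N b a c. kap' b a (c, z) (c, \<mu>) * GG b a p q * (Vtw b a (c, z) q g * Gi c g g'))"
    by (intro sum.cong refl) (simp add: V_from_Vtw[OF m] sum_distrib_left sum_distrib_right mult_ac)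
  also have "\<dots> = (\<Sum>z<N b a c. \<Sum>q\<in>J b a. kap' b a (c, z) (c, \<mu>) * GG b a p q * (\<Sum>g<D c. Vtw b a (c, z) q g * Gi c g g'))"
    by (rule trans[OF sum3_perm]) (simp add: sum_distrib_left)
  also have "\<dots> = (\<Sum>z<N b a c. \<Sum>q\<in>J b a. \<Sum>u\<in>J b a. kap' b a (c, z) (c, \<mu>) * (GG b a p q * GGi b a q u) * V b a (c, z) u g')"
    using Vtw_Gi[of g' "(c, _)"] g by (simp add: sum_distrib_left mult_ac)
  also have "\<dots> = (\<Sum>z<N b a c. \<Sum>u\<in>J b a. (if p = u then 1 else 0) * (kap' b a (c, z) (c, \<mu>) * V b a (c, z) u g'))"
  proof (rule sum.cong[OF refl])
    fix z
    have "(\<Sum>q\<in>J b a. \<Sum>u\<in>J b a. kap' b a (c, z) (c, \<mu>) * (GG b a p q * GGi b a q u) * V b a (c, z) u g') = 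
      (\<Sum>u\<in>J b a. (\<Sum>q\<in>J b a. GG b a p q * GGi b a q u) * (kap' b a (c, z) (c, \<mu>) * V b a (c, z) u g'))"
      by (subst sum.swap) (simp add: sum_distrib_left sum_distrib_right mult_ac)
    thus "(\<Sum>q\<in>J b a. \<Sum>u\<in>J b a. kap' b a (c, z) (c, \<mu>) * (GG b a p q * GGi b a q u) * V b a (c, z) u g') = 
      (\<Sum>u\<in>J b a. (if p = u then 1 else 0) * (kap' b a (c, z) (c, \<mu>) * V b a (c, z) u g'))"
      using GG_inv(1)[OF p] by simp
  qed
  finally show ?thesis using p by (simp only: sum_delta_J)
qed

lemma G_What_GGi:
  assumes m: "\<mu> < N b a c" and q: "q' \<in> J (bar b) c" and k: "k < D a"
  shows "(\<Sum>k'<D a. \<Sum>q\<in>J (bar b) c. G a k k' * What b a (c, \<mu>) k' q * GGi (bar b) c q q') = 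
     (\<Sum>z<N b a c. kap' b a (c, z) (c, \<mu>) * What b a (c, z) k q')"
proof -
  obtain s' g' where qe: "q' = (s', g')" and s': "s' < D (bar b)" and g': "g' < D c"
    using q by (auto simp: J_def)
  have 1: "(\<Sum>q\<in>J (bar b) c. What b a (c, \<mu>) k' q * GGi (bar b) c q q') = 
     (\<Sum>p'<D b. \<Sum>p<D b. \<Sum>g<D c. Z b p' s' * (G b p' p * V b a (c, \<mu>) (p, k') g * Gi c g g'))" for k'
  proof -
    have "(\<Sum>q\<in>J (bar b) c. What b a (c, \<mu>) k' q * GGi (bar b) c q q') = 
      (\<Sum>s<D (bar b). \<Sum>g<D c. \<Sum>p<D b. (V b a (c, \<mu>) (p, k') g * Gi c g g') * (Z b p s * Gi (bar b) s s'))"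
      by (simp add: sum_J What_def GGi_def qe sum_distrib_left sum_distrib_right mult_ac)
    also have "\<dots> = (\<Sum>g<D c. \<Sum>p<D b. (V b a (c, \<mu>) (p, k') g * Gi c g g') * (\<Sum>s<D (bar b). Z b p s * Gi (bar b) s s'))"
      by (rule trans[OF sum3_perm[symmetric]]) (simp add: sum_distrib_left)
    also have "\<dots> = (\<Sum>g<D c. \<Sum>p<D b. \<Sum>p'<D b. Z b p' s' * (G b p' p * V b a (c, \<mu>) (p, k') g * Gi c g g'))"
      by (intro sum.cong refl) (use s' in \<open>simp add: Z_Gi sum_distrib_left mult_ac\<close>)
    also have "\<dots> = (\<Sum>p'<D b. \<Sum>p<D b. \<Sum>g<D c. Z b p' s' * (G b p' p * V b a (c, \<mu>) (p, k') g * Gi c g g'))"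
      by (rule trans[OF sum3_perm], rule sum.cong[OF refl], rule sum.swap)
    finally show ?thesis .
  qed
  have "(\<Sum>k'<D a. \<Sum>q\<in>J (bar b) c. G a k k' * What b a (c, \<mu>) k' q * GGi (bar b) c q q') = 
    (\<Sum>k'<D a. G a k k' * (\<Sum>q\<in>J (bar b) c. What b a (c, \<mu>) k' q * GGi (bar b) c q q'))"
    by (simp add: sum_distrib_left mult.assoc)
  also have "\<dots> = (\<Sum>k'<D a. \<Sum>p'<D b. \<Sum>p<D b. \<Sum>g<D c. Z b p' s' * (G b p' p * G a k k' * V b a (c, \<mu>) (p, k') g * Gi c g g'))"
    unfolding 1 by (simp add: sum_distrib_left mult_ac)
  also have "\<dots> = (\<Sum>p'<D b. \<Sum>p<D b. \<Sum>k'<D a. \<Sum>g<D c. Z b p' s' * (G b p' p * G a k k' * V b a (c, \<mu>) (p, k') g * Gi c g g'))"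
    by (rule trans[OF sum.swap], rule sum.cong[OF refl], rule sum.swap)
  also have "\<dots> = (\<Sum>p'<D b. Z b p' s' * (\<Sum>q\<in>J b a. \<Sum>g<D c. GG b a (p', k) q * V b a (c, \<mu>) q g * Gi c g g'))"
    by (simp add: sum_J GG_def sum_distrib_left)
  also have "\<dots> = (\<Sum>p'<D b. \<Sum>z<N b a c. kap' b a (c, z) (c, \<mu>) * (Z b p' s' * V b a (c, z) (p', k) g'))"
    by (rule sum.cong[OF refl], subst GG_V_Gi[OF m _ g'])
       (use k in \<open>auto simp: J_def sum_distrib_left mult_ac\<close>)
  also have "\<dots> = (\<Sum>z<N b a c. kap' b a (c, z) (c, \<mu>) * What b a (c, z) k q')"
    by (subst sum.swap) (simp add: What_def qe sum_distrib_left)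
  finally show ?thesis .
qed

text \<open>The twisted pairing of a bent tensor with the rotated channel is computed in two ways:
  on the rotated channel it is governed by \<open>kap\<close> through \<open>kap_GGi\<close>, and on
  the original channel by \<open>kap'\<close> through \<open>G_What_GGi\<close>.\<close>

lemma RA_K: "RA b a c * K (bar b) c a = transpose_mat (K' b a c) * RA b a c"
proof (rule eq_matI)
  fix i j assume "i < dim_row (transpose_mat (K' b a c) * RA b a c)" "j < dim_col (transpose_mat (K' b a c) * RA b a c)"
  hence i: "i < N b a c" and j: "j < N (bar b) c a" by (simp_all add: K'_def RA_def)
  have "(\<Sum>\<nu><N (bar b) c a. rotA b a c i \<nu> * kap (bar b) c (a, \<nu>) (a, j)) = 
     (\<Sum>k'<D a. G a 0 k' * (\<Sum>\<nu><N (bar b) c a. rotA b a c i \<nu> * (kap (bar b) c (a, \<nu>) (a, j) * Gi a k' 0)))"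
  proof -
    have "(\<Sum>k'<D a. G a 0 k' * (\<Sum>\<nu><N (bar b) c a. rotA b a c i \<nu> * (kap (bar b) c (a, \<nu>) (a, j) * Gi a k' 0))) = 
      (\<Sum>k'<D a. G a 0 k' * Gi a k' 0) * (\<Sum>\<nu><N (bar b) c a. rotA b a c i \<nu> * kap (bar b) c (a, \<nu>) (a, j))"
      unfolding sum_product by (simp add: sum_distrib_left mult_ac)
    thus ?thesis using GGi_inv(1)[OF D_pos D_pos, of a] by simp
  qed
  also have "\<dots> = (\<Sum>k'<D a. G a 0 k' * (\<Sum>\<nu><N (bar b) c a. rotA b a c i \<nu> * 
       (\<Sum>q\<in>J (bar b) c. \<Sum>q'\<in>J (bar b) c. W (bar b) c (a, \<nu>) k' q * GGi (bar b) c q q' * V (bar b) c (a, j) q' 0)))"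
    using kap_GGi[of "(a, _)" "bar b" c "(a, j)"] j D_pos[of a] X_I by (intro sum.cong refl) simp
  also have "\<dots> = (\<Sum>k'<D a. \<Sum>q\<in>J (bar b) c. \<Sum>q'\<in>J (bar b) c. G a 0 k' * What b a (c, i) k' q * GGi (bar b) c q q' * V (bar b) c (a, j) q' 0)"
  proof (rule sum.cong[OF refl])
    fix k' assume k': "k' \<in> {..<D a}"
    have "(\<Sum>\<nu><N (bar b) c a. rotA b a c i \<nu> * 
       (\<Sum>q\<in>J (bar b) c. \<Sum>q'\<in>J (bar b) c. W (bar b) c (a, \<nu>) k' q * GGi (bar b) c q q' * V (bar b) c (a, j) q' 0)) = 
      (\<Sum>q\<in>J (bar b) c. \<Sum>q'\<in>J (bar b) c. (\<Sum>\<nu><N (bar b) c a. rotA b a c i \<nu> * W (bar b) c (a, \<nu>) k' q) * (GGi (bar b) c q q' * V (bar b) c (a, j) q' 0))"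
      unfolding sum_distrib_left sum_distrib_right by (rule trans[OF sum3_perm[symmetric]]) (simp add: mult_ac)
    also have "\<dots> = (\<Sum>q\<in>J (bar b) c. \<Sum>q'\<in>J (bar b) c. What b a (c, i) k' q * GGi (bar b) c q q' * V (bar b) c (a, j) q' 0)"
      by (intro sum.cong refl) (use k' in \<open>simp add: What_expand(1)[OF i] mult.assoc\<close>)
    finally show "G a 0 k' * (\<Sum>\<nu><N (bar b) c a. rotA b a c i \<nu> * 
       (\<Sum>q\<in>J (bar b) c. \<Sum>q'\<in>J (bar b) c. W (bar b) c (a, \<nu>) k' q * GGi (bar b) c q q' * V (bar b) c (a, j) q' 0)) = 
       (\<Sum>q\<in>J (bar b) c. \<Sum>q'\<in>J (bar b) c. G a 0 k' * What b a (c, i) k' q * GGi (bar b) c q q' * V (bar b) c (a, j) q' 0)"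
      by (simp add: sum_distrib_left mult.assoc)
  qed
  also have "\<dots> = (\<Sum>q'\<in>J (bar b) c. (\<Sum>k'<D a. \<Sum>q\<in>J (bar b) c. G a 0 k' * What b a (c, i) k' q * GGi (bar b) c q q') * V (bar b) c (a, j) q' 0)"
    by (rule trans[OF sum3_perm]) (simp add: sum_distrib_right)
  also have "\<dots> = (\<Sum>q'\<in>J (bar b) c. \<Sum>z<N b a c. kap' b a (c, z) (c, i) * (What b a (c, z) 0 q' * V (bar b) c (a, j) q' 0))"
    by (rule sum.cong[OF refl], subst G_What_GGi[OF i _ D_pos]) (simp_all add: sum_distrib_right mult.assoc)
  also have "\<dots> = (\<Sum>z<N b a c. kap' b a (c, z) (c, i) * rotA b a c z j)"
    by (subst sum.swap) (simp add: sum_distrib_left rotA_def)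
  finally show "(RA b a c * K (bar b) c a) $$ (i, j) = (transpose_mat (K' b a c) * RA b a c) $$ (i, j)"
    using i j by (simp add: RA_def K_def K'_def scalar_prod_def lessThan_atLeast0[symmetric])
qed (simp_all add: RA_def K_def K'_def)

text \<open>As RA is invertible, \<open>RA_K\<close> is a similarity between the kernel of the
  rotated channel and the transposed inverse kernel of the original one.\<close>

theorem trace_rot: "mtrace (K (bar b) c a) = mtrace (K' b a c)"
proof -
  let ?n = "N b a c"
  have c: "RA b a c \<in> carrier_mat ?n ?n" "RB b a c \<in> carrier_mat ?n ?n" "K (bar b) c a \<in> carrier_mat ?n ?n" 
    "transpose_mat (K' b a c) \<in> carrier_mat ?n ?n"
    using K_carrier(3,4)[of b a c] K_carrier(1)[of "bar b" c a] by (simp_all add: N_rot)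
  have "K (bar b) c a = RB b a c * RA b a c * K (bar b) c a" unfolding RB_RA using c by simp
  also have "\<dots> = RB b a c * (transpose_mat (K' b a c) * RA b a c)"
    unfolding RA_K[symmetric] by (rule assoc_mult_mat[OF c(2,1,3)])
  finally have "mtrace (K (bar b) c a) = mtrace (RB b a c * (transpose_mat (K' b a c) * RA b a c))" by simp
  also have "\<dots> = mtrace (transpose_mat (K' b a c) * RA b a c * RB b a c)"
    by (rule mtrace_mult_commute[OF c(2) mult_carrier_mat[OF c(4,1)]])
  also have "\<dots> = mtrace (transpose_mat (K' b a c))"
    unfolding assoc_mult_mat[OF c(4,1,2)] RA_RB right_mult_one_mat[OF c(4)] ..
  also have "\<dots> = mtrace (K' b a c)" by (simp add: mtrace_def K'_def)
  finally show ?thesis .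
qed

text \<open>The coefficient form of the integral property. Bending exchanges the channels b a
  \<rightarrow> c and bar b c \<rightarrow> a; the weight G_a on one side becomes G_c on the other
  because the tensors are twisted on the way, and RB RA = 1 replaces one pair of dual bases by the
  other.\<close>

theorem rotation_identity:
  assumes p: "p < D b" and q: "q < D b" and k: "k < D a" and i: "i < D a" and g: "\<gamma> < D c" and d: "\<delta> < D c"
  shows "w a * (\<Sum>\<mu><N b a c. V b a (c, \<mu>) (p, k) \<gamma> * (\<Sum>j<D a. W b a (c, \<mu>) \<delta> (q, j) * G a j i)) = 
    w c * (\<Sum>\<nu><N (bar b) c a. (\<Sum>s'<D (bar b). W (bar b) c (a, \<nu>) k (s', \<gamma>) * Zi b s' p) * 
       (\<Sum>s<D (bar b). \<Sum>g'<D c. G c \<delta> g' * Z b q s * V (bar b) c (a, \<nu>) (s, g') i))"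
proof -
  have 1: "(\<Sum>s'<D (bar b). What b a (c, \<mu>) k (s', \<gamma>) * Zi b s' p) = V b a (c, \<mu>) (p, k) \<gamma>" for \<mu>
  proof -
    have "(\<Sum>s'<D (bar b). What b a (c, \<mu>) k (s', \<gamma>) * Zi b s' p) = (\<Sum>p'<D b. V b a (c, \<mu>) (p', k) \<gamma> * (\<Sum>s'<D (bar b). Z b p' s' * Zi b s' p))"
      unfolding What_def sum_distrib_left sum_distrib_right by (subst sum.swap) (simp add: mult_ac)
    also have "\<dots> = (\<Sum>p'<D b. V b a (c, \<mu>) (p', k) \<gamma> * (if p' = p then 1 else 0))"
      by (intro sum.cong refl) (use p in \<open>simp add: ZZi\<close>)
    finally show ?thesis using p by (simp only: sum_delta_left)
  qed
  \<comment> \<open>The combination with \<open>kap'\<close> converts W into \<open>Wtw\<close>, so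
    that the weights in the statement can be supplied by \<open>G_Wtw\<close>. It is also the
    combination built into \<open>RB\<close>.\<close>
  define Vh where "Vh \<mu> u = (\<Sum>z<N b a c. kap' b a (c, \<mu>) (c, z) * Vhat b a (c, z) u i)" for \<mu> u
  have Vh: "Vh \<mu> (s, g') = (\<Sum>r<D b. Wtw b a (c, \<mu>) g' (r, i) * Zi (bar b) r s)" if m: "\<mu> < N b a c" and g': "g' < D c" for \<mu> s g'
  proof -
    have "Vh \<mu> (s, g') = (\<Sum>r<D b. (\<Sum>z<N b a c. kap' b a (c, \<mu>) (c, z) * W b a (c, z) g' (r, i)) * Zi (bar b) r s)"
      unfolding Vh_def Vhat_def sum_distrib_left sum_distrib_right by (subst sum.swap) (simp add: mult_ac)
    thus ?thesis using Wtw_expand[OF X_I[OF m], of _ g'] g' i by (simp add: J_def)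
  qed
  have 2: "(\<Sum>s<D (bar b). \<Sum>g'<D c. G c \<delta> g' * Z b q s * Vh \<mu> (s, g')) = (\<Sum>j<D a. W b a (c, \<mu>) \<delta> (q, j) * G a j i)"
    if m: "\<mu> < N b a c" for \<mu>
  proof -
    have "(\<Sum>s<D (bar b). \<Sum>g'<D c. G c \<delta> g' * Z b q s * Vh \<mu> (s, g')) = 
      (\<Sum>s<D (bar b). \<Sum>g'<D c. \<Sum>r<D b. G c \<delta> g' * Wtw b a (c, \<mu>) g' (r, i) * (Zi (bar b) r s * Z b q s))"
      by (intro sum.cong refl) (use m in \<open>simp add: Vh sum_distrib_left mult_ac\<close>)
    also have "\<dots> = (\<Sum>g'<D c. \<Sum>r<D b. G c \<delta> g' * Wtw b a (c, \<mu>) g' (r, i) * Gi b r q)"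
      by (rule trans[OF sum3_perm[symmetric]]) (simp add: sum_distrib_left Gi_def)
    also have "\<dots> = (\<Sum>r<D b. (\<Sum>g'<D c. G c \<delta> g' * Wtw b a (c, \<mu>) g' (r, i)) * Gi b r q)"
      by (subst sum.swap) (simp add: sum_distrib_right)
    also have "\<dots> = (\<Sum>r<D b. \<Sum>q0<D b. \<Sum>j<D a. W b a (c, \<mu>) \<delta> (q0, j) * G a j i * (G b q0 r * Gi b r q))"
      using G_Wtw[of \<delta> "(c, \<mu>)" b a] d by (simp add: sum_J GG_def sum_distrib_left sum_distrib_right mult_ac)
    also have "\<dots> = (\<Sum>q0<D b. \<Sum>j<D a. W b a (c, \<mu>) \<delta> (q0, j) * G a j i * (\<Sum>r<D b. G b q0 r * Gi b r q))"
      unfolding sum_distrib_left by (rule sum3_perm[symmetric])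
    also have "\<dots> = (\<Sum>q0<D b. (\<Sum>j<D a. W b a (c, \<mu>) \<delta> (q0, j) * G a j i) * (if q0 = q then 1 else 0))"
      unfolding sum_distrib_right by (intro sum.cong refl) (use q in \<open>simp add: GGi_inv\<close>)
    finally show ?thesis using q by (simp only: sum_delta_left)
  qed
  \<comment> \<open>Up to the factor w_c / w_a, bent tensors and rotated fusion tensors are related
    by mutually inverse matrices, hence give the same sum over the multiplicity space.\<close>
  have I: "w a * (\<Sum>\<mu><N b a c. What b a (c, \<mu>) k u * Vh \<mu> v) = w c * (\<Sum>\<nu><N (bar b) c a. W (bar b) c (a, \<nu>) k u * V (bar b) c (a, \<nu>) v i)"
    if u: "u \<in> J (bar b) c" and v: "v \<in> J (bar b) c" for u v
  proof -
    let ?n = "N b a c"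
    have rb: "(\<Sum>\<mu><?n. RB b a c $$ (l, \<mu>) * RA b a c $$ (\<mu>, \<nu>)) = (if l = \<nu> then 1 else 0)" if ln: "l < ?n" "\<nu> < ?n" for l \<nu>
    proof -
      have "(RB b a c * RA b a c) $$ (l, \<nu>) = (if l = \<nu> then 1 else 0)" unfolding RB_RA using ln by simp
      moreover have "(RB b a c * RA b a c) $$ (l, \<nu>) = (\<Sum>\<mu><?n. RB b a c $$ (l, \<mu>) * RA b a c $$ (\<mu>, \<nu>))"
        using ln by (simp add: RA_def RB_def scalar_prod_def lessThan_atLeast0[symmetric] N_rot)
      ultimately show ?thesis by simp
    qed
    have Vhe: "w a * Vh \<mu> v = w c * (\<Sum>l<?n. RB b a c $$ (l, \<mu>) * V (bar b) c (a, l) v i)" if m: "\<mu> < ?n" for \<mu>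
    proof -
      have "w a * Vh \<mu> v = (\<Sum>z<?n. \<Sum>l<?n. w c * (w a / w c * (kap' b a (c, \<mu>) (c, z) * rotB b a c z l)) * V (bar b) c (a, l) v i)"
        unfolding Vh_def sum_distrib_left
        by (intro sum.cong refl) (use w_nz[of c] v i in \<open>simp add: Vhat_expand N_rot sum_distrib_left mult_ac\<close>)
      also have "\<dots> = w c * (\<Sum>l<?n. RB b a c $$ (l, \<mu>) * V (bar b) c (a, l) v i)"
        unfolding sum_distrib_left by (subst sum.swap, rule sum.cong[OF refl]) 
          (use m in \<open>simp add: w_nz RB_def N_rot sum_distrib_left sum_distrib_right mult_ac\<close>)
      finally show ?thesis .
    qed
    have Whe: "What b a (c, \<mu>) k u = (\<Sum>\<nu><?n. RA b a c $$ (\<mu>, \<nu>) * W (bar b) c (a, \<nu>) k u)" if m: "\<mu> < ?n" for \<mu>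
      using What_expand(1)[OF m u k] m by (simp add: RA_def N_rot)
    have "w a * (\<Sum>\<mu><?n. What b a (c, \<mu>) k u * Vh \<mu> v) = (\<Sum>\<mu><?n. What b a (c, \<mu>) k u * (w a * Vh \<mu> v))"
      by (simp add: sum_distrib_left mult_ac)
    also have "\<dots> = (\<Sum>\<mu><?n. \<Sum>\<nu><?n. \<Sum>l<?n. w c * (W (bar b) c (a, \<nu>) k u * V (bar b) c (a, l) v i * (RB b a c $$ (l, \<mu>) * RA b a c $$ (\<mu>, \<nu>))))"
      by (rule sum.cong[OF refl], subst sum.swap) (simp add: Vhe Whe sum_distrib_left sum_distrib_right mult_ac)
    also have "\<dots> = (\<Sum>\<nu><?n. \<Sum>l<?n. w c * (W (bar b) c (a, \<nu>) k u * V (bar b) c (a, l) v i * (\<Sum>\<mu><?n. RB b a c $$ (l, \<mu>) * RA b a c $$ (\<mu>, \<nu>))))"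
      unfolding sum_distrib_left by (rule sum3_perm[symmetric])
    also have "\<dots> = (\<Sum>\<nu><?n. \<Sum>l<?n. (w c * (W (bar b) c (a, \<nu>) k u * V (bar b) c (a, l) v i)) * (if l = \<nu> then 1 else 0))"
      by (intro sum.cong refl) (simp add: rb)
    also have "\<dots> = (\<Sum>\<nu><?n. w c * (W (bar b) c (a, \<nu>) k u * V (bar b) c (a, \<nu>) v i))"
      by (intro sum.cong refl) (simp only: sum_delta_left lessThan_iff)
    finally show ?thesis by (simp add: N_rot sum_distrib_left)
  qed
  have "w a * (\<Sum>\<mu><N b a c. V b a (c, \<mu>) (p, k) \<gamma> * (\<Sum>j<D a. W b a (c, \<mu>) \<delta> (q, j) * G a j i)) = 
     w a * (\<Sum>\<mu><N b a c. (\<Sum>s'<D (bar b). What b a (c, \<mu>) k (s', \<gamma>) * Zi b s' p) * 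
        (\<Sum>s<D (bar b). \<Sum>g'<D c. G c \<delta> g' * Z b q s * Vh \<mu> (s, g')))"
    by (simp add: 1 2)
  also have "\<dots> = (\<Sum>s'<D (bar b). \<Sum>s<D (bar b). \<Sum>g'<D c. (Zi b s' p * (G c \<delta> g' * Z b q s)) * (w a * (\<Sum>\<mu><N b a c. What b a (c, \<mu>) k (s', \<gamma>) * Vh \<mu> (s, g'))))"
    unfolding sum_distrib_left sum_distrib_right 
    by (rule trans[OF sum4_perm], rule trans[OF sum3_perm]) (simp add: mult_ac)
  also have "\<dots> = (\<Sum>s'<D (bar b). \<Sum>s<D (bar b). \<Sum>g'<D c. (Zi b s' p * (G c \<delta> g' * Z b q s)) * 
       (w c * (\<Sum>\<nu><N (bar b) c a. W (bar b) c (a, \<nu>) k (s', \<gamma>) * V (bar b) c (a, \<nu>) (s, g') i)))"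
    by (intro sum.cong refl) (use g in \<open>simp add: I J_def\<close>)
  also have "\<dots> = w c * (\<Sum>\<nu><N (bar b) c a. (\<Sum>s'<D (bar b). W (bar b) c (a, \<nu>) k (s', \<gamma>) * Zi b s' p) * 
       (\<Sum>s<D (bar b). \<Sum>g'<D c. G c \<delta> g' * Z b q s * V (bar b) c (a, \<nu>) (s, g') i))"
    unfolding sum_distrib_left sum_distrib_right 
    by (rule trans[OF sum3_perm[symmetric]], rule trans[OF sum4_perm[symmetric]]) (simp add: mult_ac)
  finally show ?thesis .
qed

end

text \<open>(1 + A) / 2 is idempotent, so the trace of A has the form 2 k - n with a natural number
  k.\<close>

lemma involution_trace_real:
  assumes A: "A \<in> carrier_mat n n" and AA: "A * A = 1\<^sub>m n"
  shows "cnj (mtrace A) = mtrace A"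
proof -
  define B where "B = 1\<^sub>m n + A"
  have B: "B \<in> carrier_mat n n" unfolding B_def using A by simp
  have "B * B = 1\<^sub>m n * B + A * B" unfolding B_def
    by (rule add_mult_distrib_mat[OF _ A]) (use A in auto)
  also have "A * B = A * 1\<^sub>m n + A * A" unfolding B_def
    by (rule mult_add_distrib_mat[OF A _ A]) auto
  also have "1\<^sub>m n * B + (A * 1\<^sub>m n + A * A) = 2 \<cdot>\<^sub>m B"
    unfolding AA right_mult_one_mat[OF A] left_mult_one_mat[OF B] unfolding B_def by (rule eq_matI) (use A in auto)
  finally have BB: "B * B = 2 \<cdot>\<^sub>m B" .
  have "((1/2) \<cdot>\<^sub>m B) * ((1/2) \<cdot>\<^sub>m B) = (1/2) \<cdot>\<^sub>m (B * ((1/2) \<cdot>\<^sub>m B))"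
    by (rule mult_smult_assoc_mat[OF B]) (use B in auto)
  also have "B * ((1/2) \<cdot>\<^sub>m B) = (1/2) \<cdot>\<^sub>m (B * B)" by (rule mult_smult_distrib[OF B B])
  also have "(1/2) \<cdot>\<^sub>m ((1/2) \<cdot>\<^sub>m (B * B)) = (1/2) \<cdot>\<^sub>m B" unfolding BB by (rule eq_matI) auto
  finally obtain k where k: "mtrace ((1/2) \<cdot>\<^sub>m B) = of_nat k"
    using mtrace_idempotent[of "(1/2) \<cdot>\<^sub>m B" n] B by auto
  have "mtrace ((1/2) \<cdot>\<^sub>m B) = (of_nat n + mtrace A) / 2"
    using A by (simp add: mtrace_def B_def sum.distrib add_divide_distrib sum_divide_distrib)
  hence "mtrace A = 2 * of_nat k - of_nat n" unfolding k by (simp add: field_simps)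
  thus ?thesis by simp
qed

context fusion_core begin

lemma sum_X: "(\<Sum>x\<in>X b a. f x) = (\<Sum>c\<in>UNIV. \<Sum>\<mu><N b a c. f (c, \<mu>))"
  unfolding X_def by (subst sum.Sigma) auto

lemma mtrace_K: "mtrace (K b a c) = (\<Sum>\<mu><N b a c. kap b a (c, \<mu>) (c, \<mu>))" 
  and mtrace_K': "mtrace (K' b a c) = (\<Sum>\<mu><N b a c. kap' b a (c, \<mu>) (c, \<mu>))"
  by (simp_all add: mtrace_def K_def K'_def)

lemma S_t: assumes i: "i < D b" and j: "j < D b"
  shows "S (t b i j) = (\<Sum>s<D (bar b). \<Sum>s'<D (bar b). (Z b j s * Zi b s' i) *s t (bar b) s s')"
proof -
  have "(\<Sum>s<D (bar b). \<Sum>s'<D (bar b). (Z b j s * Zi b s' i) *s t (bar b) s s') = 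
     (\<Sum>s'<D (bar b). Zi b s' i *s (\<Sum>s<D (bar b). Z b j s *s t (bar b) s s'))"
    by (subst sum.swap) (simp add: scale_sum_right mult.commute)
  also have "\<dots> = (\<Sum>s'<D (bar b). Zi b s' i *s (\<Sum>p<D b. Z b p s' *s S (t b p j)))"
    by (intro sum.cong refl) (use j in \<open>simp add: conjA\<close>)
  also have "\<dots> = (\<Sum>p<D b. (\<Sum>s'<D (bar b). Z b p s' * Zi b s' i) *s S (t b p j))"
    unfolding scale_sum_right scale_sum_left by (subst sum.swap) (simp add: mult.commute)
  also have "\<dots> = (\<Sum>p<D b. if p = i then S (t b p j) else 0)"
    by (intro sum.cong refl) (use i in \<open>simp add: ZZi\<close>)
  finally show ?thesis using i by simp
qed

end

section \<open>Dimensions and the integral\<close>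

locale fusion_core_dim = fusion_core sc m D t eps N V W S ES bar Z Zi w ou r ET l sig
  for sc :: "complex \<Rightarrow> 'a::ab_group_add \<Rightarrow> 'a" (infixr \<open>*s\<close> 75) 
    and m :: "'a \<Rightarrow> 'a \<Rightarrow> 'a" (infixl \<open>\<odot>\<close> 70)
    and D :: "'i::finite \<Rightarrow> nat" and t :: "'i \<Rightarrow> nat \<Rightarrow> nat \<Rightarrow> 'a" and eps :: "'a \<Rightarrow> complex"
    and N :: "'i \<Rightarrow> 'i \<Rightarrow> 'i \<Rightarrow> nat"
    and V :: "'i \<Rightarrow> 'i \<Rightarrow> 'i \<times> nat \<Rightarrow> nat \<times> nat \<Rightarrow> nat \<Rightarrow> complex"
    and W :: "'i \<Rightarrow> 'i \<Rightarrow> 'i \<times> nat \<Rightarrow> nat \<Rightarrow> nat \<times> nat \<Rightarrow> complex"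
    and S :: "'a \<Rightarrow> 'a" and ES :: "'a \<Rightarrow> 'a" and bar :: "'i \<Rightarrow> 'i" 
    and Z Zi :: "'i \<Rightarrow> nat \<Rightarrow> nat \<Rightarrow> complex" and w :: "'i \<Rightarrow> complex" and ou :: "'i \<Rightarrow> 'a" and r :: "'i \<Rightarrow> 'i"
    and ET :: "'a \<Rightarrow> 'a" and l :: "'i \<Rightarrow> 'i" and sig :: "'a \<Rightarrow> 'a" +
  fixes d :: "'i \<Rightarrow> complex"
  assumes d2: "d a ^ 2 = w a * w (bar a)" and d_bar: "d (bar a) = d a"
begin

lemma d_nz [simp]: "d a \<noteq> 0" using d2[of a] w_nz by auto
lemma w_nz' [simp]: "w a \<noteq> 0" by (rule w_nz)

lemma dd: "d a * d a = w a * w (bar a)" using d2[of a] by (simp add: power2_eq_square)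

text \<open>A square root of the factor in \<open>kap_relation\<close>, made available by the chosen
  \<open>d\<close>. From K = rho^2 K' and K' K = 1 it follows that rho K' squares to the identity;
  \<open>tau\<close> is the trace of this involution.\<close>

definition rho where "rho b a c = d b * d a * w (bar c) / (w (bar b) * w (bar a) * d c)"
definition tau where "tau b a c = rho b a c * mtrace (K' b a c)"

lemma rho_rho: "rho b a c * rho b a c = w (bar c) * w b * w a / (w c * w (bar a) * w (bar b))"
proof -
  have "rho b a c * rho b a c = (d b * d b) * (d a * d a) * (w (bar c) * w (bar c)) / ((w (bar b) * w (bar a)) * (w (bar b) * w (bar a)) * (d c * d c))"
    by (simp add: rho_def mult_ac)
  thus ?thesis unfolding dd by (simp add: field_simps)
qed

lemma K_rho: "K b a c = (rho b a c * rho b a c) \<cdot>\<^sub>m K' b a c"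
proof (rule eq_matI)
  fix i j assume "i < dim_row ((rho b a c * rho b a c) \<cdot>\<^sub>m K' b a c)" "j < dim_col ((rho b a c * rho b a c) \<cdot>\<^sub>m K' b a c)"
  hence ij: "i < N b a c" "j < N b a c" by (simp_all add: K'_def)
  show "K b a c $$ (i, j) = ((rho b a c * rho b a c) \<cdot>\<^sub>m K' b a c) $$ (i, j)"
    unfolding rho_rho using kap_relation[OF X_I[OF ij(2)] X_I[OF ij(1)]] ij by (simp add: K_def K'_def field_simps)
qed (simp_all add: K_def K'_def)

lemma trace_K: "mtrace (K b a c) = rho b a c * tau b a c"
  unfolding K_rho by (simp add: tau_def mtrace_def K'_def sum_distrib_left mult.assoc)

text \<open>The normalized kernel is an involution, so its trace is an integer.\<close>
lemma tau_real: "cnj (tau b a c) = tau b a c"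
proof -
  let ?K = "rho b a c \<cdot>\<^sub>m K' b a c"
  have "?K * ?K = rho b a c \<cdot>\<^sub>m (K' b a c * ?K)"
    by (rule mult_smult_assoc_mat[OF K_carrier(2) smult_carrier_mat[OF K_carrier(2)]])
  also have "\<dots> = rho b a c \<cdot>\<^sub>m (rho b a c \<cdot>\<^sub>m (K' b a c * K' b a c))"
    by (subst mult_smult_distrib[OF K_carrier(2) K_carrier(2)]) (rule refl)
  also have "\<dots> = (rho b a c * rho b a c) \<cdot>\<^sub>m (K' b a c * K' b a c)"
    by (rule eq_matI) auto
  also have "\<dots> = K' b a c * K b a c" 
    unfolding K_rho by (rule mult_smult_distrib[OF K_carrier(2) K_carrier(2), symmetric])
  finally have "?K * ?K = 1\<^sub>m (N b a c)" unfolding K'_K .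
  from involution_trace_real[OF _ this] have "cnj (mtrace ?K) = mtrace ?K" by simp
  moreover have "mtrace ?K = tau b a c" by (simp add: mtrace_def tau_def K'_def sum_distrib_left)
  ultimately show ?thesis by simp
qed

lemma tau_zero: "N b a c = 0 \<Longrightarrow> tau b a c = 0"
  by (simp add: tau_def mtrace_def K'_def)

text \<open>This is \<open>kap_sum\<close> after renormalization: d_c^2 = w_c w_{bar c} turns the
  weights w_c into d_c, and the remaining factors do not depend on c.\<close>

lemma tau_sum: assumes lr: "l a = r b" shows "(\<Sum>c\<in>UNIV. tau b a c * d c) = d b * d a"
proof -
  have "w b * w a = (\<Sum>c\<in>UNIV. mtrace (K b a c) * w c)"
    using kap_sum[OF lr] by (simp add: sum_X mtrace_K sum_distrib_right)
  also have "\<dots> = (\<Sum>c\<in>UNIV. d b * d a / (w (bar b) * w (bar a)) * (tau b a c * d c))"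
  proof (rule sum.cong[OF refl])
    fix c
    have "w c * w (bar c) / d c = d c" using dd[of c] by (simp add: field_simps)
    moreover have "mtrace (K b a c) * w c = d b * d a / (w (bar b) * w (bar a)) * (tau b a c * (w c * w (bar c) / d c))"
      by (simp add: trace_K rho_def)
    ultimately show "mtrace (K b a c) * w c = d b * d a / (w (bar b) * w (bar a)) * (tau b a c * d c)" by simp
  qed
  finally have "w b * w a = d b * d a / (w (bar b) * w (bar a)) * (\<Sum>c\<in>UNIV. tau b a c * d c)" 
    by (simp add: sum_distrib_left)
  hence "d b * d a * (\<Sum>c\<in>UNIV. tau b a c * d c) = (w b * w (bar b)) * (w a * w (bar a))" by (simp add: field_simps)
  also have "\<dots> = d b * d a * (d b * d a)" unfolding dd[symmetric] by (simp add: mult_ac)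
  finally show ?thesis by (simp only: mult_cancel_left) simp
qed

text \<open>The normalizing factors of a channel and of its rotation multiply to 1, so
  \<open>trace_rot\<close> becomes an exact symmetry of \<open>tau\<close>.\<close>

lemma tau_rot: "tau (bar b) c a = tau b a c"
proof -
  have "rho (bar b) c a * tau (bar b) c a = mtrace (K' b a c)" using trace_rot[of b c a] by (simp add: trace_K)
  hence "tau b a c = rho b a c * rho (bar b) c a * tau (bar b) c a" by (simp add: tau_def)
  moreover have "rho b a c * rho (bar b) c a = 1"
  proof -
    have "rho b a c * rho (bar b) c a = (d b * d b) / (w b * w (bar b))"
      by (simp add: rho_def d_bar bar_bar field_simps)
    thus ?thesis unfolding dd by simp
  qed
  ultimately show ?thesis by simp
qed

lemma tau_sum_mid: assumes "l c = l b" shows "(\<Sum>a\<in>UNIV. tau b a c * d a) = d b * d c"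
  using tau_sum[of c "bar b"] assms by (simp add: tau_rot d_bar r_bar)

text \<open>Multiply \<open>tau_sum\<close> by \<phi>(d a), sum over a, exchange the sums and apply
  \<open>tau_sum_mid\<close> under \<phi>. The map \<phi> stands for the identity, which compares
  left and right denominators, and for complex conjugation, which fixes \<open>tau\<close> as well
  and gives positivity.\<close>

lemma class_sum:
  assumes \<phi>_sum: "\<And>f. \<phi> (\<Sum>a\<in>(UNIV :: 'i set). f a) = (\<Sum>a\<in>UNIV. \<phi> (f a))" 
    and \<phi>_mult: "\<And>x y. \<phi> (x * y) = \<phi> x * \<phi> y" and \<phi>_tau: "\<And>a c. \<phi> (tau b a c) = tau b a c"
  shows "d b * (\<Sum>a\<in>{a. l a = r b}. d a * \<phi> (d a)) = \<phi> (d b) * (\<Sum>c\<in>{c. l c = l b}. d c * \<phi> (d c))"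
proof -
  \<comment> \<open>Outside the classes the multiplicity vanishes, so sums over a class can be
    extended to all labels and restricted again.\<close>
  have t0: "tau b a c = 0" if "l a \<noteq> r b \<or> l c \<noteq> l b" for a c using sel[of b a c] tau_zero[of b a c] that by metis
  have "d b * (\<Sum>a\<in>{a. l a = r b}. d a * \<phi> (d a)) = (\<Sum>a\<in>{a. l a = r b}. (\<Sum>c\<in>UNIV. tau b a c * d c) * \<phi> (d a))"
    unfolding sum_distrib_left by (intro sum.cong refl) (simp add: tau_sum)
  also have "\<dots> = (\<Sum>a\<in>UNIV. (\<Sum>c\<in>UNIV. tau b a c * d c) * \<phi> (d a))"
    by (rule sum.mono_neutral_left) (auto simp: t0)
  also have "\<dots> = (\<Sum>c\<in>UNIV. d c * (\<Sum>a\<in>UNIV. tau b a c * \<phi> (d a)))"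
    unfolding sum_distrib_left sum_distrib_right by (subst sum.swap) (simp add: mult_ac)
  also have "\<dots> = (\<Sum>c\<in>{c. l c = l b}. d c * (\<Sum>a\<in>UNIV. tau b a c * \<phi> (d a)))"
    by (rule sum.mono_neutral_right) (auto simp: t0)
  also have "\<dots> = (\<Sum>c\<in>{c. l c = l b}. d c * \<phi> (d b * d c))"
    by (rule sum.cong[OF refl]) (simp add: tau_sum_mid[symmetric] \<phi>_sum \<phi>_mult \<phi>_tau)
  finally show ?thesis by (simp add: \<phi>_mult sum_distrib_left mult_ac)
qed

definition DD where "DD e = (\<Sum>x\<in>{x. l x = e}. d x ^ 2)"

lemma DD_lr: "DD (l b) = DD (r b)"
  using class_sum[of "\<lambda>x. x" b] by (simp add: DD_def power2_eq_square)

text \<open>Complex conjugation in \<open>class_sum\<close> expresses d_b^2 as |d_b|^2 times a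
  quotient of two class sums of squared moduli. Both are positive: the class of l b contains
  \<open>b\<close>, that of r b contains \<open>bar b\<close>, and no \<open>d\<close>
  vanishes.\<close>

lemma d2_pos: "\<exists>x>0. d b ^ 2 = complex_of_real x"
proof -
  define L where "L e = (\<Sum>a\<in>{a. l a = e}. (cmod (d a))\<^sup>2)" for e
  have L: "complex_of_real (L e) = (\<Sum>a\<in>{a. l a = e}. d a * cnj (d a))" for e
    by (simp add: L_def complex_norm_square del: of_real_power)
  have Lp: "L (l c) > 0" for c unfolding L_def by (rule sum_pos) auto
  have "d b * complex_of_real (L (r b)) = cnj (d b) * complex_of_real (L (l b))"
    unfolding L by (rule class_sum) (simp_all add: tau_real)
  hence "d b * d b * complex_of_real (L (r b)) = (d b * cnj (d b)) * complex_of_real (L (l b))" by simp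
  also have "\<dots> = complex_of_real ((cmod (d b))\<^sup>2 * L (l b))" by (simp only: complex_norm_square[symmetric] of_real_mult)
  finally have "d b ^ 2 = complex_of_real ((cmod (d b))\<^sup>2 * L (l b) / L (r b))"
    using Lp[of "bar b"] by (simp add: l_bar field_simps power2_eq_square)
  moreover have "(cmod (d b))\<^sup>2 * L (l b) / L (r b) > 0" using Lp[of b] Lp[of "bar b"] by (simp add: l_bar)
  ultimately show ?thesis by blast
qed

lemma DD_nz: "DD (l a) \<noteq> 0"
proof -
  obtain x where x: "\<And>b. x b > (0::real)" "\<And>b. d b ^ 2 = complex_of_real (x b)" using d2_pos by metis
  have "DD (l a) = complex_of_real (\<Sum>b\<in>{b. l b = l a}. x b)" by (simp add: DD_def x(2))
  moreover have "(\<Sum>b\<in>{b. l b = l a}. x b) > 0" by (rule sum_pos) (auto simp: x(1))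
  ultimately show ?thesis by (metis of_real_eq_0_iff less_irrefl)
qed

text \<open>The coefficient of the G-weighted trace of t^a in \<Lambda>: the d_a in the formula for
  \<Lambda> and the factor d_a / w_{bar a} in \<open>g\<close> multiply to w_a.\<close>

definition cc where "cc a = w a / DD (l a)"

lemma cc_nz: "cc a \<noteq> 0" by (simp add: cc_def DD_nz)

text \<open>On a nonzero channel all denominators coincide by \<open>DD_lr\<close>. In terms of
  \<open>tau\<close>, the inner sum is d_b d_c by \<open>tau_sum_mid\<close>, and the remaining sum
  of d_b^2 cancels one of the two denominators.\<close>

lemma cc_sum: "(\<Sum>b\<in>UNIV. \<Sum>a\<in>UNIV. cc b * cc a * mtrace (K' b a c)) = cc c"
proof -
  let ?D = "DD (l c)"
  have e: "cc b * cc a * mtrace (K' b a c) = d c / (w (bar c) * ?D * ?D) * (d b * (tau b a c * d a))" for a b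
  proof (cases "N b a c = 0")
    case True thus ?thesis by (simp add: tau_zero mtrace_def K'_def)
  next
    case False
    hence s: "r b = l a" "l c = l b" using sel by auto
    have "DD (l b) = ?D" "DD (l a) = ?D" using s DD_lr[of b] by simp_all
    moreover have "mtrace (K' b a c) = w (bar b) * w (bar a) * d c / (d b * d a * w (bar c)) * tau b a c"
      by (simp add: tau_def rho_def)
    ultimately have "cc b * cc a * mtrace (K' b a c) = (w b * w (bar b)) * (w a * w (bar a)) * d c / (d b * d a * w (bar c) * ?D * ?D) * tau b a c"
      by (simp add: cc_def mult_ac)
    also have "\<dots> = d c / (w (bar c) * ?D * ?D) * (d b * (tau b a c * d a))"
      unfolding dd[symmetric] by (simp add: field_simps)
    finally show ?thesis .
  qed
  have t0: "tau b a c = 0" if "l c \<noteq> l b" for a b using sel[of b a c] tau_zero[of b a c] that by metis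
  have "(\<Sum>b\<in>UNIV. \<Sum>a\<in>UNIV. cc b * cc a * mtrace (K' b a c)) = 
    d c / (w (bar c) * ?D * ?D) * (\<Sum>b\<in>UNIV. d b * (\<Sum>a\<in>UNIV. tau b a c * d a))"
    unfolding e by (simp add: sum_distrib_left)
  also have "(\<Sum>b\<in>UNIV. d b * (\<Sum>a\<in>UNIV. tau b a c * d a)) = (\<Sum>b\<in>{b. l b = l c}. d b * (\<Sum>a\<in>UNIV. tau b a c * d a))"
    by (rule sum.mono_neutral_right) (auto simp: t0)
  also have "\<dots> = (\<Sum>b\<in>{b. l b = l c}. d b * (d b * d c))"
    by (rule sum.cong[OF refl]) (simp add: tau_sum_mid)
  also have "\<dots> = ?D * d c" by (simp add: DD_def sum_distrib_right power2_eq_square mult.assoc)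
  also have "d c / (w (bar c) * ?D * ?D) * (?D * d c) = (d c * d c) / (w (bar c) * ?D)" using DD_nz[of c] by (simp add: field_simps)
  also have "\<dots> = cc c" unfolding dd by (simp add: cc_def)
  finally show ?thesis .
qed

definition Lam where "Lam = (\<Sum>a\<in>UNIV. cc a *s (\<Sum>i<D a. \<Sum>j<D a. G a i j *s t a j i))"

text \<open>Under fusion, each channel contributes W (G \<otimes> G) V, which is \<open>kap'\<close>
  times G. The trace pairs a channel with itself, so only the diagonal of \<open>kap'\<close>
  enters.\<close>

lemma product_trace:
  "(\<Sum>i<D b. \<Sum>j<D b. G b i j *s t b j i) \<odot> (\<Sum>i<D a. \<Sum>j<D a. G a i j *s t a j i) = 
   (\<Sum>c\<in>UNIV. mtrace (K' b a c) *s (\<Sum>i<D c. \<Sum>j<D c. G c i j *s t c j i))"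
proof -
  have sw: "(\<Sum>i<D b. \<Sum>j<D b. \<Sum>k<D a. \<Sum>n<D a. f i j k n) = (\<Sum>p\<in>J b a. \<Sum>q\<in>J b a. f (fst p) (fst q) (snd p) (snd q))" 
    for f :: "nat \<Rightarrow> nat \<Rightarrow> nat \<Rightarrow> nat \<Rightarrow> 'a"
    unfolding sum_J by (rule sum.cong[OF refl], rule trans[OF sum.swap]) simp
  have "(\<Sum>i<D b. \<Sum>j<D b. G b i j *s t b j i) \<odot> (\<Sum>i<D a. \<Sum>j<D a. G a i j *s t a j i) = 
    (\<Sum>i<D b. \<Sum>j<D b. \<Sum>k<D a. \<Sum>n<D a. (G b i j * G a k n) *s (t b j i \<odot> t a n k))"
    unfolding m_sum1 m_sc1 unfolding m_sum2 m_sc2 scale_sum_right scale_scale ..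
  also have "\<dots> = (\<Sum>p\<in>J b a. \<Sum>q\<in>J b a. GG b a p q *s T b a q p)"
    unfolding sw GG_def T_def ..
  also have "\<dots> = (\<Sum>p\<in>J b a. \<Sum>q\<in>J b a. \<Sum>x\<in>X b a. \<Sum>\<gamma><D (fst x). \<Sum>\<delta><D (fst x). (W b a x \<delta> p * GG b a p q * V b a x q \<gamma>) *s t (fst x) \<gamma> \<delta>)"
    by (intro sum.cong refl) (simp add: fusJ scale_sum_right mult_ac)
  also have "\<dots> = (\<Sum>x\<in>X b a. \<Sum>p\<in>J b a. \<Sum>q\<in>J b a. \<Sum>\<gamma><D (fst x). \<Sum>\<delta><D (fst x). (W b a x \<delta> p * GG b a p q * V b a x q \<gamma>) *s t (fst x) \<gamma> \<delta>)"
    by (rule sum3_perm)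
  also have "\<dots> = (\<Sum>x\<in>X b a. \<Sum>\<gamma><D (fst x). \<Sum>\<delta><D (fst x). (\<Sum>p\<in>J b a. \<Sum>q\<in>J b a. W b a x \<delta> p * GG b a p q * V b a x q \<gamma>) *s t (fst x) \<gamma> \<delta>)"
    unfolding scale_sum_left by (rule sum.cong[OF refl]) (rule trans[OF sum_swap22], rule refl)
  also have "\<dots> = (\<Sum>x\<in>X b a. \<Sum>\<gamma><D (fst x). \<Sum>\<delta><D (fst x). (kap' b a x x * G (fst x) \<delta> \<gamma>) *s t (fst x) \<gamma> \<delta>)"
    by (intro sum.cong refl) (simp add: kap'_GG)
  also have "\<dots> = (\<Sum>x\<in>X b a. kap' b a x x *s (\<Sum>i<D (fst x). \<Sum>j<D (fst x). G (fst x) i j *s t (fst x) j i))"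
    by (rule sum.cong[OF refl], subst sum.swap) (simp add: scale_sum_right)
  also have "\<dots> = (\<Sum>c\<in>UNIV. mtrace (K' b a c) *s (\<Sum>i<D c. \<Sum>j<D c. G c i j *s t c j i))"
    by (simp add: sum_X mtrace_K' scale_sum_left)
  finally show ?thesis .
qed

theorem Lam_idem: "Lam \<odot> Lam = Lam"
proof -
  let ?h = "\<lambda>c. \<Sum>i<D c. \<Sum>j<D c. G c i j *s t c j i"
  have "Lam \<odot> Lam = (\<Sum>b\<in>UNIV. \<Sum>a\<in>UNIV. (cc b * cc a) *s (?h b \<odot> ?h a))"
    unfolding Lam_def by (rule m_bilin)
  also have "\<dots> = (\<Sum>b\<in>UNIV. \<Sum>a\<in>UNIV. \<Sum>c\<in>UNIV. (cc b * cc a * mtrace (K' b a c)) *s ?h c)"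
    unfolding product_trace by (simp add: scale_sum_right mult.assoc)
  also have "\<dots> = (\<Sum>c\<in>UNIV. (\<Sum>b\<in>UNIV. \<Sum>a\<in>UNIV. cc b * cc a * mtrace (K' b a c)) *s ?h c)"
    unfolding scale_sum_left by (rule sum3_perm)
  also have "\<dots> = Lam" unfolding cc_sum Lam_def ..
  finally show ?thesis .
qed

text \<open>The integral property for a coefficient of \<psi> b, tested by a bilinear form. Expanded
  in pairs of t^a and t^c, the two sides involve the channels b a \<rightarrow> c and bar b c
  \<rightarrow> a, and \<open>rotation_identity\<close> matches them term by term.\<close>

theorem Lam_integral:
  fixes B :: "'a \<Rightarrow> 'a \<Rightarrow> complex"
  assumes B1: "\<And>x x' y. B (x + x') y = B x y + B x' y" and B2: "\<And>x y y'. B x (y + y') = B x y + B x y'"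
    and B3: "\<And>z x y. B (z *s x) y = z * B x y" and B4: "\<And>z x y. B x (z *s y) = z * B x y"
    and p: "p < D b" and q: "q < D b"
  shows "(\<Sum>a\<in>UNIV. cc a * (\<Sum>i<D a. \<Sum>j<D a. \<Sum>k<D a. G a i j * B (t a j k) (t b p q \<odot> t a k i))) = 
    (\<Sum>c\<in>UNIV. cc c * (\<Sum>i<D c. \<Sum>j<D c. \<Sum>k<D c. G c i j * B (S (t b p q) \<odot> t c j k) (t c k i)))"
proof -
  have B0: "B 0 y = 0" "B y 0 = 0" for y using B3[of 0 0 y] B4[of y 0 0] by simp_all
  have Bs1: "B (\<Sum>i\<in>I. f i) y = (\<Sum>i\<in>I. B (f i) y)" for I :: "'s set" and f y
    by (induction I rule: infinite_finite_induct) (simp_all add: B0 B1)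
  have Bs2: "B y (\<Sum>i\<in>I. f i) = (\<Sum>i\<in>I. B y (f i))" for I :: "'s set" and f y
    by (induction I rule: infinite_finite_induct) (simp_all add: B0 B2)
  define A1 where "A1 a c i k \<gamma> \<delta> = (\<Sum>\<mu><N b a c. V b a (c, \<mu>) (p, k) \<gamma> * (\<Sum>j<D a. W b a (c, \<mu>) \<delta> (q, j) * G a j i))" for a c i k \<gamma> \<delta>
  define A2 where "A2 a c i k \<gamma> \<delta> = (\<Sum>\<nu><N (bar b) c a. (\<Sum>s'<D (bar b). W (bar b) c (a, \<nu>) k (s', \<gamma>) * Zi b s' p) * 
       (\<Sum>s<D (bar b). \<Sum>g'<D c. G c \<delta> g' * Z b q s * V (bar b) c (a, \<nu>) (s, g') i))" for a c i k \<gamma> \<delta>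
  have L: "(\<Sum>i<D a. \<Sum>j<D a. \<Sum>k<D a. G a i j * B (t a j k) (t b p q \<odot> t a k i)) = 
     (\<Sum>c\<in>UNIV. \<Sum>i<D a. \<Sum>k<D a. \<Sum>\<gamma><D c. \<Sum>\<delta><D c. A1 a c i k \<gamma> \<delta> * B (t a i k) (t c \<gamma> \<delta>))" for a
  proof -
    have "(\<Sum>i<D a. \<Sum>j<D a. \<Sum>k<D a. G a i j * B (t a j k) (t b p q \<odot> t a k i)) = 
      (\<Sum>i<D a. \<Sum>j<D a. \<Sum>k<D a. \<Sum>c\<in>UNIV. \<Sum>\<mu><N b a c. \<Sum>\<gamma><D c. \<Sum>\<delta><D c. 
         (V b a (c, \<mu>) (p, k) \<gamma> * (W b a (c, \<mu>) \<delta> (q, i) * G a i j)) * B (t a j k) (t c \<gamma> \<delta>))"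
      by (intro sum.cong refl) (use p q in \<open>simp add: fus X_def[symmetric] sum_X Bs2 B4 sum_distrib_left mult_ac\<close>)
    also have "\<dots> = (\<Sum>c\<in>UNIV. \<Sum>j<D a. \<Sum>k<D a. \<Sum>\<gamma><D c. \<Sum>\<delta><D c. \<Sum>\<mu><N b a c. \<Sum>i<D a. 
         (V b a (c, \<mu>) (p, k) \<gamma> * (W b a (c, \<mu>) \<delta> (q, i) * G a i j)) * B (t a j k) (t c \<gamma> \<delta>))"
      apply (rule trans[OF sum4_perm[symmetric]], rule sum.cong[OF refl])
      unfolding sum.cartesian_product by (rule sum.reindex_bij_witness[where 
         i="\<lambda>(j,k,g,d,m,i). (i,j,k,m,g,d)" and j="\<lambda>(i,j,k,m,g,d). (j,k,g,d,m,i)"]) auto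
    finally show ?thesis by (simp add: A1_def sum_distrib_left sum_distrib_right)
  qed
  have R: "(\<Sum>i<D c. \<Sum>j<D c. \<Sum>k<D c. G c i j * B (S (t b p q) \<odot> t c j k) (t c k i)) = 
     (\<Sum>a\<in>UNIV. \<Sum>i<D a. \<Sum>k<D a. \<Sum>\<gamma><D c. \<Sum>\<delta><D c. A2 a c i k \<gamma> \<delta> * B (t a i k) (t c \<gamma> \<delta>))" for c
  proof -
    have "(\<Sum>i<D c. \<Sum>j<D c. \<Sum>k<D c. G c i j * B (S (t b p q) \<odot> t c j k) (t c k i)) = 
      (\<Sum>i<D c. \<Sum>j<D c. \<Sum>k<D c. \<Sum>s<D (bar b). \<Sum>s'<D (bar b). \<Sum>a\<in>UNIV. \<Sum>\<nu><N (bar b) c a. \<Sum>\<gamma><D a. \<Sum>\<delta><D a. 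
         (W (bar b) c (a, \<nu>) \<delta> (s', k) * Zi b s' p * (G c i j * Z b q s * V (bar b) c (a, \<nu>) (s, j) \<gamma>)) * B (t a \<gamma> \<delta>) (t c k i))"
      by (intro sum.cong refl) (use p q in \<open>simp add: S_t m_sum1 m_sc1 fus X_def[symmetric] sum_X Bs1 B3 sum_distrib_left mult_ac\<close>)
    also have "\<dots> = (\<Sum>a\<in>UNIV. \<Sum>\<gamma><D a. \<Sum>\<delta><D a. \<Sum>k<D c. \<Sum>i<D c. \<Sum>\<nu><N (bar b) c a. \<Sum>s<D (bar b). \<Sum>j<D c. \<Sum>s'<D (bar b).
         (W (bar b) c (a, \<nu>) \<delta> (s', k) * Zi b s' p * (G c i j * Z b q s * V (bar b) c (a, \<nu>) (s, j) \<gamma>)) * B (t a \<gamma> \<delta>) (t c k i))"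
      apply (rule trans, rule sum.cong[OF refl], rule sum.cong[OF refl], rule sum4_perm[symmetric])
      apply (rule trans[OF sum3_perm], rule sum.cong[OF refl])
      unfolding sum.cartesian_product by (rule sum.reindex_bij_witness[where 
         i="\<lambda>(g,d,k,i,n,s,j,s'). (i,j,k,s,s',n,g,d)" and j="\<lambda>(i,j,k,s,s',n,g,d). (g,d,k,i,n,s,j,s')"]) auto
    finally show ?thesis by (simp add: A2_def sum_product sum_distrib_right sum_distrib_left)
  qed
  \<comment> \<open>\<open>rotation_identity\<close> carries the weights w_a and w_c. The
    denominators agree on a channel because l a = r b and l c = l b, while \<open>DD\<close> takes
    the same value at l b and r b.\<close>
  have key: "cc a * A1 a c i k \<gamma> \<delta> = cc c * A2 a c i k \<gamma> \<delta>" if "i < D a" "k < D a" "\<gamma> < D c" "\<delta> < D c" for a c i k \<gamma> \<delta>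
  proof (cases "N b a c = 0")
    case True thus ?thesis by (simp add: A1_def A2_def N_rot)
  next
    case False
    hence s: "r b = l a" "l c = l b" using sel by auto
    have "w a * A1 a c i k \<gamma> \<delta> = w c * A2 a c i k \<gamma> \<delta>" unfolding A1_def A2_def
      using rotation_identity[OF p q that(2,1,3,4)] .
    moreover have "DD (l a) = DD (l c)" using s DD_lr[of b] by simp
    ultimately show ?thesis by (simp add: cc_def)
  qed
  have "(\<Sum>a\<in>UNIV. cc a * (\<Sum>i<D a. \<Sum>j<D a. \<Sum>k<D a. G a i j * B (t a j k) (t b p q \<odot> t a k i))) = 
    (\<Sum>a\<in>UNIV. \<Sum>c\<in>UNIV. \<Sum>i<D a. \<Sum>k<D a. \<Sum>\<gamma><D c. \<Sum>\<delta><D c. cc a * A1 a c i k \<gamma> \<delta> * B (t a i k) (t c \<gamma> \<delta>))"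
    unfolding L by (simp add: sum_distrib_left mult.assoc)
  also have "\<dots> = (\<Sum>a\<in>UNIV. \<Sum>c\<in>UNIV. \<Sum>i<D a. \<Sum>k<D a. \<Sum>\<gamma><D c. \<Sum>\<delta><D c. cc c * A2 a c i k \<gamma> \<delta> * B (t a i k) (t c \<gamma> \<delta>))"
    by (intro sum.cong refl) (simp add: key)
  also have "\<dots> = (\<Sum>c\<in>UNIV. cc c * (\<Sum>i<D c. \<Sum>j<D c. \<Sum>k<D c. G c i j * B (S (t b p q) \<odot> t c j k) (t c k i)))"
    unfolding R by (subst sum.swap) (simp add: sum_distrib_left mult.assoc)
  finally show ?thesis .
qed

end

section \<open>Isolating a single fusion channel\<close>

context tensor_calculus begin

lemma matrix_unit_of_channel:
  assumes x: "x \<in> X b a" and g: "\<gamma> < D (fst x)" "\<delta> < D (fst x)"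
  shows "(\<Sum>p\<in>J b a. \<Sum>q\<in>J b a. (W b a x \<gamma> p * V b a x q \<delta>) *s T b a p q) = t (fst x) \<gamma> \<delta>"
proof -
  have "(\<Sum>p\<in>J b a. \<Sum>q\<in>J b a. (W b a x \<gamma> p * V b a x q \<delta>) *s T b a p q) = 
    (\<Sum>p\<in>J b a. W b a x \<gamma> p *s (\<Sum>e<D (fst x). V b a x p e *s t (fst x) e \<delta>))"
    by (rule sum.cong[OF refl]) (use Vmor_V[OF x] g in \<open>simp add: Vmor_def scale_scale[symmetric] scale_sum_right[symmetric] del: scale_scale\<close>)
  also have "\<dots> = (\<Sum>e<D (fst x). (\<Sum>p\<in>J b a. W b a x \<gamma> p * V b a x p e) *s t (fst x) e \<delta>)"
    unfolding scale_sum_right scale_sum_left by (subst sum.swap) simp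
  also have "\<dots> = (\<Sum>e<D (fst x). if \<gamma> = e then t (fst x) e \<delta> else 0)"
    by (intro sum.cong refl) (use orthJ[OF x x] g in auto)
  finally show ?thesis using g by simp
qed

text \<open>Contraction with the tensors W and V of one channel isolates its contribution by
  orthogonality. With 0-1 valued weights this converts identities between products of coefficients
  into selection rules.\<close>

lemma channel_weight_zero:
  assumes z: "\<And>p q. p \<in> J b a \<Longrightarrow> q \<in> J b a \<Longrightarrow> 
      (\<Sum>x\<in>X b a. \<Sum>\<gamma><D (fst x). \<Sum>\<delta><D (fst x). (V b a x p \<gamma> * W b a x \<delta> q) *s (\<kappa> (fst x) *s t (fst x) \<gamma> \<delta>)) = 0"
    and N: "N b a c \<noteq> 0" and D: "D c > 0"
  shows "\<kappa> c = 0"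
proof -
  let ?y = "(c, 0)"
  have y: "?y \<in> X b a" using N by (simp add: X_def)
  have "0 = (\<Sum>p\<in>J b a. \<Sum>q\<in>J b a. (W b a ?y 0 p * V b a ?y q 0) *s 
     (\<Sum>x\<in>X b a. \<Sum>\<gamma><D (fst x). \<Sum>\<delta><D (fst x). (V b a x p \<gamma> * W b a x \<delta> q) *s (\<kappa> (fst x) *s t (fst x) \<gamma> \<delta>)))"
    by (rule sum.neutral[symmetric], rule ballI, rule sum.neutral, rule ballI) (simp only: z scale_zero_right)
  also have "\<dots> = (\<Sum>p\<in>J b a. \<Sum>q\<in>J b a. \<Sum>x\<in>X b a. \<Sum>\<gamma><D (fst x). \<Sum>\<delta><D (fst x). 
     ((W b a ?y 0 p * V b a x p \<gamma>) * (W b a x \<delta> q * V b a ?y q 0)) *s (\<kappa> (fst x) *s t (fst x) \<gamma> \<delta>))"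
    unfolding scale_sum_right scale_scale by (simp add: mult_ac)
  also have "\<dots> = (\<Sum>x\<in>X b a. \<Sum>p\<in>J b a. \<Sum>q\<in>J b a. \<Sum>\<gamma><D (fst x). \<Sum>\<delta><D (fst x). 
     ((W b a ?y 0 p * V b a x p \<gamma>) * (W b a x \<delta> q * V b a ?y q 0)) *s (\<kappa> (fst x) *s t (fst x) \<gamma> \<delta>))"
    by (rule sum3_perm)
  also have "\<dots> = (\<Sum>x\<in>X b a. \<Sum>\<gamma><D (fst x). \<Sum>\<delta><D (fst x). 
     ((\<Sum>p\<in>J b a. W b a ?y 0 p * V b a x p \<gamma>) * (\<Sum>q\<in>J b a. W b a x \<delta> q * V b a ?y q 0)) *s (\<kappa> (fst x) *s t (fst x) \<gamma> \<delta>))"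
    unfolding sum_product scale_sum_left by (rule sum.cong[OF refl]) (rule sum_swap22)
  also have "\<dots> = (\<Sum>x\<in>X b a. if x = ?y then (\<Sum>\<gamma><D c. \<Sum>\<delta><D c. if \<gamma> = 0 \<and> \<delta> = 0 then \<kappa> c *s t c 0 0 else 0) else 0)"
  proof (rule sum.cong[OF refl])
    fix x assume x: "x \<in> X b a"
    have "(\<Sum>\<gamma><D (fst x). \<Sum>\<delta><D (fst x). ((\<Sum>p\<in>J b a. W b a ?y 0 p * V b a x p \<gamma>) * (\<Sum>q\<in>J b a. W b a x \<delta> q * V b a ?y q 0)) *s (\<kappa> (fst x) *s t (fst x) \<gamma> \<delta>)) = 
       (\<Sum>\<gamma><D (fst x). \<Sum>\<delta><D (fst x). if x = ?y \<and> \<gamma> = 0 \<and> \<delta> = 0 then \<kappa> c *s t c 0 0 else 0)"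
    proof (rule sum.cong[OF refl], rule sum.cong[OF refl])
      fix \<gamma> \<delta> assume "\<gamma> \<in> {..<D (fst x)}" "\<delta> \<in> {..<D (fst x)}"
      with orthJ[OF y x, of 0 \<gamma>] orthJ[OF x y, of \<delta> 0] D 
      show "((\<Sum>p\<in>J b a. W b a ?y 0 p * V b a x p \<gamma>) * (\<Sum>q\<in>J b a. W b a x \<delta> q * V b a ?y q 0)) *s (\<kappa> (fst x) *s t (fst x) \<gamma> \<delta>) = 
        (if x = ?y \<and> \<gamma> = 0 \<and> \<delta> = 0 then \<kappa> c *s t c 0 0 else 0)" by auto
    qed
    thus "(\<Sum>\<gamma><D (fst x). \<Sum>\<delta><D (fst x). ((\<Sum>p\<in>J b a. W b a ?y 0 p * V b a x p \<gamma>) * (\<Sum>q\<in>J b a. W b a x \<delta> q * V b a ?y q 0)) *s (\<kappa> (fst x) *s t (fst x) \<gamma> \<delta>)) = 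
      (if x = ?y then (\<Sum>\<gamma><D c. \<Sum>\<delta><D c. if \<gamma> = 0 \<and> \<delta> = 0 then \<kappa> c *s t c 0 0 else 0) else 0)" by auto
  qed
  also have "\<dots> = (\<Sum>\<gamma><D c. \<Sum>\<delta><D c. if \<gamma> = 0 \<and> \<delta> = 0 then \<kappa> c *s t c 0 0 else 0)"
    by (subst sum.delta[OF finite_X]) (use y in simp)
  also have "\<dots> = (\<Sum>\<gamma><D c. if \<gamma> = 0 then (\<Sum>\<delta><D c. if \<delta> = 0 then \<kappa> c *s t c 0 0 else 0) else 0)"
    by (rule sum.cong[OF refl]) auto
  also have "\<dots> = \<kappa> c *s t c 0 0" using D by simp
  finally have "eps (\<kappa> c *s t c 0 0) = 0" by (simp only: eps_zero)
  thus ?thesis using D by (simp add: eps_sc eps_t)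
qed

end

lemma minv_inverse:
  assumes A: "A \<in> carrier_mat n k" and inv: "invertible_mat A"
  shows "minv A \<in> carrier_mat k n" "A * minv A = 1\<^sub>m n" "minv A * A = 1\<^sub>m k"
proof -
  have "\<exists>B. inverts_mat A B \<and> inverts_mat B A" using inv by (simp add: invertible_mat_def)
  hence "inverts_mat A (minv A) \<and> inverts_mat (minv A) A" unfolding minv_def by (rule someI_ex)
  hence AB: "A * minv A = 1\<^sub>m n" and BA: "minv A * A = 1\<^sub>m (dim_row (minv A))"
    using A by (auto simp: inverts_mat_def)
  have "dim_col (minv A) = n" using arg_cong[OF AB, of dim_col] by simp
  moreover have "dim_row (minv A) = k" using arg_cong[OF BA, of dim_col] A by simp
  ultimately show "minv A \<in> carrier_mat k n" "A * minv A = 1\<^sub>m n" "minv A * A = 1\<^sub>m k" using AB BA by auto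
qed

lemma sum_div_mod: "(\<Sum>p<n*k. f p) = (\<Sum>i<n. \<Sum>j<k. f (i * k + j))" for f :: "nat \<Rightarrow> 'a::comm_monoid_add"
proof -
  have "(\<Sum>j\<in>{i * k..<i * k + k}. f j) = (\<Sum>j<k. f (i * k + j))" for i
    using sum.shift_bounds_nat_ivl[of f 0 "i * k" k] by (simp add: lessThan_atLeast0 add.commute)
  thus ?thesis by (simp add: sum.nat_group[symmetric])
qed

lemma index_less: "i < n \<Longrightarrow> j < k \<Longrightarrow> i * k + j < n * (k::nat)"
proof -
  assume "i < n" "j < k"
  hence "i * k + j < Suc i * k" by simp
  also have "\<dots> \<le> n * k" using \<open>i < n\<close> by (intro mult_le_mono1) simp
  finally show ?thesis .
qed

lemma pair_ev_bvec: "pair_ev f (bvec k) = f k"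
  by (simp add: pair_ev_def sum_bvec_out)

lemma linear_pair_ev: "linear_functional (pair_ev f)"
  by (simp add: linear_functional_def pair_ev_def algebra_simps sum.distrib sum_distrib_left)

section \<open>Matrix coefficients of a weak Hopf algebra\<close>

locale weak_hopf_fusion =
  fixes m :: "('n::finite \<Rightarrow> complex) \<Rightarrow> ('n \<Rightarrow> complex) \<Rightarrow> ('n \<Rightarrow> complex)"
    and unitA :: "'n \<Rightarrow> complex"
    and \<Delta> :: "('n \<Rightarrow> complex) \<Rightarrow> ('n \<times> 'n \<Rightarrow> complex)"
    and \<epsilon> :: "('n \<Rightarrow> complex) \<Rightarrow> complex"
    and S :: "('n \<Rightarrow> complex) \<Rightarrow> ('n \<Rightarrow> complex)"
    and \<psi> :: "'i::finite \<Rightarrow> ('n \<Rightarrow> complex) \<Rightarrow> complex mat"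
    and D :: "'i \<Rightarrow> nat"
    and N :: "'i \<Rightarrow> 'i \<Rightarrow> 'i \<Rightarrow> nat"
    and V W :: "'i \<Rightarrow> 'i \<Rightarrow> 'i \<Rightarrow> nat \<Rightarrow> complex mat"
    and b :: "'i \<Rightarrow> complex mat"
    and E :: "'i set"
    and v u :: "'i \<Rightarrow> complex vec"
    and l r bar :: "'i \<Rightarrow> 'i"
    and Z :: "'i \<Rightarrow> complex mat"
    and w d :: "'i \<Rightarrow> complex"
    and g \<Lambda> :: "'n \<Rightarrow> complex"
  assumes wha: "weak_hopf_algebra m unitA \<Delta> \<epsilon> S"
    and semisimple: "semisimple_alg (dmult \<Delta>) (dunit \<epsilon>)"
    and irreps: "\<forall>a. is_rep (dmult \<Delta>) (dunit \<epsilon>) (\<psi> a) (D a) \<and> irreducible_rep (\<psi> a) (D a)"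
    and irreps_distinct: "\<forall>a a'. rep_iso (\<psi> a) (D a) (\<psi> a') (D a') \<longrightarrow> a = a'"
    and irreps_complete: "\<forall>\<rho> k. is_rep (dmult \<Delta>) (dunit \<epsilon>) \<rho> k \<and> irreducible_rep \<rho> k
                             \<longrightarrow> (\<exists>a. rep_iso \<rho> k (\<psi> a) (D a))"
    and fusion_dims: "\<forall>a a' c \<mu>. \<mu> < N a a' c \<longrightarrow>
           V a a' c \<mu> \<in> carrier_mat (D a * D a') (D c) \<and> W a a' c \<mu> \<in> carrier_mat (D c) (D a * D a')"
    and fusion_decomp: "\<forall>a a' f. tensor_rep m (\<psi> a) (D a) (\<psi> a') (D a') f =
           msum (D a * D a') (D a * D a') (\<lambda>(c, \<mu>). V a a' c \<mu> * \<psi> c f * W a a' c \<mu>)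
             {(c, \<mu>). \<mu> < N a a' c}"
    and fusion_orth: "\<forall>a a' c c' \<mu> \<nu>. \<mu> < N a a' c \<and> \<nu> < N a a' c' \<longrightarrow>
           W a a' c \<mu> * V a a' c' \<nu> = (if c = c' \<and> \<mu> = \<nu> then 1\<^sub>m (D c) else 0\<^sub>m (D c) (D c'))"
    and vac_dims: "\<forall>a. b a \<in> carrier_mat (D a) (D a)"
    and vac: "\<forall>f. pair_ev f unitA = (\<Sum>a\<in>UNIV. mtrace (b a * \<psi> a f))"
    and E_def: "E = {a. b a \<noteq> 0\<^sub>m (D a) (D a)}"
    and vac_rank1: "\<forall>e\<in>E. v e \<in> carrier_vec (D e) \<and> u e \<in> carrier_vec (D e) \<and> b e = outer (v e) (u e)"
    and l_def: "\<forall>a. l a \<in> E \<and> (\<forall>e\<in>E. \<forall>c. N e a c = (if e = l a \<and> a = c then 1 else 0))"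
    and r_def: "\<forall>a. r a \<in> E \<and> (\<forall>e\<in>E. \<forall>c. N a e c = (if e = r a \<and> a = c then 1 else 0))"
    and conj: "\<forall>a. Z a \<in> carrier_mat (D a) (D (bar a)) \<and> invertible_mat (Z a) \<and>
           (\<forall>f. transpose_mat (\<psi> a (dantipode S f)) = Z a * \<psi> (bar a) f * minv (Z a))"
    and bar_bar: "\<forall>a. bar (bar a) = a"
    and w_def: "\<forall>c. N (bar c) c (r c) = 1 \<and> w c \<noteq> 0 \<and>
           (\<forall>p q. p < D (bar c) * D c \<and> q < D (bar c) * D c \<longrightarrow>
              Z c $$ (p mod D c, p div D c) * minv (Z (bar c)) $$ (q mod D c, q div D c) =
              w c * (transpose_mat (W (bar c) c (r c) 0) *\<^sub>v u (r c)) $ p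
                  * (V (bar c) c (r c) 0 *\<^sub>v v (r c)) $ q)"
    and d_def: "\<forall>a. d a ^ 2 = w a * w (bar a) \<and> d a = d (bar a)"
    and g_def: "\<forall>a. \<psi> a g = (d a / w (bar a)) \<cdot>\<^sub>m (transpose_mat (minv (Z a)) * Z (bar a))"
    and \<Lambda>_def: "\<forall>f. pair_ev f \<Lambda> =
           (\<Sum>a\<in>UNIV. d a / (\<Sum>x\<in>{x. l x = l a}. d x ^ 2) * mtrace (\<psi> a g * \<psi> a f))"
begin

sublocale H: weak_hopf m unitA \<Delta> \<epsilon> S by (rule weak_hopf_intro[OF wha])

text \<open>The element of the algebra that represents a matrix coefficient: its pairing with
  \<open>f\<close> is the (i, j) entry of \<psi> a f.\<close>

definition t where "t a i j = (\<lambda>k. \<psi> a (bvec k) $$ (i, j))"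

lemma psi_carrier [simp]: "\<psi> a f \<in> carrier_mat (D a) (D a)" 
  and psi_dmult: "\<psi> a (dmult \<Delta> f f') = \<psi> a f * \<psi> a f'" and psi_unit: "\<psi> a (dunit \<epsilon>) = 1\<^sub>m (D a)"
  and rep: "is_rep (dmult \<Delta>) (dunit \<epsilon>) (\<psi> a) (D a)" and irr: "irreducible_rep (\<psi> a) (D a)"
  using irreps by (simp_all add: is_rep_def)

lemma psi_dim [simp]: "dim_row (\<psi> a f) = D a" "dim_col (\<psi> a f) = D a"
  by (rule carrier_matD[OF psi_carrier])+

lemma D_pos: "D a > 0" using irr[of a] by (simp add: irreducible_rep_def)

lemma psi_lin: "i < D a \<Longrightarrow> j < D a \<Longrightarrow> linear_functional (\<lambda>f. \<psi> a f $$ (i, j))"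
  using rep[of a] psi_carrier[of a] unfolding is_rep_def linear_functional_def by auto

lemma pair_t: "i < D a \<Longrightarrow> j < D a \<Longrightarrow> pair_ev f (t a i j) = \<psi> a f $$ (i, j)"
  using linear_functional_expand[OF psi_lin, of i a j f] by (simp add: pair_ev_def t_def)

lemma functional_t: 
  assumes "linear_functional \<phi>" "i < D a" "j < D a"
  shows "\<phi> (t a i j) = \<psi> a (\<lambda>k. \<phi> (bvec k)) $$ (i, j)"
  using linear_functional_expand[OF assms(1), of "t a i j"] pair_t[OF assms(2,3), of "\<lambda>k. \<phi> (bvec k)"]
  by (simp add: pair_ev_def mult.commute)

lemma pair_ext: "(\<And>f. pair_ev f x = pair_ev f y) \<Longrightarrow> x = (y :: 'n \<Rightarrow> complex)"
proof (rule ext)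
  fix k assume "\<And>f. pair_ev f x = pair_ev f y"
  from this[of "bvec k"] show "x k = y k" by (simp add: pair_ev_def bvec_def if_distrib[of "\<lambda>z. z * _"] cong: if_cong)
qed

lemma pair_sum: "pair_ev f (\<Sum>i\<in>I. h i) = (\<Sum>i\<in>I. pair_ev f (h i))" 
  and pair_sc: "pair_ev f (z *v x) = z * pair_ev f x"
  using linear_functional_sum[OF linear_pair_ev] linear_pair_ev[of f] by (auto simp: linear_functional_iff)

lemma psi_mult_index: "i < D a \<Longrightarrow> j < D a \<Longrightarrow> (\<psi> a f * \<psi> a f') $$ (i, j) = (\<Sum>k<D a. \<psi> a f $$ (i, k) * \<psi> a f' $$ (k, j))"
  using psi_carrier[of a f] psi_carrier[of a f'] by (simp add: scalar_prod_def lessThan_atLeast0)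

text \<open>The product of the dual algebra is dual to \<Delta>, so multiplicativity of \<psi> a is
  matrix comultiplication of its coefficients.\<close>

lemma Delta_t: 
  assumes "i < D a" "j < D a" shows "\<Delta> (t a i j) (p, q) = (\<Sum>k<D a. t a i k p * t a k j q)"
proof -
  have "pair_ev (dmult \<Delta> (bvec p) (bvec q)) x = \<Delta> x (p, q)" for x
  proof -
    have "dmult \<Delta> (bvec p) (bvec q) k = \<Delta> (bvec k) (p, q)" for k
      by (simp add: dmult_def bvec_def if_distrib[of "\<lambda>z. _ * z"] if_distrib[of "\<lambda>z. z * _"] cong: if_cong)
    thus ?thesis using linear_fun_expand[OF H.lin_D, of x "(p, q)"] by (simp add: pair_ev_def mult.commute)
  qed
  from this[of "t a i j", symmetric] show ?thesis
    unfolding pair_t[OF assms] psi_dmult psi_mult_index[OF assms] by (simp add: t_def)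
qed

lemma sw_t: 
  assumes B: "bilin B" and "i < D a" "j < D a"
  shows "sw \<Delta> B (t a i j) = (\<Sum>k<D a. B (t a i k) (t a k j))"
proof -
  have "sw \<Delta> B (t a i j) = (\<Sum>p\<in>UNIV. \<Sum>q\<in>UNIV. \<Sum>k<D a. t a i k p * t a k j q * B (bvec p) (bvec q))"
    by (simp add: sw_def Delta_t[OF assms(2,3)] sum_distrib_right)
  also have "\<dots> = (\<Sum>k<D a. B (t a i k) (t a k j))"
    by (rule trans[OF sum3_perm]) (simp add: bilin_expand[OF B, symmetric])
  finally show ?thesis .
qed

lemma eps_t: "i < D a \<Longrightarrow> j < D a \<Longrightarrow> \<epsilon> (t a i j) = (if i = j then 1 else 0)"
  using functional_t[OF H.lin_e, of i a j] psi_unit[of a] by (simp add: dunit_def)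

lemma eps_add: "\<epsilon> (x + y) = \<epsilon> x + \<epsilon> y" and eps_sc: "\<epsilon> (z *v x) = z * \<epsilon> x"
  using H.lin_e by (simp_all add: linear_functional_iff)

lemma indep:
  assumes e: "(\<Sum>a\<in>UNIV. \<Sum>i<D a. \<Sum>j<D a. f a i j *v t a i j) = 0" and ij: "i < D a" "j < D a"
  shows "f a i j = 0"
proof (rule coefficients_independent[where c = f and \<psi> = \<psi> and D = D, OF rep irr _ _ ij])
  show "a = a'" if "rep_iso (\<psi> a) (D a) (\<psi> a') (D a')" for a a' using irreps_distinct that by blast
next
  fix h
  have "pair_ev h (\<Sum>a\<in>UNIV. \<Sum>i<D a. \<Sum>j<D a. f a i j *v t a i j) = 0"
    unfolding e by (rule linear_functional_zero[OF linear_pair_ev])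
  thus "(\<Sum>a\<in>UNIV. \<Sum>i<D a. \<Sum>j<D a. f a i j * \<psi> a h $$ (i, j)) = 0"
    by (simp add: pair_sum pair_sc pair_t)
qed

definition V' where "V' e a x p \<gamma> = V e a (fst x) (snd x) $$ (fst p * D a + snd p, \<gamma>)"
definition W' where "W' e a x \<gamma> p = W e a (fst x) (snd x) $$ (\<gamma>, fst p * D a + snd p)"

lemma tensor_rep_index:
  assumes "k < D e" "j < D e" "n < D a" "n' < D a"
  shows "tensor_rep m (\<psi> e) (D e) (\<psi> a) (D a) f $$ (k * D a + n, j * D a + n') = pair_ev f (m (t e k j) (t a n n'))"
proof -
  have B: "bilin (\<lambda>x y. pair_ev f (m x y))"
    using linear_pair_ev[of f] by (simp add: bilin_def linear_functional_iff H.m_add1 H.m_add2 H.m_sc1 H.m_sc2)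
  have "kron (\<psi> e (bvec p)) (\<psi> a (bvec q)) $$ (k * D a + n, j * D a + n') = t e k j p * t a n n' q" for p q
    using psi_carrier[of e "bvec p"] psi_carrier[of a "bvec q"] assms by (simp add: kron_def index_less t_def)
  moreover have "dim_row (kron (\<psi> e (bvec p)) (\<psi> a (bvec q))) = D e * D a" "dim_col (kron (\<psi> e (bvec p)) (\<psi> a (bvec q))) = D e * D a" for p q
    using psi_carrier[of e "bvec p"] psi_carrier[of a "bvec q"] by (simp_all add: kron_def)
  ultimately have "tensor_rep m (\<psi> e) (D e) (\<psi> a) (D a) f $$ (k * D a + n, j * D a + n') = 
    (\<Sum>x\<in>UNIV. pair_ev f (m (bvec (fst x)) (bvec (snd x))) * (t e k j (fst x) * t a n n' (snd x)))"
    using assms by (simp add: tensor_rep_def msum_def index_less case_prod_beta)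
  also have "\<dots> = (\<Sum>p\<in>UNIV. \<Sum>q\<in>UNIV. pair_ev f (m (bvec p) (bvec q)) * (t e k j p * t a n n' q))"
    by (simp add: sum.cartesian_product UNIV_Times_UNIV[symmetric] case_prod_beta del: UNIV_Times_UNIV)
  finally show ?thesis using bilin_expand[OF B, of "t e k j" "t a n n'"] by (simp add: mult_ac)
qed

lemma fus:
  assumes k: "k < D e" "j < D e" "n < D a" "n' < D a" 
  shows "m (t e k j) (t a n n') = (\<Sum>x\<in>(SIGMA c:UNIV. {..<N e a c}). \<Sum>\<gamma><D (fst x). \<Sum>\<delta><D (fst x). 
           (V' e a x (k, n) \<gamma> * W' e a x \<delta> (j, n')) *v t (fst x) \<gamma> \<delta>)"
proof (rule pair_ext)
  fix f
  have eq: "(V e a c \<mu> * \<psi> c f * W e a c \<mu>) $$ (k * D a + n, j * D a + n') = 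
     (\<Sum>\<gamma><D c. \<Sum>\<delta><D c. V' e a (c, \<mu>) (k, n) \<gamma> * W' e a (c, \<mu>) \<delta> (j, n') * \<psi> c f $$ (\<gamma>, \<delta>))" if "\<mu> < N e a c" for c \<mu>
  proof -
    have c: "V e a c \<mu> \<in> carrier_mat (D e * D a) (D c)" "W e a c \<mu> \<in> carrier_mat (D c) (D e * D a)"
      using fusion_dims that by auto
    have "(V e a c \<mu> * \<psi> c f * W e a c \<mu>) $$ (k * D a + n, j * D a + n') = 
      (\<Sum>\<delta><D c. (\<Sum>\<gamma><D c. V e a c \<mu> $$ (k * D a + n, \<gamma>) * \<psi> c f $$ (\<gamma>, \<delta>)) * W e a c \<mu> $$ (\<delta>, j * D a + n'))"
      using c psi_carrier[of c f] k by (simp add: scalar_prod_def lessThan_atLeast0[symmetric] index_less)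
    also have "\<dots> = (\<Sum>\<gamma><D c. \<Sum>\<delta><D c. V' e a (c, \<mu>) (k, n) \<gamma> * W' e a (c, \<mu>) \<delta> (j, n') * \<psi> c f $$ (\<gamma>, \<delta>))"
      unfolding sum_distrib_right by (subst sum.swap) (simp add: V'_def W'_def mult_ac)
    finally show ?thesis .
  qed
  have s: "{(c, \<mu>). \<mu> < N e a c} = (SIGMA c:UNIV. {..<N e a c})" by auto
  have "pair_ev f (m (t e k j) (t a n n')) = 
    (\<Sum>x\<in>(SIGMA c:UNIV. {..<N e a c}). (V e a (fst x) (snd x) * \<psi> (fst x) f * W e a (fst x) (snd x)) $$ (k * D a + n, j * D a + n'))"
    unfolding tensor_rep_index[OF k, symmetric] using k by (simp add: fusion_decomp msum_def index_less case_prod_beta s)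
  also have "\<dots> = (\<Sum>x\<in>(SIGMA c:UNIV. {..<N e a c}). \<Sum>\<gamma><D (fst x). \<Sum>\<delta><D (fst x). V' e a x (k, n) \<gamma> * W' e a x \<delta> (j, n') * \<psi> (fst x) f $$ (\<gamma>, \<delta>))"
    by (rule sum.cong[OF refl]) (use eq in auto)
  finally show "pair_ev f (m (t e k j) (t a n n')) = pair_ev f (\<Sum>x\<in>(SIGMA c:UNIV. {..<N e a c}). \<Sum>\<gamma><D (fst x). \<Sum>\<delta><D (fst x). 
           (V' e a x (k, n) \<gamma> * W' e a x \<delta> (j, n')) *v t (fst x) \<gamma> \<delta>)"
    by (simp add: pair_sum pair_sc pair_t)
qed

lemma orth:
  assumes x: "\<xi> \<in> (SIGMA c:UNIV. {..<N e a c})" "\<eta> \<in> (SIGMA c:UNIV. {..<N e a c})" and g: "\<gamma> < D (fst \<xi>)" "\<delta> < D (fst \<eta>)"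
  shows "(\<Sum>p\<in>{..<D e} \<times> {..<D a}. W' e a \<xi> \<gamma> p * V' e a \<eta> p \<delta>) = (if \<xi> = \<eta> \<and> \<gamma> = \<delta> then 1 else 0)"
proof -
  obtain c \<mu> c' \<nu> where eq: "\<xi> = (c, \<mu>)" "\<eta> = (c', \<nu>)" by fastforce
  have N: "\<mu> < N e a c" "\<nu> < N e a c'" using x eq by auto
  have c: "V e a c' \<nu> \<in> carrier_mat (D e * D a) (D c')" "W e a c \<mu> \<in> carrier_mat (D c) (D e * D a)"
    using fusion_dims N by auto
  have "(\<Sum>p\<in>{..<D e} \<times> {..<D a}. W' e a \<xi> \<gamma> p * V' e a \<eta> p \<delta>) = 
    (\<Sum>p<D e * D a. W e a c \<mu> $$ (\<gamma>, p) * V e a c' \<nu> $$ (p, \<delta>))"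
    by (simp add: sum_div_mod sum.cartesian_product' V'_def W'_def eq)
  also have "\<dots> = (W e a c \<mu> * V e a c' \<nu>) $$ (\<gamma>, \<delta>)"
    using c g eq by (simp add: scalar_prod_def lessThan_atLeast0[symmetric])
  also have "\<dots> = (if \<xi> = \<eta> \<and> \<gamma> = \<delta> then 1 else 0)"
    using fusion_orth N g eq by auto
  finally show ?thesis .
qed

sublocale F: tensor_calculus vscale m D t \<epsilon> N V' W'
  by unfold_locales (rule H.m_add1 H.m_add2 H.m_sc1 H.m_sc2 H.assoc eps_add eps_sc eps_t indep fus orth; assumption)+

end

context weak_hopf_fusion begin

definition Zf where "Zf c i s = Z c $$ (i, s)"
definition Zi where "Zi c s i = minv (Z c) $$ (s, i)"

lemma Z_carrier: "Z c \<in> carrier_mat (D c) (D (bar c))" and Z_inv: "invertible_mat (Z c)"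
  using conj by auto

lemmas minv_Z = minv_inverse[OF Z_carrier Z_inv]

lemma ZZi: assumes "i < D c" "j < D c" shows "(\<Sum>s<D (bar c). Zf c i s * Zi c s j) = (if i = j then 1 else 0)"
proof -
  have "(Z c * minv (Z c)) $$ (i, j) = (\<Sum>s<D (bar c). Zf c i s * Zi c s j)"
    using assms Z_carrier[of c] minv_Z(1)[of c] by (simp add: scalar_prod_def lessThan_atLeast0[symmetric] Zf_def Zi_def)
  thus ?thesis using assms by (simp add: minv_Z(2))
qed

lemma ZiZ: assumes "s < D (bar c)" "s' < D (bar c)" shows "(\<Sum>i<D c. Zi c s i * Zf c i s') = (if s = s' then 1 else 0)"
proof -
  have "(minv (Z c) * Z c) $$ (s, s') = (\<Sum>i<D c. Zi c s i * Zf c i s')"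
    using assms Z_carrier[of c] minv_Z(1)[of c] by (simp add: scalar_prod_def lessThan_atLeast0[symmetric] Zf_def Zi_def)
  thus ?thesis using assms by (simp add: minv_Z(3))
qed

lemma bar2 [simp]: "bar (bar c) = c" using bar_bar by blast

lemma pair_S: "pair_ev (dantipode S f) x = pair_ev f (S x)"
proof -
  have "linear_functional (\<lambda>x. pair_ev f (S x))"
    using linear_pair_ev[of f] by (simp add: linear_functional_iff H.S_add H.S_sc)
  from linear_functional_expand[OF this, of x] show ?thesis
    unfolding pair_ev_def[of "dantipode S f"] by (simp add: dantipode_def mult.commute)
qed

lemma S_t:
  assumes i: "i < D c" and j: "j < D c"
  shows "S (t c i j) = (\<Sum>s<D (bar c). \<Sum>s'<D (bar c). (Zf c j s * Zi c s' i) *v t (bar c) s s')"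
proof (rule pair_ext)
  fix f
  have "pair_ev f (S (t c i j)) = transpose_mat (\<psi> c (dantipode S f)) $$ (j, i)"
    using i j by (simp add: pair_S[symmetric] pair_t)
  also have "\<dots> = (Z c * \<psi> (bar c) f * minv (Z c)) $$ (j, i)" using conj by simp
  also have "\<dots> = (\<Sum>s'<D (bar c). (\<Sum>s<D (bar c). Zf c j s * \<psi> (bar c) f $$ (s, s')) * Zi c s' i)"
    using i j Z_carrier[of c] minv_Z(1)[of c] by (simp add: scalar_prod_def lessThan_atLeast0[symmetric] Zf_def Zi_def)
  also have "\<dots> = (\<Sum>s<D (bar c). \<Sum>s'<D (bar c). (Zf c j s * Zi c s' i) * \<psi> (bar c) f $$ (s, s'))"
    unfolding sum_distrib_right by (subst sum.swap) (simp add: mult_ac)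
  also have "\<dots> = pair_ev f (\<Sum>s<D (bar c). \<Sum>s'<D (bar c). (Zf c j s * Zi c s' i) *v t (bar c) s s')"
    by (simp add: pair_sum pair_sc pair_t)
  finally show "pair_ev f (S (t c i j)) = pair_ev f (\<Sum>s<D (bar c). \<Sum>s'<D (bar c). (Zf c j s * Zi c s' i) *v t (bar c) s s')" .
qed

lemma conjA: 
  assumes p: "p < D e" and s: "s' < D (bar e)"
  shows "(\<Sum>s<D (bar e). Zf e p s *v t (bar e) s s') = (\<Sum>p'<D e. Zf e p' s' *v S (t e p' p))"
proof -
  have "(\<Sum>p'<D e. Zf e p' s' *v S (t e p' p)) = (\<Sum>p'<D e. \<Sum>s<D (bar e). \<Sum>s''<D (bar e). (Zf e p s * (Zi e s'' p' * Zf e p' s')) *v t (bar e) s s'')"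
    by (intro sum.cong refl) (use p in \<open>simp add: S_t F.scale_sum_right mult_ac\<close>)
  also have "\<dots> = (\<Sum>s<D (bar e). \<Sum>s''<D (bar e). (Zf e p s * (\<Sum>p'<D e. Zi e s'' p' * Zf e p' s')) *v t (bar e) s s'')"
    by (rule trans[OF sum3_perm[symmetric]]) (simp only: sum_distrib_left F.scale_sum_left)
  also have "\<dots> = (\<Sum>s<D (bar e). \<Sum>s''<D (bar e). if s'' = s' then Zf e p s *v t (bar e) s s'' else 0)"
    by (intro sum.cong refl) (use s in \<open>simp add: ZiZ\<close>)
  finally show ?thesis using s by simp
qed

lemma conjB:
  assumes s: "s < D (bar e)" and p: "p < D e"
  shows "(\<Sum>s'<D (bar e). Zi e s' p *v t (bar e) s s') = (\<Sum>p'<D e. Zi e s p' *v S (t e p p'))"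
proof -
  have "(\<Sum>p'<D e. Zi e s p' *v S (t e p p')) = (\<Sum>p'<D e. \<Sum>r<D (bar e). \<Sum>s'<D (bar e). (Zi e s' p * (Zi e s p' * Zf e p' r)) *v t (bar e) r s')"
    by (intro sum.cong refl) (use p in \<open>simp add: S_t F.scale_sum_right mult_ac\<close>)
  also have "\<dots> = (\<Sum>r<D (bar e). \<Sum>s'<D (bar e). (Zi e s' p * (\<Sum>p'<D e. Zi e s p' * Zf e p' r)) *v t (bar e) r s')"
    by (rule trans[OF sum3_perm[symmetric]]) (simp only: sum_distrib_left F.scale_sum_left)
  also have "\<dots> = (\<Sum>r<D (bar e). if s = r then (\<Sum>s'<D (bar e). Zi e s' p *v t (bar e) r s') else 0)"
    by (intro sum.cong refl) (use s in \<open>simp add: ZiZ\<close>)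
  finally show ?thesis using s by simp
qed

lemma bilin_comp:
  assumes "linear_functional \<phi>" "linear_fun A" "linear_fun B"
  shows "bilin (\<lambda>x y. \<phi> (m (A x) (B y)))"
  using assms by (simp add: bilin_def linear_functional_iff linear_fun_iff H.m_add1 H.m_add2 H.m_sc1 H.m_sc2)

lemma linear_id: "linear_fun (\<lambda>x. x)" by (simp add: linear_fun_def)

lemma es_t: assumes "i < D a" "j < D a" shows "H.es (t a i j) = (\<Sum>k<D a. m (S (t a i k)) (t a k j))"
proof (rule H.functional_ext)
  fix \<phi> :: "('n \<Rightarrow> complex) \<Rightarrow> complex" assume p: "linear_functional \<phi>"
  show "\<phi> (H.es (t a i j)) = \<phi> (\<Sum>k<D a. m (S (t a i k)) (t a k j))"
    using sw_t[OF bilin_comp[OF p H.lin_S linear_id] assms] by (simp add: H.es_sw[OF p] linear_functional_sum[OF p])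
qed

lemma et_t: assumes "i < D a" "j < D a" shows "H.et (t a i j) = (\<Sum>k<D a. m (t a i k) (S (t a k j)))"
proof (rule H.functional_ext)
  fix \<phi> :: "('n \<Rightarrow> complex) \<Rightarrow> complex" assume p: "linear_functional \<phi>"
  show "\<phi> (H.et (t a i j)) = \<phi> (\<Sum>k<D a. m (t a i k) (S (t a k j)))"
    using sw_t[OF bilin_comp[OF p linear_id H.lin_S] assms] by (simp add: H.et_sw[OF p] linear_functional_sum[OF p])
qed

lemma bilin_mult: "linear_functional \<phi> \<Longrightarrow> linear_functional \<chi> \<Longrightarrow> bilin (\<lambda>x y. \<phi> x * \<chi> y)"
  by (simp add: bilin_def linear_functional_iff algebra_simps)

lemma lin_eps: "linear_functional (\<lambda>x. \<epsilon> (m y x))" "linear_functional (\<lambda>x. \<epsilon> (m x y))"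
  using H.lin_e by (simp_all add: linear_functional_iff H.m_add1 H.m_add2 H.m_sc1 H.m_sc2)

lemma lin_comp: "linear_functional \<phi> \<Longrightarrow> linear_fun A \<Longrightarrow> linear_functional (\<lambda>x. \<phi> (A x))"
  by (simp add: linear_functional_iff linear_fun_iff)

lemma lin_sc: "linear_functional \<phi> \<Longrightarrow> \<phi> (c *v x) = c * \<phi> x"
  by (simp add: linear_functional_iff)

text \<open>Transfers a Sweedler identity, tested against functionals, to an explicit combination of
  coefficients when the scalar factor sits on the second leg. \<open>sw_t_left\<close> treats the
  first leg.\<close>

lemma sw_t_right:
  fixes x :: "'n \<Rightarrow> complex"
  assumes x: "\<And>\<phi>. linear_functional \<phi> \<Longrightarrow> \<phi> x = sw \<Delta> (\<lambda>p q. \<phi> (A p) * \<chi> q) (t a i j)"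
    and "linear_fun A" "linear_functional \<chi>" "i < D a" "j < D a"
  shows "x = (\<Sum>k<D a. \<chi> (t a k j) *v A (t a i k))"
proof (rule H.functional_ext)
  fix \<phi> :: "('n \<Rightarrow> complex) \<Rightarrow> complex" assume p: "linear_functional \<phi>"
  show "\<phi> x = \<phi> (\<Sum>k<D a. \<chi> (t a k j) *v A (t a i k))"
    unfolding x[OF p] sw_t[OF bilin_mult[OF lin_comp[OF p assms(2)] assms(3)] assms(4,5)] linear_functional_sum[OF p] lin_sc[OF p]
    by (simp add: mult.commute)
qed

lemma sw_t_left:
  fixes x :: "'n \<Rightarrow> complex"
  assumes x: "\<And>\<phi>. linear_functional \<phi> \<Longrightarrow> \<phi> x = sw \<Delta> (\<lambda>p q. \<chi> p * \<phi> (A q)) (t a i j)"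
    and "linear_fun A" "linear_functional \<chi>" "i < D a" "j < D a"
  shows "x = (\<Sum>k<D a. \<chi> (t a i k) *v A (t a k j))"
proof (rule H.functional_ext)
  fix \<phi> :: "('n \<Rightarrow> complex) \<Rightarrow> complex" assume p: "linear_functional \<phi>"
  show "\<phi> x = \<phi> (\<Sum>k<D a. \<chi> (t a i k) *v A (t a k j))"
    unfolding x[OF p] sw_t[OF bilin_mult[OF assms(3) lin_comp[OF p assms(2)]] assms(4,5)] linear_functional_sum[OF p] lin_sc[OF p] ..
qed

text \<open>The component of the unit of the algebra in the block of e. By the vacuum hypothesis
  these components add up to the unit.\<close>

definition vc where "vc e = (\<Sum>i<D e. \<Sum>j<D e. b e $$ (i, j) *v t e j i)"

lemma pair_o: "pair_ev f (vc e) = mtrace (b e * \<psi> e f)"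
proof -
  have "b e \<in> carrier_mat (D e) (D e)" using vac_dims by blast
  thus ?thesis by (simp add: vc_def pair_sum pair_sc pair_t mtrace_def scalar_prod_def lessThan_atLeast0[symmetric])
qed

lemma sum_o: "(\<Sum>e\<in>UNIV. vc e) = unitA"
  by (rule pair_ext) (simp add: pair_sum pair_o vac)

lemma o_zero: "e \<notin> E \<Longrightarrow> vc e = 0"
  using E_def by (simp add: vc_def)

text \<open>Coefficients are independent, so a vanishing component would make every entry of
  \<open>b e\<close> zero.\<close>

lemma o_nz: assumes e: "e \<in> E" shows "vc e \<noteq> 0"
proof
  assume 0: "vc e = 0"
  have eq: "(\<Sum>i<D e. \<Sum>j<D e. b e $$ (j, i) *v t e i j) = (\<Sum>i<D e. \<Sum>j<D e. 0 *v t e i j)"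
  proof -
    have "(\<Sum>i<D e. \<Sum>j<D e. b e $$ (j, i) *v t e i j) = vc e" unfolding vc_def by (rule sum.swap)
    thus ?thesis by (simp only: 0 F.scale_zero_left sum.neutral_const)
  qed
  have zz: "b e $$ (j, i) = (if e = e then 0 else 0)" if "i < D e" "j < D e" for i j
    apply (rule F.indep_block[where a = e and a' = e and f = "\<lambda>i j. b e $$ (j, i)" and g = "\<lambda>i j. 0"])
    subgoal by (rule eq)
    subgoal by (rule that)
    subgoal by (rule that)
    done
  have z: "b e $$ (i, j) = 0" if "i < D e" "j < D e" for i j
    using zz[OF that(2,1)] by (simp only: if_cancel)
  have "b e \<in> carrier_mat (D e) (D e)" using vac_dims by blast
  hence "b e = 0\<^sub>m (D e) (D e)"
    by (intro eq_matI) (auto simp: z)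
  thus False using e E_def by simp
qed

lemma l_E: "l a \<in> E" and r_E: "r a \<in> E" using l_def r_def by auto

lemma o_left_zero: assumes e: "e \<in> E" "e \<noteq> l a" and ij: "i < D a" "j < D a" shows "m (vc e) (t a i j) = 0"
proof -
  have "N e a c = 0" for c using l_def e by auto
  hence "m (t e p q) (t a i j) = 0" if "p < D e" "q < D e" for p q
    using fus[OF that ij] by simp
  thus ?thesis by (simp add: vc_def F.m_sum1 H.m_sc1)
qed

lemma o_right_zero: assumes e: "e \<in> E" "e \<noteq> r a" and ij: "i < D a" "j < D a" shows "m (t a i j) (vc e) = 0"
proof -
  have "N a e c = 0" for c using r_def e by auto
  hence "m (t a i j) (t e p q) = 0" if "p < D e" "q < D e" for p q
    using fus[OF ij that] by simp
  thus ?thesis by (simp add: vc_def F.m_sum2 H.m_sc2)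
qed

text \<open>Multiply by the unit, decomposed into vacuum components. By the fusion rules with vacuum
  labels, only the component of \<open>l a\<close> acts nontrivially.\<close>

lemma o_left: assumes ij: "i < D a" "j < D a" shows "m (vc (l a)) (t a i j) = t a i j"
proof -
  have "t a i j = (\<Sum>e\<in>UNIV. m (vc e) (t a i j))"
    unfolding F.m_sum1[symmetric] sum_o by (simp add: H.unit1)
  also have "\<dots> = (\<Sum>e\<in>UNIV. if e = l a then m (vc e) (t a i j) else 0)"
  proof (rule sum.cong[OF refl])
    fix e show "m (vc e) (t a i j) = (if e = l a then m (vc e) (t a i j) else 0)"
      using o_left_zero[OF _ _ ij, of e] o_zero[of e] by (cases "e \<in> E") (auto simp: F.m_zero1)
  qed
  finally show ?thesis by simp
qed

lemma o_right: assumes ij: "i < D a" "j < D a" shows "m (t a i j) (vc (r a)) = t a i j"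
proof -
  have "t a i j = (\<Sum>e\<in>UNIV. m (t a i j) (vc e))"
    unfolding F.m_sum2[symmetric] sum_o by (simp add: H.unit2)
  also have "\<dots> = (\<Sum>e\<in>UNIV. if e = r a then m (t a i j) (vc e) else 0)"
  proof (rule sum.cong[OF refl])
    fix e show "m (t a i j) (vc e) = (if e = r a then m (t a i j) (vc e) else 0)"
      using o_right_zero[OF _ _ ij, of e] o_zero[of e] by (cases "e \<in> E") (auto simp: F.m_zero2)
  qed
  finally show ?thesis by simp
qed

lemma TX: "p \<in> F.J e a \<Longrightarrow> q \<in> F.J e a \<Longrightarrow> F.T e a p q = 
  (\<Sum>x\<in>F.X e a. \<Sum>\<gamma><D (fst x). \<Sum>\<delta><D (fst x). (V' e a x p \<gamma> * W' e a x \<delta> q) *v t (fst x) \<gamma> \<delta>)"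
  by (rule F.fusJ)

text \<open>Inserting the vacuum component of r e between t^e and t^a changes nothing, but if r e
  and l a differ it annihilates the product and with it every channel.\<close>

lemma sel_mid: assumes N: "N e a c \<noteq> 0" shows "r e = l a"
proof (rule ccontr)
  assume ne: "r e \<noteq> l a"
  have "(1::complex) = 0"
  proof (rule F.channel_weight_zero[where \<kappa> = "\<lambda>_. 1", OF _ N D_pos])
    fix p q assume p: "p \<in> F.J e a" and q: "q \<in> F.J e a"
    have pq: "fst p < D e" "fst q < D e" "snd p < D a" "snd q < D a" using p q by (auto simp: F.J_def)
    have "F.T e a p q = m (m (t e (fst p) (fst q)) (vc (r e))) (t a (snd p) (snd q))"
      using pq by (simp add: o_right F.T_def)
    also have "\<dots> = 0" using pq o_left_zero[OF r_E[of e] ne] by (simp add: H.assoc F.m_zero2)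
    finally show "(\<Sum>x\<in>F.X e a. \<Sum>\<gamma><D (fst x). \<Sum>\<delta><D (fst x). (V' e a x p \<gamma> * W' e a x \<delta> q) *v (1 *v t (fst x) \<gamma> \<delta>)) = 0"
      using TX[OF p q] by simp
  qed
  thus False by simp
qed

text \<open>Left multiplication by the vacuum component of l e fixes t^e t^a, and on the right-hand
  side of the fusion formula it keeps only the channels with the same left vacuum.\<close>

lemma sel_left: assumes N: "N e a c \<noteq> 0" shows "l c = l e"
proof (rule ccontr)
  assume ne: "l c \<noteq> l e"
  have "(if l c = l e then 0 else 1 :: complex) = 0"
  proof (rule F.channel_weight_zero[where \<kappa> = "\<lambda>c. if l c = l e then 0 else 1", OF _ N D_pos])
    fix p q assume p: "p \<in> F.J e a" and q: "q \<in> F.J e a"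
    have pq: "fst p < D e" "fst q < D e" "snd p < D a" "snd q < D a" using p q by (auto simp: F.J_def)
    have vc: "m (vc (l e)) (t c' i j) = (if l c' = l e then t c' i j else 0)" if "i < D c'" "j < D c'" for c' i j
      using o_left[OF that] o_left_zero[OF l_E[of e] _ that] by metis
    have "m (vc (l e)) (F.T e a p q) = F.T e a p q"
      using pq by (simp add: F.T_def o_left H.assoc[symmetric])
    hence "(\<Sum>x\<in>F.X e a. \<Sum>\<gamma><D (fst x). \<Sum>\<delta><D (fst x). (V' e a x p \<gamma> * W' e a x \<delta> q) *v (t (fst x) \<gamma> \<delta> - m (vc (l e)) (t (fst x) \<gamma> \<delta>))) = 0"
      by (simp add: TX[OF p q] F.m_sum2 H.m_sc2 F.scale_right_diff_distrib sum_subtractf)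
    thus "(\<Sum>x\<in>F.X e a. \<Sum>\<gamma><D (fst x). \<Sum>\<delta><D (fst x). (V' e a x p \<gamma> * W' e a x \<delta> q) *v ((if l (fst x) = l e then 0 else 1) *v t (fst x) \<gamma> \<delta>)) = 0"
      by (rule trans[rotated], intro sum.cong refl) (simp add: vc)
  qed
  thus False using ne by simp
qed

lemma sel_right: assumes N: "N e a c \<noteq> 0" shows "r c = r a"
proof (rule ccontr)
  assume ne: "r c \<noteq> r a"
  have "(if r c = r a then 0 else 1 :: complex) = 0"
  proof (rule F.channel_weight_zero[where \<kappa> = "\<lambda>c. if r c = r a then 0 else 1", OF _ N D_pos])
    fix p q assume p: "p \<in> F.J e a" and q: "q \<in> F.J e a"
    have pq: "fst p < D e" "fst q < D e" "snd p < D a" "snd q < D a" using p q by (auto simp: F.J_def)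
    have vc: "m (t c' i j) (vc (r a)) = (if r c' = r a then t c' i j else 0)" if "i < D c'" "j < D c'" for c' i j
      using o_right[OF that] o_right_zero[OF r_E[of a] _ that] by metis
    have "m (F.T e a p q) (vc (r a)) = F.T e a p q"
      using pq by (simp add: F.T_def o_right H.assoc)
    hence "(\<Sum>x\<in>F.X e a. \<Sum>\<gamma><D (fst x). \<Sum>\<delta><D (fst x). (V' e a x p \<gamma> * W' e a x \<delta> q) *v (t (fst x) \<gamma> \<delta> - m (t (fst x) \<gamma> \<delta>) (vc (r a)))) = 0"
      by (simp add: TX[OF p q] F.m_sum1 H.m_sc1 F.scale_right_diff_distrib sum_subtractf)
    thus "(\<Sum>x\<in>F.X e a. \<Sum>\<gamma><D (fst x). \<Sum>\<delta><D (fst x). (V' e a x p \<gamma> * W' e a x \<delta> q) *v ((if r (fst x) = r a then 0 else 1) *v t (fst x) \<gamma> \<delta>)) = 0"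
      by (rule trans[rotated], intro sum.cong refl) (simp add: vc)
  qed
  thus False using ne by simp
qed

text \<open>The vacuum channel bar a, a \<rightarrow> r a has multiplicity 1, so the selection rule
  \<open>sel_mid\<close> applies to it.\<close>

lemma l_bar: "l (bar c) = r c"
proof -
  have "l a = r (bar a)" for a using sel_mid[of "bar a" a "r a"] w_def by auto
  from this[of "bar c"] show ?thesis by simp
qed

lemma r_bar: "r (bar c) = l c" using l_bar[of "bar c"] by simp

text \<open>The condition defining w_c factorizes the product of the two conjugation tensors through
  W and V of the vacuum channel. Contracting these with t^{bar c} t^c leaves t^{r c} paired with u
  and v, and v u is exactly the rank-one matrix of the vacuum component.\<close>

lemma vacuum_channel:
  "(\<Sum>s<D (bar c). \<Sum>k<D c. \<Sum>s'<D (bar c). \<Sum>j<D c. (Zf c k s * Zi (bar c) j s') *v m (t (bar c) s s') (t c k j)) = w c *v vc (r c)"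
proof -
  let ?x = "(r c, 0)" and ?J = "F.J (bar c) c"
  have N1: "N (bar c) c (r c) = 1" using w_def by blast
  hence x: "?x \<in> F.X (bar c) c" by (simp add: F.X_def)
  have dims: "V (bar c) c (r c) 0 \<in> carrier_mat (D (bar c) * D c) (D (r c))" "W (bar c) c (r c) 0 \<in> carrier_mat (D (r c)) (D (bar c) * D c)"
    using fusion_dims N1 by auto
  have vu: "v (r c) \<in> carrier_vec (D (r c))" "u (r c) \<in> carrier_vec (D (r c))" "b (r c) = outer (v (r c)) (u (r c))"
    using vac_rank1 r_E by auto
  have key: "Zf c (snd p) (fst p) * Zi (bar c) (snd q) (fst q) = 
    (\<Sum>\<gamma><D (r c). \<Sum>\<delta><D (r c). (w c * (u (r c) $ \<gamma> * v (r c) $ \<delta>)) * (W' (bar c) c ?x \<gamma> p * V' (bar c) c ?x q \<delta>))" 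
    if p: "p \<in> ?J" and q: "q \<in> ?J" for p q
  proof -
    let ?p = "fst p * D c + snd p" and ?q = "fst q * D c + snd q"
    have pq: "fst p < D (bar c)" "snd p < D c" "fst q < D (bar c)" "snd q < D c" using p q by (auto simp: F.J_def)
    have i: "?p < D (bar c) * D c" "?q < D (bar c) * D c" using pq by (simp_all add: index_less)
    have "Zf c (snd p) (fst p) * Zi (bar c) (snd q) (fst q) = 
       w c * (transpose_mat (W (bar c) c (r c) 0) *\<^sub>v u (r c)) $ ?p * (V (bar c) c (r c) 0 *\<^sub>v v (r c)) $ ?q"
    proof -
      have "Z c $$ (?p mod D c, ?p div D c) * minv (Z (bar c)) $$ (?q mod D c, ?q div D c) = 
         w c * (transpose_mat (W (bar c) c (r c) 0) *\<^sub>v u (r c)) $ ?p * (V (bar c) c (r c) 0 *\<^sub>v v (r c)) $ ?q"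
        using w_def i by blast
      thus ?thesis using pq by (simp add: Zf_def Zi_def)
    qed
    also have "(transpose_mat (W (bar c) c (r c) 0) *\<^sub>v u (r c)) $ ?p = (\<Sum>\<gamma><D (r c). u (r c) $ \<gamma> * W' (bar c) c ?x \<gamma> p)"
      using dims vu i by (simp add: mult_mat_vec_def scalar_prod_def lessThan_atLeast0[symmetric] W'_def mult.commute)
    also have "(V (bar c) c (r c) 0 *\<^sub>v v (r c)) $ ?q = (\<Sum>\<delta><D (r c). v (r c) $ \<delta> * V' (bar c) c ?x q \<delta>)"
      using dims vu i by (simp add: mult_mat_vec_def scalar_prod_def lessThan_atLeast0[symmetric] V'_def mult.commute)
    finally show ?thesis unfolding mult.assoc[of "w c"] unfolding sum_product unfolding sum_distrib_left by (simp add: mult_ac)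
  qed
  have "(\<Sum>s<D (bar c). \<Sum>k<D c. \<Sum>s'<D (bar c). \<Sum>j<D c. (Zf c k s * Zi (bar c) j s') *v m (t (bar c) s s') (t c k j)) = 
    (\<Sum>p\<in>?J. \<Sum>q\<in>?J. (Zf c (snd p) (fst p) * Zi (bar c) (snd q) (fst q)) *v F.T (bar c) c p q)"
    by (simp add: F.sum_J F.T_def)
  also have "\<dots> = (\<Sum>p\<in>?J. \<Sum>q\<in>?J. \<Sum>\<gamma><D (r c). \<Sum>\<delta><D (r c). (w c * (u (r c) $ \<gamma> * v (r c) $ \<delta>)) *v ((W' (bar c) c ?x \<gamma> p * V' (bar c) c ?x q \<delta>) *v F.T (bar c) c p q))"
    by (intro sum.cong refl) (simp only: key F.scale_sum_left F.scale_scale)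
  also have "\<dots> = (\<Sum>\<gamma><D (r c). \<Sum>\<delta><D (r c). (w c * (u (r c) $ \<gamma> * v (r c) $ \<delta>)) *v (\<Sum>p\<in>?J. \<Sum>q\<in>?J. (W' (bar c) c ?x \<gamma> p * V' (bar c) c ?x q \<delta>) *v F.T (bar c) c p q))"
    unfolding F.scale_sum_right by (rule sum_swap22)
  also have "\<dots> = (\<Sum>\<gamma><D (r c). \<Sum>\<delta><D (r c). (w c * (u (r c) $ \<gamma> * v (r c) $ \<delta>)) *v t (r c) \<gamma> \<delta>)"
    by (intro sum.cong refl) (use F.matrix_unit_of_channel[OF x] in simp)
  also have "\<dots> = w c *v vc (r c)"
    unfolding vc_def F.scale_sum_right by (subst sum.swap) (use vu in \<open>simp add: outer_def mult_ac\<close>)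
  finally show ?thesis .
qed

text \<open>On coefficients \<open>es\<close> is the sum of S(t) t; \<open>conjA\<close> replaces
  S(t^c) by t^{bar c}, and the expression becomes the one in \<open>vacuum_channel\<close>.\<close>

lemma chi: "(\<Sum>i<D c. \<Sum>j<D c. (\<Sum>s<D (bar c). Zi (bar c) j s * Zf c i s) *v H.es (t c i j)) = w c *v vc (r c)"
proof -
  have "(\<Sum>i<D c. \<Sum>j<D c. (\<Sum>s<D (bar c). Zi (bar c) j s * Zf c i s) *v H.es (t c i j)) = 
     (\<Sum>i<D c. \<Sum>j<D c. \<Sum>s'<D (bar c). \<Sum>k<D c. Zi (bar c) j s' *v m (Zf c i s' *v S (t c i k)) (t c k j))"
    by (rule sum.cong[OF refl], rule sum.cong[OF refl], subst sum.swap) (simp add: es_t H.m_sc1 F.scale_sum_left F.scale_sum_right)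
  also have "\<dots> = (\<Sum>j<D c. \<Sum>s'<D (bar c). \<Sum>k<D c. Zi (bar c) j s' *v m (\<Sum>i<D c. Zf c i s' *v S (t c i k)) (t c k j))"
    by (rule trans[OF sum4_perm]) (simp only: F.m_sum1 F.scale_sum_right)
  also have "\<dots> = (\<Sum>j<D c. \<Sum>s'<D (bar c). \<Sum>k<D c. Zi (bar c) j s' *v m (\<Sum>s<D (bar c). Zf c k s *v t (bar c) s s') (t c k j))"
    by (intro sum.cong refl) (simp add: conjA)
  also have "\<dots> = (\<Sum>j<D c. \<Sum>s'<D (bar c). \<Sum>k<D c. \<Sum>s<D (bar c). (Zf c k s * Zi (bar c) j s') *v m (t (bar c) s s') (t c k j))"
    by (simp add: F.m_sum1 H.m_sc1 F.scale_sum_right mult.commute)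
  also have "\<dots> = (\<Sum>s<D (bar c). \<Sum>k<D c. \<Sum>s'<D (bar c). \<Sum>j<D c. (Zf c k s * Zi (bar c) j s') *v m (t (bar c) s s') (t c k j))"
    unfolding sum.cartesian_product
    by (rule sum.reindex_bij_witness[where i="\<lambda>(s,k,s',j). (j,s',k,s)" and j="\<lambda>(j,s',k,s). (s,k,s',j)"]) auto
  finally show ?thesis unfolding vacuum_channel .
qed

text \<open>The same computation for \<open>et\<close> with \<open>conjB\<close>. The conjugate
  factor now stands on the right, so \<open>vacuum_channel\<close> is used for \<open>bar c\<close>;
  this explains the constant w_{bar c} and the vacuum l c.\<close>

lemma chi': "(\<Sum>i<D c. \<Sum>j<D c. (\<Sum>s<D (bar c). Zf (bar c) s j * Zi c s i) *v H.et (t c j i)) = w (bar c) *v vc (l c)"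
proof -
  have "(\<Sum>i<D c. \<Sum>j<D c. (\<Sum>s<D (bar c). Zf (bar c) s j * Zi c s i) *v H.et (t c j i)) = 
     (\<Sum>i<D c. \<Sum>j<D c. \<Sum>s<D (bar c). \<Sum>k<D c. Zf (bar c) s j *v m (t c j k) (Zi c s i *v S (t c k i)))"
    by (rule sum.cong[OF refl], rule sum.cong[OF refl], subst sum.swap) (simp add: et_t H.m_sc2 F.scale_sum_left F.scale_sum_right)
  also have "\<dots> = (\<Sum>j<D c. \<Sum>s<D (bar c). \<Sum>k<D c. Zf (bar c) s j *v m (t c j k) (\<Sum>i<D c. Zi c s i *v S (t c k i)))"
    by (rule trans[OF sum4_perm]) (simp only: F.m_sum2 F.scale_sum_right)
  also have "\<dots> = (\<Sum>j<D c. \<Sum>s<D (bar c). \<Sum>k<D c. Zf (bar c) s j *v m (t c j k) (\<Sum>s'<D (bar c). Zi c s' k *v t (bar c) s s'))"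
    by (intro sum.cong refl) (simp add: conjB)
  also have "\<dots> = (\<Sum>j<D c. \<Sum>s<D (bar c). \<Sum>k<D c. \<Sum>s'<D (bar c). (Zf (bar c) s j * Zi c s' k) *v m (t c j k) (t (bar c) s s'))"
    by (simp add: F.m_sum2 H.m_sc2 F.scale_sum_right)
  finally show ?thesis using vacuum_channel[of "bar c"] by (simp add: r_bar)
qed

end

section \<open>Instantiation of the abstract framework\<close>

context weak_hopf_fusion begin

lemma rotation_left:
  "left_rotation vscale m D t \<epsilon> N V' W' S H.es bar Zf Zi w (\<lambda>c. vc (r c))"
proof (unfold_locales, goal_cases)
  case (1 p e s') thus ?case by (rule conjA)
next
  case (2 s e p) thus ?case by (rule conjB)
next
  case 3 thus ?case by (rule bar2)
next
  case (4 k e j n a n')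
  show ?case unfolding es_t[OF 4(1,2), symmetric]
    by (rule sw_t_right[where A = "\<lambda>x. x" and \<chi> = "\<lambda>x. \<epsilon> (m (t e k j) x)", OF H.es_mult_left linear_id lin_eps(1) 4(3,4)])
next
  case (5 k e j n a n')
  show ?case unfolding et_t[OF 5(1,2), symmetric]
    by (rule sw_t_left[where A = "\<lambda>x. x" and \<chi> = "\<lambda>x. \<epsilon> (m (S (t e k j)) x)", OF H.et_mult_left linear_id lin_eps(1) 5(3,4)])
next
  case 6 thus ?case by (rule H.es_add)
next
  case 7 thus ?case by (rule H.es_sc)
next
  case (8 k e j n a n')
  show ?case 
    by (rule sw_t_right[where A = H.es and \<chi> = "\<lambda>x. \<epsilon> (m (t e k j) x)", OF H.es_mult H.lin_es lin_eps(1) 8(3,4)])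
next
  case (9 c) thus ?case by (rule chi)
qed

text \<open>With the opposite product and transposed coefficients, V and W, \<open>Zf\<close> and
  \<open>Zi\<close>, and the two counital maps change places. The counital identities needed here
  are those obtained through \<open>mirror\<close>.\<close>

lemma rotation_right:
  "left_rotation vscale (\<lambda>x y. m y x) D (\<lambda>a i j. t a j i) \<epsilon> (\<lambda>b a c. N a b c)
      (\<lambda>b a x p \<gamma>. W' a b x \<gamma> (prod.swap p)) (\<lambda>b a x \<gamma> p. V' a b x (prod.swap p) \<gamma>) S H.et bar
      (\<lambda>b p s. Zi b s p) (\<lambda>b s p. Zf b p s) (\<lambda>c. w (bar c)) (\<lambda>c. vc (l c))"
proof (unfold_locales, goal_cases)
  case 1 show ?case by (rule H.m_add2)
next
  case 2 show ?case by (rule H.m_add1)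
next
  case 3 show ?case by (rule H.m_sc2)
next
  case 4 show ?case by (rule H.m_sc1)
next
  case 5 show ?case by (rule H.assoc[symmetric])
next
  case 6 show ?case by (rule eps_add)
next
  case 7 show ?case by (rule eps_sc)
next
  case (8 i a j) thus ?case by (simp add: eps_t)
next
  case (9 f i a j)
  have "(\<Sum>a\<in>UNIV. \<Sum>i<D a. \<Sum>j<D a. f a j i *v t a i j) = 0"
    using 9(1) by (subst (asm) sum.swap[of _ "{..<D _}" "{..<D _}"])
  from indep[OF this 9(3,2)] show ?case .
next
  case (10 k e j n a n')
  have "m (t a n' n) (t e j k) = (\<Sum>x\<in>(SIGMA c:UNIV. {..<N a e c}). \<Sum>\<gamma><D (fst x). \<Sum>\<delta><D (fst x). 
           (V' a e x (n', j) \<gamma> * W' a e x \<delta> (n, k)) *v t (fst x) \<gamma> \<delta>)"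
    by (rule fus[OF 10(4,3,2,1)])
  also have "\<dots> = (\<Sum>x\<in>(SIGMA c:UNIV. {..<N a e c}). \<Sum>\<gamma><D (fst x). \<Sum>\<delta><D (fst x). 
           (W' a e x \<gamma> (prod.swap (k, n)) * V' a e x (prod.swap (j, n')) \<delta>) *v t (fst x) \<delta> \<gamma>)"
    by (rule sum.cong[OF refl], subst sum.swap) (simp add: mult.commute)
  finally show ?case .
next
  case (11 \<xi> e a \<eta> \<gamma> \<delta>)
  have "(\<Sum>p\<in>{..<D e} \<times> {..<D a}. V' a e \<xi> (prod.swap p) \<gamma> * W' a e \<eta> \<delta> (prod.swap p)) = 
     (\<Sum>p\<in>{..<D a} \<times> {..<D e}. W' a e \<eta> \<delta> p * V' a e \<xi> p \<gamma>)"
    by (rule sum.reindex_bij_witness[where i=prod.swap and j=prod.swap]) auto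
  thus ?case using orth[OF 11(2,1,4,3)] by auto
next
  case (12 p e s') thus ?case using conjB[of s' e p] by simp
next
  case (13 s e p) thus ?case using conjA[of p e s] by simp
next
  case 14 thus ?case by (rule bar2)
next
  case (15 k e j n a n')
  show ?case unfolding et_t[OF 15(2,1), symmetric]
    by (rule sw_t_left[where A = "\<lambda>x. x" and \<chi> = "\<lambda>x. \<epsilon> (m x (t e j k))", OF _ linear_id lin_eps(2) 15(4,3)])
       (subst H.et_mult_right, assumption, simp only: mult.commute)
next
  case (16 k e j n a n')
  show ?case unfolding es_t[OF 16(2,1), symmetric]
    by (rule sw_t_right[where A = "\<lambda>x. x" and \<chi> = "\<lambda>x. \<epsilon> (m x (S (t e j k)))", OF _ linear_id lin_eps(2) 16(4,3)])
       (subst H.es_mult_right, assumption, simp only: mult.commute)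
next
  case 17 thus ?case by (rule H.et_add)
next
  case 18 thus ?case by (rule H.et_sc)
next
  case (19 k e j n a n')
  show ?case 
    by (rule sw_t_left[where A = H.et and \<chi> = "\<lambda>x. \<epsilon> (m x (t e j k))", OF _ H.lin_et lin_eps(2) 19(4,3)])
       (subst H.et_mult, assumption, simp only: mult.commute)
next
  case (20 c) show ?case using chi'[of c] by simp
qed

text \<open>Conjugation is applied twice: \<open>conjA\<close> removes the inner antipode at the
  price of passing to bar c, and \<open>conjB\<close> at bar c removes the outer one and returns to
  c. The two conjugating matrices combine to \<open>Gi\<close>.\<close>

lemma S2_t: assumes i: "i < D c" and j: "j < D c"
  shows "(\<Sum>k<D c. (\<Sum>s<D (bar c). Zi (bar c) i s * Zf c k s) *v S (S (t c k j))) = 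
         (\<Sum>k<D c. (\<Sum>s<D (bar c). Zi (bar c) k s * Zf c j s) *v t c i k)"
proof -
  have "(\<Sum>k<D c. (\<Sum>s<D (bar c). Zi (bar c) i s * Zf c k s) *v S (S (t c k j))) = 
     (\<Sum>s<D (bar c). Zi (bar c) i s *v S (\<Sum>k<D c. Zf c k s *v S (t c k j)))"
    unfolding F.scale_sum_left by (subst sum.swap) (simp add: linear_fun_sum[OF H.lin_S] H.S_sc F.scale_sum_right)
  also have "\<dots> = (\<Sum>s<D (bar c). Zi (bar c) i s *v S (\<Sum>s'<D (bar c). Zf c j s' *v t (bar c) s' s))"
    by (intro sum.cong refl) (use j in \<open>simp add: conjA\<close>)
  also have "\<dots> = (\<Sum>s'<D (bar c). Zf c j s' *v (\<Sum>s<D (bar c). Zi (bar c) i s *v S (t (bar c) s' s)))"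
    by (simp add: linear_fun_sum[OF H.lin_S] H.S_sc F.scale_sum_right) (subst sum.swap, simp add: mult.commute)
  also have "\<dots> = (\<Sum>s'<D (bar c). Zf c j s' *v (\<Sum>k<D c. Zi (bar c) k s' *v t c i k))"
    by (intro sum.cong refl) (use conjB[of i "bar c"] i in simp)
  also have "\<dots> = (\<Sum>k<D c. (\<Sum>s<D (bar c). Zi (bar c) k s * Zf c j s) *v t c i k)"
    unfolding F.scale_sum_right F.scale_sum_left by (subst sum.swap) (simp add: mult.commute)
  finally show ?thesis .
qed

sublocale F: fusion_core_dim vscale m D t \<epsilon> N V' W' S H.es bar Zf Zi w vc r H.et l "\<lambda>x. S (S x)" d
proof -
  interpret L: left_rotation vscale m D t \<epsilon> N V' W' S H.es bar Zf Zi w "\<lambda>c. vc (r c)"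
    by (rule rotation_left)
  interpret R: left_rotation vscale "\<lambda>x y. m y x" D "\<lambda>a i j. t a j i" \<epsilon> "\<lambda>b a c. N a b c"
      "\<lambda>b a x p \<gamma>. W' a b x \<gamma> (prod.swap p)" "\<lambda>b a x \<gamma> p. V' a b x (prod.swap p) \<gamma>" S H.et bar
      "\<lambda>b p s. Zi b s p" "\<lambda>b s p. Zf b p s" "\<lambda>c. w (bar c)" "\<lambda>c. vc (l c)"
    by (rule rotation_right)
  show "fusion_core_dim vscale m D t \<epsilon> N V' W' S H.es bar Zf Zi w vc r H.et l (\<lambda>x. S (S x)) d"
  proof (unfold_locales, goal_cases)
    case 1 show ?case by (rule D_pos)
  next
    case 2 thus ?case by (rule ZZi)
  next
    case 3 thus ?case by (rule ZiZ)
  next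
    case 4 thus ?case by (rule es_t)
  next
    case 5 thus ?case by (rule et_t)
  next
    case 6 show ?case by (simp add: H.S_add)
  next
    case 7 show ?case by (simp add: H.S_sc)
  next
    case 8 show ?case by (simp add: H.S_mult)
  next
    case 9 thus ?case by (rule S2_t)
  next
    case 10 thus ?case by (rule o_left)
  next
    case 11 show ?case by (rule o_nz[OF r_E])
  next
    case (12 e a c) thus ?case using sel_mid sel_left sel_right by blast
  next
    case 13 show ?case by (rule l_bar)
  next
    case 14 show ?case using w_def by blast
  next
    case 15 show ?case using d_def by blast
  next
    case 16 show ?case using d_def by metis
  qed
qed

sublocale C: complete_irreps "dmult \<Delta>" "dunit \<epsilon>" \<psi> D
proof -
  have de: "pair_ev (dmult \<Delta> f h) x = sw \<Delta> (\<lambda>p q. pair_ev f p * pair_ev h q) x" for f h x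
  proof -
    have "linear_functional (\<lambda>x. sw \<Delta> (\<lambda>p q. pair_ev f p * pair_ev h q) x)"
      by (simp add: linear_functional_iff H.sw_add H.sw_sc)
    from linear_functional_expand[OF this, of x] show ?thesis
      unfolding pair_ev_def[of "dmult \<Delta> f h"] by (simp add: dmult_def sw_def pair_ev_bvec mult_ac)
  qed
  have un: "pair_ev (dunit \<epsilon>) x = \<epsilon> x" for x
    using linear_functional_expand[OF H.lin_e, of x] by (simp add: pair_ev_def dunit_def mult.commute)
  have ext: "f = h" if "\<And>x. pair_ev f x = pair_ev h x" for f h :: "'n \<Rightarrow> complex"
    using that[of "bvec _"] by (simp add: pair_ev_bvec fun_eq_iff)
  show "complete_irreps (dmult \<Delta>) (dunit \<epsilon>) \<psi> D"
  proof (unfold_locales, goal_cases)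
    case 1 show ?case by (simp add: linear_fun_def dmult_def algebra_simps sum.distrib sum_distrib_left)
  next
    case 2 show ?case by (simp add: linear_fun_def dmult_def algebra_simps sum.distrib sum_distrib_left)
  next
    case (3 x y z) show ?case
      by (rule ext) (simp only: de sw_scale_form[symmetric] sw_scale_form2[symmetric] mult.assoc[symmetric] H.coassoc[of "\<lambda>p q r. pair_ev x p * pair_ev y q * pair_ev z r"])
  next
    case (4 x) show ?case by (rule ext) (simp only: de un H.counit1[OF linear_pair_ev])
  next
    case (5 x) show ?case by (rule ext) (simp only: de un H.counit2[OF linear_pair_ev])
  next
    case 6 show ?case by (rule semisimple)
  next
    case 7 show ?case by (rule rep)
  next
    case (8 \<rho> k) thus ?case using irreps_complete by blast
  qed
qed

text \<open>A functional on the algebra is an element of its dual, and its values on coefficients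
  are the entries of its representation matrices. Faithfulness therefore says that the coefficients
  span the algebra.\<close>

lemma functional_zero:
  assumes p: "linear_functional \<phi>" and z: "\<And>a i j. i < D a \<Longrightarrow> j < D a \<Longrightarrow> \<phi> (t a i j) = 0"
  shows "\<phi> x = 0"
proof -
  have "(\<lambda>k. \<phi> (bvec k)) = 0"
    by (rule C.faithful, rule eq_matI) (use z in \<open>auto simp: functional_t[OF p, symmetric]\<close>)
  hence "\<phi> (bvec k) = 0" for k by (simp add: fun_eq_iff zero_fun_def)
  thus ?thesis using linear_functional_expand[OF p, of x] by simp
qed

lemma g_index: assumes "i < D a" "j < D a" shows "\<psi> a g $$ (i, j) = d a / w (bar a) * F.G a i j"
proof -
  have "Z (bar a) \<in> carrier_mat (D (bar a)) (D a)" using Z_carrier[of "bar a"] by simp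
  hence "(transpose_mat (minv (Z a)) * Z (bar a)) $$ (i, j) = F.G a i j"
    using assms minv_Z(1)[of a] by (simp add: scalar_prod_def lessThan_atLeast0[symmetric] F.G_def Zf_def Zi_def)
  moreover have "dim_row (transpose_mat (minv (Z a)) * Z (bar a)) = D a" "dim_col (transpose_mat (minv (Z a)) * Z (bar a)) = D a"
    using minv_Z(1)[of a] Z_carrier[of "bar a"] by auto
  ultimately show ?thesis using g_def assms by simp
qed

section \<open>Properties of the integral\<close>

lemma Lambda_eq: "\<Lambda> = F.Lam"
proof (rule pair_ext)
  fix f
  have "d a / (\<Sum>x\<in>{x. l x = l a}. d x ^ 2) * mtrace (\<psi> a g * \<psi> a f) = 
     F.cc a * (\<Sum>i<D a. \<Sum>j<D a. F.G a i j * \<psi> a f $$ (j, i))" for a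
  proof -
    have m1: "mtrace (\<psi> a g * \<psi> a f) = d a / w (bar a) * (\<Sum>i<D a. \<Sum>j<D a. F.G a i j * \<psi> a f $$ (j, i))"
      by (simp add: mtrace_def psi_mult_index g_index sum_distrib_left mult.assoc del: index_mult_mat(1))
    have m2: "d a / F.DD (l a) * (d a / w (bar a)) = F.cc a"
      using F.dd[of a] F.w_nz'[of "bar a"] by (simp add: F.cc_def)
    show ?thesis unfolding F.DD_def[symmetric] m1 mult.assoc[symmetric] m2 ..
  qed
  thus "pair_ev f \<Lambda> = pair_ev f F.Lam"
    using \<Lambda>_def by (simp add: F.Lam_def pair_sum pair_sc pair_t)
qed

lemma sw_Lam: assumes B: "bilin B" 
  shows "sw \<Delta> B \<Lambda> = (\<Sum>a\<in>UNIV. F.cc a * (\<Sum>i<D a. \<Sum>j<D a. \<Sum>k<D a. F.G a i j * B (t a j k) (t a k i)))"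
proof -
  have p: "linear_functional (\<lambda>x. sw \<Delta> B x)" by (simp add: linear_functional_iff H.sw_add H.sw_sc)
  show ?thesis unfolding Lambda_eq F.Lam_def linear_functional_sum[OF p] lin_sc[OF p]
    by (simp add: sw_t[OF B] sum_distrib_left)
qed

lemma bilin_coord: "linear_fun A \<Longrightarrow> linear_fun B \<Longrightarrow> bilin (\<lambda>x y. A x P * B y Q)"
  by (simp add: bilin_def linear_functional_iff linear_fun_iff algebra_simps)

lemma Lam_coord: "\<Delta> \<Lambda> (P, Q) = (\<Sum>a\<in>UNIV. F.cc a * (\<Sum>i<D a. \<Sum>j<D a. \<Sum>k<D a. F.G a i j * (t a j k P * t a k i Q)))"
proof -
  have "\<Delta> \<Lambda> (P, Q) = sw \<Delta> (\<lambda>x y. x P * y Q) \<Lambda>" by (simp add: sw_def mult.assoc[symmetric])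
  thus ?thesis using sw_Lam[OF bilin_coord[OF linear_id linear_id]] by simp
qed

text \<open>Suppose the contraction with \<open>f\<close> vanishes. Independence of the coefficients
  and the nonzero weights \<open>cc\<close> give G \<psi>_a(f) = 0 for every a; since G is
  invertible, all \<psi>_a(f) vanish, and faithfulness yields f = 0.\<close>

lemma nondegenerate_left: "range (\<lambda>f. \<lambda>q. \<Sum>p\<in>UNIV. f p * \<Delta> \<Lambda> (p, q)) = UNIV"
proof (rule linear_injective_surj)
  show "linear_fun (\<lambda>f. \<lambda>q. \<Sum>p\<in>UNIV. f p * \<Delta> \<Lambda> (p, q))"
    by (simp add: linear_fun_def algebra_simps sum.distrib sum_distrib_left)
next
  fix f :: "'n \<Rightarrow> complex" assume 0: "(\<lambda>q. \<Sum>p\<in>UNIV. f p * \<Delta> \<Lambda> (p, q)) = 0"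
  define M where "M a k i = F.cc a * (\<Sum>j<D a. F.G a i j * \<psi> a f $$ (j, k))" for a k i
  have "(\<Sum>p\<in>UNIV. f p * \<Delta> \<Lambda> (p, q)) = (\<Sum>a\<in>UNIV. \<Sum>k<D a. \<Sum>i<D a. M a k i *v t a k i) q" for q
  proof -
    have "bilin (\<lambda>x y. pair_ev f x * y q)" 
      using linear_pair_ev[of f] by (simp add: bilin_def linear_functional_iff algebra_simps)
    moreover have "(\<Sum>p\<in>UNIV. f p * \<Delta> \<Lambda> (p, q)) = sw \<Delta> (\<lambda>x y. pair_ev f x * y q) \<Lambda>"
      unfolding mult.commute[of "f _"] by (simp add: sw_def pair_ev_bvec mult.assoc[symmetric])
    ultimately have "(\<Sum>p\<in>UNIV. f p * \<Delta> \<Lambda> (p, q)) = 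
      (\<Sum>a\<in>UNIV. F.cc a * (\<Sum>i<D a. \<Sum>j<D a. \<Sum>k<D a. F.G a i j * (\<psi> a f $$ (j, k) * t a k i q)))"
      by (simp add: sw_Lam pair_t)
    also have "\<dots> = (\<Sum>a\<in>UNIV. F.cc a * (\<Sum>k<D a. \<Sum>i<D a. \<Sum>j<D a. F.G a i j * (\<psi> a f $$ (j, k) * t a k i q)))"
      by (subst sum3_perm) (rule refl)
    finally show ?thesis by (simp add: M_def sum_fun_apply sum_distrib_left sum_distrib_right mult.assoc)
  qed
  hence z: "(\<Sum>a\<in>UNIV. \<Sum>k<D a. \<Sum>i<D a. M a k i *v t a k i) = 0" using 0 by (simp add: fun_eq_iff)
  have M0: "(\<Sum>j<D a. F.G a i j * \<psi> a f $$ (j, k)) = 0" if "i < D a" "k < D a" for a i k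
    using indep[OF z that(2,1)] F.cc_nz[of a] by (simp add: M_def)
  show "f = 0"
  proof (rule C.faithful, rule eq_matI)
    fix a i k assume "i < dim_row (0\<^sub>m (D a) (D a) :: complex mat)" "k < dim_col (0\<^sub>m (D a) (D a) :: complex mat)"
    hence ik: "i < D a" "k < D a" by simp_all
    have "0 = (\<Sum>s<D a. F.Gi a i s * (\<Sum>j<D a. F.G a s j * \<psi> a f $$ (j, k)))" by (simp add: M0 ik)
    also have "\<dots> = (\<Sum>j<D a. (\<Sum>s<D a. F.Gi a i s * F.G a s j) * \<psi> a f $$ (j, k))"
      unfolding sum_distrib_left sum_distrib_right by (subst sum.swap) (simp add: mult.assoc)
    also have "\<dots> = (\<Sum>j<D a. (if i = j then 1 else 0) * \<psi> a f $$ (j, k))"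
      by (intro sum.cong refl) (use ik in \<open>simp add: F.GGi_inv(2)\<close>)
    finally show "\<psi> a f $$ (i, k) = 0\<^sub>m (D a) (D a) $$ (i, k)" using ik by (simp add: if_distrib[of "\<lambda>z. z * _"] cong: if_cong)
  qed simp_all
qed

lemma nondegenerate_right: "range (\<lambda>f. \<lambda>p. \<Sum>q\<in>UNIV. \<Delta> \<Lambda> (p, q) * f q) = UNIV"
proof (rule linear_injective_surj)
  show "linear_fun (\<lambda>f. \<lambda>p. \<Sum>q\<in>UNIV. \<Delta> \<Lambda> (p, q) * f q)"
    by (simp add: linear_fun_def algebra_simps sum.distrib sum_distrib_left)
next
  fix f :: "'n \<Rightarrow> complex" assume 0: "(\<lambda>p. \<Sum>q\<in>UNIV. \<Delta> \<Lambda> (p, q) * f q) = 0"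
  define M where "M a j k = F.cc a * (\<Sum>i<D a. \<psi> a f $$ (k, i) * F.G a i j)" for a j k
  have "(\<Sum>q\<in>UNIV. \<Delta> \<Lambda> (p, q) * f q) = (\<Sum>a\<in>UNIV. \<Sum>j<D a. \<Sum>k<D a. M a j k *v t a j k) p" for p
  proof -
    have "bilin (\<lambda>x y. x p * pair_ev f y)" 
      using linear_pair_ev[of f] by (simp add: bilin_def linear_functional_iff algebra_simps)
    moreover have "(\<Sum>q\<in>UNIV. \<Delta> \<Lambda> (p, q) * f q) = sw \<Delta> (\<lambda>x y. x p * pair_ev f y) \<Lambda>"
      unfolding sw_def by (subst sum.swap) (simp add: pair_ev_bvec mult.assoc[symmetric] sum_distrib_right[symmetric])
    ultimately have "(\<Sum>q\<in>UNIV. \<Delta> \<Lambda> (p, q) * f q) = 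
      (\<Sum>a\<in>UNIV. F.cc a * (\<Sum>i<D a. \<Sum>j<D a. \<Sum>k<D a. F.G a i j * (t a j k p * \<psi> a f $$ (k, i))))"
      by (simp add: sw_Lam pair_t)
    also have "\<dots> = (\<Sum>a\<in>UNIV. F.cc a * (\<Sum>j<D a. \<Sum>k<D a. \<Sum>i<D a. F.G a i j * (t a j k p * \<psi> a f $$ (k, i))))"
      by (subst sum3_perm[symmetric]) (rule refl)
    finally show ?thesis by (simp add: M_def sum_fun_apply sum_distrib_left sum_distrib_right mult_ac)
  qed
  hence z: "(\<Sum>a\<in>UNIV. \<Sum>j<D a. \<Sum>k<D a. M a j k *v t a j k) = 0" using 0 by (simp add: fun_eq_iff)
  have M0: "(\<Sum>i<D a. \<psi> a f $$ (k, i) * F.G a i j) = 0" if "j < D a" "k < D a" for a j k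
    using indep[OF z that] F.cc_nz[of a] by (simp add: M_def)
  show "f = 0"
  proof (rule C.faithful, rule eq_matI)
    fix a k i assume "k < dim_row (0\<^sub>m (D a) (D a) :: complex mat)" "i < dim_col (0\<^sub>m (D a) (D a) :: complex mat)"
    hence ik: "i < D a" "k < D a" by simp_all
    have "0 = (\<Sum>s<D a. (\<Sum>j<D a. \<psi> a f $$ (k, j) * F.G a j s) * F.Gi a s i)" by (simp add: M0 ik)
    also have "\<dots> = (\<Sum>j<D a. \<psi> a f $$ (k, j) * (\<Sum>s<D a. F.G a j s * F.Gi a s i))"
      unfolding sum_distrib_left sum_distrib_right by (subst sum.swap) (simp add: mult.assoc)
    also have "\<dots> = (\<Sum>j<D a. \<psi> a f $$ (k, j) * (if j = i then 1 else 0))"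
      by (intro sum.cong refl) (use ik in \<open>simp add: F.GGi_inv(1)\<close>)
    finally show "\<psi> a f $$ (k, i) = 0\<^sub>m (D a) (D a) $$ (k, i)" using ik by (simp add: if_distrib[of "\<lambda>z. _ * z"] cong: if_cong)
  qed simp_all
qed

text \<open>At fixed coordinates (P, Q) the difference of the two sides is a linear functional of
  \<open>x\<close>. By \<open>functional_zero\<close> it suffices to treat coefficients, where
  \<open>F.Lam_integral\<close> applies with the form x P * y Q.\<close>

lemma left_integral: "mult2 m (tens unitA x) (\<Delta> \<Lambda>) = mult2 m (tens (S x) unitA) (\<Delta> \<Lambda>)"
proof (rule ext, clarify)
  fix P Q
  have lm: "linear_fun (m x)" "linear_fun (\<lambda>x. m x y)" for x y by (rule H.lin_m2 H.lin_m1)+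
  have e: "mult2 m (tens y z) (\<Delta> \<Lambda>) (P, Q) = sw \<Delta> (\<lambda>p q. m y p P * m z q Q) \<Lambda>" for y z
  proof -
    have "mult2 m (tens y z) (\<Delta> \<Lambda>) (P, Q) = (\<Sum>i\<in>UNIV. \<Sum>j\<in>UNIV. \<Sum>k\<in>UNIV. \<Sum>n\<in>UNIV. 
       \<Delta> \<Lambda> (k, n) * ((y i * m (bvec i) (bvec k) P) * (z j * m (bvec j) (bvec n) Q)))"
      by (simp add: mult2_def tens_def mult_ac)
    also have "\<dots> = (\<Sum>k\<in>UNIV. \<Sum>n\<in>UNIV. \<Delta> \<Lambda> (k, n) * ((\<Sum>i\<in>UNIV. y i * m (bvec i) (bvec k) P) * (\<Sum>j\<in>UNIV. z j * m (bvec j) (bvec n) Q)))"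
      by (rule trans[OF sum_swap22], intro sum.cong refl, subst sum_product) (simp only: sum_distrib_left)
    finally show ?thesis by (simp add: linear_fun_expand[OF lm(2), symmetric] sw_def)
  qed
  define \<phi> where "\<phi> x = sw \<Delta> (\<lambda>p q. p P * m x q Q) \<Lambda> - sw \<Delta> (\<lambda>p q. m (S x) p P * q Q) \<Lambda>" for x
  have "linear_functional \<phi>"
    by (simp add: \<phi>_def linear_functional_iff H.m_add1 H.m_sc1 H.S_add H.S_sc sw_def algebra_simps sum.distrib sum_distrib_left sum_subtractf del: sum_bvec)
  moreover have "\<phi> (t e p q) = 0" if p: "p < D e" and q: "q < D e" for e p q
  proof -
    have "sw \<Delta> (\<lambda>x y. x P * m (t e p q) y Q) \<Lambda> = sw \<Delta> (\<lambda>x y. m (S (t e p q)) x P * y Q) \<Lambda>"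
      unfolding sw_Lam[OF bilin_coord[OF linear_id lm(1)]] sw_Lam[OF bilin_coord[OF lm(1) linear_id]]
      by (rule F.Lam_integral[where B = "\<lambda>x y. x P * y Q"]) (simp_all add: p q algebra_simps)
    thus ?thesis by (simp add: \<phi>_def)
  qed
  ultimately have "\<phi> x = 0" by (rule functional_zero)
  thus "mult2 m (tens unitA x) (\<Delta> \<Lambda>) (P, Q) = mult2 m (tens (S x) unitA) (\<Delta> \<Lambda>) (P, Q)"
    unfolding e by (simp add: \<phi>_def H.unit1)
qed

text \<open>Since S^2 is conjugation by G, applying its inverse moves G from the left of t to its
  right. Inside the trace that defines \<Lambda>, this amounts to exchanging the two legs of
  \<Delta> \<Lambda>.\<close>

lemma q_trace: "tswap (\<Delta> \<Lambda>) = tmap (inv_into UNIV S \<circ> inv_into UNIV S) id (\<Delta> \<Lambda>)"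
proof (rule ext, clarify)
  fix P Q
  let ?R = "inv_into UNIV S \<circ> inv_into UNIV S"
  have bij: "bij S" using wha by (simp add: weak_hopf_algebra_def)
  have RS: "?R (S (S x)) = x" for x using bij by (simp add: bij_is_inj)
  have lin_inv: "linear_fun (inv_into UNIV S)"
  proof -
    have SI: "S (inv_into UNIV S x) = x" for x using bij by (simp add: bij_is_surj surj_f_inv_f)
    have IS: "inv_into UNIV S (S x) = x" for x using bij by (simp add: bij_is_inj)
    have "inv_into UNIV S (x + y) = inv_into UNIV S x + inv_into UNIV S y" for x y
      using IS[of "inv_into UNIV S x + inv_into UNIV S y"] unfolding H.S_add SI .
    moreover have "inv_into UNIV S (z *v x) = z *v inv_into UNIV S x" for z x
      using IS[of "z *v inv_into UNIV S x"] unfolding H.S_sc SI .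
    ultimately show ?thesis unfolding linear_fun_iff by blast
  qed
  hence R: "linear_fun ?R" by (simp add: linear_fun_iff)
  have key: "(\<Sum>j<D a. F.G a i j *v ?R (t a j k)) = (\<Sum>n<D a. F.G a n k *v t a i n)" if "i < D a" "k < D a" for a i k
  proof -
    have "(\<Sum>n<D a. F.G a n k *v t a i n) = ?R (\<Sum>n<D a. F.G a n k *v S (S (t a i n)))"
      unfolding linear_fun_sum[OF R] using R RS by (simp add: linear_fun_iff)
    also have "\<dots> = ?R (\<Sum>j<D a. F.G a i j *v t a j k)" by (subst F.sig_G[OF that]) (rule refl)
    also have "\<dots> = (\<Sum>j<D a. F.G a i j *v ?R (t a j k))"
      unfolding linear_fun_sum[OF R] using R by (simp add: linear_fun_iff)
    finally show ?thesis ..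
  qed
  have "tmap ?R id (\<Delta> \<Lambda>) (P, Q) = sw \<Delta> (\<lambda>x y. ?R x P * y Q) \<Lambda>"
    by (simp add: tmap_def sw_def mult.assoc)
  also have "\<dots> = (\<Sum>a\<in>UNIV. F.cc a * (\<Sum>i<D a. \<Sum>j<D a. \<Sum>k<D a. F.G a i j * (?R (t a j k) P * t a k i Q)))"
    by (rule sw_Lam[OF bilin_coord[OF R linear_id]])
  also have "\<dots> = (\<Sum>a\<in>UNIV. F.cc a * (\<Sum>i<D a. \<Sum>k<D a. (\<Sum>j<D a. F.G a i j *v ?R (t a j k)) P * t a k i Q))"
    by (rule sum.cong[OF refl], rule arg_cong[where f = "\<lambda>z. _ * z"], rule sum.cong[OF refl], subst sum.swap)
       (simp add: sum_fun_apply sum_distrib_right mult.assoc)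
  also have "\<dots> = (\<Sum>a\<in>UNIV. F.cc a * (\<Sum>i<D a. \<Sum>k<D a. \<Sum>n<D a. F.G a n k * (t a k i Q * t a i n P)))"
    by (intro sum.cong refl arg_cong[where f = "\<lambda>z. _ * z"], subst key) (simp_all add: sum_fun_apply sum_distrib_right sum_distrib_left mult_ac)
  \<comment> \<open>Cyclicity of the trace: only the summation indices are renamed and
    reordered.\<close>
  also have "\<dots> = (\<Sum>a\<in>UNIV. F.cc a * (\<Sum>i<D a. \<Sum>j<D a. \<Sum>k<D a. F.G a i j * (t a j k Q * t a k i P)))"
    by (rule sum.cong[OF refl], rule arg_cong[where f = "\<lambda>z. _ * z"], rule trans[OF sum3_perm], rule sum.cong[OF refl], rule sum.swap)
  also have "\<dots> = tswap (\<Delta> \<Lambda>) (P, Q)" by (simp add: tswap_def Lam_coord)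
  finally show "tswap (\<Delta> \<Lambda>) (P, Q) = tmap ?R id (\<Delta> \<Lambda>) (P, Q)" ..
qed

theorem nondegenerate_integral:
  "(\<forall>a. (\<Sum>x\<in>{x. l x = l a}. d x ^ 2) \<noteq> 0) \<and>
   m \<Lambda> \<Lambda> = \<Lambda> \<and>
   range (\<lambda>f. \<lambda>q. \<Sum>p\<in>UNIV. f p * \<Delta> \<Lambda> (p, q)) = UNIV \<and>
   range (\<lambda>f. \<lambda>p. \<Sum>q\<in>UNIV. \<Delta> \<Lambda> (p, q) * f q) = UNIV \<and>
   (\<forall>x. mult2 m (tens unitA x) (\<Delta> \<Lambda>) = mult2 m (tens (S x) unitA) (\<Delta> \<Lambda>)) \<and>
   tswap (\<Delta> \<Lambda>) = tmap (inv_into UNIV S \<circ> inv_into UNIV S) id (\<Delta> \<Lambda>)"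
proof (intro conjI allI)
  show "(\<Sum>x\<in>{x. l x = l a}. d x ^ 2) \<noteq> 0" for a
    using F.DD_nz[of a] unfolding F.DD_def .
  show "m \<Lambda> \<Lambda> = \<Lambda>" unfolding Lambda_eq by (rule F.Lam_idem)
qed (rule nondegenerate_left nondegenerate_right left_integral q_trace)+

end

theorem theorem5p8:
  fixes m :: "('n::finite \<Rightarrow> complex) \<Rightarrow> ('n \<Rightarrow> complex) \<Rightarrow> ('n \<Rightarrow> complex)"
    and unitA :: "'n \<Rightarrow> complex"
    and \<Delta> :: "('n \<Rightarrow> complex) \<Rightarrow> ('n \<times> 'n \<Rightarrow> complex)"
    and \<epsilon> :: "('n \<Rightarrow> complex) \<Rightarrow> complex"
    and S :: "('n \<Rightarrow> complex) \<Rightarrow> ('n \<Rightarrow> complex)"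
    and \<psi> :: "'i::finite \<Rightarrow> ('n \<Rightarrow> complex) \<Rightarrow> complex mat"
    and D :: "'i \<Rightarrow> nat"
    and N :: "'i \<Rightarrow> 'i \<Rightarrow> 'i \<Rightarrow> nat"
    and V W :: "'i \<Rightarrow> 'i \<Rightarrow> 'i \<Rightarrow> nat \<Rightarrow> complex mat"
    and b :: "'i \<Rightarrow> complex mat"
    and E :: "'i set"
    and v u :: "'i \<Rightarrow> complex vec"
    and l r bar :: "'i \<Rightarrow> 'i"
    and Z :: "'i \<Rightarrow> complex mat"
    and w d :: "'i \<Rightarrow> complex"
    and g \<Lambda> :: "'n \<Rightarrow> complex"
  assumes wha: "weak_hopf_algebra m unitA \<Delta> \<epsilon> S"
    and semisimple: "semisimple_alg (dmult \<Delta>) (dunit \<epsilon>)"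
    \<comment> \<open>\<psi>_a, a \<in> 'i, is a complete system of representatives of Irr(A^*)\<close>
    and irreps: "\<forall>a. is_rep (dmult \<Delta>) (dunit \<epsilon>) (\<psi> a) (D a) \<and> irreducible_rep (\<psi> a) (D a)"
    and irreps_distinct: "\<forall>a a'. rep_iso (\<psi> a) (D a) (\<psi> a') (D a') \<longrightarrow> a = a'"
    and irreps_complete: "\<forall>\<rho> k. is_rep (dmult \<Delta>) (dunit \<epsilon>) \<rho> k \<and> irreducible_rep \<rho> k
                             \<longrightarrow> (\<exists>a. rep_iso \<rho> k (\<psi> a) (D a))"
    \<comment> \<open>fusion multiplicities N and fusion tensors V, W\<close>
    and fusion_dims: "\<forall>a a' c \<mu>. \<mu> < N a a' c \<longrightarrow>
           V a a' c \<mu> \<in> carrier_mat (D a * D a') (D c) \<and> W a a' c \<mu> \<in> carrier_mat (D c) (D a * D a')"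
    and fusion_decomp: "\<forall>a a' f. tensor_rep m (\<psi> a) (D a) (\<psi> a') (D a') f =
           msum (D a * D a') (D a * D a') (\<lambda>(c, \<mu>). V a a' c \<mu> * \<psi> c f * W a a' c \<mu>)
             {(c, \<mu>). \<mu> < N a a' c}"
    and fusion_orth: "\<forall>a a' c c' \<mu> \<nu>. \<mu> < N a a' c \<and> \<nu> < N a a' c' \<longrightarrow>
           W a a' c \<mu> * V a a' c' \<nu> = (if c = c' \<and> \<mu> = \<nu> then 1\<^sub>m (D c) else 0\<^sub>m (D c) (D c'))"
    \<comment> \<open>vacuum\<close>
    and vac_dims: "\<forall>a. b a \<in> carrier_mat (D a) (D a)"
    and vac: "\<forall>f. pair_ev f unitA = (\<Sum>a\<in>UNIV. mtrace (b a * \<psi> a f))"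
    and E_def: "E = {a. b a \<noteq> 0\<^sub>m (D a) (D a)}"
    and vac_rank1: "\<forall>e\<in>E. v e \<in> carrier_vec (D e) \<and> u e \<in> carrier_vec (D e) \<and> b e = outer (v e) (u e)"
    and l_def: "\<forall>a. l a \<in> E \<and> (\<forall>e\<in>E. \<forall>c. N e a c = (if e = l a \<and> a = c then 1 else 0))"
    and r_def: "\<forall>a. r a \<in> E \<and> (\<forall>e\<in>E. \<forall>c. N a e c = (if e = r a \<and> a = c then 1 else 0))"
    \<comment> \<open>conjugation\<close>
    and conj: "\<forall>a. Z a \<in> carrier_mat (D a) (D (bar a)) \<and> invertible_mat (Z a) \<and>
           (\<forall>f. transpose_mat (\<psi> a (dantipode S f)) = Z a * \<psi> (bar a) f * minv (Z a))"
    and bar_bar: "\<forall>a. bar (bar a) = a"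
    and w_def: "\<forall>c. N (bar c) c (r c) = 1 \<and> w c \<noteq> 0 \<and>
           (\<forall>p q. p < D (bar c) * D c \<and> q < D (bar c) * D c \<longrightarrow>
              Z c $$ (p mod D c, p div D c) * minv (Z (bar c)) $$ (q mod D c, q div D c) =
              w c * (transpose_mat (W (bar c) c (r c) 0) *\<^sub>v u (r c)) $ p
                  * (V (bar c) c (r c) 0 *\<^sub>v v (r c)) $ q)"
    and d_def: "\<forall>a. d a ^ 2 = w a * w (bar a) \<and> d a = d (bar a)"
    and g_def: "\<forall>a. \<psi> a g = (d a / w (bar a)) \<cdot>\<^sub>m (transpose_mat (minv (Z a)) * Z (bar a))"
    and \<Lambda>_def: "\<forall>f. pair_ev f \<Lambda> =
           (\<Sum>a\<in>UNIV. d a / (\<Sum>x\<in>{x. l x = l a}. d x ^ 2) * mtrace (\<psi> a g * \<psi> a f))"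
  shows "(\<forall>a. (\<Sum>x\<in>{x. l x = l a}. d x ^ 2) \<noteq> 0) \<and>
         m \<Lambda> \<Lambda> = \<Lambda> \<and>
         range (\<lambda>f. \<lambda>q. \<Sum>p\<in>UNIV. f p * \<Delta> \<Lambda> (p, q)) = UNIV \<and>
         range (\<lambda>f. \<lambda>p. \<Sum>q\<in>UNIV. \<Delta> \<Lambda> (p, q) * f q) = UNIV \<and>
         (\<forall>x. mult2 m (tens unitA x) (\<Delta> \<Lambda>) = mult2 m (tens (S x) unitA) (\<Delta> \<Lambda>)) \<and>
         tswap (\<Delta> \<Lambda>) = tmap (inv_into UNIV S \<circ> inv_into UNIV S) id (\<Delta> \<Lambda>)"
proof (rule weak_hopf_fusion.nondegenerate_integral)
  show "weak_hopf_fusion m unitA \<Delta> \<epsilon> S \<psi> D N V W b E v u l r bar Z w d g \<Lambda>"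
    by (rule weak_hopf_fusion.intro) (rule assms)+
qed

end
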